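(* Let $\Phi$ be an admissible function such that $$\lim_{r\to0}r^{\varepsilon}\log\Phi(r)=0\quad\text{for all }\varepsilon>0 .$$ Then the following hold. (i) Let $T_1,\dots,T_m$ be a fixed family of contracting invertible real $d\times d$ matrices, $\Sigma=\{1,\dots,m\}^{\mathbb N}$, and let $\pi^{\mathbf a}:\Sigma\to\mathbb R^d$ be the coding map of $\{T_jx+a_j\}_{j=1}^m$ for $\mathbf a=(a_1,\dots,a_m)\in\mathbb R^{dm}$. Let $E\subset\Sigma$ be non-empty. Then for all $\mathbf a\in\mathbb R^{dm}$, $$\underline{\dim}_\Phi\,\pi^{\mathbf a}(E)\le\underline{\dim}_{\mathrm C,\Phi}E\quad\text{and}\quad\overline{\dim}_\Phi\,\pi^{\mathbf a}(E)\le\overline{\dim}_{\mathrm C,\Phi}E .$$ Assume moreover $\|T_j\|<1/2$ for $1\le j\le m$. Then for $\mathcal L^{dm}$-a.e. $\mathbf a\in\mathbb R^{dm}$, $$\underline{\dim}_\Phi\,\pi^{\mathbf a}(E)=\underline{\dim}_{\mathrm C,\Phi}E\quad\text{and}\quad\overline{\dim}_\Phi\,\pi^{\mathbf a}(E)=\overline{\dim}_{\mathrm C,\Phi}E .$$ (ii) Let $G(d,m)$ be the Grassmannian of $m$-dimensional subspaces of $\mathbb R^d$, $\gamma_{d,m}$ its natural invariant probability measure, and $P_V$ the orthogonal projection of $\mathbb R^d$ onto $V\in G(d,m)$. Let $E\subset\mathbb R^d$ be non-empty and bounded. Then for all $V\in G(d,m)$, $$\underline{\dim}_\Phi P_VE\le\underline{\dim}_\Phi^{m}E\quad\text{and}\quad\overline{\dim}_\Phi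 P_VE\le\overline{\dim}_\Phi^{m}E .$$ Moreover, for $\gamma_{d,m}$-a.e. $V\in G(d,m)$, $$\underline{\dim}_\Phi P_VE=\underline{\dim}_\Phi^{m}E\quad\text{and}\quad\overline{\dim}_\Phi P_VE=\overline{\dim}_\Phi^{m}E .$$ (iii) Let $0<\alpha<1$, let $B_\alpha:\mathbb R^d\to\mathbb R^m$ be index-$\alpha$ fractional Brownian motion, and let $E\subset\mathbb R^d$ be non-empty and bounded. Then almost surely, $$\underline{\dim}_\Phi B_\alpha(E)=\frac1\alpha\,\underline{\dim}_{\Phi_\alpha}^{\alpha m}E\quad\text{and}\quad\overline{\dim}_\Phi B_\alpha(E)=\frac1\alpha\,\overline{\dim}_{\Phi_\alpha}^{\alpha m}E ,$$ where $\Phi_\alpha(r)=\Phi(r^\alpha)^{1/\alpha}$.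
   Context: Admissible: $\Phi$ is called admissible if there is $Y>0$ such that $\Phi:(0,Y)\to(0,\infty)$ is monotonic on $(0,Y)$, $0<\Phi(r)\le r$ for $0<r<Y$, and $\lim_{r\to0}\Phi(r)/r=0$. For $0<\alpha\le1$, $\Phi_\alpha(r):=\Phi(r^\alpha)^{1/\alpha}$ for $0<r<Y^{1/\alpha}$; it is again admissible. Scales $r$ are always restricted to the domain of the relevant function. $\|\cdot\|$ is the Euclidean operator norm, $\mathcal L^{dm}$ Lebesgue measure, $|U|$ the diameter of $U$. $\Phi$-intermediate dimensions: for non-empty bounded $F$ in a Euclidean space, $\overline{\dim}_\Phi F$ is the infimum of all $s\ge0$ such that for all $\varepsilon>0$ there is $r_0\in(0,1]$ such that for all $r\in(0,r_0)$ there is a cover $\{U_i\}$ of $F$ with $\Phi(r)\le|U_i|\le r$ for all $i$ and $\sum_i|U_i|^s\le\varepsilon$. $\underline{\dim}_\Phi F$ is the infimum of all $s\ge0$ such that for all $\varepsilon>0$ and all $r_0\in(0,1]$ there are $r\in(0,r_0)$ and a cover $\{U_i\}$ of $F$ with $\Phi(r)\le|U_i|\le r$ for all $i$ and $\sum_i|U_i|^s\le\varepsilon$. Coding map: with $f^{\mathbf a}_j(x)=T_jx+a_j$, $\pi^{\mathbf a}(\mathbf i)=\lim_{n\to\infty}f^{\mathbf a}_{i_1}\circ\cdots\circ f^{\mathbf a}_{i_n}(0)$ for $\mathbf i=i_1i_2\ldots\in\Sigma$. $x\wedge y$ is the common initial segment of $x,y\in\Sigma$; $\Sigma$ carries the metric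 $\exp(-|x\wedge y|)$, where $|I|$ is the length of $I$; $T_I=T_{i_1}\cdots T_{i_n}$ for $I=i_1\cdots i_n$ and $T_\varnothing$ is the identity; $\alpha_1(T)\ge\dots\ge\alpha_d(T)$ are singular values. Capacities: for a positive continuous kernel $K$ and compact $E$, $C_K(E)=\big(\inf_{\mu\in\mathcal P(E)}\iint K(x,y)\,d\mu(x)d\mu(y)\big)^{-1}$, where $\mathcal P(E)$ is the set of Borel probability measures supported on $E$; for non-compact $E$, $C_K(E):=C_K(\overline E)$. $\Phi$-capacity dimensions (for $E\subset\Sigma$): let $Z_r(x\wedge y)=\prod_{k=1}^d\min\{1,r/\alpha_k(T_{x\wedge y})\}$ if $x\ne y$, and $1$ if $x=y$. For $0\le s\le d$ and $0<r\le 1$, let $J^s_{\Phi,r}(x\wedge y)=\max_{\Phi(r)\le u\le r}u^{-s}Z_u(x\wedge y)$, and let $C^s_{\Phi,r}(E)$ be the capacity $C_K(E)$ for the kernel $K(x,y)=J^s_{\Phi,r}(x\wedge y)$. Then $$\overline{\dim}_{\mathrm C,\Phi}E=\inf\{s\in[0,d]:\limsup_{r\to0}C^s_{\Phi,r}(E)<\infty\},\quad \underline{\dim}_{\mathrm C,\Phi}E=\inf\{s\in[0,d]:\liminf_{r\to0}C^s_{\Phi,r}(E)<\infty\}.$$ (Equivalently, they are the suprema of the $s\in[0,d]$ for which the respective upper/lower limit is $>0$.) $\Phi$-dimension profiles (for bounded $E\subset\mathbb R^d$, $\tau>0$): let $\phi^\tau_u(\Delta)=\min\{1,(u/\Delta)^\tau\}$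 for $\Delta\ge0$ (equal to $1$ at $\Delta=0$). For $0\le s\le\tau$ and $0<r\le1$, let $J^{s,\tau}_{\Phi,r}(|x-y|)=\max_{\Phi(r)\le u\le r}u^{-s}\phi^\tau_u(|x-y|)$, and let $C^{s,\tau}_{\Phi,r}(E)$ be the capacity for this kernel. Then $$\overline{\dim}^\tau_\Phi E=\inf\{s\in[0,\tau]:\limsup_{r\to0}C^{s,\tau}_{\Phi,r}(E)<\infty\},\quad \underline{\dim}^\tau_\Phi E=\inf\{s\in[0,\tau]:\liminf_{r\to0}C^{s,\tau}_{\Phi,r}(E)<\infty\}.$$ (Equivalently, the suprema of the $s\in[0,\tau]$ for which the respective upper/lower limit is $>0$.) Fractional Brownian motion: $B_\alpha=(B_{\alpha,1},\dots,B_{\alpha,m}):\mathbb R^d\to\mathbb R^m$ is the Gaussian random function, with probability 1 continuous and $B_\alpha(0)=0$, whose components are independent and whose increments $B_\alpha(x)-B_\alpha(y)$ are multivariate normal with mean $0$ and covariance matrix $\mathrm{diag}(|x-y|^{2\alpha},\dots,|x-y|^{2\alpha})$. *)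

theory Defs
  imports "HOL-Probability.Probability"
begin

section \<open>Admissible functions and \<open>\<Phi>\<close>-intermediate dimensions\<close>

text \<open>
  A function on \<open>(0, Y)\<close> is represented by a total function whose values outside \<open>(0, Y)\<close> are
  arbitrary.  All dimensions below depend only on arbitrarily small scales, so neither \<open>Y\<close>
  nor these values matter and \<open>Y\<close> is not carried along.  A monotonic function that
  satisfies the remaining conditions is necessarily increasing.
\<close>

definition admissible :: "(real \<Rightarrow> real) \<Rightarrow> bool" where
  "admissible \<Phi> \<longleftrightarrow>
     (\<exists>Y>0. mono_on {0<..<Y} \<Phi> \<and> (\<forall>r\<in>{0<..<Y}. 0 < \<Phi> r \<and> \<Phi> r \<le> r)) \<and>
     ((\<lambda>r. \<Phi> r / r) \<longlongrightarrow> 0) (at_right 0)"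

definition Phi_pow :: "(real \<Rightarrow> real) \<Rightarrow> real \<Rightarrow> real \<Rightarrow> real" where
  "Phi_pow \<Phi> \<alpha> r = \<Phi> (r powr \<alpha>) powr (1 / \<alpha>)"

text \<open>
  Boundedness is required because \<^const>\<open>diameter\<close> is unspecified on unbounded sets.
\<close>

definition scale_cover :: "real \<Rightarrow> real \<Rightarrow> 'a::metric_space set \<Rightarrow> 'a set set \<Rightarrow> bool" where
  "scale_cover l r F \<U> \<longleftrightarrow>
     countable \<U> \<and> F \<subseteq> \<Union>\<U> \<and> (\<forall>U\<in>\<U>. bounded U \<and> l \<le> diameter U \<and> diameter U \<le> r)"

definition upper_Phi_dim :: "(real \<Rightarrow> real) \<Rightarrow> 'a::euclidean_space set \<Rightarrow> real" where
  "upper_Phi_dim \<Phi> F = Inf {s. 0 \<le> s \<and>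
     (\<forall>\<epsilon>>0. \<exists>r0\<in>{0<..1}. \<forall>r\<in>{0<..<r0}. \<exists>\<U>. scale_cover (\<Phi> r) r F \<U> \<and>
        (\<Sum>\<^sub>\<infinity>U\<in>\<U>. ennreal (diameter U powr s)) \<le> ennreal \<epsilon>)}"

definition lower_Phi_dim :: "(real \<Rightarrow> real) \<Rightarrow> 'a::euclidean_space set \<Rightarrow> real" where
  "lower_Phi_dim \<Phi> F = Inf {s. 0 \<le> s \<and>
     (\<forall>\<epsilon>>0. \<forall>r0\<in>{0<..1}. \<exists>r\<in>{0<..<r0}. \<exists>\<U>. scale_cover (\<Phi> r) r F \<U> \<and>
        (\<Sum>\<^sub>\<infinity>U\<in>\<U>. ennreal (diameter U powr s)) \<le> ennreal \<epsilon>)}"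


section \<open>Capacities\<close>

definition borel_of :: "'a topology \<Rightarrow> 'a measure" where
  "borel_of X = sigma (topspace X) {U. openin X U}"

definition prob_measures_on :: "'a topology \<Rightarrow> 'a set \<Rightarrow> 'a measure set" where
  "prob_measures_on X E =
     {\<mu>. prob_space \<mu> \<and> sets \<mu> = sets (borel_of X) \<and> emeasure \<mu> (topspace X - E) = 0}"

text \<open>
  In a Hausdorff space the closure of a compact set is the set itself, so taking the closure
  in the definition covers compact and non-compact sets uniformly.
\<close>

definition capacity :: "'a topology \<Rightarrow> ('a \<Rightarrow> 'a \<Rightarrow> real) \<Rightarrow> 'a set \<Rightarrow> ennreal" where
  "capacity X K E =
     inverse (INF \<mu>\<in>prob_measures_on X (X closure_of E).
       \<integral>\<^sup>+ y. (\<integral>\<^sup>+ x. ennreal (K x y) \<partial>\<mu>) \<partial>\<mu>)"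


section \<open>Self-affine sets: coding and \<open>\<Phi>\<close>-capacity dimensions\<close>

text \<open>
  The alphabet is a finite type \<open>'k\<close> and \<open>\<Sigma>\<close> is the type \<open>nat \<Rightarrow> 'k\<close>; sequences are indexed
  from 0.
\<close>

definition op_norm :: "real^'d^'d \<Rightarrow> real" where
  "op_norm A = onorm (\<lambda>x. A *v x)"

definition coding_map :: "('k::finite \<Rightarrow> real^'d^'d) \<Rightarrow> real^'d^'k \<Rightarrow> (nat \<Rightarrow> 'k) \<Rightarrow> real^'d" where
  "coding_map T a i = lim (\<lambda>n. foldr (\<lambda>j x. T j *v x + a $ j) (map i [0..<n]) 0)"

text \<open>
  The common initial segment is a finite word when \<open>x \<noteq> y\<close>; for \<open>x = y\<close> it is infinite, and
  every use below treats that case separately.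
\<close>

definition common_prefix :: "(nat \<Rightarrow> 'k) \<Rightarrow> (nat \<Rightarrow> 'k) \<Rightarrow> 'k list" where
  "common_prefix x y = map x [0..<(LEAST n. x n \<noteq> y n)]"

definition code_dist :: "(nat \<Rightarrow> 'k) \<Rightarrow> (nat \<Rightarrow> 'k) \<Rightarrow> real" where
  "code_dist x y = (if x = y then 0 else exp (- real (length (common_prefix x y))))"

definition code_topology :: "(nat \<Rightarrow> 'k) topology" where
  "code_topology = Metric_space.mtopology UNIV code_dist"

lemma Metric_space_code: "Metric_space UNIV code_dist"
proof
  fix x y z :: "nat \<Rightarrow> 'k"
  show "0 \<le> code_dist x y" by (simp add: code_dist_def)
  have "(\<lambda>n. x n \<noteq> y n) = (\<lambda>n. y n \<noteq> x n)" by auto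
  then show "code_dist x y = code_dist y x"
    by (simp add: code_dist_def common_prefix_def)
  show "code_dist x y = 0 \<longleftrightarrow> x = y" by (simp add: code_dist_def)
  show "code_dist x z \<le> code_dist x y + code_dist y z"
  proof (cases "x = y \<or> y = z \<or> x = z")
    case True
    then show ?thesis by (auto simp: code_dist_def)
  next
    case False
    define k where "k = (LEAST n. x n \<noteq> z n)"
    have "\<exists>n. x n \<noteq> z n" using False by auto
    then have "x k \<noteq> z k" unfolding k_def by (rule LeastI_ex)
    then have "x k \<noteq> y k \<or> y k \<noteq> z k" by metis
    then have "(LEAST n. x n \<noteq> y n) \<le> k \<or> (LEAST n. y n \<noteq> z n) \<le> k"
      by (auto intro: Least_le)
    then have "code_dist x z \<le> code_dist x y \<or> code_dist x z \<le> code_dist y z"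
      using False by (auto simp: code_dist_def common_prefix_def k_def)
    moreover have "0 \<le> code_dist x y" "0 \<le> code_dist y z" by (auto simp: code_dist_def)
    ultimately show ?thesis by linarith
  qed
qed

definition word_matrix :: "('k \<Rightarrow> real^'d^'d) \<Rightarrow> 'k list \<Rightarrow> real^'d^'d" where
  "word_matrix T I = foldr (\<lambda>j A. T j ** A) I (mat 1)"

text \<open>
  Singular values are the square roots of the eigenvalues of \<open>A\<^sup>T A\<close>, repeated according to
  multiplicity; geometric and algebraic multiplicities agree because \<open>A\<^sup>T A\<close> is symmetric.
  The index \<open>k\<close> runs from 1 to \<open>d\<close>, in decreasing order.
\<close>

definition eigenspace :: "real^'d^'d \<Rightarrow> real \<Rightarrow> (real^'d) set" where
  "eigenspace A c = {v. A *v v = c *\<^sub>R v}"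

definition singular_values :: "real^'d^'d \<Rightarrow> real multiset" where
  "singular_values A =
     (let S = transpose A ** A in
      \<Sum>c\<in>{c. eigenspace S c \<noteq> {0}}. replicate_mset (dim (eigenspace S c)) (sqrt c))"

definition singular_value :: "real^'d^'d \<Rightarrow> nat \<Rightarrow> real" where
  "singular_value A k = rev (sorted_list_of_multiset (singular_values A)) ! (k - 1)"

definition Z_kernel ::
  "('k \<Rightarrow> real^'d^'d) \<Rightarrow> real \<Rightarrow> (nat \<Rightarrow> 'k) \<Rightarrow> (nat \<Rightarrow> 'k) \<Rightarrow> real" where
  "Z_kernel T r x y =
     (if x = y then 1
      else \<Prod>k=1..CARD('d). min 1 (r / singular_value (word_matrix T (common_prefix x y)) k))"

definition code_kernel ::
  "(real \<Rightarrow> real) \<Rightarrow> ('k \<Rightarrow> real^'d^'d) \<Rightarrow> real \<Rightarrow> real \<Rightarrow> (nat \<Rightarrow> 'k) \<Rightarrow> (nat \<Rightarrow> 'k) \<Rightarrow> real" where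
  "code_kernel \<Phi> T s r x y = (SUP u\<in>{\<Phi> r..r}. u powr (- s) * Z_kernel T u x y)"

definition upper_capacity_dim ::
  "(real \<Rightarrow> real) \<Rightarrow> ('k \<Rightarrow> real^'d^'d) \<Rightarrow> (nat \<Rightarrow> 'k) set \<Rightarrow> real" where
  "upper_capacity_dim \<Phi> T E = Inf {s\<in>{0..real CARD('d)}.
     Limsup (at_right 0) (\<lambda>r. capacity code_topology (code_kernel \<Phi> T s r) E) < \<infinity>}"

definition lower_capacity_dim ::
  "(real \<Rightarrow> real) \<Rightarrow> ('k \<Rightarrow> real^'d^'d) \<Rightarrow> (nat \<Rightarrow> 'k) set \<Rightarrow> real" where
  "lower_capacity_dim \<Phi> T E = Inf {s\<in>{0..real CARD('d)}.
     Liminf (at_right 0) (\<lambda>r. capacity code_topology (code_kernel \<Phi> T s r) E) < \<infinity>}"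


section \<open>\<open>\<Phi>\<close>-dimension profiles\<close>

definition profile_phi :: "real \<Rightarrow> real \<Rightarrow> real \<Rightarrow> real" where
  "profile_phi \<tau> u \<Delta> = (if \<Delta> = 0 then 1 else min 1 ((u / \<Delta>) powr \<tau>))"

definition profile_kernel ::
  "(real \<Rightarrow> real) \<Rightarrow> real \<Rightarrow> real \<Rightarrow> real \<Rightarrow> 'a::euclidean_space \<Rightarrow> 'a \<Rightarrow> real" where
  "profile_kernel \<Phi> \<tau> s r x y = (SUP u\<in>{\<Phi> r..r}. u powr (- s) * profile_phi \<tau> u (dist x y))"

definition upper_profile :: "(real \<Rightarrow> real) \<Rightarrow> real \<Rightarrow> 'a::euclidean_space set \<Rightarrow> real" where
  "upper_profile \<Phi> \<tau> E = Inf {s\<in>{0..\<tau>}.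
     Limsup (at_right 0) (\<lambda>r. capacity euclidean (profile_kernel \<Phi> \<tau> s r) E) < \<infinity>}"

definition lower_profile :: "(real \<Rightarrow> real) \<Rightarrow> real \<Rightarrow> 'a::euclidean_space set \<Rightarrow> real" where
  "lower_profile \<Phi> \<tau> E = Inf {s\<in>{0..\<tau>}.
     Liminf (at_right 0) (\<lambda>r. capacity euclidean (profile_kernel \<Phi> \<tau> s r) E) < \<infinity>}"


section \<open>The Grassmannian\<close>

definition grassmannian :: "nat \<Rightarrow> 'a::euclidean_space set set" where
  "grassmannian m = {V. subspace V \<and> dim V = m}"

definition orth_proj :: "'a::euclidean_space set \<Rightarrow> 'a \<Rightarrow> 'a" where
  "orth_proj V x = (THE y. y \<in> V \<and> (\<forall>w\<in>V. orthogonal (x - y) w))"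

text \<open>
  The topology of the Grassmannian is that of the metric
  \<open>(V, W) \<mapsto> \<parallel>P\<^sub>V - P\<^sub>W\<parallel>\<close> (operator norm).  The value 0 outside
  subspaces is irrelevant; \<^locale>\<open>Metric_space\<close> demands nonnegativity everywhere.
\<close>

definition grass_dist :: "'a::euclidean_space set \<Rightarrow> 'a set \<Rightarrow> real" where
  "grass_dist V W =
     (if subspace V \<and> subspace W then onorm (\<lambda>x. orth_proj V x - orth_proj W x) else 0)"

definition grass_topology :: "nat \<Rightarrow> 'a::euclidean_space set topology" where
  "grass_topology m = Metric_space.mtopology (grassmannian m) grass_dist"

lemma orth_proj_unique:
  assumes "subspace V" "y \<in> V" "\<And>w. w \<in> V \<Longrightarrow> orthogonal (x - y) w"
  shows "orth_proj V x = y"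
  unfolding orth_proj_def
proof (rule the_equality)
  fix z assume z: "z \<in> V \<and> (\<forall>w\<in>V. orthogonal (x - z) w)"
  have V: "z - y \<in> V" using assms z by (simp add: subspace_diff)
  then have "(x - y) \<bullet> (z - y) = 0" "(x - z) \<bullet> (z - y) = 0"
    using assms(3) z by (auto simp: orthogonal_def)
  then have "(z - y) \<bullet> (z - y) = 0" by (simp add: inner_diff_left)
  then show "z = y" by simp
qed (use assms in auto)

lemma orth_proj:
  fixes V :: "'a::euclidean_space set"
  assumes "subspace V"
  shows "orth_proj V x \<in> V" "w \<in> V \<Longrightarrow> orthogonal (x - orth_proj V x) w"
proof -
  obtain y z where yz: "y \<in> span V" "\<And>w. w \<in> span V \<Longrightarrow> orthogonal z w" "x = y + z"
    using orthogonal_subspace_decomp_exists by blast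
  have sp: "span V = V" using assms by (simp add: span_eq_iff)
  have "orth_proj V x = y"
    using yz sp by (intro orth_proj_unique assms) auto
  then show "orth_proj V x \<in> V" "w \<in> V \<Longrightarrow> orthogonal (x - orth_proj V x) w"
    using yz sp by auto
qed

lemma linear_orth_proj:
  fixes V :: "'a::euclidean_space set"
  assumes "subspace V"
  shows "linear (orth_proj V)"
proof (rule linearI)
  fix x y :: 'a and c :: real
  note P = orth_proj[OF assms]
  show "orth_proj V (x + y) = orth_proj V x + orth_proj V y"
  proof (rule orth_proj_unique[OF assms])
    show "orth_proj V x + orth_proj V y \<in> V"
      using assms P by (simp add: subspace_add)
    fix w assume "w \<in> V"
    then show "orthogonal (x + y - (orth_proj V x + orth_proj V y)) w"
      using P(2)[of w x] P(2)[of w y] by (simp add: orthogonal_def algebra_simps)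
  qed
  show "orth_proj V (c *\<^sub>R x) = c *\<^sub>R orth_proj V x"
  proof (rule orth_proj_unique[OF assms])
    show "c *\<^sub>R orth_proj V x \<in> V" using assms P by (simp add: subspace_scale)
    fix w assume "w \<in> V"
    then show "orthogonal (c *\<^sub>R x - c *\<^sub>R orth_proj V x) w"
      using P(2)[of w x] by (simp add: orthogonal_def algebra_simps)
  qed
qed

lemma Metric_space_grassmannian: "Metric_space (grassmannian m) grass_dist"
proof
  have bl: "bounded_linear (\<lambda>x. orth_proj V x - orth_proj W x)"
    if "subspace V" "subspace W" for V W :: "'a set"
    using that by (intro bounded_linear_sub linear_conv_bounded_linear[THEN iffD1] linear_orth_proj)
  have range: "range (orth_proj V) = V" if "subspace V" for V :: "'a set"
  proof -
    have "orth_proj V x = x" if "x \<in> V" for x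
      using \<open>subspace V\<close> that by (intro orth_proj_unique) (auto simp: orthogonal_def)
    then show ?thesis using orth_proj(1)[OF that] by (metis (no_types) image_subset_iff rangeI subsetI subset_antisym)
  qed
  fix x y z :: "'a set"
  have neg: "(\<lambda>v. orth_proj x v - orth_proj y v) = (\<lambda>v. - (orth_proj y v - orth_proj x v))"
    by auto
  show "grass_dist x y = grass_dist y x"
    unfolding grass_dist_def neg by (subst onorm_neg) simp
  show "0 \<le> grass_dist x y"
    by (simp add: grass_dist_def onorm_pos_le bl)
  assume x: "x \<in> grassmannian m" and y: "y \<in> grassmannian m"
  then have s: "subspace x" "subspace y" by (auto simp: grassmannian_def)
  have "grass_dist x y = 0 \<longleftrightarrow> (\<forall>v. orth_proj x v - orth_proj y v = 0)"
    using onorm_eq_0[OF bl[OF s]] s by (simp add: grass_dist_def)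
  also have "\<dots> \<longleftrightarrow> x = y"
  proof
    assume "\<forall>v. orth_proj x v - orth_proj y v = 0"
    then have "orth_proj x = orth_proj y" by auto
    then show "x = y" using range s by metis
  qed auto
  finally show "grass_dist x y = 0 \<longleftrightarrow> x = y" .
  assume z: "z \<in> grassmannian m"
  then have sz: "subspace z" by (auto simp: grassmannian_def)
  have "(\<lambda>v. orth_proj x v - orth_proj z v) =
        (\<lambda>v. (orth_proj x v - orth_proj y v) + (orth_proj y v - orth_proj z v))" by auto
  then show "grass_dist x z \<le> grass_dist x y + grass_dist y z"
    using onorm_triangle[OF bl[OF s] bl[OF s(2) sz]] s sz by (simp add: grass_dist_def)
qed

text \<open>
  The natural measure \<open>\<gamma>\<close> on the Grassmannian is the unique Borel probability measure
  that is invariant under the orthogonal group.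
\<close>

definition grass_invariant_measure :: "nat \<Rightarrow> 'a::euclidean_space set measure \<Rightarrow> bool" where
  "grass_invariant_measure m \<gamma> \<longleftrightarrow>
     prob_space \<gamma> \<and> sets \<gamma> = sets (borel_of (grass_topology m)) \<and>
     (\<forall>g. orthogonal_transformation g \<longrightarrow> distr \<gamma> \<gamma> (\<lambda>V. g ` V) = \<gamma>)"


section \<open>Fractional Brownian motion\<close>

text \<open>Normal distributions may be degenerate: variance 0 means almost surely constant.\<close>

definition normal_rv :: "'w measure \<Rightarrow> ('w \<Rightarrow> real) \<Rightarrow> real \<Rightarrow> real \<Rightarrow> bool" where
  "normal_rv M X \<mu> v \<longleftrightarrow> X \<in> borel_measurable M \<and>
     (if v = 0 then AE \<omega> in M. X \<omega> = \<mu>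
      else 0 < v \<and> distributed M lborel X (normal_density \<mu> (sqrt v)))"

definition multivariate_normal ::
  "'w measure \<Rightarrow> ('w \<Rightarrow> real^'n) \<Rightarrow> real^'n \<Rightarrow> real^'n^'n \<Rightarrow> bool" where
  "multivariate_normal M X \<mu> C \<longleftrightarrow> X \<in> borel_measurable M \<and>
     (\<forall>c. normal_rv M (\<lambda>\<omega>. c \<bullet> X \<omega>) (c \<bullet> \<mu>) (c \<bullet> (C *v c)))"

definition gaussian_process :: "'w measure \<Rightarrow> ('x \<Rightarrow> 'w \<Rightarrow> real^'n) \<Rightarrow> bool" where
  "gaussian_process M B \<longleftrightarrow> (\<forall>x. B x \<in> borel_measurable M) \<and>
     (\<forall>A c. finite A \<longrightarrow> (\<exists>\<mu> v. normal_rv M (\<lambda>\<omega>. \<Sum>x\<in>A. c x \<bullet> B x \<omega>) \<mu> v))"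

text \<open>
  The components are independent as random functions; \<^term>\<open>mat c\<close> is the diagonal matrix with
  all diagonal entries \<open>c\<close>.
\<close>

definition fractional_brownian_motion ::
  "'w measure \<Rightarrow> real \<Rightarrow> (real^'d \<Rightarrow> 'w \<Rightarrow> real^'n) \<Rightarrow> bool" where
  "fractional_brownian_motion M \<alpha> B \<longleftrightarrow>
     prob_space M \<and>
     gaussian_process M B \<and>
     (AE \<omega> in M. continuous_on UNIV (\<lambda>x. B x \<omega>) \<and> B 0 \<omega> = 0) \<and>
     prob_space.indep_vars M (\<lambda>_. PiM UNIV (\<lambda>_. borel)) (\<lambda>i \<omega> x. B x \<omega> $ i) UNIV \<and>
     (\<forall>x y. multivariate_normal M (\<lambda>\<omega>. B x \<omega> - B y \<omega>) 0 (mat (norm (x - y) powr (2 * \<alpha>))))"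

end

theory Submission
  imports Defs
begin

text \<open>
  Capacities are replaced by energies \<open>\<Sum>\<^sub>i\<^sub>j p\<^sub>i p\<^sub>j J(x\<^sub>i, x\<^sub>j)\<close> of finitely supported
  probability vectors on \<open>E\<close> itself, which is possible up to constants because at a fixed scale
  \<open>r\<close> the kernels hardly vary on small pieces.  This removes closures, measurability of kernels
  and the existence of equilibrium measures from the argument.

  Upper bounds: a nearly minimising vector has potential at least half the minimal energy at every
  point.  The kernel is a maximum over scales \<open>u \<in> [\<Phi>(r), r]\<close>, hence at most a sum over
  \<open>O(log (1/\<Phi>(r)))\<close> dyadic ones, so every point has a large potential at some scale \<open>u\<close>; the
  points belonging to \<open>u\<close> can be covered by few balls of radius \<open>u\<close>.  Lower bounds: if two
  points come within distance \<open>u\<close> with probability at most a multiple of \<open>Z\<^sub>u(x, y)\<close>, the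
  expected energy of the image is at most logarithmically larger than that of \<open>E\<close>; Borel-Cantelli
  and Cauchy-Schwarz turn this into a lower bound for all covers.  The logarithms are harmless
  because of the hypothesis on \<open>log \<Phi>\<close>.

  The probability estimates come from Solomyak's transversality argument for self-affine sets, from
  rotation invariance for projections, and from independent Gaussian components for fractional
  Brownian motion.  The covers come from singular value decompositions, from orthogonality, and
  from a modulus of continuity with logarithmic loss.
\<close>

section \<open>Finitely supported energies and coverings\<close>

text \<open>All three settings enter one locale through two hypotheses on a kernel \<open>Z\<close>:
  the deterministic \<open>cover_hyp\<close>, and a bound \<open>c * Z u x y\<close> for the
  probability that two images come within \<open>u\<close>. Scales are always those of the image;
  for fractional Brownian motion the domain scale is \<open>u powr (1 / \<alpha>)\<close>, and this
  substitution produces \<open>Phi_pow\<close> and the factor \<open>1 / \<alpha>\<close>. Crude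
  estimates suffice because every comparison sacrifices a little exponent: passing from
  \<open>s\<close> to \<open>t > s\<close> gains \<open>r powr (t - s)\<close>, which beats every
  power of \<open>ln (1 / \<Phi> r)\<close>. The real constraint is that covering sets must have
  diameters between \<open>\<Phi> r\<close> and \<open>r\<close>. In upper bounds a net of spacing
  \<open>\<Phi> r / 4\<close> and balls of diameter exactly \<open>u\<close> respect it. In lower
  bounds the exceptional events must be summable along a sequence of scales, while the lower
  dimension quantifies over all small \<open>r\<close>; hence each estimate is made for all
  \<open>r\<close> in an interval \<open>{\<rho>..2 * \<rho>}\<close> at once. Null sets depend on
  the exponents, which therefore run through the rationals.\<close>

text \<open>First variation at a near-minimiser \<open>p\<close>: moving mass \<open>t\<close> to
  the atom \<open>i\<close> cannot lower the energy below its infimum, and expanding in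
  \<open>t\<close> bounds the potential at \<open>i\<close> from below. An error of order
  \<open>t\<close> times the infimum is affordable, so no minimiser has to exist. Atoms outside the
  support of \<open>p\<close> are included, as covering the whole set requires.\<close>

lemma finite_potential_bound:
  fixes K :: "nat \<Rightarrow> nat \<Rightarrow> real"
  assumes n: "n > 0" and K0: "\<And>i j. i < n \<Longrightarrow> j < n \<Longrightarrow> 0 \<le> K i j"
    and sym: "\<And>i j. i < n \<Longrightarrow> j < n \<Longrightarrow> K i j = K j i"
    and \<gamma>: "\<gamma> > 0"
    and low: "\<And>p. (\<forall>i<n. 0 \<le> p i) \<Longrightarrow> (\<Sum>i<n. p i) = 1 \<Longrightarrow>
      \<gamma> \<le> (\<Sum>i<n. \<Sum>j<n. p i * p j * K i j)"
  obtains p where "\<forall>i<n. 0 \<le> p i" "(\<Sum>i<n. p i) = 1"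
    "\<forall>i<n. \<gamma> / 2 \<le> (\<Sum>j<n. p j * K i j)"
proof -
  define Q where "Q p = (\<Sum>i<n. \<Sum>j<n. p i * p j * K i j)" for p
  define P where "P = {p::nat \<Rightarrow> real. (\<forall>i<n. 0 \<le> p i) \<and> (\<Sum>i<n. p i) = 1}"
  define I where "I = Inf (Q ` P)"
  have "(\<lambda>i. if i = 0 then 1 else 0) \<in> P"
    using n by (simp add: P_def)
  then have ne: "Q ` P \<noteq> {}" by blast
  have lowP: "\<gamma> \<le> q" if "q \<in> Q ` P" for q
    using that low by (auto simp: P_def Q_def)
  have bdd: "bdd_below (Q ` P)"
    using lowP by (rule bdd_belowI)
  have I: "\<gamma> \<le> I"
    unfolding I_def using ne lowP by (rule cInf_greatest)
  have Ile: "I \<le> Q p" if "p \<in> P" for p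
    unfolding I_def using that bdd by (intro cInf_lower) auto
  define M where "M = 1 + (\<Sum>i<n. K i i)"
  have Mi: "K i i \<le> M" if "i < n" for i
  proof -
    have "K i i \<le> (\<Sum>i<n. K i i)"
      using that K0 by (intro member_le_sum) auto
    then show ?thesis by (simp add: M_def)
  qed
  have M: "M \<ge> 1"
    unfolding M_def using sum_nonneg[of "{..<n}" "\<lambda>i. K i i"] K0 by simp
  \<comment> \<open>Small enough for the quadratic self-energy term \<open>t^2 * K i i\<close> to be
    at most \<open>t * I / 4\<close>; the bound 1/2 keeps \<open>1 - t\<close> positive for the
    final division. The \<open>1 +\<close> in \<open>M\<close> keeps the quotient meaningful when
    the diagonal vanishes.\<close>
  define t where "t = min (1/2) (I / (4 * M))"
  have t0: "t > 0" using I \<gamma> M by (simp add: t_def)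
  have t1: "t \<le> 1/2" by (simp add: t_def)
  have tM: "t * M \<le> I / 4"
  proof -
    have "t * M \<le> I / (4 * M) * M" using M by (intro mult_right_mono) (auto simp: t_def)
    then show ?thesis using M by simp
  qed
  have "I < I + t * I / 4" using t0 I \<gamma> by simp
  then obtain p where p: "p \<in> P" "Q p < I + t * I / 4"
    using cInf_lessD[OF ne, of "I + t * I / 4"] unfolding I_def[symmetric] by auto
  show thesis
  proof (rule that)
    show "\<forall>i<n. 0 \<le> p i" "(\<Sum>i<n. p i) = 1" using p by (auto simp: P_def)
    show "\<forall>i<n. \<gamma> / 2 \<le> (\<Sum>j<n. p j * K i j)"
    proof (intro allI impI)
      fix i assume i: "i < n"
      define U where "U = (\<Sum>j<n. p j * K i j)"
      define e :: "nat \<Rightarrow> real" where "e j = (if j = i then 1 else 0)" for j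
      define q where "q j = (1 - t) * p j + t * e j" for j
      have esum: "(\<Sum>j<n. e j * f j) = f i" for f
        using i by (simp add: e_def if_distrib[of "\<lambda>x. x * _"] cong: if_cong)
      have "q \<in> P"
        using p i t0 t1 esum[of "\<lambda>_. 1"]
        by (auto simp: P_def q_def e_def sum.distrib simp flip: sum_distrib_left)
      then have "I \<le> Q q" by (rule Ile)
      also have "Q q = (\<Sum>a<n. \<Sum>b<n. (1-t)^2 * (p a * p b * K a b)
          + (1-t) * t * (e b * (p a * K a b)) + t * (1-t) * (e a * (p b * K a b))
          + t^2 * (e a * (e b * K a b)))"
        unfolding Q_def q_def by (intro sum.cong refl) (simp add: algebra_simps power2_eq_square)
      also have "\<dots> = (1-t)^2 * Q p + (1-t) * t * (\<Sum>a<n. p a * K a i)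
          + t * (1-t) * (\<Sum>a<n. e a * (\<Sum>b<n. p b * K a b)) + t^2 * (\<Sum>a<n. e a * K a i)"
        by (simp add: sum.distrib Q_def esum flip: sum_distrib_left)
      also have "(\<Sum>a<n. p a * K a i) = U"
        unfolding U_def using i sym by (intro sum.cong) auto
      also have "(\<Sum>a<n. e a * (\<Sum>b<n. p b * K a b)) = U"
        unfolding U_def by (rule esum)
      also have "(\<Sum>a<n. e a * K a i) = K i i" by (rule esum)
      finally have 1: "I \<le> (1-t)^2 * Q p + 2 * t * (1-t) * U + t^2 * K i i"
        by (simp add: mult_ac)
      have "(1-t)^2 * Q p \<le> (1-t)^2 * (I + t * I / 4)"
        using p by (intro mult_left_mono) auto
      also have "\<dots> = (1-t)^2 * I + (1-t)^2 * (t * I / 4)" by (simp add: algebra_simps)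
      also have "(1-t)^2 * (t * I / 4) \<le> 1 * (t * I / 4)"
        using t0 t1 I \<gamma> by (intro mult_right_mono) (auto simp: power_le_one)
      finally have 2: "(1-t)^2 * Q p \<le> (1-t)^2 * I + t * I / 4" by simp
      have "t^2 * K i i \<le> t * (t * M)"
        using Mi[OF i] t0 by (simp add: power2_eq_square mult_left_mono)
      also have "\<dots> \<le> t * (I / 4)" using tM t0 by (intro mult_left_mono) auto
      finally have 3: "t^2 * K i i \<le> t * I / 4" by simp
      \<comment> \<open>Moving \<open>(1-t)^2 * I\<close> to the left leaves
        \<open>I * (2 * t - t^2)\<close>, of which the two error terms consume
        \<open>t * I / 2\<close>.\<close>
      have "t * (I * (3/2 - t)) \<le> t * (2 * (1-t) * U)"
        using 1 2 3 by (simp add: algebra_simps power2_eq_square)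
      then have "I * (3/2 - t) \<le> 2 * (1-t) * U" using t0 by simp
      moreover have "I * (1 - t) \<le> I * (3/2 - t)" using I \<gamma> by (intro mult_left_mono) auto
      ultimately have "I * (1-t) \<le> (2 * U) * (1-t)" by (simp add: algebra_simps)
      then have "I \<le> 2 * U" using t1 by (simp add: mult_le_cancel_right)
      then show "\<gamma> / 2 \<le> (\<Sum>j<n. p j * K i j)" using I by (simp add: U_def)
    qed
  qed
qed

text \<open>Cauchy-Schwarz for the masses of the classes of \<open>U\<close>, weighted by
  \<open>sqrt (d V)\<close>. With \<open>d V\<close> a power of the diameter, it turns an upper
  bound for the energy of pairs in a common covering set into a lower bound for the sum over the
  cover.\<close>

lemma cauchy_schwarz_classes:
  fixes p :: "nat \<Rightarrow> real" and d :: "'u \<Rightarrow> real"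
  assumes "(\<Sum>i<n. p i) = 1" and d: "\<And>i. i < n \<Longrightarrow> 0 < d (U i)"
  shows "1 \<le> (\<Sum>i<n. \<Sum>j<n. if U i = U j then p i * p j / d (U i) else 0) * (\<Sum>V\<in>U ` {..<n}. d V)"
proof -
  let ?S = "U ` {..<n}"
  define q where "q V = (\<Sum>i | i < n \<and> U i = V. p i)" for V
  have grp: "(\<Sum>V\<in>?S. \<Sum>i | i < n \<and> U i = V. g i V) = (\<Sum>i<n. g i (U i))" for g :: "nat \<Rightarrow> 'u \<Rightarrow> real"
  proof -
    have "(\<Sum>V\<in>?S. \<Sum>i | i < n \<and> U i = V. g i V) = (\<Sum>V\<in>?S. \<Sum>i | i \<in> {..<n} \<and> U i = V. g i (U i))"
      by (intro sum.cong) auto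
    also have "\<dots> = (\<Sum>i<n. g i (U i))"
      by (rule sum.group) auto
    finally show ?thesis .
  qed
  have "1 = (\<Sum>V\<in>?S. q V)^2" unfolding q_def using grp[of "\<lambda>i V. p i"] assms by simp
  also have "\<dots> = (\<Sum>V\<in>?S. (q V / sqrt (d V)) * sqrt (d V))^2"
  proof -
    have "(\<Sum>V\<in>?S. q V) = (\<Sum>V\<in>?S. (q V / sqrt (d V)) * sqrt (d V))"
      using d by (intro sum.cong refl) force
    then show ?thesis by simp
  qed
  also have "\<dots> \<le> (\<Sum>V\<in>?S. (q V / sqrt (d V))^2) * (\<Sum>V\<in>?S. (sqrt (d V))^2)"
    by (rule Cauchy_Schwarz_ineq_sum)
  also have "(\<Sum>V\<in>?S. (sqrt (d V))^2) = (\<Sum>V\<in>?S. d V)"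
    using d by (intro sum.cong refl) (force simp: less_imp_le)
  also have "(\<Sum>V\<in>?S. (q V / sqrt (d V))^2) = (\<Sum>V\<in>?S. \<Sum>i | i < n \<and> U i = V. p i * q V / d V)"
  proof (intro sum.cong refl)
    fix V assume "V \<in> ?S"
    then have "d V > 0" using d by auto
    then have "(q V / sqrt (d V))^2 = q V * q V / d V"
      by (simp add: power2_eq_square)
    also have "\<dots> = (\<Sum>i | i < n \<and> U i = V. p i * q V / d V)"
      by (simp add: q_def sum_distrib_right sum_divide_distrib)
    finally show "(q V / sqrt (d V))^2 = (\<Sum>i | i < n \<and> U i = V. p i * q V / d V)" .
  qed
  also have "\<dots> = (\<Sum>i<n. p i * q (U i) / d (U i))"
    by (rule grp)
  also have "\<dots> = (\<Sum>i<n. \<Sum>j<n. if U i = U j then p i * p j / d (U i) else 0)"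
  proof (intro sum.cong refl)
    fix i
    have "p i * q (U i) / d (U i) = (\<Sum>j | j < n \<and> U j = U i. p i * p j / d (U i))"
      by (simp add: q_def sum_distrib_left sum_divide_distrib)
    also have "\<dots> = (\<Sum>j\<in>{..<n}. if U i = U j then p i * p j / d (U i) else 0)"
      by (intro sum.mono_neutral_cong_left) auto
    finally show "p i * q (U i) / d (U i) = (\<Sum>j<n. if U i = U j then p i * p j / d (U i) else 0)" .
  qed
  finally show ?thesis .
qed

text \<open>The bound \<open>N\<close> is real because it will be a quotient of constants,
  logarithms and potentials. The centres may lie anywhere.\<close>

definition covered :: "'e::metric_space set \<Rightarrow> real \<Rightarrow> real \<Rightarrow> bool" where
  "covered F N \<delta> \<longleftrightarrow> (\<exists>Y. finite Y \<and> real (card Y) \<le> N \<and> F \<subseteq> (\<Union>z\<in>Y. cball z \<delta>))"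

lemma covered_mono: "covered F N \<delta> \<Longrightarrow> G \<subseteq> F \<Longrightarrow> N \<le> M \<Longrightarrow> covered G M \<delta>"
  unfolding covered_def by (meson order.trans)

lemma covered_UN:
  assumes "finite I" "\<And>i. i \<in> I \<Longrightarrow> covered (F i) (N i) \<delta>"
  shows "covered (\<Union>i\<in>I. F i) (\<Sum>i\<in>I. N i) \<delta>"
proof -
  from assms(2) obtain Y where Y: "\<And>i. i \<in> I \<Longrightarrow> finite (Y i) \<and> real (card (Y i)) \<le> N i \<and> F i \<subseteq> (\<Union>z\<in>Y i. cball z \<delta>)"
    unfolding covered_def by metis
  have "real (card (\<Union>i\<in>I. Y i)) \<le> (\<Sum>i\<in>I. real (card (Y i)))"
    using card_UN_le[OF assms(1), of Y] by (simp flip: of_nat_sum)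
  also have "\<dots> \<le> (\<Sum>i\<in>I. N i)" using Y by (intro sum_mono) auto
  finally show ?thesis
    unfolding covered_def using Y assms(1) by (intro exI[of _ "\<Union>i\<in>I. Y i"]) blast
qed

text \<open>Common form of \<open>code_kernel\<close> and \<open>profile_kernel\<close>, so that
  both kinds of capacity dimension are treated at once.\<close>

definition ker_max :: "(real \<Rightarrow> real) \<Rightarrow> (real \<Rightarrow> 'p \<Rightarrow> 'p \<Rightarrow> real) \<Rightarrow> real \<Rightarrow> real \<Rightarrow> 'p \<Rightarrow> 'p \<Rightarrow> real" where
  "ker_max \<Phi> Z s r x y = (SUP u\<in>{\<Phi> r..r}. u powr (- s) * Z u x y)"

definition weights :: "'p set \<Rightarrow> nat \<Rightarrow> (nat \<Rightarrow> 'p) \<Rightarrow> (nat \<Rightarrow> real) \<Rightarrow> bool" where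
  "weights E n x p \<longleftrightarrow> (\<forall>i<n. x i \<in> E \<and> 0 \<le> p i) \<and> (\<Sum>i<n. p i) = 1"

definition energy :: "('p \<Rightarrow> 'p \<Rightarrow> real) \<Rightarrow> nat \<Rightarrow> (nat \<Rightarrow> 'p) \<Rightarrow> (nat \<Rightarrow> real) \<Rightarrow> real" where
  "energy K n x p = (\<Sum>i<n. \<Sum>j<n. p i * p j * K (x i) (x j))"

text \<open>The exponent sets whose infima are the dimensions are isolated as predicates because the
  almost sure statements concern the membership of individual exponents.\<close>

definition upper_admits :: "(real \<Rightarrow> real) \<Rightarrow> 'a::euclidean_space set \<Rightarrow> real \<Rightarrow> bool" where
  "upper_admits \<Phi> F s \<longleftrightarrow> 0 \<le> s \<and>
     (\<forall>\<epsilon>>0. \<exists>r0\<in>{0<..1}. \<forall>r\<in>{0<..<r0}. \<exists>\<U>. scale_cover (\<Phi> r) r F \<U> \<and>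
        (\<Sum>\<^sub>\<infinity>U\<in>\<U>. ennreal (diameter U powr s)) \<le> ennreal \<epsilon>)"

definition lower_admits :: "(real \<Rightarrow> real) \<Rightarrow> 'a::euclidean_space set \<Rightarrow> real \<Rightarrow> bool" where
  "lower_admits \<Phi> F s \<longleftrightarrow> 0 \<le> s \<and>
     (\<forall>\<epsilon>>0. \<forall>r0\<in>{0<..1}. \<exists>r\<in>{0<..<r0}. \<exists>\<U>. scale_cover (\<Phi> r) r F \<U> \<and>
        (\<Sum>\<^sub>\<infinity>U\<in>\<U>. ennreal (diameter U powr s)) \<le> ennreal \<epsilon>)"

lemma Phi_dim_eq:
  "upper_Phi_dim \<Phi> F = Inf (Collect (upper_admits \<Phi> F))"
  "lower_Phi_dim \<Phi> F = Inf (Collect (lower_admits \<Phi> F))"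
  unfolding upper_Phi_dim_def lower_Phi_dim_def upper_admits_def[abs_def] lower_admits_def[abs_def]
  by simp_all

lemma sum_le_infsum_ennreal:
  fixes f :: "'a \<Rightarrow> ennreal"
  assumes "finite A" "A \<subseteq> B"
  shows "sum f A \<le> infsum f B"
proof -
  have "sum f A = infsum f A" using assms by simp
  also have "\<dots> \<le> infsum f B"
    by (rule infsum_mono_neutral) (use assms in \<open>auto simp: nonneg_summable_on_complete\<close>)
  finally show ?thesis .
qed

lemma inverse_antimono_ennreal: "(a::ennreal) \<le> b \<Longrightarrow> inverse b \<le> inverse a"
  by (simp add: less_eq_ennreal.rep_eq inverse_ennreal.rep_eq ereal_inverse_antimono enn2ereal_nonneg)

lemma ennreal_less_imp_less: "ennreal x < ennreal y \<Longrightarrow> x < y"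
  by (meson ennreal_leI not_le)

lemma dyadic_scale:
  assumes "0 < u" "u \<le> (r::real)"
  obtains k where "u \<le> (1/2)^k * r" "(1/2)^k * r < 2 * u"
proof -
  obtain m where "(1/2)^m < u / r"
    using real_arch_pow_inv[of "u / r" "1/2"] assms by auto
  then have m: "(1/2)^m * r < u" using assms by (simp add: field_simps)
  define k where "k = (GREATEST k. u \<le> (1/2)^k * r)"
  have bnd: "k' \<le> m" if "u \<le> (1/2)^k' * r" for k'
  proof (rule ccontr)
    assume "\<not> k' \<le> m"
    then have "(1/2::real)^k' \<le> (1/2)^m" by (intro power_decreasing) auto
    then have "(1/2)^k' * r \<le> (1/2)^m * r" using assms by (intro mult_right_mono) auto
    then show False using that m by simp
  qed
  have P0: "u \<le> (1/2)^0 * r" using assms by simp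
  have 1: "u \<le> (1/2)^k * r"
    unfolding k_def by (rule GreatestI_nat[where P = "\<lambda>k. u \<le> (1/2)^k * r" and k = 0 and b = m]) (use bnd P0 in auto)
  have "\<not> u \<le> (1/2)^(Suc k) * r"
  proof
    assume "u \<le> (1/2)^(Suc k) * r"
    then have "Suc k \<le> k" unfolding k_def by (rule Greatest_le_nat[where P = "\<lambda>k. u \<le> (1/2)^k * r" and b = m]) (use bnd in auto)
    then show False by simp
  qed
  then have "(1/2)^k * r < 2 * u" by simp
  with 1 that show thesis by blast
qed

text \<open>\<open>E\<close> may carry no topology at all; only its image is bounded. Compactness is
  therefore applied to the closure of the image, and the net is pulled back to points of
  \<open>E\<close>.\<close>

lemma finite_image_net:
  fixes f :: "'p \<Rightarrow> 'e::euclidean_space"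
  assumes "bounded (f ` E)" "\<delta> > 0" "E \<noteq> {}"
  obtains n x where "n > 0" "\<forall>i<n. x i \<in> E" "\<And>e. e \<in> E \<Longrightarrow> \<exists>i<n::nat. dist (f e) (f (x i)) \<le> \<delta>"
proof -
  have "compact (closure (f ` E))" using assms by (simp add: compact_closure)
  moreover have "closure (f ` E) \<subseteq> (\<Union>e\<in>E. ball (f e) \<delta>)"
  proof
    fix z assume "z \<in> closure (f ` E)"
    then obtain y where "y \<in> f ` E" "dist y z < \<delta>"
      using assms(2) by (metis closure_approachable)
    then show "z \<in> (\<Union>e\<in>E. ball (f e) \<delta>)" by auto
  qed
  ultimately obtain E' where E': "E' \<subseteq> E" "finite E'" "closure (f ` E) \<subseteq> (\<Union>e\<in>E'. ball (f e) \<delta>)"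
    using compactE_image[of "closure (f ` E)" E "\<lambda>e. ball (f e) \<delta>"] by auto
  have "E' \<noteq> {}"
  proof
    assume "E' = {}"
    then have "f ` E \<subseteq> {}" using E'(3) closure_subset by fastforce
    then show False using assms by simp
  qed
  obtain x where x: "bij_betw x {0..<card E'} E'"
    using ex_bij_betw_nat_finite[OF E'(2)] by blast
  show thesis
  proof
    show "card E' > 0" using E' \<open>E' \<noteq> {}\<close> by (simp add: card_gt_0_iff)
    show "\<forall>i<card E'. x i \<in> E" using x E'(1) by (auto simp: bij_betw_def)
    fix e assume "e \<in> E"
    then have "f e \<in> closure (f ` E)" using closure_subset by fastforce
    then obtain e' where e': "e' \<in> E'" "dist (f e') (f e) < \<delta>" using E'(3) by auto
    then obtain i where "i < card E'" "x i = e'"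
      using x by (metis atLeastLessThan_iff bij_betw_imp_surj_on imageE)
    then show "\<exists>i<card E'. dist (f e) (f (x i)) \<le> \<delta>"
      using e' by (intro exI[of _ i]) (auto simp: dist_commute)
  qed
qed

section \<open>Upper bounds from capacities\<close>

text \<open>Heuristically, a point whose potential at scale \<open>u\<close> exceeds
  \<open>lam\<close> has a neighbourhood of mass \<open>lam\<close>, and about
  \<open>1 / lam\<close> such neighbourhoods exhaust the unit mass. The constants may depend on
  \<open>f\<close>, hence on the random parameter. The radius \<open>u / 4\<close> leaves room to
  pass from a net to all of \<open>E\<close> with balls of radius \<open>u / 2\<close>.\<close>

definition cover_hyp :: "(real \<Rightarrow> 'p \<Rightarrow> 'p \<Rightarrow> real) \<Rightarrow> 'p set \<Rightarrow> ('p \<Rightarrow> 'e::metric_space) \<Rightarrow> bool" where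
  "cover_hyp Z E f \<longleftrightarrow> (\<exists>C \<kappa> u0. C > 0 \<and> u0 > 0 \<and>
     (\<forall>u n x p X lam. 0 < u \<longrightarrow> u < u0 \<longrightarrow> weights E n x p \<longrightarrow> 0 < lam \<longrightarrow>
        (\<forall>i\<in>X. i < n \<and> lam \<le> (\<Sum>j<n. p j * Z u (x i) (x j))) \<longrightarrow>
        covered (f ` x ` X) (C * ln (1 / u) ^ \<kappa> / lam) (u / 4)))"

text \<open>\<open>Z u x y\<close> plays the role of the probability, up to a constant, that the
  images of \<open>x\<close> and \<open>y\<close> come within \<open>u\<close>. Doubling permits
  bounded changes of scale.\<close>

locale kernel_family =
  fixes \<Phi> :: "real \<Rightarrow> real" and Z :: "real \<Rightarrow> 'p \<Rightarrow> 'p \<Rightarrow> real" and C0 :: real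
  assumes adm: "admissible \<Phi>"
    and log_cond: "\<And>\<epsilon>. \<epsilon> > 0 \<Longrightarrow> ((\<lambda>r. r powr \<epsilon> * ln (\<Phi> r)) \<longlongrightarrow> 0) (at_right 0)"
    and Z_nonneg: "\<And>u x y. 0 < u \<Longrightarrow> 0 \<le> Z u x y"
    and Z_le1: "\<And>u x y. 0 < u \<Longrightarrow> Z u x y \<le> 1"
    and Z_mono: "\<And>u v x y. 0 < u \<Longrightarrow> u \<le> v \<Longrightarrow> Z u x y \<le> Z v x y"
    and Z_double: "\<And>u x y. 0 < u \<Longrightarrow> Z (2 * u) x y \<le> C0 * Z u x y"
    and Z_sym: "\<And>u x y. Z u x y = Z u y x"
    and C0: "C0 > 0"
begin

text \<open>The facts about \<Phi> at a small scale in one filter statement. Monotonicity up to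
  \<open>4 * r\<close> allows the values of \<Phi> at \<open>r\<close> and at scales up to
  \<open>2 * r\<close> to be compared.\<close>

lemma Phi_small: "\<forall>\<^sub>F r in at_right 0. 0 < r \<and> r < \<delta> \<and> 0 < \<Phi> r \<and> \<Phi> r \<le> r \<and> mono_on {0<..4*r} \<Phi>" if "\<delta> > 0"
proof -
  obtain Y where Y: "Y > 0" "\<And>r. 0 < r \<Longrightarrow> r < Y \<Longrightarrow> 0 < \<Phi> r \<and> \<Phi> r \<le> r" "mono_on {0<..<Y} \<Phi>"
    using adm unfolding admissible_def by auto
  have "\<forall>\<^sub>F r in at_right 0. r \<in> {0<..<min \<delta> (Y/4)}"
    by (rule eventually_at_rightI[of 0 "min \<delta> (Y/4)"]) (use that Y in auto)
  then show ?thesis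
  proof eventually_elim
    case (elim r)
    then show ?case using Y by (auto intro: mono_on_subset)
  qed
qed

text \<open>The power of \<open>r\<close> is split into \<open>\<kappa> + 1\<close> equal factors.
  Each logarithm is absorbed by one of them, and the spare factor tends to 0, which also settles
  \<open>\<kappa> = 0\<close>.\<close>

lemma log_power_small:
  assumes "a > 0"
  shows "((\<lambda>r. ln (1 / \<Phi> r) ^ \<kappa> * r powr a) \<longlongrightarrow> 0) (at_right 0)"
proof -
  define \<delta> where "\<delta> = a / (real \<kappa> + 1)"
  have \<delta>: "\<delta> > 0" using assms by (simp add: \<delta>_def)
  have "((\<lambda>r. (- (r powr \<delta> * ln (\<Phi> r))) ^ \<kappa>) \<longlongrightarrow> (- 0) ^ \<kappa>) (at_right 0)"
    by (intro tendsto_intros log_cond \<delta>)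
  moreover have "((\<lambda>r. r powr \<delta>) \<longlongrightarrow> 0) (at_right 0)"
  proof -
    have "((\<lambda>r::real. r powr \<delta>) \<longlongrightarrow> 0 powr \<delta>) (at_right 0)"
      by (intro tendsto_powr' tendsto_intros) (use \<delta> in \<open>auto intro: eventually_mono[OF eventually_at_right_less]\<close>)
    then show ?thesis by simp
  qed
  ultimately have "((\<lambda>r. r powr \<delta> * (- (r powr \<delta> * ln (\<Phi> r))) ^ \<kappa>) \<longlongrightarrow> 0 * (- 0) ^ \<kappa>) (at_right 0)"
    by (rule tendsto_mult[rotated])
  then have "((\<lambda>r. r powr \<delta> * (- (r powr \<delta> * ln (\<Phi> r))) ^ \<kappa>) \<longlongrightarrow> 0) (at_right 0)"
    by simp
  moreover have "\<forall>\<^sub>F r in at_right 0. r powr \<delta> * (- (r powr \<delta> * ln (\<Phi> r))) ^ \<kappa> = ln (1 / \<Phi> r) ^ \<kappa> * r powr a"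
    using Phi_small[of 1, OF zero_less_one]
  proof eventually_elim
    case (elim r)
    have "r powr \<delta> * (- (r powr \<delta> * ln (\<Phi> r))) ^ \<kappa> = (r powr \<delta>) ^ Suc \<kappa> * (- ln (\<Phi> r)) ^ \<kappa>"
      by (simp only: minus_mult_right[of "r powr \<delta>"] power_mult_distrib power_Suc mult.assoc)
    also have "(r powr \<delta>) ^ Suc \<kappa> = r powr (\<delta> * (real \<kappa> + 1))"
      using elim by (subst powr_power) (auto simp: algebra_simps)
    also have "\<delta> * (real \<kappa> + 1) = a" by (simp add: \<delta>_def)
    also have "- ln (\<Phi> r) = ln (1 / \<Phi> r)" using elim by (simp add: ln_div)
    finally show ?case by simp
  qed
  ultimately show ?thesis by (rule Lim_transform_eventually)
qed

lemma ker_max_ge: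
  assumes "0 < \<Phi> r" "\<Phi> r \<le> u" "u \<le> r" "0 \<le> s"
  shows "u powr (- s) * Z u x y \<le> ker_max \<Phi> Z s r x y"
  unfolding ker_max_def
proof (rule cSUP_upper)
  show "bdd_above ((\<lambda>u. u powr - s * Z u x y) ` {\<Phi> r..r})"
  proof (rule bdd_aboveI2)
    fix v assume v: "v \<in> {\<Phi> r..r}"
    have "v powr - s * Z v x y \<le> \<Phi> r powr (- s) * 1"
      using v assms Z_nonneg[of v] Z_le1[of v] by (intro mult_mono powr_mono2') auto
    then show "v powr - s * Z v x y \<le> \<Phi> r powr (- s)" by simp
  qed
qed (use assms in auto)

lemma ker_max_le:
  assumes "\<Phi> r \<le> r" "\<And>u. \<Phi> r \<le> u \<Longrightarrow> u \<le> r \<Longrightarrow> u powr (- s) * Z u x y \<le> B"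
  shows "ker_max \<Phi> Z s r x y \<le> B"
  unfolding ker_max_def using assms by (intro cSUP_least) auto

lemma ker_max_nonneg: "0 < \<Phi> r \<Longrightarrow> \<Phi> r \<le> r \<Longrightarrow> 0 \<le> s \<Longrightarrow> 0 \<le> ker_max \<Phi> Z s r x y"
  using ker_max_ge[of r r s x y] Z_nonneg[of r x y] by (smt (verit) mult_nonneg_nonneg powr_ge_zero)

lemma ker_max_sym: "ker_max \<Phi> Z s r x y = ker_max \<Phi> Z s r y x"
  unfolding ker_max_def by (simp add: Z_sym)

section \<open>Dyadic scales between \<open>\<Phi> r\<close> and \<open>r\<close>\<close>

definition scales :: "real \<Rightarrow> nat set" where
  "scales r = {k. \<Phi> r \<le> (1/2)^k * r}"

text \<open>For \<open>r < 1\<close> an index \<open>k\<close> in \<open>scales r\<close> satisfies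
  \<open>k * ln 2 \<le> ln (1 / \<Phi> r)\<close>, and \<open>ln 2 \<ge> 1/2\<close>. For
  \<open>r < exp (-1)\<close> the logarithm is at least 1 and swallows the added 1.\<close>

definition nscales :: "real \<Rightarrow> nat" where
  "nscales r = nat \<lfloor>2 * ln (1 / \<Phi> r)\<rfloor> + 1"

lemma scales:
  assumes "0 < \<Phi> r" "\<Phi> r \<le> r" "r < exp (-1)"
  shows "scales r \<subseteq> {..<nscales r}" "finite (scales r)" "card (scales r) \<le> nscales r"
    "1 \<le> ln (1 / \<Phi> r)" "real (nscales r) \<le> 3 * ln (1 / \<Phi> r)"
proof -
  have "\<Phi> r < exp (-1)" using assms by simp
  then have "ln (\<Phi> r) < -1" using assms by (metis ln_exp ln_less_cancel_iff exp_gt_zero)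
  then show L: "1 \<le> ln (1 / \<Phi> r)" using assms by (simp add: ln_div)
  then show "real (nscales r) \<le> 3 * ln (1 / \<Phi> r)" unfolding nscales_def by simp linarith
  show sub: "scales r \<subseteq> {..<nscales r}"
  proof
    fix k assume "k \<in> scales r"
    then have k: "\<Phi> r \<le> (1/2)^k * r" by (simp add: scales_def)
    have "r < 1" using assms(3) by (smt (verit) exp_le_one_iff)
    then have "(1/2)^k * r \<le> (1/2)^k * 1" by (intro mult_left_mono) auto
    then have "\<Phi> r \<le> (1/2)^k" using k by linarith
    then have "ln (\<Phi> r) \<le> ln ((1/2)^k)" using assms by (subst ln_le_cancel_iff) auto
    also have "\<dots> = - (real k * ln 2)" by (simp add: ln_realpow ln_div)
    finally have "real k * ln 2 \<le> ln (1 / \<Phi> r)" using assms by (simp add: ln_div)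
    moreover have "real k * (1/2) \<le> real k * ln 2"
      using ln2_ge_two_thirds by (intro mult_left_mono) auto
    ultimately have "real k \<le> 2 * ln (1 / \<Phi> r)" by simp
    then have "int k \<le> \<lfloor>2 * ln (1 / \<Phi> r)\<rfloor>" by (simp add: le_floor_iff)
    then show "k \<in> {..<nscales r}" unfolding nscales_def by (simp add: le_nat_iff less_Suc_eq_le)
  qed
  then show "finite (scales r)" by (rule finite_subset) simp
  show "card (scales r) \<le> nscales r" using card_mono[OF _ sub] by simp
qed

text \<open>Rounding \<open>u\<close> up to the next dyadic scale increases \<open>Z\<close> and
  costs \<open>2 powr s\<close> in the power. Rounding up, not down, keeps the scale above
  \<open>\<Phi> r\<close>.\<close>

lemma ker_max_le_sum:
  assumes "0 < \<Phi> r" "\<Phi> r \<le> r" "r < exp (-1)" "0 \<le> s"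
  shows "ker_max \<Phi> Z s r x y \<le> (\<Sum>k\<in>scales r. 2 powr s * ((1/2)^k * r) powr (- s) * Z ((1/2)^k * r) x y)"
proof (rule ker_max_le)
  fix u assume u: "\<Phi> r \<le> u" "u \<le> r"
  obtain k where k: "u \<le> (1/2)^k * r" "(1/2)^k * r < 2 * u"
    using dyadic_scale[of u r] u assms by auto
  let ?v = "(1/2)^k * r"
  have "u powr (- s) \<le> (?v / 2) powr (- s)"
    using k u assms by (intro powr_mono2') auto
  also have "\<dots> = 2 powr s * ?v powr (- s)"
    using assms by (simp add: powr_divide powr_minus divide_simps powr_mult)
  finally have "u powr (- s) * Z u x y \<le> (2 powr s * ?v powr (- s)) * Z ?v x y"
    using k u assms Z_nonneg[of u] Z_mono[of u ?v] by (intro mult_mono) auto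
  also have "\<dots> \<le> (\<Sum>k\<in>scales r. 2 powr s * ((1/2)^k * r) powr (- s) * Z ((1/2)^k * r) x y)"
  proof (rule member_le_sum[where f = "\<lambda>k. 2 powr s * ((1/2)^k * r) powr (- s) * Z ((1/2)^k * r) x y"])
    show "k \<in> scales r" using k u by (simp add: scales_def)
    show "finite (scales r)" using scales assms by blast
    show "0 \<le> 2 powr s * ((1/2)^k * r) powr (- s) * Z ((1/2)^k * r) x y" for k
      using assms Z_nonneg[of "(1/2)^k * r"] by auto
  qed
  finally show "u powr (- s) * Z u x y \<le> (\<Sum>k\<in>scales r. 2 powr s * ((1/2)^k * r) powr (- s) * Z ((1/2)^k * r) x y)" .
qed (use assms in auto)

end

text \<open>\<open>cap\<close> abstracts the two kinds of capacity; only its comparison with finite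
  energies is retained. Its inverse is below every finite energy, and a value above 1 yields a
  weight vector of energy at most \<open>c0\<close>. Boundedness at the top exponent
  \<open>D\<close> makes the sets in the infima non-empty.\<close>

locale dim_kernel = kernel_family \<Phi> Z C0 for \<Phi> and Z :: "real \<Rightarrow> 'p \<Rightarrow> 'p \<Rightarrow> real" and C0 +
  fixes E :: "'p set" and cap :: "real \<Rightarrow> real \<Rightarrow> ennreal" and D c0 :: real
  assumes E_ne: "E \<noteq> {}"
    and D0: "D \<ge> 0"
    and cap_le: "\<And>s. 0 \<le> s \<Longrightarrow> s \<le> D \<Longrightarrow> \<forall>\<^sub>F r in at_right 0. \<forall>n x p. weights E n x p \<longrightarrow>
        inverse (cap s r) \<le> ennreal (energy (ker_max \<Phi> Z s r) n x p)"
    and energy_le: "\<And>s. 0 \<le> s \<Longrightarrow> s \<le> D \<Longrightarrow> \<forall>\<^sub>F r in at_right 0. 1 < cap s r \<longrightarrow>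
        (\<exists>n x p. weights E n x p \<and> energy (ker_max \<Phi> Z s r) n x p \<le> c0)"
    and cap_D: "Limsup (at_right 0) (cap D) < \<infinity>"
begin

text \<open>Capacity at most \<open>B\<close> forces every energy to be at least
  \<open>1 / B\<close>, so a suitable weight vector on a fine net has potential at least
  \<open>1 / (2 * B)\<close> at every net point. Distributing this over the scales assigns to each
  net point a scale where its potential is large, and \<open>cover_hyp\<close> covers the points
  belonging to one scale. The spare exponent \<open>t - s\<close> pays for the logarithms.\<close>

lemma cover_of_cap:
  fixes f :: "'p \<Rightarrow> 'e::euclidean_space"
  assumes hyp: "cover_hyp Z E f" and bd: "bounded (f ` E)"
    and s: "0 \<le> s" "s \<le> D" "s < t" and B: "B > 0" and \<epsilon>: "\<epsilon> > 0"
  shows "\<forall>\<^sub>F r in at_right 0. cap s r \<le> ennreal B \<longrightarrow> (\<exists>\<U>. scale_cover (\<Phi> r) r (f ` E) \<U> \<and>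
    (\<Sum>\<^sub>\<infinity>U\<in>\<U>. ennreal (diameter U powr t)) \<le> ennreal \<epsilon>)"
proof -
  from hyp obtain C \<kappa> u0 where C: "C > 0" and u0: "u0 > 0" and hyp': "\<forall>u n x p X lam. 0 < u \<longrightarrow> u < u0 \<longrightarrow> weights E n x p \<longrightarrow> 0 < lam \<longrightarrow>
        (\<forall>i\<in>X. i < n \<and> lam \<le> (\<Sum>j<n. p j * Z u (x i) (x j))) \<longrightarrow>
        covered (f ` x ` X) (C * ln (1 / u) ^ \<kappa> / lam) (u / 4)"
    unfolding cover_hyp_def by (elim exE conjE) (rule that)
  note hyp = hyp'[rule_format]
  \<comment> \<open>Collects the constant of \<open>cover_hyp\<close>, the factors in
    \<open>1 / lam\<close>, and 9 from two factors \<open>N \<le> 3 * ln (1 / \<Phi> r)\<close>: one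
    enters through \<open>lam\<close>, the other through the sum over scales. Hence also the
    exponent \<open>\<kappa> + 2\<close>.\<close>
  define A where "A = C * 2 * 2 powr s * B * 9"
  have A: "A > 0" using C B by (simp add: A_def)
  have "((\<lambda>r. A * (ln (1 / \<Phi> r) ^ (\<kappa> + 2) * r powr (t - s))) \<longlongrightarrow> A * 0) (at_right 0)"
    using s by (intro tendsto_intros log_power_small) auto
  then have "\<forall>\<^sub>F r in at_right 0. A * (ln (1 / \<Phi> r) ^ (\<kappa> + 2) * r powr (t - s)) < \<epsilon>"
    using \<epsilon> by (intro order_tendstoD) auto
  moreover have "\<forall>\<^sub>F r in at_right 0. 0 < r \<and> r < min u0 (exp (-1)) \<and> 0 < \<Phi> r \<and> \<Phi> r \<le> r \<and> mono_on {0<..4*r} \<Phi>"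
    using u0 by (intro Phi_small) auto
  moreover note cap_le[OF s(1,2)]
  ultimately show ?thesis
  proof eventually_elim
    case (elim r)
    note r = elim(2)
    have r': "0 < r" "r < u0" "r < exp (-1)" "0 < \<Phi> r" "\<Phi> r \<le> r" using r by auto
    note sc = scales[OF r'(4,5,3)]
    show ?case
    proof
      assume capB: "cap s r \<le> ennreal B"
      let ?J = "ker_max \<Phi> Z s r"
      let ?L = "ln (1 / \<Phi> r)"
      define N where "N = real (nscales r)"
      have N: "N \<ge> 1" "N \<le> 3 * ?L" using sc by (auto simp: N_def nscales_def)
      have low: "1 / B \<le> energy ?J n x p" if "weights E n x p" for n x p
      proof -
        have "ennreal (1 / B) = inverse (ennreal B)" using B by (simp add: inverse_ennreal inverse_eq_divide)
        also have "\<dots> \<le> inverse (cap s r)" using capB by (rule inverse_antimono_ennreal)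
        also have "\<dots> \<le> ennreal (energy ?J n x p)" using elim(3) that by blast
        finally show ?thesis
          using B by (subst (asm) ennreal_le_iff2) auto
      qed
      \<comment> \<open>The spacing \<open>\<Phi> r / 4\<close> is at most a quarter of every scale
        in use, so one net serves all scales.\<close>
      obtain n x where nx: "n > 0" "\<forall>i<n. x i \<in> E" "\<And>e. e \<in> E \<Longrightarrow> \<exists>i<n::nat. dist (f e) (f (x i)) \<le> \<Phi> r / 4"
        using finite_image_net[OF bd, of "\<Phi> r / 4"] r' E_ne by auto
      obtain p where p: "\<forall>i<n. 0 \<le> p i" "(\<Sum>i<n. p i) = 1"
        "\<forall>i<n. (1 / B) / 2 \<le> (\<Sum>j<n. p j * ?J (x i) (x j))"
      proof (rule finite_potential_bound[OF nx(1), where K="\<lambda>i j. ?J (x i) (x j)" and \<gamma>="1/B"])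
        fix q assume "\<forall>i<n. 0 \<le> (q::nat\<Rightarrow>real) i" "(\<Sum>i<n. q i) = 1"
        then have "weights E n x q" using nx by (auto simp: weights_def)
        from low[OF this] show "1 / B \<le> (\<Sum>i<n. \<Sum>j<n. q i * q j * ?J (x i) (x j))"
          by (simp add: energy_def)
      qed (use B r' s ker_max_nonneg ker_max_sym in auto)
      have w: "weights E n x p" using p nx by (auto simp: weights_def)
      define u where "u k = (1/2)^k * r" for k :: nat
      have u: "0 < u k" "u k \<le> r" for k using r' by (auto simp: u_def power_le_one mult_le_cancel_right1)
      have u\<Phi>: "\<Phi> r \<le> u k" if "k \<in> scales r" for k using that by (simp add: u_def scales_def)
      \<comment> \<open>Chosen so that
        \<open>2 powr s * u k powr (- s) * lam k = 1 / (2 * B * N)\<close>: if all of the at most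
        \<open>N\<close> scales fell below it, their total would stay under the potential
        \<open>1 / (2 * B)\<close>.\<close>
      define lam where "lam k = u k powr s / (2 * B * N * 2 powr s)" for k
      have lam: "lam k > 0" for k using u[of k] B N by (simp add: lam_def)
      define X where "X k = {i. i < n \<and> lam k \<le> (\<Sum>j<n. p j * Z (u k) (x i) (x j))}" for k
      have exk: "\<exists>k\<in>scales r. i \<in> X k" if i: "i < n" for i
      proof (rule ccontr)
        assume "\<not> ?thesis"
        then have lt: "(\<Sum>j<n. p j * Z (u k) (x i) (x j)) < lam k" if "k \<in> scales r" for k
          using that i by (force simp: X_def)
        have ne: "0 \<in> scales r" using r' by (simp add: scales_def)
        have "1 / (2 * B) \<le> (\<Sum>j<n. p j * ?J (x i) (x j))" using p i by (simp add: mult.commute)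
        also have "\<dots> \<le> (\<Sum>j<n. p j * (\<Sum>k\<in>scales r. 2 powr s * u k powr (- s) * Z (u k) (x i) (x j)))"
          unfolding u_def using p r' s by (intro sum_mono mult_left_mono ker_max_le_sum) auto
        also have "\<dots> = (\<Sum>k\<in>scales r. 2 powr s * u k powr (- s) * (\<Sum>j<n. p j * Z (u k) (x i) (x j)))"
          unfolding sum_distrib_left by (subst sum.swap) (auto intro!: sum.cong)
        also have "\<dots> < (\<Sum>k\<in>scales r. 2 powr s * u k powr (- s) * lam k)"
        proof (rule sum_strict_mono)
          fix k assume k: "k \<in> scales r"
          show "2 powr s * u k powr (- s) * (\<Sum>j<n. p j * Z (u k) (x i) (x j)) < 2 powr s * u k powr (- s) * lam k"
            using lt[OF k] u(1)[of k] by (intro mult_strict_left_mono) (auto simp: less_imp_neq[symmetric])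
        qed (use sc ne in auto)
        also have "\<dots> = (\<Sum>k\<in>scales r. 1 / (2 * B * N))"
        proof (intro sum.cong refl)
          fix k
          show "2 powr s * u k powr (- s) * lam k = 1 / (2 * B * N)"
            using u[of k] B N by (simp add: lam_def powr_minus divide_simps)
        qed
        also have "\<dots> = real (card (scales r)) / (2 * B * N)" by simp
        also have "\<dots> \<le> N / (2 * B * N)"
          using sc B N by (intro divide_right_mono) (auto simp: N_def)
        also have "\<dots> = 1 / (2 * B)" using N by simp
        finally show False by simp
      qed
      have "\<forall>k\<in>scales r. \<exists>Y. finite Y \<and> real (card Y) \<le> C * ?L ^ \<kappa> / lam k \<and> f ` x ` X k \<subseteq> (\<Union>z\<in>Y. cball z (u k / 4))"
      proof
        fix k assume k: "k \<in> scales r"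
        have "covered (f ` x ` X k) (C * ln (1 / u k) ^ \<kappa> / lam k) (u k / 4)"
          by (rule hyp[OF _ _ w lam]) (use u[of k] r' in \<open>auto simp: X_def\<close>)
        moreover have "ln (1 / u k) ^ \<kappa> \<le> ?L ^ \<kappa>"
        proof (rule power_mono)
          show "ln (1 / u k) \<le> ?L" using u\<Phi>[OF k] u[of k] r' by (simp add: ln_div)
          have "r < 1" using r'(3) by (smt (verit) exp_le_one_iff)
          then have "ln (u k) \<le> 0" using u[of k] by simp
          then show "0 \<le> ln (1 / u k)" using u[of k] by (simp add: ln_div)
        qed
        then have "C * ln (1 / u k) ^ \<kappa> / lam k \<le> C * ?L ^ \<kappa> / lam k"
          using C lam[of k] by (intro divide_right_mono mult_left_mono) auto
        ultimately show "\<exists>Y. finite Y \<and> real (card Y) \<le> C * ?L ^ \<kappa> / lam k \<and> f ` x ` X k \<subseteq> (\<Union>z\<in>Y. cball z (u k / 4))"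
          unfolding covered_def by (meson order.trans)
      qed
      then obtain Y where Y: "\<And>k. k \<in> scales r \<Longrightarrow> finite (Y k) \<and> real (card (Y k)) \<le> C * ?L ^ \<kappa> / lam k \<and> f ` x ` X k \<subseteq> (\<Union>z\<in>Y k. cball z (u k / 4))"
        by metis
      define S where "S = Sigma (scales r) Y"
      have finS: "finite S" unfolding S_def using sc Y by blast
      \<comment> \<open>The covering radius \<open>u / 4\<close> plus room for the net error. The
        diameter is then exactly the scale, which lies between \<open>\<Phi> r\<close> and
        \<open>r\<close>.\<close>
      define g where "g kz = cball (snd kz) (u (fst kz) / 2)" for kz :: "nat \<times> 'e"
      have diam: "diameter (g kz) = u (fst kz)" for kz using u[of "fst kz"] by (simp add: g_def)
      show "\<exists>\<U>. scale_cover (\<Phi> r) r (f ` E) \<U> \<and> (\<Sum>\<^sub>\<infinity>U\<in>\<U>. ennreal (diameter U powr t)) \<le> ennreal \<epsilon>"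
      proof (intro exI[of _ "g ` S"] conjI)
        show "scale_cover (\<Phi> r) r (f ` E) (g ` S)"
          unfolding scale_cover_def
        proof (intro conjI ballI)
          show "countable (g ` S)" using finS by (simp add: countable_finite)
          fix U assume "U \<in> g ` S"
          then obtain kz where kz: "kz \<in> S" "U = g kz" by auto
          then show "bounded U" "\<Phi> r \<le> diameter U" "diameter U \<le> r"
            using u[of "fst kz"] u\<Phi>[of "fst kz"] by (auto simp: diam S_def) (auto simp: g_def)
        next
          show "f ` E \<subseteq> \<Union> (g ` S)"
          proof
            fix z assume "z \<in> f ` E"
            then obtain i where i: "i < n" "dist z (f (x i)) \<le> \<Phi> r / 4" using nx(3) by auto
            from exk[OF i(1)] obtain k where k: "k \<in> scales r" "i \<in> X k" by auto
            then obtain y where y: "y \<in> Y k" "dist y (f (x i)) \<le> u k / 4" 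
            proof -
              have "f (x i) \<in> (\<Union>z\<in>Y k. cball z (u k / 4))" using Y[OF k(1)] k(2) by blast
              then show thesis using that by auto
            qed
            have "dist y z \<le> dist y (f (x i)) + dist z (f (x i))"
              by (rule dist_triangle2)
            also have "\<dots> \<le> u k / 2" using y i u\<Phi>[OF k(1)] by simp
            finally have "z \<in> g (k, y)" by (simp add: g_def)
            then show "z \<in> \<Union> (g ` S)" using k y by (auto simp: S_def)
          qed
        qed
        have "(\<Sum>\<^sub>\<infinity>U\<in>g ` S. ennreal (diameter U powr t)) = (\<Sum>U\<in>g ` S. ennreal (diameter U powr t))"
          using finS by simp
        also have "\<dots> \<le> (\<Sum>kz\<in>S. ennreal (diameter (g kz) powr t))"
          using sum_image_le[OF finS, of "\<lambda>U. ennreal (diameter U powr t)" g] by (simp add: o_def)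
        also have "\<dots> = ennreal (\<Sum>kz\<in>S. u (fst kz) powr t)"
          by (simp add: diam)
        also have "(\<Sum>kz\<in>S. u (fst kz) powr t) = (\<Sum>k\<in>scales r. real (card (Y k)) * u k powr t)"
        proof -
          have "(\<Sum>k\<in>scales r. real (card (Y k)) * u k powr t) = (\<Sum>k\<in>scales r. \<Sum>z\<in>Y k. u k powr t)"
            by simp
          also have "\<dots> = (\<Sum>(k,z)\<in>S. u k powr t)"
            unfolding S_def using sc Y by (intro sum.Sigma) auto
          finally show ?thesis by (simp add: case_prod_beta)
        qed
        also have "\<dots> \<le> (\<Sum>k\<in>scales r. C * ?L ^ \<kappa> * (2 * B * N * 2 powr s) * r powr (t - s))"
        proof (rule sum_mono)
          fix k assume k: "k \<in> scales r"
          have "real (card (Y k)) * u k powr t \<le> (C * ?L ^ \<kappa> / lam k) * u k powr t"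
            using Y[OF k] by (intro mult_right_mono) auto
          also have "\<dots> = C * ?L ^ \<kappa> * (2 * B * N * 2 powr s) * u k powr (t - s)"
            using u[of k] N B by (simp add: lam_def powr_diff)
          also have "\<dots> \<le> C * ?L ^ \<kappa> * (2 * B * N * 2 powr s) * r powr (t - s)"
            using u[of k] C B N sc s by (intro mult_left_mono powr_mono2) auto
          finally show "real (card (Y k)) * u k powr t \<le> C * ?L ^ \<kappa> * (2 * B * N * 2 powr s) * r powr (t - s)" .
        qed
        also have "\<dots> = real (card (scales r)) * (C * ?L ^ \<kappa> * (2 * B * N * 2 powr s) * r powr (t - s))"
          by simp
        also have "\<dots> \<le> N * (C * ?L ^ \<kappa> * (2 * B * N * 2 powr s) * r powr (t - s))"
          using sc C B N by (intro mult_right_mono) (auto simp: N_def)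
        also have "\<dots> = N^2 * (C * ?L ^ \<kappa> * (2 * B * 2 powr s) * r powr (t - s))"
          by (simp add: power2_eq_square)
        also have "\<dots> \<le> (3 * ?L)^2 * (C * ?L ^ \<kappa> * (2 * B * 2 powr s) * r powr (t - s))"
          using N sc C B by (intro mult_right_mono power_mono) auto
        also have "\<dots> = A * (?L ^ (\<kappa> + 2) * r powr (t - s))"
          by (simp add: A_def power_add power2_eq_square)
        also have "\<dots> \<le> \<epsilon>" using elim(1) by simp
        finally show "(\<Sum>\<^sub>\<infinity>U\<in>g ` S. ennreal (diameter U powr t)) \<le> ennreal \<epsilon>"
          by (simp add: ennreal_leI)
      qed
    qed
  qed
qed

section \<open>Upper bounds for the dimensions of the image\<close>

definition upper_cap :: real where
  "upper_cap = Inf {s\<in>{0..D}. Limsup (at_right 0) (cap s) < \<infinity>}"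
definition lower_cap :: real where
  "lower_cap = Inf {s\<in>{0..D}. Liminf (at_right 0) (cap s) < \<infinity>}"

lemma upper_cap_mem:
  fixes f :: "'p \<Rightarrow> 'e::euclidean_space"
  assumes "cover_hyp Z E f" "bounded (f ` E)" and t: "upper_cap < t"
  shows "upper_admits \<Phi> (f ` E) t"
proof -
  have "D \<in> {s\<in>{0..D}. Limsup (at_right 0) (cap s) < \<infinity>}" using D0 cap_D by simp
  then obtain s where s: "s \<in> {s\<in>{0..D}. Limsup (at_right 0) (cap s) < \<infinity>}" "s < t"
    using t cInf_lessD unfolding upper_cap_def by (metis (no_types, lifting) empty_iff)
  then have "Limsup (at_right 0) (cap s) < \<infinity>" by simp
  then obtain b where b: "Limsup (at_right 0) (cap s) < ennreal b"
    by (metis ennreal_Ex_less_of_nat ennreal_of_nat_eq_real_of_nat infinity_ennreal_def)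
  define B where "B = max 1 b"
  have ev: "\<forall>\<^sub>F r in at_right 0. cap s r \<le> ennreal B"
    using Limsup_lessD[OF b] by eventually_elim (auto simp: B_def intro: order.trans[OF less_imp_le] ennreal_leI)
  show ?thesis
    unfolding upper_admits_def
  proof (intro conjI allI impI)
    show "0 \<le> t" using s by auto
    fix \<epsilon> :: real assume "\<epsilon> > 0"
    then have "\<forall>\<^sub>F r in at_right 0. cap s r \<le> ennreal B \<longrightarrow> (\<exists>\<U>. scale_cover (\<Phi> r) r (f ` E) \<U> \<and>
        (\<Sum>\<^sub>\<infinity>U\<in>\<U>. ennreal (diameter U powr t)) \<le> ennreal \<epsilon>)"
      using s assms by (intro cover_of_cap) (auto simp: B_def)
    with ev have "\<forall>\<^sub>F r in at_right 0. \<exists>\<U>. scale_cover (\<Phi> r) r (f ` E) \<U> \<and>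
        (\<Sum>\<^sub>\<infinity>U\<in>\<U>. ennreal (diameter U powr t)) \<le> ennreal \<epsilon>"
      by eventually_elim auto
    then obtain b where "b > 0" "\<And>r. 0 < r \<Longrightarrow> r < b \<Longrightarrow> \<exists>\<U>. scale_cover (\<Phi> r) r (f ` E) \<U> \<and>
        (\<Sum>\<^sub>\<infinity>U\<in>\<U>. ennreal (diameter U powr t)) \<le> ennreal \<epsilon>"
      by (auto simp: eventually_at_right_field)
    then show "\<exists>r0\<in>{0<..1}. \<forall>r\<in>{0<..<r0}. \<exists>\<U>. scale_cover (\<Phi> r) r (f ` E) \<U> \<and>
        (\<Sum>\<^sub>\<infinity>U\<in>\<U>. ennreal (diameter U powr t)) \<le> ennreal \<epsilon>"
      by (intro bexI[of _ "min b 1"]) auto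
  qed
qed

text \<open>A finite lower limit bounds the capacity along some scales tending to 0, and covers
  along some such scales are what the lower dimension asks for; hence \<open>frequently\<close>
  replaces \<open>eventually\<close>.\<close>

lemma lower_cap_mem:
  fixes f :: "'p \<Rightarrow> 'e::euclidean_space"
  assumes "cover_hyp Z E f" "bounded (f ` E)" and t: "lower_cap < t"
  shows "lower_admits \<Phi> (f ` E) t"
proof -
  have "Liminf (at_right 0) (cap D) \<le> Limsup (at_right 0) (cap D)"
    by (rule Liminf_le_Limsup) simp
  then have "D \<in> {s\<in>{0..D}. Liminf (at_right 0) (cap s) < \<infinity>}"
    using D0 cap_D by (auto intro: le_less_trans)
  then obtain s where s: "s \<in> {s\<in>{0..D}. Liminf (at_right 0) (cap s) < \<infinity>}" "s < t"
    using t cInf_lessD unfolding lower_cap_def by (metis (no_types, lifting) empty_iff)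
  then have "Liminf (at_right 0) (cap s) < \<infinity>" by simp
  then obtain b where b: "Liminf (at_right 0) (cap s) < ennreal b"
    by (metis ennreal_Ex_less_of_nat ennreal_of_nat_eq_real_of_nat infinity_ennreal_def)
  define B where "B = max 1 b"
  have ev: "\<exists>\<^sub>F r in at_right 0. cap s r \<le> ennreal B"
  proof -
    have "\<exists>\<^sub>F r in at_right 0. cap s r < ennreal b"
    proof (rule ccontr)
      assume "\<not> ?thesis"
      then have "\<forall>\<^sub>F r in at_right 0. ennreal b \<le> cap s r"
        by (simp add: not_frequently not_less)
      then have "ennreal b \<le> Liminf (at_right 0) (cap s)" by (rule Liminf_bounded)
      then show False using b by simp
    qed
    then show ?thesis
      by (rule frequently_elim1) (auto simp: B_def intro: order.trans[OF less_imp_le] ennreal_leI)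
  qed
  show ?thesis
    unfolding lower_admits_def
  proof (intro conjI allI impI ballI)
    show "0 \<le> t" using s by auto
    fix \<epsilon> r0 :: real assume "\<epsilon> > 0" and r0: "r0 \<in> {0<..1}"
    then have "\<forall>\<^sub>F r in at_right 0. cap s r \<le> ennreal B \<longrightarrow> (\<exists>\<U>. scale_cover (\<Phi> r) r (f ` E) \<U> \<and>
        (\<Sum>\<^sub>\<infinity>U\<in>\<U>. ennreal (diameter U powr t)) \<le> ennreal \<epsilon>)"
      using s assms by (intro cover_of_cap) (auto simp: B_def)
    moreover have "\<forall>\<^sub>F r in at_right 0. r \<in> {0<..<r0}"
      by (rule eventually_at_rightI[of 0 r0]) (use r0 in auto)
    ultimately have "\<forall>\<^sub>F r in at_right 0. cap s r \<le> ennreal B \<longrightarrow> r \<in> {0<..<r0} \<and> (\<exists>\<U>. scale_cover (\<Phi> r) r (f ` E) \<U> \<and>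
        (\<Sum>\<^sub>\<infinity>U\<in>\<U>. ennreal (diameter U powr t)) \<le> ennreal \<epsilon>)"
      by eventually_elim auto
    from frequently_mp[OF this ev] obtain r where "r \<in> {0<..<r0}" "\<exists>\<U>. scale_cover (\<Phi> r) r (f ` E) \<U> \<and>
        (\<Sum>\<^sub>\<infinity>U\<in>\<U>. ennreal (diameter U powr t)) \<le> ennreal \<epsilon>"
      using frequently_ex by blast
    then show "\<exists>r\<in>{0<..<r0}. \<exists>\<U>. scale_cover (\<Phi> r) r (f ` E) \<U> \<and>
        (\<Sum>\<^sub>\<infinity>U\<in>\<U>. ennreal (diameter U powr t)) \<le> ennreal \<epsilon>"
      by blast
  qed
qed

lemma Phi_dims_le:
  fixes f :: "'p \<Rightarrow> 'e::euclidean_space"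
  assumes "cover_hyp Z E f" "bounded (f ` E)"
  shows "lower_Phi_dim \<Phi> (f ` E) \<le> lower_cap" "upper_Phi_dim \<Phi> (f ` E) \<le> upper_cap"
proof -
  have bdd: "bdd_below (Collect (lower_admits \<Phi> (f ` E)))" "bdd_below (Collect (upper_admits \<Phi> (f ` E)))"
    by (auto intro!: bdd_belowI[of _ 0] simp: lower_admits_def upper_admits_def)
  show "lower_Phi_dim \<Phi> (f ` E) \<le> lower_cap"
    unfolding Phi_dim_eq
  proof (rule dense_ge)
    fix t assume "lower_cap < t"
    from lower_cap_mem[OF assms this] show "Inf (Collect (lower_admits \<Phi> (f ` E))) \<le> t"
      by (intro cInf_lower[OF _ bdd(1)]) simp
  qed
  show "upper_Phi_dim \<Phi> (f ` E) \<le> upper_cap"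
    unfolding Phi_dim_eq
  proof (rule dense_ge)
    fix t assume "upper_cap < t"
    from upper_cap_mem[OF assms this] show "Inf (Collect (upper_admits \<Phi> (f ` E))) \<le> t"
      by (intro cInf_lower[OF _ bdd(2)]) simp
  qed
qed

end

section \<open>Almost sure lower bounds\<close>

context dim_kernel begin

section \<open>Discretised energies of the image against covers\<close>

text \<open>Each atom is assigned one covering set containing its image. Two atoms sharing a set of
  diameter \<open>d\<close> are within \<open>d\<close>, hence counted in the discretised energy at
  a scale between \<open>d\<close> and \<open>16 * d\<close>, with weight at least
  \<open>(16 * d) powr (- s)\<close>. When this energy is below \<open>16 powr (- s)\<close>, the
  first factor in \<open>cauchy_schwarz_classes\<close> is below 1, so the second exceeds 1.\<close>

lemma cover_sum_gt_1:
  fixes g :: "'p \<Rightarrow> 'e::euclidean_space"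
  assumes w: "weights E n x p" and r: "0 < \<Phi> \<rho>" "\<Phi> \<rho> \<le> \<rho>" and s: "0 \<le> s"
    and cov: "scale_cover l r (g ` E) \<U>" and l: "\<Phi> \<rho> \<le> l" "r \<le> 2 * \<rho>"
    and fin: "finite (scales \<rho>)"
    and small: "(\<Sum>i<n. \<Sum>j<n. \<Sum>k\<in>scales \<rho>. p i * p j * (8 * ((1/2)^k * \<rho>)) powr (- s) *
        (if dist (g (x i)) (g (x j)) \<le> 8 * ((1/2)^k * \<rho>) then 1 else 0)) < 16 powr (- s)"
  shows "1 < (\<Sum>\<^sub>\<infinity>U\<in>\<U>. ennreal (diameter U powr s))"
proof -
  define u where "u k = 8 * ((1/2)^k * \<rho>)" for k :: nat
  have u0: "u k > 0" for k using r by (simp add: u_def)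
  have p0: "0 \<le> p i" if "i < n" for i using w that by (simp add: weights_def)
  have "\<forall>i<n. \<exists>U. U \<in> \<U> \<and> g (x i) \<in> U"
    using w cov by (fastforce simp: weights_def scale_cover_def)
  then obtain U where U: "\<And>i. i < n \<Longrightarrow> U i \<in> \<U> \<and> g (x i) \<in> U i" by metis
  have dU: "l \<le> diameter V" "diameter V \<le> r" "bounded V" if "V \<in> \<U>" for V
    using cov that by (auto simp: scale_cover_def)
  define d where "d V = diameter V powr s" for V :: "'e set"
  have d0: "0 < d (U i)" if "i < n" for i
    using dU(1)[of "U i"] U[OF that] l r by (simp add: d_def)
  define H where "H i j = (\<Sum>k\<in>scales \<rho>. p i * p j * u k powr (- s) *
        (if dist (g (x i)) (g (x j)) \<le> u k then 1 else 0))" for i j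
  have H0: "0 \<le> H i j" if "i < n" "j < n" for i j
    unfolding H_def using p0 that by (intro sum_nonneg) auto
  have key: "(if U i = U j then p i * p j / d (U i) else 0) \<le> 16 powr s * H i j" if ij: "i < n" "j < n" for i j
  proof (cases "U i = U j")
    case True
    let ?d = "diameter (U i)"
    have d: "\<Phi> \<rho> \<le> ?d" "?d \<le> 2 * \<rho>" using dU[of "U i"] U[OF ij(1)] l by auto
    \<comment> \<open>Half of the diameter is rounded, since \<open>?d\<close> may reach
      \<open>2 * \<rho>\<close> while the dyadic scales stop at \<open>\<rho>\<close>.\<close>
    have "0 < ?d / 2" "?d / 2 \<le> \<rho>" using d r by auto
    then obtain k where k: "?d / 2 \<le> (1/2)^k * \<rho>" "(1/2)^k * \<rho> < 2 * (?d / 2)"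
      by (rule dyadic_scale)
    obtain k' where k': "k' \<in> scales \<rho>" "?d \<le> u k'" "u k' \<le> 16 * ?d"
    proof (cases "k \<in> scales \<rho>")
      case True
      have "?d \<le> u k" "u k \<le> 16 * ?d" using k d r unfolding u_def by linarith+
      then show ?thesis using True by (intro that[of k])
    next
      case False
      \<comment> \<open>The rounded half diameter can drop below \<open>\<Phi> \<rho>\<close>. The
        preceding index is then admissible, because \<open>?d\<close> itself is at least
        \<open>\<Phi> \<rho>\<close>.\<close>
      then have "(1/2)^k * \<rho> < \<Phi> \<rho>" by (simp add: scales_def)
      moreover have "k \<noteq> 0" using False r by (intro notI) (simp add: scales_def)
      then obtain k1 where k1: "k = Suc k1" by (cases k) auto
      moreover have "\<Phi> \<rho> \<le> (1/2)^k1 * \<rho>"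
      proof -
        have "?d \<le> (1/2)^k1 * \<rho>" using k(1) k1 by simp
        then show ?thesis using d by simp
      qed
      moreover have "u k1 = 16 * ((1/2)^k * \<rho>)" by (simp add: u_def k1)
      then have "?d \<le> u k1" "u k1 \<le> 16 * ?d" using k d r by linarith+
      ultimately show ?thesis by (intro that[of k1]) (auto simp: scales_def)
    qed
    have "dist (g (x i)) (g (x j)) \<le> ?d"
      using U[OF ij(1)] U[OF ij(2)] True dU(3)[of "U i"] by (intro diameter_bounded_bound) auto
    then have "dist (g (x i)) (g (x j)) \<le> u k'" using k' by simp
    then have "p i * p j * u k' powr (- s) \<le> H i j"
      unfolding H_def using member_le_sum[OF k'(1) _ fin, of "\<lambda>k. p i * p j * u k powr (- s) *
        (if dist (g (x i)) (g (x j)) \<le> u k then 1 else 0)"] p0 ij by auto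
    moreover have "(16 * ?d) powr (- s) \<le> u k' powr (- s)"
      using k' u0[of k'] s by (intro powr_mono2') auto
    then have "p i * p j * (16 * ?d) powr (- s) \<le> p i * p j * u k' powr (- s)"
      using p0 ij by (intro mult_left_mono) auto
    moreover have "p i * p j / d (U i) = 16 powr s * (p i * p j * (16 * ?d) powr (- s))"
      using d r by (simp add: d_def powr_minus powr_mult divide_simps)
    ultimately have "p i * p j / d (U i) \<le> 16 powr s * H i j" by simp
    then show ?thesis using True by simp
  next
    case False
    then show ?thesis using H0[OF ij] by simp
  qed
  define T where "T = (\<Sum>i<n. \<Sum>j<n. if U i = U j then p i * p j / d (U i) else 0)"
  have "T \<le> (\<Sum>i<n. \<Sum>j<n. 16 powr s * H i j)"
    unfolding T_def by (intro sum_mono key) auto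
  also have "\<dots> = 16 powr s * (\<Sum>i<n. \<Sum>j<n. H i j)" by (simp add: sum_distrib_left)
  also have "\<dots> < 16 powr s * 16 powr (- s)"
    using small by (intro mult_strict_left_mono) (auto simp: H_def u_def)
  finally have T1: "T < 1" by (simp add: powr_minus)
  have T0: "0 \<le> T" unfolding T_def using p0 d0 by (intro sum_nonneg) (auto simp: less_imp_le)
  define S where "S = (\<Sum>V\<in>U ` {..<n}. d V)"
  have "1 \<le> T * S"
    unfolding T_def S_def using w d0 by (intro cauchy_schwarz_classes) (auto simp: weights_def)
  moreover have "S \<le> 1 \<Longrightarrow> T * S \<le> T" using T0 by (simp add: mult_left_le)
  ultimately have "1 < S" using T1 by linarith
  then have "ennreal 1 < ennreal S" by (subst ennreal_less_iff) auto
  also have "ennreal S = (\<Sum>V\<in>U ` {..<n}. ennreal (d V))"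
    unfolding S_def by (simp add: d_def)
  also have "\<dots> \<le> (\<Sum>\<^sub>\<infinity>U\<in>\<U>. ennreal (diameter U powr s))"
    unfolding d_def using U by (intro sum_le_infsum_ennreal) auto
  finally show ?thesis by simp
qed

text \<open>First moment method with a loss of exponent from \<open>s'\<close> to \<open>s\<close>.
  As the capacity exceeds 1 at \<open>\<rho> n\<close>, there are weights whose
  \<open>s'\<close>-energy is at most \<open>c0\<close>; the expected discretised
  \<open>s\<close>-energy of their image is at most a multiple of the number of scales times
  \<open>\<rho> n powr (s' - s)\<close>. Markov's inequality and Borel-Cantelli leave finitely many
  bad \<open>n\<close>, and \<open>cover_sum_gt_1\<close> applies to the others.\<close>

lemma lower_key:
  fixes f :: "'w \<Rightarrow> 'p \<Rightarrow> 'e::euclidean_space"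
  assumes P: "finite_measure P" and meas: "\<And>x. x \<in> E \<Longrightarrow> (\<lambda>\<omega>. f \<omega> x) \<in> borel_measurable P"
    and ball: "\<And>x y u. x \<in> E \<Longrightarrow> y \<in> E \<Longrightarrow> 0 < u \<Longrightarrow> u < u1 \<Longrightarrow>
        emeasure P {\<omega> \<in> space P. dist (f \<omega> x) (f \<omega> y) \<le> u} \<le> ennreal (c * Z u x y)"
    and u1: "u1 > 0" and c: "c \<ge> 0"
    and s: "0 \<le> s" "s < s'" "s' \<le> D"
    and \<rho>: "\<And>n. 0 < \<rho> n" "\<And>n. \<rho> n \<le> (1/2)^n" "\<forall>\<^sub>F n in sequentially. 1 < cap s' (\<rho> n)"
  shows "AE \<omega> in P. \<forall>\<^sub>F n in sequentially. \<forall>r\<in>{\<rho> n..2 * \<rho> n}. \<forall>\<U>.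
    scale_cover (\<Phi> r) r (f \<omega> ` E) \<U> \<longrightarrow> 1 < (\<Sum>\<^sub>\<infinity>U\<in>\<U>. ennreal (diameter U powr s))"
proof -
  interpret P: finite_measure P by fact
  \<comment> \<open>Half of the spare exponent cancels the number of scales; the other half makes
    the probabilities summable, because \<open>\<rho> n \<le> (1/2)^n\<close>.\<close>
  define \<delta> where "\<delta> = (s' - s) / 2"
  have \<delta>: "\<delta> > 0" using s by (simp add: \<delta>_def)
  \<comment> \<open>3 comes from the number of scales, \<open>C0 ^ 3\<close> from the factor 8
    between \<open>u m k\<close> and the dyadic scale, and \<open>16 powr s\<close> from the
    threshold of \<open>cover_sum_gt_1\<close>.\<close>
  define A where "A = 3 * c * C0 ^ 3 * max c0 0 * 16 powr s"
  have A: "A \<ge> 0" using c C0 by (simp add: A_def)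
  have lim0: "filterlim \<rho> (at_right 0) sequentially"
  proof (rule tendsto_imp_filterlim_at_right)
    show "\<rho> \<longlonglongrightarrow> 0"
      by (rule tendsto_sandwich[OF _ _ tendsto_const LIMSEQ_realpow_zero[of "1/2"]])
        (use \<rho> in \<open>auto intro!: always_eventually less_imp_le\<close>)
  qed (use \<rho> in auto)
  define good where "good r \<longleftrightarrow> 0 < r \<and> r < min (u1/8) (exp (-1)) \<and> 0 < \<Phi> r \<and> \<Phi> r \<le> r \<and> mono_on {0<..4*r} \<Phi> \<and>
     A * (ln (1 / \<Phi> r) ^ 1 * r powr \<delta>) < 1 \<and>
     (1 < cap s' r \<longrightarrow> (\<exists>n x p. weights E n x p \<and> energy (ker_max \<Phi> Z s' r) n x p \<le> c0))" for r
  have "\<forall>\<^sub>F r in at_right 0. good r"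
  proof -
    have "((\<lambda>r. A * (ln (1 / \<Phi> r) ^ 1 * r powr \<delta>)) \<longlongrightarrow> A * 0) (at_right 0)"
      using \<delta> by (intro tendsto_intros log_power_small)
    then have "\<forall>\<^sub>F r in at_right 0. A * (ln (1 / \<Phi> r) ^ 1 * r powr \<delta>) < 1"
      by (intro order_tendstoD) auto
    moreover have "\<forall>\<^sub>F r in at_right 0. 0 < r \<and> r < min (u1/8) (exp (-1)) \<and> 0 < \<Phi> r \<and> \<Phi> r \<le> r \<and> mono_on {0<..4*r} \<Phi>"
      using u1 by (intro Phi_small) auto
    moreover have "\<forall>\<^sub>F r in at_right 0. 1 < cap s' r \<longrightarrow>
        (\<exists>n x p. weights E n x p \<and> energy (ker_max \<Phi> Z s' r) n x p \<le> c0)"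
      using s by (intro energy_le) auto
    ultimately show ?thesis unfolding good_def by eventually_elim auto
  qed
  then have "\<forall>\<^sub>F n in sequentially. good (\<rho> n)"
    using lim0 by (rule eventually_compose_filterlim)
  then have "\<forall>\<^sub>F n in sequentially. good (\<rho> n) \<and> 1 < cap s' (\<rho> n)"
    using \<rho>(3) by eventually_elim auto
  then obtain n0 where n0: "\<And>n. n \<ge> n0 \<Longrightarrow> good (\<rho> n) \<and> 1 < cap s' (\<rho> n)"
    by (auto simp: eventually_sequentially)
  have "\<forall>m. \<exists>n x p. m \<ge> n0 \<longrightarrow> weights E n x p \<and> energy (ker_max \<Phi> Z s' (\<rho> m)) n x p \<le> c0"
    using n0 unfolding good_def by meson
  then obtain N x p where W: "\<And>m. m \<ge> n0 \<Longrightarrow> weights E (N m) (x m) (p m) \<and>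
      energy (ker_max \<Phi> Z s' (\<rho> m)) (N m) (x m) (p m) \<le> c0"
    by metis
  define u where "u m k = 8 * ((1/2)^k * \<rho> m)" for m k :: nat
  define B where "B m i j k = {\<omega> \<in> space P. dist (f \<omega> (x m i)) (f \<omega> (x m j)) \<le> u m k}" for m i j k
  define q where "q m i j k = p m i * p m j * u m k powr (- s)" for m i j k
  define H where "H m \<omega> = (\<Sum>i<N m. \<Sum>j<N m. \<Sum>k\<in>scales (\<rho> m). ennreal (q m i j k) * indicator (B m i j k) \<omega>)" for m \<omega>
  have mx: "(\<lambda>\<omega>. f \<omega> (x m i)) \<in> borel_measurable P" if "m \<ge> n0" "i < N m" for m i
    using W[OF that(1)] that(2) by (intro meas) (auto simp: weights_def)
  have Bm: "B m i j k \<in> sets P" if "m \<ge> n0" "i < N m" "j < N m" for m i j k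
    unfolding B_def using mx[OF that(1,2)] mx[OF that(1,3)] by measurable
  have Hm: "H m \<in> borel_measurable P" if "m \<ge> n0" for m
    unfolding H_def using Bm[OF that] by (intro borel_measurable_sum borel_measurable_times_ennreal) auto
  have EH: "(\<integral>\<^sup>+ \<omega>. H m \<omega> \<partial>P) \<le> ennreal (16 powr (- s) * (\<rho> m) powr \<delta>)" if m: "m \<ge> n0" for m
  proof -
    have g: "0 < \<rho> m" "\<rho> m < u1/8" "\<rho> m < exp (-1)" "0 < \<Phi> (\<rho> m)" "\<Phi> (\<rho> m) \<le> \<rho> m"
      "A * (ln (1 / \<Phi> (\<rho> m)) ^ 1 * \<rho> m powr \<delta>) < 1"
      using n0[OF m] unfolding good_def by auto
    note sc = scales[OF g(4,5,3)]
    have w: "x m i \<in> E" "0 \<le> p m i" if "i < N m" for i using W[OF m] that by (auto simp: weights_def)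
    let ?J = "ker_max \<Phi> Z s' (\<rho> m)"
    let ?R = "\<rho> m powr (s' - s)"
    \<comment> \<open>Three doublings lead back from \<open>u m k\<close> to the dyadic scale
      \<open>v\<close>, where \<open>ker_max\<close> dominates; trading \<open>s\<close> for
      \<open>s'\<close> yields the factor \<open>?R\<close>.\<close>
    have est: "u m k powr (- s) * Z (u m k) a b \<le> C0 ^ 3 * ?R * ?J a b" if k: "k \<in> scales (\<rho> m)" for k a b
    proof -
      define v where "v = (1/2)^k * \<rho> m"
      have v: "0 < v" "v \<le> \<rho> m" "\<Phi> (\<rho> m) \<le> v"
        using g k by (auto simp: v_def scales_def power_le_one mult_le_cancel_right1)
      have "u m k = 2 * (2 * (2 * v))" by (simp add: u_def v_def)
      then have "Z (u m k) a b \<le> C0 * Z (2 * (2 * v)) a b" using v Z_double[of "2 * (2 * v)"] by simp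
      also have "\<dots> \<le> C0 * (C0 * Z (2 * v) a b)" using v C0 Z_double[of "2 * v"] by (intro mult_left_mono) auto
      also have "\<dots> \<le> C0 * (C0 * (C0 * Z v a b))" using v C0 Z_double[of v] by (intro mult_left_mono) auto
      also have "\<dots> = C0 ^ 3 * Z v a b" by (simp add: power3_eq_cube)
      finally have 1: "Z (u m k) a b \<le> C0 ^ 3 * Z v a b" .
      have "u m k powr (- s) \<le> v powr (- s)"
        using v s by (intro powr_mono2') (auto simp: u_def v_def)
      also have "\<dots> = v powr (- s') * v powr (s' - s)" by (simp flip: powr_add)
      also have "\<dots> \<le> v powr (- s') * ?R" using v s by (intro mult_left_mono powr_mono2) auto
      finally have 2: "u m k powr (- s) \<le> v powr (- s') * ?R" .
      have "u m k powr (- s) * Z (u m k) a b \<le> (v powr (- s') * ?R) * (C0 ^ 3 * Z v a b)"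
        using 1 2 v by (intro mult_mono Z_nonneg) (auto simp: u_def v_def)
      also have "\<dots> = C0 ^ 3 * ?R * (v powr (- s') * Z v a b)" by simp
      also have "\<dots> \<le> C0 ^ 3 * ?R * ?J a b"
        using v s g C0 by (intro mult_left_mono ker_max_ge) auto
      finally show ?thesis .
    qed
    have "(\<integral>\<^sup>+ \<omega>. H m \<omega> \<partial>P) = (\<Sum>i<N m. \<Sum>j<N m. \<Sum>k\<in>scales (\<rho> m). ennreal (q m i j k) * emeasure P (B m i j k))"
    proof -
      have bm: "(\<lambda>\<omega>. ennreal (q m i j k) * indicator (B m i j k) \<omega>) \<in> borel_measurable P" if "i < N m" "j < N m" for i j k
        using Bm[OF m that] by (intro borel_measurable_times_ennreal) auto
      have "(\<integral>\<^sup>+ \<omega>. H m \<omega> \<partial>P) = (\<Sum>i<N m. \<integral>\<^sup>+ \<omega>. (\<Sum>j<N m. \<Sum>k\<in>scales (\<rho> m). ennreal (q m i j k) * indicator (B m i j k) \<omega>) \<partial>P)"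
        unfolding H_def using bm by (intro nn_integral_sum borel_measurable_sum) auto
      also have "\<dots> = (\<Sum>i<N m. \<Sum>j<N m. \<integral>\<^sup>+ \<omega>. (\<Sum>k\<in>scales (\<rho> m). ennreal (q m i j k) * indicator (B m i j k) \<omega>) \<partial>P)"
        using bm by (intro sum.cong refl nn_integral_sum borel_measurable_sum) auto
      also have "\<dots> = (\<Sum>i<N m. \<Sum>j<N m. \<Sum>k\<in>scales (\<rho> m). \<integral>\<^sup>+ \<omega>. ennreal (q m i j k) * indicator (B m i j k) \<omega> \<partial>P)"
        using bm by (intro sum.cong refl nn_integral_sum) auto
      also have "\<dots> = (\<Sum>i<N m. \<Sum>j<N m. \<Sum>k\<in>scales (\<rho> m). ennreal (q m i j k) * emeasure P (B m i j k))"
        using Bm[OF m] by (intro sum.cong refl nn_integral_cmult_indicator) auto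
      finally show ?thesis .
    qed
    also have "\<dots> \<le> (\<Sum>i<N m. \<Sum>j<N m. \<Sum>k\<in>scales (\<rho> m). ennreal (c * C0 ^ 3 * ?R * (p m i * p m j * ?J (x m i) (x m j))))"
    proof (intro sum_mono)
      fix i j k assume ij: "i \<in> {..<N m}" "j \<in> {..<N m}" and k: "k \<in> scales (\<rho> m)"
      have p0: "0 \<le> p m i * p m j" using w ij by auto
      have "(1/2)^k * \<rho> m \<le> \<rho> m" using g by (simp add: power_le_one mult_le_cancel_right1)
      then have "u m k < u1" unfolding u_def using g by linarith
      then have ub: "0 < u m k" "u m k < u1" using g by (auto simp: u_def)
      have "ennreal (q m i j k) * emeasure P (B m i j k) \<le> ennreal (q m i j k) * ennreal (c * Z (u m k) (x m i) (x m j))"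
        unfolding B_def using w ij ub by (intro mult_left_mono ball) auto
      also have "\<dots> = ennreal (q m i j k * (c * Z (u m k) (x m i) (x m j)))"
        using p0 c Z_nonneg[OF ub(1)] by (subst ennreal_mult) (auto simp: q_def)
      also have "q m i j k * (c * Z (u m k) (x m i) (x m j)) = c * (p m i * p m j) * (u m k powr (- s) * Z (u m k) (x m i) (x m j))"
        by (simp add: q_def)
      also have "\<dots> \<le> c * (p m i * p m j) * (C0 ^ 3 * ?R * ?J (x m i) (x m j))"
        using p0 c by (intro mult_left_mono est k) auto
      also have "\<dots> = c * C0 ^ 3 * ?R * (p m i * p m j * ?J (x m i) (x m j))" by simp
      finally show "ennreal (q m i j k) * emeasure P (B m i j k) \<le> ennreal (c * C0 ^ 3 * ?R * (p m i * p m j * ?J (x m i) (x m j)))"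
        by (simp add: ennreal_leI)
    qed
    also have "\<dots> = (\<Sum>i<N m. \<Sum>j<N m. ennreal (real (card (scales (\<rho> m))) * (c * C0 ^ 3 * ?R * (p m i * p m j * ?J (x m i) (x m j)))))"
      by (simp add: ennreal_mult' ennreal_of_nat_eq_real_of_nat)
    also have "\<dots> = ennreal (\<Sum>i<N m. \<Sum>j<N m. real (card (scales (\<rho> m))) * (c * C0 ^ 3 * ?R * (p m i * p m j * ?J (x m i) (x m j))))"
    proof -
      have nn: "0 \<le> real (card (scales (\<rho> m))) * (c * C0 ^ 3 * ?R * (p m i * p m j * ?J (x m i) (x m j)))" if "i < N m" "j < N m" for i j
        using that w c C0 g s ker_max_nonneg[of "\<rho> m" s'] by simp
      show ?thesis
        using nn by (subst sum_ennreal[symmetric]) (auto intro!: sum_nonneg sum.cong sum_ennreal)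
    qed
    also have "(\<Sum>i<N m. \<Sum>j<N m. real (card (scales (\<rho> m))) * (c * C0 ^ 3 * ?R * (p m i * p m j * ?J (x m i) (x m j))))
        = real (card (scales (\<rho> m))) * (c * C0 ^ 3 * ?R) * energy ?J (N m) (x m) (p m)"
      by (simp add: energy_def sum_distrib_left mult.assoc)
    also have "\<dots> \<le> real (card (scales (\<rho> m))) * (c * C0 ^ 3 * ?R) * max c0 0"
      using W[OF m] c C0 by (intro mult_left_mono) auto
    also have "\<dots> \<le> (3 * ln (1 / \<Phi> (\<rho> m))) * (c * C0 ^ 3 * ?R) * max c0 0"
      using sc c C0 by (intro mult_right_mono) auto
    also have "\<dots> = 16 powr (- s) * (A * (ln (1 / \<Phi> (\<rho> m)) ^ 1 * \<rho> m powr \<delta>) * \<rho> m powr \<delta>)"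
    proof -
      have "?R = \<rho> m powr \<delta> * \<rho> m powr \<delta>" by (simp add: \<delta>_def flip: powr_add)
      then show ?thesis by (simp add: A_def powr_minus)
    qed
    also have "\<dots> \<le> 16 powr (- s) * (1 * \<rho> m powr \<delta>)"
      using g by (intro mult_left_mono mult_right_mono) auto
    finally show ?thesis by (simp add: ennreal_leI)
  qed
  \<comment> \<open>Empty for the finitely many early indices, so that the geometric bound holds for
    every \<open>m\<close>.\<close>
  define G where "G m = (if m \<ge> n0 then {\<omega> \<in> space P. ennreal (16 powr (- s)) \<le> H m \<omega>} else {})" for m
  have Gm: "G m \<in> sets P" for m
    unfolding G_def using Hm[of m] by auto
  have Gle: "measure P (G m) \<le> ((1/2) powr \<delta>) ^ m" for m
  proof (cases "m \<ge> n0")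
    case True
    have "ennreal (16 powr (- s)) * emeasure P (G m) \<le> (\<integral>\<^sup>+ \<omega>. H m \<omega> \<partial>P)"
    proof -
      have "ennreal (16 powr (- s)) * emeasure P (G m) = (\<integral>\<^sup>+ \<omega>. ennreal (16 powr (- s)) * indicator (G m) \<omega> \<partial>P)"
        using Gm by (simp add: nn_integral_cmult_indicator)
      also have "\<dots> \<le> (\<integral>\<^sup>+ \<omega>. H m \<omega> \<partial>P)"
        using True by (intro nn_integral_mono) (auto simp: G_def indicator_def)
      finally show ?thesis .
    qed
    also note EH[OF True]
    finally have "ennreal (16 powr (- s) * measure P (G m)) \<le> ennreal (16 powr (- s) * (\<rho> m) powr \<delta>)"
      by (simp add: P.emeasure_eq_measure ennreal_mult')
    then have "16 powr (- s) * measure P (G m) \<le> 16 powr (- s) * (\<rho> m) powr \<delta>"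
      by (subst (asm) ennreal_le_iff) auto
    then have "measure P (G m) \<le> (\<rho> m) powr \<delta>"
      by (subst (asm) mult_le_cancel_left_pos) auto
    also have "\<dots> \<le> ((1/2)^m) powr \<delta>"
      using \<rho>(1)[of m] \<rho>(2)[of m] \<delta> by (intro powr_mono2) auto
    also have "\<dots> = ((1/2) powr \<delta>) ^ m"
      by (simp add: powr_power powr_powr mult.commute flip: powr_realpow)
    finally show ?thesis .
  qed (auto simp: G_def)
  have "(1/2::real) powr \<delta> < 1" using \<delta> powr_less_mono2_neg[of "-\<delta>" "1" "2"] by (simp add: powr_divide powr_minus divide_simps)
  then have "summable (\<lambda>m. ((1/2::real) powr \<delta>) ^ m)"
    by (intro summable_geometric) auto
  then have "summable (\<lambda>m. measure P (G m))"
    by (rule summable_comparison_test[rotated]) (use Gle in auto)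
  then have "AE \<omega> in P. \<forall>\<^sub>F m in sequentially. \<omega> \<in> space P - G m"
    using Gm by (intro borel_cantelli_AE1) (auto simp: P.emeasure_eq_measure)
  then show ?thesis
  proof eventually_elim
    case (elim \<omega>)
    have "\<forall>\<^sub>F m in sequentially. m \<ge> n0" by (rule eventually_ge_at_top)
    with elim show ?case
    proof eventually_elim
      case (elim m)
      note m = elim(2)
      have \<omega>: "\<omega> \<in> space P" using elim by simp
      have g: "0 < \<rho> m" "\<rho> m < exp (-1)" "0 < \<Phi> (\<rho> m)" "\<Phi> (\<rho> m) \<le> \<rho> m" "mono_on {0<..4 * \<rho> m} \<Phi>"
        using n0[OF m] unfolding good_def by auto
      have w: "0 \<le> p m i" if "i < N m" for i using W[OF m] that by (auto simp: weights_def)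
      have "H m \<omega> = ennreal (\<Sum>i<N m. \<Sum>j<N m. \<Sum>k\<in>scales (\<rho> m). q m i j k *
          (if dist (f \<omega> (x m i)) (f \<omega> (x m j)) \<le> u m k then 1 else 0))"
      proof -
        have q0: "0 \<le> q m i j k" if "i < N m" "j < N m" for i j k using w that by (simp add: q_def)
        have "H m \<omega> = (\<Sum>i<N m. \<Sum>j<N m. \<Sum>k\<in>scales (\<rho> m). ennreal (q m i j k *
          (if dist (f \<omega> (x m i)) (f \<omega> (x m j)) \<le> u m k then 1 else 0)))"
          unfolding H_def using \<omega> by (intro sum.cong refl) (auto simp: B_def indicator_def)
        also have "\<dots> = (\<Sum>i<N m. \<Sum>j<N m. ennreal (\<Sum>k\<in>scales (\<rho> m). q m i j k *
          (if dist (f \<omega> (x m i)) (f \<omega> (x m j)) \<le> u m k then 1 else 0)))"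
          using q0 by (intro sum.cong refl sum_ennreal) auto
        also have "\<dots> = (\<Sum>i<N m. ennreal (\<Sum>j<N m. \<Sum>k\<in>scales (\<rho> m). q m i j k *
          (if dist (f \<omega> (x m i)) (f \<omega> (x m j)) \<le> u m k then 1 else 0)))"
          using q0 by (intro sum.cong refl sum_ennreal sum_nonneg) auto
        also have "\<dots> = ennreal (\<Sum>i<N m. \<Sum>j<N m. \<Sum>k\<in>scales (\<rho> m). q m i j k *
          (if dist (f \<omega> (x m i)) (f \<omega> (x m j)) \<le> u m k then 1 else 0))"
          using q0 by (intro sum_ennreal sum_nonneg) auto
        finally show ?thesis .
      qed
      moreover have "H m \<omega> < ennreal (16 powr (- s))" using elim m by (auto simp: G_def not_le)
      ultimately have small: "(\<Sum>i<N m. \<Sum>j<N m. \<Sum>k\<in>scales (\<rho> m). q m i j k *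
          (if dist (f \<omega> (x m i)) (f \<omega> (x m j)) \<le> u m k then 1 else 0)) < 16 powr (- s)"
        by (intro ennreal_less_imp_less) simp
      show ?case
      proof (intro ballI allI impI)
        fix r \<U> assume r: "r \<in> {\<rho> m..2 * \<rho> m}" and cov: "scale_cover (\<Phi> r) r (f \<omega> ` E) \<U>"
        \<comment> \<open>Monotonicity of \<Phi> lets the scales chosen for \<open>\<rho> m\<close>
          serve every \<open>r\<close> up to \<open>2 * \<rho> m\<close>.\<close>
        have "\<Phi> (\<rho> m) \<le> \<Phi> r" using r g by (intro mono_onD[OF g(5)]) auto
        then show "1 < (\<Sum>\<^sub>\<infinity>U\<in>\<U>. ennreal (diameter U powr s))"
          using W[OF m] g r s small scales(2)[OF g(3,4,2)]
          by (intro cover_sum_gt_1[OF _ g(3,4) s(1) cov, where n="N m" and x="x m" and p="p m"])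
            (auto simp: u_def q_def)
      qed
    qed
  qed
qed

lemma infsum_diameter_antimono:
  assumes "scale_cover l r F \<U>" "r \<le> 1" "t \<le> s"
  shows "(\<Sum>\<^sub>\<infinity>U\<in>\<U>. ennreal (diameter U powr s)) \<le> (\<Sum>\<^sub>\<infinity>U\<in>\<U>. ennreal (diameter U powr t))"
proof (rule infsum_mono_neutral)
  fix U assume "U \<in> \<U> \<inter> \<U>"
  then show "ennreal (diameter U powr s) \<le> ennreal (diameter U powr t)"
    using assms by (intro ennreal_leI powr_mono') (auto simp: scale_cover_def diameter_ge_0)
qed (auto simp: nonneg_summable_on_complete)

text \<open>Admitting \<open>t\<close> demands covers at every small \<open>r\<close>, so failure
  along one sequence suffices. An infinite upper limit supplies scales of capacity above 1, selected
  so that \<open>\<rho> n \<le> (1/2)^n\<close>. All \<open>t \<le> s\<close> are excluded together,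
  since cover sums decrease in the exponent once diameters are at most 1.\<close>

lemma AE_not_upper_admits:
  fixes f :: "'w \<Rightarrow> 'p \<Rightarrow> 'e::euclidean_space"
  assumes P: "finite_measure P" and meas: "\<And>x. x \<in> E \<Longrightarrow> (\<lambda>\<omega>. f \<omega> x) \<in> borel_measurable P"
    and ball: "\<And>x y u. x \<in> E \<Longrightarrow> y \<in> E \<Longrightarrow> 0 < u \<Longrightarrow> u < u1 \<Longrightarrow>
        emeasure P {\<omega> \<in> space P. dist (f \<omega> x) (f \<omega> y) \<le> u} \<le> ennreal (c * Z u x y)"
    and u1: "u1 > 0" and c: "c \<ge> 0"
    and s: "0 \<le> s" "s < s'" "s' \<le> D" and inf: "\<not> Limsup (at_right 0) (cap s') < \<infinity>"
  shows "AE \<omega> in P. \<forall>t\<le>s. \<not> upper_admits \<Phi> (f \<omega> ` E) t"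
proof -
  have fr: "\<exists>\<^sub>F r in at_right 0. 1 < cap s' r"
  proof (rule ccontr)
    assume "\<not> ?thesis"
    then have "\<forall>\<^sub>F r in at_right 0. cap s' r \<le> 1" by (simp add: not_frequently not_less)
    then have "Limsup (at_right 0) (cap s') \<le> 1" by (rule Limsup_bounded)
    then show False using inf by (simp add: le_less_trans)
  qed
  have "\<exists>r. 0 < r \<and> r \<le> (1/2)^n \<and> 1 < cap s' r" for n :: nat
  proof -
    have "\<forall>\<^sub>F r::real in at_right 0. r \<in> {0<..<(1/2)^n}"
      by (rule eventually_at_rightI[of 0 "(1/2)^n"]) auto
    then have "\<forall>\<^sub>F r in at_right 0. 1 < cap s' r \<longrightarrow> 0 < r \<and> r \<le> (1/2)^n \<and> 1 < cap s' r"
      by eventually_elim auto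
    from frequently_mp[OF this fr] show ?thesis by (rule frequently_ex)
  qed
  then obtain \<rho> where \<rho>: "\<And>n. 0 < \<rho> n" "\<And>n. \<rho> n \<le> (1/2)^n" "\<And>n. 1 < cap s' (\<rho> n)" by metis
  have "AE \<omega> in P. \<forall>\<^sub>F n in sequentially. \<forall>r\<in>{\<rho> n..2 * \<rho> n}. \<forall>\<U>.
    scale_cover (\<Phi> r) r (f \<omega> ` E) \<U> \<longrightarrow> 1 < (\<Sum>\<^sub>\<infinity>U\<in>\<U>. ennreal (diameter U powr s))"
    using \<rho> by (intro lower_key[OF P meas ball u1 c s]) auto
  then show ?thesis
  proof eventually_elim
    case (elim \<omega>)
    show ?case
    proof (intro allI impI notI)
      fix t assume t: "t \<le> s" and adm: "upper_admits \<Phi> (f \<omega> ` E) t"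
      obtain r0 where r0: "r0 \<in> {0<..1}" "\<And>r. r \<in> {0<..<r0} \<Longrightarrow> \<exists>\<U>. scale_cover (\<Phi> r) r (f \<omega> ` E) \<U> \<and>
        (\<Sum>\<^sub>\<infinity>U\<in>\<U>. ennreal (diameter U powr t)) \<le> ennreal 1"
        using adm zero_less_one unfolding upper_admits_def by blast
      obtain n1 where n1: "\<And>n r \<U>. n \<ge> n1 \<Longrightarrow> r \<in> {\<rho> n..2 * \<rho> n} \<Longrightarrow>
        scale_cover (\<Phi> r) r (f \<omega> ` E) \<U> \<Longrightarrow> 1 < (\<Sum>\<^sub>\<infinity>U\<in>\<U>. ennreal (diameter U powr s))"
        using elim unfolding eventually_sequentially by blast
      obtain n2 where n2: "(1/2)^n2 < r0" using real_arch_pow_inv[of r0 "1/2"] r0 by auto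
      define n where "n = max n1 n2"
      have "\<rho> n \<le> (1/2)^n" by (rule \<rho>)
      also have "\<dots> \<le> (1/2)^n2" by (intro power_decreasing) (auto simp: n_def)
      finally have "\<rho> n \<in> {0<..<r0}" using n2 \<rho>(1) by auto
      then obtain \<U> where \<U>: "scale_cover (\<Phi> (\<rho> n)) (\<rho> n) (f \<omega> ` E) \<U>"
        "(\<Sum>\<^sub>\<infinity>U\<in>\<U>. ennreal (diameter U powr t)) \<le> ennreal 1" using r0(2) by blast
      have "1 < (\<Sum>\<^sub>\<infinity>U\<in>\<U>. ennreal (diameter U powr s))"
        using \<U>(1) \<rho>(1)[of n] by (intro n1[of n "\<rho> n"]) (auto simp: n_def)
      also have "\<dots> \<le> (\<Sum>\<^sub>\<infinity>U\<in>\<U>. ennreal (diameter U powr t))"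
        using t \<open>\<rho> n \<in> {0<..<r0}\<close> r0(1) by (intro infsum_diameter_antimono[OF \<U>(1)]) auto
      also note \<U>(2)
      finally show False by simp
    qed
  qed
qed

text \<open>Here failure is required at all small \<open>r\<close>. An infinite lower limit gives
  capacity above 1 at every small scale, in particular along \<open>(1/2)^n\<close>, and the
  intervals \<open>{\<rho> n..2 * \<rho> n}\<close> fill a right neighbourhood of 0.\<close>

lemma AE_not_lower_admits:
  fixes f :: "'w \<Rightarrow> 'p \<Rightarrow> 'e::euclidean_space"
  assumes P: "finite_measure P" and meas: "\<And>x. x \<in> E \<Longrightarrow> (\<lambda>\<omega>. f \<omega> x) \<in> borel_measurable P"
    and ball: "\<And>x y u. x \<in> E \<Longrightarrow> y \<in> E \<Longrightarrow> 0 < u \<Longrightarrow> u < u1 \<Longrightarrow>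
        emeasure P {\<omega> \<in> space P. dist (f \<omega> x) (f \<omega> y) \<le> u} \<le> ennreal (c * Z u x y)"
    and u1: "u1 > 0" and c: "c \<ge> 0"
    and s: "0 \<le> s" "s < s'" "s' \<le> D" and inf: "\<not> Liminf (at_right 0) (cap s') < \<infinity>"
  shows "AE \<omega> in P. \<forall>t\<le>s. \<not> lower_admits \<Phi> (f \<omega> ` E) t"
proof -
  define \<rho> :: "nat \<Rightarrow> real" where "\<rho> n = (1/2)^n" for n
  have "1 < Liminf (at_right 0) (cap s')"
  proof -
    have "Liminf (at_right 0) (cap s') = \<infinity>" using inf by (simp add: not_less top_unique)
    then show ?thesis by simp
  qed
  then have "\<forall>\<^sub>F r in at_right 0. 1 < cap s' r" by (rule less_LiminfD)
  moreover have "filterlim \<rho> (at_right 0) sequentially"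
    unfolding \<rho>_def by (rule tendsto_imp_filterlim_at_right) (auto intro!: LIMSEQ_realpow_zero)
  ultimately have ev: "\<forall>\<^sub>F n in sequentially. 1 < cap s' (\<rho> n)"
    by (rule eventually_compose_filterlim)
  have "AE \<omega> in P. \<forall>\<^sub>F n in sequentially. \<forall>r\<in>{\<rho> n..2 * \<rho> n}. \<forall>\<U>.
    scale_cover (\<Phi> r) r (f \<omega> ` E) \<U> \<longrightarrow> 1 < (\<Sum>\<^sub>\<infinity>U\<in>\<U>. ennreal (diameter U powr s))"
    using ev by (intro lower_key[OF P meas ball u1 c s]) (auto simp: \<rho>_def)
  then show ?thesis
  proof eventually_elim
    case (elim \<omega>)
    show ?case
    proof (intro allI impI notI)
      fix t assume t: "t \<le> s" and adm: "lower_admits \<Phi> (f \<omega> ` E) t"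
      obtain n1 where n1: "\<And>n r \<U>. n \<ge> n1 \<Longrightarrow> r \<in> {\<rho> n..2 * \<rho> n} \<Longrightarrow>
        scale_cover (\<Phi> r) r (f \<omega> ` E) \<U> \<Longrightarrow> 1 < (\<Sum>\<^sub>\<infinity>U\<in>\<U>. ennreal (diameter U powr s))"
        using elim unfolding eventually_sequentially by blast
      have "(1/2::real) ^ (n1 + 1) \<le> 1" by (rule power_le_one) auto
      then have "\<rho> (n1 + 1) \<in> {0<..1}" by (simp add: \<rho>_def)
      then obtain r \<U> where r: "r \<in> {0<..<\<rho> (n1 + 1)}" and \<U>: "scale_cover (\<Phi> r) r (f \<omega> ` E) \<U>"
        "(\<Sum>\<^sub>\<infinity>U\<in>\<U>. ennreal (diameter U powr t)) \<le> ennreal 1"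
        using adm zero_less_one unfolding lower_admits_def by blast
      have r1: "r \<le> 1" using r \<open>\<rho> (n1 + 1) \<in> {0<..1}\<close> by auto
      then obtain k where k: "r \<le> (1/2)^k * 1" "(1/2)^k * 1 < 2 * r"
        using dyadic_scale[of r 1] r by auto
      have "k \<ge> n1"
      proof (rule ccontr)
        assume "\<not> k \<ge> n1"
        then have "(1/2::real)^n1 \<le> (1/2)^k" by (intro power_decreasing) auto
        moreover have "2 * r < (1/2)^n1" using r by (simp add: \<rho>_def)
        ultimately show False using k by linarith
      qed
      \<comment> \<open>\<open>r\<close> lies between \<open>(1/2)^(k+1)\<close> and
        \<open>(1/2)^k\<close>, so the interval belonging to \<open>k + 1\<close> contains
        it.\<close>
      then have "1 < (\<Sum>\<^sub>\<infinity>U\<in>\<U>. ennreal (diameter U powr s))"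
        using k by (intro n1[OF _ _ \<U>(1), of "k+1"]) (auto simp: \<rho>_def)
      also have "\<dots> \<le> (\<Sum>\<^sub>\<infinity>U\<in>\<U>. ennreal (diameter U powr t))"
        using \<U>(1) t r1 by (intro infsum_diameter_antimono)
      also note \<U>(2)
      finally show False by simp
    qed
  qed
qed

lemma AE_Phi_dims_eq:
  fixes f :: "'w \<Rightarrow> 'p \<Rightarrow> 'e::euclidean_space"
  assumes P: "finite_measure P" and meas: "\<And>x. x \<in> E \<Longrightarrow> (\<lambda>\<omega>. f \<omega> x) \<in> borel_measurable P"
    and ball: "\<And>x y u. x \<in> E \<Longrightarrow> y \<in> E \<Longrightarrow> 0 < u \<Longrightarrow> u < u1 \<Longrightarrow>
        emeasure P {\<omega> \<in> space P. dist (f \<omega> x) (f \<omega> y) \<le> u} \<le> ennreal (c * Z u x y)"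
    and u1: "u1 > 0" and c: "c \<ge> 0"
    and hyp: "AE \<omega> in P. cover_hyp Z E (f \<omega>) \<and> bounded (f \<omega> ` E)"
  shows "AE \<omega> in P. lower_Phi_dim \<Phi> (f \<omega> ` E) = lower_cap \<and> upper_Phi_dim \<Phi> (f \<omega> ` E) = upper_cap"
proof -
  have u: "AE \<omega> in P. \<forall>ab::rat \<times> rat. 0 \<le> fst ab \<longrightarrow> fst ab < snd ab \<longrightarrow> of_rat (snd ab) \<le> D \<longrightarrow>
      \<not> Limsup (at_right 0) (cap (of_rat (snd ab))) < \<infinity> \<longrightarrow> (\<forall>t\<le>of_rat (fst ab). \<not> upper_admits \<Phi> (f \<omega> ` E) t)"
    unfolding AE_all_countable
  proof
    fix ab :: "rat \<times> rat"
    let ?Q = "0 \<le> fst ab \<and> fst ab < snd ab \<and> of_rat (snd ab) \<le> D \<and> \<not> Limsup (at_right 0) (cap (of_rat (snd ab))) < \<infinity>"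
    show "AE \<omega> in P. 0 \<le> fst ab \<longrightarrow> fst ab < snd ab \<longrightarrow> of_rat (snd ab) \<le> D \<longrightarrow>
      \<not> Limsup (at_right 0) (cap (of_rat (snd ab))) < \<infinity> \<longrightarrow> (\<forall>t\<le>of_rat (fst ab). \<not> upper_admits \<Phi> (f \<omega> ` E) t)"
    proof (cases ?Q)
      case True
      have "AE \<omega> in P. \<forall>t\<le>of_rat (fst ab). \<not> upper_admits \<Phi> (f \<omega> ` E) t"
        by (rule AE_not_upper_admits[OF P meas ball u1 c, where s' = "of_rat (snd ab)"])
          (use True in \<open>auto simp: of_rat_less zero_le_of_rat_iff\<close>)
      then show ?thesis by eventually_elim auto
    qed auto
  qed
  have l: "AE \<omega> in P. \<forall>ab::rat \<times> rat. 0 \<le> fst ab \<longrightarrow> fst ab < snd ab \<longrightarrow> of_rat (snd ab) \<le> D \<longrightarrow>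
      \<not> Liminf (at_right 0) (cap (of_rat (snd ab))) < \<infinity> \<longrightarrow> (\<forall>t\<le>of_rat (fst ab). \<not> lower_admits \<Phi> (f \<omega> ` E) t)"
    unfolding AE_all_countable
  proof
    fix ab :: "rat \<times> rat"
    let ?Q = "0 \<le> fst ab \<and> fst ab < snd ab \<and> of_rat (snd ab) \<le> D \<and> \<not> Liminf (at_right 0) (cap (of_rat (snd ab))) < \<infinity>"
    show "AE \<omega> in P. 0 \<le> fst ab \<longrightarrow> fst ab < snd ab \<longrightarrow> of_rat (snd ab) \<le> D \<longrightarrow>
      \<not> Liminf (at_right 0) (cap (of_rat (snd ab))) < \<infinity> \<longrightarrow> (\<forall>t\<le>of_rat (fst ab). \<not> lower_admits \<Phi> (f \<omega> ` E) t)"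
    proof (cases ?Q)
      case True
      have "AE \<omega> in P. \<forall>t\<le>of_rat (fst ab). \<not> lower_admits \<Phi> (f \<omega> ` E) t"
        by (rule AE_not_lower_admits[OF P meas ball u1 c, where s' = "of_rat (snd ab)"])
          (use True in \<open>auto simp: of_rat_less zero_le_of_rat_iff\<close>)
      then show ?thesis by eventually_elim auto
    qed auto
  qed
  have dense: "\<exists>a b::rat. 0 \<le> a \<and> a < b \<and> t \<le> of_rat a \<and> of_rat b < y" if ty: "0 \<le> t" "t < y" for t y :: real
  proof -
    obtain a :: rat where a: "t < of_rat a" "of_rat a < y" using of_rat_dense[OF ty(2)] by auto
    obtain b :: rat where b: "of_rat a < (of_rat b :: real)" "of_rat b < y" using of_rat_dense[OF a(2)] by auto
    have "0 < (of_rat a :: real)" using a ty by linarith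
    then have "0 \<le> a" by simp
    then show ?thesis using a b by (intro exI[of _ a] exI[of _ b]) (auto simp: of_rat_less)
  qed
  have DU: "D \<in> {s\<in>{0..D}. Limsup (at_right 0) (cap s) < \<infinity>}" using D0 cap_D by simp
  have "Liminf (at_right 0) (cap D) \<le> Limsup (at_right 0) (cap D)"
    by (rule Liminf_le_Limsup) simp
  then have DL: "D \<in> {s\<in>{0..D}. Liminf (at_right 0) (cap s) < \<infinity>}"
    using D0 cap_D by (auto intro: le_less_trans)
  have bdd: "bdd_below {s\<in>{0..D}. Limsup (at_right 0) (cap s) < \<infinity>}" "bdd_below {s\<in>{0..D}. Liminf (at_right 0) (cap s) < \<infinity>}"
    by (auto intro!: bdd_belowI[of _ 0])
  have capD: "upper_cap \<le> D" "lower_cap \<le> D"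
    unfolding upper_cap_def lower_cap_def using DU DL bdd by (auto intro!: cInf_lower)
  have nU: "\<not> Limsup (at_right 0) (cap b) < \<infinity>" if "0 \<le> b" "b < upper_cap" for b
    using that capD cInf_lower[OF _ bdd(1), of b] unfolding upper_cap_def[symmetric] by force
  have nL: "\<not> Liminf (at_right 0) (cap b) < \<infinity>" if "0 \<le> b" "b < lower_cap" for b
    using that capD cInf_lower[OF _ bdd(2), of b] unfolding lower_cap_def[symmetric] by force
  show ?thesis
    using hyp u l
  proof eventually_elim
    case (elim \<omega>)
    have le: "lower_Phi_dim \<Phi> (f \<omega> ` E) \<le> lower_cap" "upper_Phi_dim \<Phi> (f \<omega> ` E) \<le> upper_cap"
      using Phi_dims_le elim(1) by blast+
    have "lower_cap \<le> lower_Phi_dim \<Phi> (f \<omega> ` E)"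
      unfolding Phi_dim_eq
    proof (rule cInf_greatest)
      have "lower_admits \<Phi> (f \<omega> ` E) (lower_cap + 1)" using elim(1) by (intro lower_cap_mem) auto
      then show "Collect (lower_admits \<Phi> (f \<omega> ` E)) \<noteq> {}" by blast
      fix t assume t: "t \<in> Collect (lower_admits \<Phi> (f \<omega> ` E))"
      show "lower_cap \<le> t"
      proof (rule ccontr)
        assume "\<not> lower_cap \<le> t"
        then obtain a b :: rat where ab: "0 \<le> a" "a < b" "t \<le> of_rat a" "of_rat b < lower_cap"
          using dense[of t lower_cap] t by (auto simp: lower_admits_def)
        then have "0 \<le> (of_rat b :: real)" by (simp add: zero_le_of_rat_iff)
        then show False
          using elim(3)[rule_format, of "(a, b)" t] ab t nL[of "of_rat b"] capD by auto
      qed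
    qed
    moreover have "upper_cap \<le> upper_Phi_dim \<Phi> (f \<omega> ` E)"
      unfolding Phi_dim_eq
    proof (rule cInf_greatest)
      have "upper_admits \<Phi> (f \<omega> ` E) (upper_cap + 1)" using elim(1) by (intro upper_cap_mem) auto
      then show "Collect (upper_admits \<Phi> (f \<omega> ` E)) \<noteq> {}" by blast
      fix t assume t: "t \<in> Collect (upper_admits \<Phi> (f \<omega> ` E))"
      show "upper_cap \<le> t"
      proof (rule ccontr)
        assume "\<not> upper_cap \<le> t"
        then obtain a b :: rat where ab: "0 \<le> a" "a < b" "t \<le> of_rat a" "of_rat b < upper_cap"
          using dense[of t upper_cap] t by (auto simp: upper_admits_def)
        then have "0 \<le> (of_rat b :: real)" by (simp add: zero_le_of_rat_iff)
        then show False
          using elim(2)[rule_format, of "(a, b)" t] ab t nU[of "of_rat b"] capD by auto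
      qed
    qed
    ultimately show ?case using le by auto
  qed
qed

end

section \<open>Capacities, grids and slabs\<close>

text \<open>Stated for arbitrary \<open>f\<close>: the integral is a supremum over simple functions
  below \<open>f\<close>, and each of these pulls back along \<open>g\<close>. This admits kernels
  whose measurability has not been established.\<close>

lemma nn_integral_distr_le:
  assumes g: "g \<in> measurable M N"
  shows "(\<integral>\<^sup>+x. f x \<partial>distr M N g) \<le> (\<integral>\<^sup>+x. f (g x) \<partial>M)"
  unfolding nn_integral_def[of "distr M N g"]
proof (rule SUP_least)
  fix s assume s: "s \<in> {h. simple_function (distr M N g) h \<and> h \<le> f}"
  then have s': "simple_function (distr M N g) s" "s \<le> f" by auto
  have sN: "s \<in> borel_measurable (distr M N g)" by (rule borel_measurable_simple_function[OF s'(1)])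
  have "integral\<^sup>S (distr M N g) s = (\<integral>\<^sup>+x. s x \<partial>distr M N g)"
    by (rule nn_integral_eq_simple_integral[OF s'(1), symmetric])
  also have "\<dots> = (\<integral>\<^sup>+x. s (g x) \<partial>M)" by (rule nn_integral_distr[OF g sN])
  also have "\<dots> \<le> (\<integral>\<^sup>+x. f (g x) \<partial>M)"
    using s'(2) by (intro nn_integral_mono) (auto simp: le_fun_def)
  finally show "integral\<^sup>S (distr M N g) s \<le> (\<integral>\<^sup>+x. f (g x) \<partial>M)" .
qed

lemma space_borel_of: "space (borel_of X) = topspace X"
  by (simp add: borel_of_def space_measure_of_conv)

lemma sets_borel_of: "sets (borel_of X) = sigma_sets (topspace X) {U. openin X U}"
  unfolding borel_of_def by (rule sets_measure_of) (auto dest: openin_subset)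

lemma openin_borel_of: "openin X U \<Longrightarrow> U \<in> sets (borel_of X)"
  by (simp add: sets_borel_of sigma_sets.Basic)

lemma ennreal_inverse_inverse: "inverse (inverse (a::ennreal)) = a"
proof (cases a)
  case (real r)
  then show ?thesis by (cases "r = 0") (auto simp: inverse_ennreal)
qed auto

text \<open>The push-forward of an atomic measure on the indices competes in the infimum, as its
  atoms lie in \<open>E\<close> and so in the closure.\<close>

lemma inverse_capacity_le_energy:
  assumes w: "weights E n x p" and E: "E \<subseteq> topspace X" and K: "\<And>x y. 0 \<le> K x y"
  shows "inverse (capacity X K E) \<le> ennreal (energy K n x p)"
proof -
  define N where "N = point_measure {..<n} (\<lambda>i. ennreal (p i))"
  define \<mu> where "\<mu> = distr N (borel_of X) x"
  have p0: "0 \<le> p i" "x i \<in> E" if "i < n" for i using w that by (auto simp: weights_def)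
  have xm: "x \<in> measurable N (borel_of X)"
    unfolding N_def using p0 E by (auto simp: measurable_point_measure_eq1 space_borel_of)
  have nn: "(\<integral>\<^sup>+i. f i \<partial>N) = (\<Sum>i<n. ennreal (p i) * f i)" for f
    unfolding N_def by (rule nn_integral_point_measure_finite) simp
  interpret N: prob_space N
  proof
    have "emeasure N (space N) = (\<integral>\<^sup>+i. 1 \<partial>N)" by simp
    also have "\<dots> = (\<Sum>i<n. ennreal (p i))" by (simp only: nn) simp
    also have "\<dots> = ennreal (\<Sum>i<n. p i)" using p0 by (intro sum_ennreal) auto
    finally show "emeasure N (space N) = 1" using w by (simp add: weights_def)
  qed
  have clo: "E \<subseteq> X closure_of E" using E by (simp add: closure_of_subset)
  have "\<mu> \<in> prob_measures_on X (X closure_of E)"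
    unfolding prob_measures_on_def
  proof (intro CollectI conjI)
    show "prob_space \<mu>" unfolding \<mu>_def by (rule N.prob_space_distr[OF xm])
    show "sets \<mu> = sets (borel_of X)" by (simp add: \<mu>_def)
    have "topspace X - X closure_of E \<in> sets (borel_of X)"
      by (intro openin_borel_of openin_diff) auto
    then have "emeasure \<mu> (topspace X - X closure_of E) = emeasure N (x -` (topspace X - X closure_of E) \<inter> space N)"
      unfolding \<mu>_def by (rule emeasure_distr[OF xm])
    also have "x -` (topspace X - X closure_of E) \<inter> space N = {}"
      using p0 clo by (auto simp: N_def space_point_measure)
    finally show "emeasure \<mu> (topspace X - X closure_of E) = 0" by simp
  qed
  then have "inverse (capacity X K E) \<le> (\<integral>\<^sup>+ y. (\<integral>\<^sup>+ x. ennreal (K x y) \<partial>\<mu>) \<partial>\<mu>)"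
    unfolding capacity_def ennreal_inverse_inverse by (rule INF_lower)
  also have "\<dots> \<le> (\<integral>\<^sup>+ j. (\<integral>\<^sup>+ x. ennreal (K x (x' j)) \<partial>\<mu>) \<partial>N)" if "x' = x" for x'
    unfolding that unfolding \<mu>_def by (rule nn_integral_distr_le[OF xm])
  also have "(\<integral>\<^sup>+ j. (\<integral>\<^sup>+ y. ennreal (K y (x j)) \<partial>\<mu>) \<partial>N) \<le> (\<integral>\<^sup>+ j. (\<integral>\<^sup>+ i. ennreal (K (x i) (x j)) \<partial>N) \<partial>N)"
    unfolding \<mu>_def by (intro nn_integral_mono nn_integral_distr_le[OF xm])
  also have "\<dots> = (\<Sum>j<n. \<Sum>i<n. ennreal (p j * (p i * K (x i) (x j))))"
    unfolding nn sum_distrib_left using p0 K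
    by (intro sum.cong refl) (simp add: ennreal_mult)
  also have "\<dots> = (\<Sum>j<n. ennreal (\<Sum>i<n. p j * (p i * K (x i) (x j))))"
    using p0 K by (intro sum.cong refl sum_ennreal) auto
  also have "\<dots> = ennreal (\<Sum>j<n. \<Sum>i<n. p j * (p i * K (x i) (x j)))"
    using p0 K by (intro sum_ennreal sum_nonneg) auto
  also have "(\<Sum>j<n. \<Sum>i<n. p j * (p i * K (x i) (x j))) = energy K n x p"
    unfolding energy_def by (subst sum.swap) (simp add: mult_ac)
  finally show ?thesis by simp
qed

text \<open>Converse comparison: a measure of energy below 1 is condensed onto the representatives
  \<open>e i\<close> of the cells \<open>A i\<close>, with the measures of the cells as masses. The
  representatives lie in \<open>E\<close> although the measure lives on the closure; near-constancy
  of the kernel on pairs of cells costs the factor \<open>c\<close>.\<close>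

lemma energy_le_of_capacity:
  fixes A :: "nat \<Rightarrow> 'a set"
  assumes cap: "1 < capacity X K E"
    and A: "\<And>i. i < n \<Longrightarrow> A i \<in> sets (borel_of X)" "disjoint_family_on A {..<n}"
      "X closure_of E \<subseteq> (\<Union>i<n. A i)"
    and e: "\<And>i. i < n \<Longrightarrow> e i \<in> E" and K: "\<And>x y. 0 \<le> K x y" and c: "c > 0"
    and comp: "\<And>i j x y. i < n \<Longrightarrow> j < n \<Longrightarrow> x \<in> A i \<inter> X closure_of E \<Longrightarrow> y \<in> A j \<inter> X closure_of E \<Longrightarrow>
       K (e i) (e j) \<le> c * K x y"
  shows "\<exists>p. weights E n e p \<and> energy K n e p \<le> c"
proof -
  let ?S = "X closure_of E"
  let ?I = "INF \<mu>\<in>prob_measures_on X ?S. \<integral>\<^sup>+ y. (\<integral>\<^sup>+ x. ennreal (K x y) \<partial>\<mu>) \<partial>\<mu>"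
  have "?I < 1"
  proof (rule ccontr)
    assume "\<not> ?thesis"
    then have "1 \<le> ?I" by (simp add: not_less)
    then have "inverse ?I \<le> inverse 1" by (rule inverse_antimono_ennreal)
    then show False using cap unfolding capacity_def by simp
  qed
  then obtain \<mu> where \<mu>: "\<mu> \<in> prob_measures_on X ?S" and I: "(\<integral>\<^sup>+ y. (\<integral>\<^sup>+ x. ennreal (K x y) \<partial>\<mu>) \<partial>\<mu>) < 1"
    by (auto simp: INF_less_iff)
  then interpret prob_space \<mu> by (simp add: prob_measures_on_def)
  have sets: "sets \<mu> = sets (borel_of X)" using \<mu> by (simp add: prob_measures_on_def)
  have space: "space \<mu> = topspace X" using sets_eq_imp_space_eq[OF sets] by (simp add: space_borel_of)
  have null: "topspace X - ?S \<in> null_sets \<mu>"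
    using \<mu> by (auto simp: prob_measures_on_def null_sets_def intro!: openin_borel_of openin_diff)
  have AE: "AE x in \<mu>. x \<in> ?S"
    by (rule AE_I'[OF null]) (auto simp: space)
  have Am: "A i \<in> sets \<mu>" if "i < n" for i using A(1)[OF that] sets by simp
  define p where "p i = measure \<mu> (A i)" for i
  have "(\<Sum>i<n. p i) = measure \<mu> (\<Union>i<n. A i)"
    unfolding p_def using Am A(2) by (intro finite_measure_finite_Union[symmetric]) auto
  also have "\<dots> = 1"
  proof -
    have "AE x in \<mu>. x \<in> (\<Union>i<n. A i)" by (rule eventually_mono[OF AE]) (use A(3) in auto)
    then show ?thesis using Am by (subst prob_eq_1) auto
  qed
  finally have w: "weights E n e p" using e by (simp add: weights_def p_def)
  have em: "emeasure \<mu> (A i) = ennreal (p i)" for i by (simp add: p_def emeasure_eq_measure)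
  define g where "g j = (\<Sum>i<n. ennreal (K (e i) (e j) / c) * ennreal (p i))" for j
  have inner: "g j \<le> (\<integral>\<^sup>+ x. ennreal (K x y) \<partial>\<mu>)" if j: "j < n" and y: "y \<in> A j" "y \<in> ?S" for j y
  proof -
    have "g j = (\<integral>\<^sup>+ x. (\<Sum>i<n. ennreal (K (e i) (e j) / c) * indicator (A i) x) \<partial>\<mu>)"
      unfolding g_def using Am
      by (subst nn_integral_sum) (auto simp: nn_integral_cmult_indicator em)
    also have "\<dots> \<le> (\<integral>\<^sup>+ x. ennreal (K x y) \<partial>\<mu>)"
    proof (rule nn_integral_mono_AE)
      show "AE x in \<mu>. (\<Sum>i<n. ennreal (K (e i) (e j) / c) * indicator (A i) x) \<le> ennreal (K x y)"
        using AE
      proof eventually_elim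
        case (elim x)
        then obtain i where i: "i < n" "x \<in> A i" using A(3) by auto
        have "(\<Sum>i<n. ennreal (K (e i) (e j) / c) * indicator (A i) x) = ennreal (K (e i) (e j) / c)"
          using A(2) i by (intro sum_indicator_disjoint_family) auto
        also have "\<dots> \<le> ennreal (K x y)"
          using comp[of i j x y] i j y elim c by (intro ennreal_leI) (simp add: divide_simps mult.commute)
        finally show ?case .
      qed
    qed
    finally show ?thesis .
  qed
  have "(\<Sum>j<n. g j * ennreal (p j)) = (\<integral>\<^sup>+ y. (\<Sum>j<n. g j * indicator (A j) y) \<partial>\<mu>)"
    using Am by (subst nn_integral_sum) (auto simp: nn_integral_cmult_indicator em)
  also have "\<dots> \<le> (\<integral>\<^sup>+ y. (\<integral>\<^sup>+ x. ennreal (K x y) \<partial>\<mu>) \<partial>\<mu>)"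
  proof (rule nn_integral_mono_AE)
    show "AE y in \<mu>. (\<Sum>j<n. g j * indicator (A j) y) \<le> (\<integral>\<^sup>+ x. ennreal (K x y) \<partial>\<mu>)"
      using AE
    proof eventually_elim
      case (elim y)
      then obtain j where j: "j < n" "y \<in> A j" using A(3) by auto
      have "(\<Sum>j<n. g j * indicator (A j) y) = g j"
        using A(2) j by (intro sum_indicator_disjoint_family) auto
      then show ?case using inner[of j y] j elim by simp
    qed
  qed
  also note I
  finally have "(\<Sum>j<n. g j * ennreal (p j)) \<le> ennreal 1" by simp
  also have "(\<Sum>j<n. g j * ennreal (p j)) = (\<Sum>j<n. \<Sum>i<n. ennreal (K (e i) (e j) / c * p i * p j))"
    unfolding g_def sum_distrib_right using K c by (intro sum.cong refl) (simp add: p_def flip: ennreal_mult)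
  also have "\<dots> = (\<Sum>j<n. ennreal (\<Sum>i<n. K (e i) (e j) / c * p i * p j))"
    using K c by (intro sum.cong refl sum_ennreal) (auto simp: p_def)
  also have "\<dots> = ennreal (\<Sum>j<n. \<Sum>i<n. K (e i) (e j) / c * p i * p j)"
    using K c by (intro sum_ennreal sum_nonneg) (auto simp: p_def)
  also have "(\<Sum>j<n. \<Sum>i<n. K (e i) (e j) / c * p i * p j) = energy K n e p / c"
    unfolding energy_def sum_divide_distrib by (subst sum.swap) (simp add: mult_ac)
  finally have "energy K n e p \<le> c" using c by (simp add: ennreal_le_iff2 divide_simps split: if_splits)
  then show ?thesis using w by auto
qed

text \<open>Every competing measure has energy at least \<open>b\<close>. This serves the top
  exponent, where the kernel is bounded below uniformly in \<open>r\<close>.\<close>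

lemma capacity_le:
  assumes b: "b > 0" and K: "\<And>x y. x \<in> X closure_of E \<Longrightarrow> y \<in> X closure_of E \<Longrightarrow> b \<le> K x y"
  shows "capacity X K E \<le> ennreal (1 / b)"
proof -
  have "ennreal b \<le> (INF \<mu>\<in>prob_measures_on X (X closure_of E). \<integral>\<^sup>+ y. (\<integral>\<^sup>+ x. ennreal (K x y) \<partial>\<mu>) \<partial>\<mu>)"
  proof (rule INF_greatest)
    fix \<mu> assume \<mu>: "\<mu> \<in> prob_measures_on X (X closure_of E)"
    then interpret prob_space \<mu> by (simp add: prob_measures_on_def)
    have sets: "sets \<mu> = sets (borel_of X)" using \<mu> by (simp add: prob_measures_on_def)
    have space: "space \<mu> = topspace X" using sets_eq_imp_space_eq[OF sets] by (simp add: space_borel_of)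
    have null: "topspace X - X closure_of E \<in> null_sets \<mu>"
      using \<mu> by (auto simp: prob_measures_on_def null_sets_def intro!: openin_borel_of openin_diff)
    have AE: "AE x in \<mu>. x \<in> X closure_of E"
      by (rule AE_I'[OF null]) (auto simp: space)
    have inner: "ennreal b \<le> (\<integral>\<^sup>+ x. ennreal (K x y) \<partial>\<mu>)" if y: "y \<in> X closure_of E" for y
    proof -
      have "ennreal b = (\<integral>\<^sup>+ x. ennreal b \<partial>\<mu>)" by (simp add: emeasure_space_1)
      also have "\<dots> \<le> (\<integral>\<^sup>+ x. ennreal (K x y) \<partial>\<mu>)"
        by (intro nn_integral_mono_AE eventually_mono[OF AE] ennreal_leI K y)
      finally show ?thesis .
    qed
    have "ennreal b = (\<integral>\<^sup>+ y. ennreal b \<partial>\<mu>)" by (simp add: emeasure_space_1)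
    also have "\<dots> \<le> (\<integral>\<^sup>+ y. (\<integral>\<^sup>+ x. ennreal (K x y) \<partial>\<mu>) \<partial>\<mu>)"
      by (intro nn_integral_mono_AE eventually_mono[OF AE] inner)
    finally show "ennreal b \<le> (\<integral>\<^sup>+ y. (\<integral>\<^sup>+ x. ennreal (K x y) \<partial>\<mu>) \<partial>\<mu>)" .
  qed
  then have "capacity X K E \<le> inverse (ennreal b)"
    unfolding capacity_def by (rule inverse_antimono_ennreal)
  then show ?thesis using b by (simp add: inverse_ennreal inverse_eq_divide)
qed

section \<open>Covering numbers and volumes of coordinate boxes\<close>

text \<open>Pigeonhole on the integer cells of the coordinates \<open>g i / \<delta>\<close>: points
  in a common cell differ by at most \<delta> in each coordinate, and one centre per occupied cell
  suffices. The range of one coordinate meets at most \<open>2 * w i / \<delta> + 2\<close>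
  cells.\<close>

lemma grid_covered:
  fixes S :: "'a::metric_space set" and g :: "'i \<Rightarrow> 'a \<Rightarrow> real"
  assumes I: "finite I" and \<delta>: "\<delta> > 0" and w: "\<And>i. i \<in> I \<Longrightarrow> 0 \<le> w i"
    and g: "\<And>a i. a \<in> S \<Longrightarrow> i \<in> I \<Longrightarrow> \<bar>g i a\<bar> \<le> w i"
    and d: "\<And>a b. a \<in> S \<Longrightarrow> b \<in> S \<Longrightarrow> (\<And>i. i \<in> I \<Longrightarrow> \<bar>g i a - g i b\<bar> \<le> \<delta>) \<Longrightarrow> dist a b \<le> \<epsilon>"
  shows "covered S (\<Prod>i\<in>I. 2 * w i / \<delta> + 2) \<epsilon>"
proof -
  define h where "h a = restrict (\<lambda>i. \<lfloor>g i a / \<delta>\<rfloor>) I" for a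
  let ?P = "PiE I (\<lambda>i. {\<lfloor>- w i / \<delta>\<rfloor>..\<lfloor>w i / \<delta>\<rfloor>})"
  have hP: "h ` S \<subseteq> ?P"
  proof (rule image_subsetI)
    fix a assume a: "a \<in> S"
    show "h a \<in> ?P"
    proof (rule PiE_I)
      fix i assume i: "i \<in> I"
      have "- w i / \<delta> \<le> g i a / \<delta>" "g i a / \<delta> \<le> w i / \<delta>"
        using g[OF a i] \<delta> by (intro divide_right_mono; simp)+
      then show "h a i \<in> {\<lfloor>- w i / \<delta>\<rfloor>..\<lfloor>w i / \<delta>\<rfloor>}"
        using i by (auto simp: h_def intro: floor_mono)
    qed (simp add: h_def)
  qed
  have fP: "finite ?P" using I by (intro finite_PiE) auto
  define y where "y v = (SOME a. a \<in> S \<and> h a = v)" for v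
  have y: "y (h a) \<in> S \<and> h (y (h a)) = h a" if "a \<in> S" for a
    unfolding y_def by (rule someI[of _ a]) (use that in auto)
  have "real (card (y ` h ` S)) \<le> real (card ?P)"
    using card_image_le[OF finite_subset[OF hP fP], of y] card_mono[OF fP hP] by simp
  also have "\<dots> = (\<Prod>i\<in>I. real (card {\<lfloor>- w i / \<delta>\<rfloor>..\<lfloor>w i / \<delta>\<rfloor>}))"
    using I by (simp add: card_PiE)
  also have "\<dots> \<le> (\<Prod>i\<in>I. 2 * w i / \<delta> + 2)"
  proof (rule prod_mono)
    fix i assume i: "i \<in> I"
    have "0 \<le> w i / \<delta>" using w[OF i] \<delta> by simp
    then have "real (card {\<lfloor>- w i / \<delta>\<rfloor>..\<lfloor>w i / \<delta>\<rfloor>}) \<le> 2 * (w i / \<delta>) + 2"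
      by simp linarith
    then show "0 \<le> real (card {\<lfloor>- w i / \<delta>\<rfloor>..\<lfloor>w i / \<delta>\<rfloor>}) \<and> real (card {\<lfloor>- w i / \<delta>\<rfloor>..\<lfloor>w i / \<delta>\<rfloor>}) \<le> 2 * w i / \<delta> + 2"
      by simp
  qed
  finally have "real (card (y ` h ` S)) \<le> (\<Prod>i\<in>I. 2 * w i / \<delta> + 2)" .
  moreover have "S \<subseteq> (\<Union>z\<in>y ` h ` S. cball z \<epsilon>)"
  proof
    fix a assume a: "a \<in> S"
    have "dist (y (h a)) a \<le> \<epsilon>"
    proof (rule d)
      fix i assume i: "i \<in> I"
      have "h (y (h a)) i = h a i" using y[OF a] by simp
      then have "\<lfloor>g i (y (h a)) / \<delta>\<rfloor> = \<lfloor>g i a / \<delta>\<rfloor>" using i by (simp add: h_def)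
      then have "\<bar>g i (y (h a)) / \<delta> - g i a / \<delta>\<bar> \<le> 1" by linarith
      then have "\<bar>g i (y (h a)) - g i a\<bar> / \<delta> \<le> 1" using \<delta> by (simp add: abs_divide flip: diff_divide_distrib)
      then show "\<bar>g i (y (h a)) - g i a\<bar> \<le> \<delta>" using \<delta> by simp
    qed (use y a in auto)
    then show "a \<in> (\<Union>z\<in>y ` h ` S. cball z \<epsilon>)" using a by auto
  qed
  ultimately show ?thesis
    unfolding covered_def using finite_subset[OF hP fP] by blast
qed

text \<open>A substitute for a change of variables: \<open>S\<close> is covered by balls at the
  resolution of its smallest width. There the additive 2 in each factor of
  \<open>grid_covered\<close> is absorbed into \<open>4 * w i / \<delta>\<close>, and the powers of
  \<delta> cancel against the volumes of the balls.\<close>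

lemma emeasure_slab_le:
  fixes S :: "'a::euclidean_space set" and g :: "'i \<Rightarrow> 'a \<Rightarrow> real"
  assumes I: "finite I" "card I = DIM('a)" and c: "c > 0" and w: "\<And>i. i \<in> I \<Longrightarrow> 0 < w i"
    and g: "\<And>a i. a \<in> S \<Longrightarrow> i \<in> I \<Longrightarrow> \<bar>g i a\<bar> \<le> w i"
    and d: "\<And>a b. a \<in> S \<Longrightarrow> b \<in> S \<Longrightarrow> norm (a - b) \<le> c * (\<Sum>i\<in>I. \<bar>g i a - g i b\<bar>)"
  shows "emeasure lborel S \<le> ennreal (unit_ball_vol (real DIM('a)) * (4 * c * real DIM('a)) ^ DIM('a) * (\<Prod>i\<in>I. w i))"
proof -
  let ?n = "DIM('a)"
  define \<delta> where "\<delta> = Min (w ` I)"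
  have "I \<noteq> {}" using I by auto
  then have \<delta>: "\<delta> > 0" "\<And>i. i \<in> I \<Longrightarrow> \<delta> \<le> w i"
    unfolding \<delta>_def using I w by auto
  define \<epsilon> where "\<epsilon> = c * real ?n * \<delta>"
  have \<epsilon>: "\<epsilon> \<ge> 0" using c \<delta> by (simp add: \<epsilon>_def)
  have "covered S (\<Prod>i\<in>I. 2 * w i / \<delta> + 2) \<epsilon>"
  proof (rule grid_covered[OF I(1) \<delta>(1)])
    fix a b assume ab: "a \<in> S" "b \<in> S" "\<And>i. i \<in> I \<Longrightarrow> \<bar>g i a - g i b\<bar> \<le> \<delta>"
    have "norm (a - b) \<le> c * (\<Sum>i\<in>I. \<bar>g i a - g i b\<bar>)" by (rule d) fact+
    also have "\<dots> \<le> c * (\<Sum>i\<in>I. \<delta>)" using c ab(3) by (intro mult_left_mono sum_mono) auto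
    finally show "dist a b \<le> \<epsilon>" by (simp add: dist_norm \<epsilon>_def I)
  qed (use w g in \<open>auto intro: less_imp_le\<close>)
  then obtain Y where Y: "finite Y" "real (card Y) \<le> (\<Prod>i\<in>I. 2 * w i / \<delta> + 2)" "S \<subseteq> (\<Union>z\<in>Y. cball z \<epsilon>)"
    unfolding covered_def by blast
  have "emeasure lborel S \<le> emeasure lborel (\<Union>z\<in>Y. cball z \<epsilon>)"
    using Y by (intro emeasure_mono) (auto intro!: borel_closed closed_UN)
  also have "\<dots> \<le> (\<Sum>z\<in>Y. emeasure lborel (cball z \<epsilon>))"
    using Y by (intro emeasure_subadditive_finite) auto
  also have "\<dots> = ennreal (real (card Y) * (unit_ball_vol (real ?n) * \<epsilon> ^ ?n))"
    using \<epsilon> by (simp add: emeasure_cball ennreal_mult' ennreal_of_nat_eq_real_of_nat)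
  also have "\<dots> \<le> ennreal (unit_ball_vol (real DIM('a)) * (4 * c * real DIM('a)) ^ DIM('a) * (\<Prod>i\<in>I. w i))"
  proof (rule ennreal_leI)
    have "real (card Y) \<le> (\<Prod>i\<in>I. 2 * w i / \<delta> + 2)" by (rule Y)
    also have "\<dots> \<le> (\<Prod>i\<in>I. 4 * w i / \<delta>)"
    proof (rule prod_mono)
      fix i assume i: "i \<in> I"
      have "1 \<le> w i / \<delta>" using \<delta>(2)[OF i] \<delta>(1) by simp
      then show "0 \<le> 2 * w i / \<delta> + 2 \<and> 2 * w i / \<delta> + 2 \<le> 4 * w i / \<delta>"
        using times_divide_eq_right[of 2 "w i" \<delta>] times_divide_eq_right[of 4 "w i" \<delta>] by linarith
    qed
    also have "\<dots> = (4 / \<delta>) ^ ?n * (\<Prod>i\<in>I. w i)"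
      using I by (simp add: prod.distrib prod_dividef power_divide)
    finally have "real (card Y) * (unit_ball_vol (real ?n) * \<epsilon> ^ ?n) \<le>
        ((4 / \<delta>) ^ ?n * (\<Prod>i\<in>I. w i)) * (unit_ball_vol (real ?n) * \<epsilon> ^ ?n)"
      using \<epsilon> by (intro mult_right_mono) auto
    also have "\<dots> = unit_ball_vol (real ?n) * (4 / \<delta> * \<epsilon>) ^ ?n * (\<Prod>i\<in>I. w i)"
      by (simp only: power_mult_distrib mult_ac)
    also have "4 / \<delta> * \<epsilon> = 4 * c * real ?n" using \<delta> by (simp add: \<epsilon>_def)
    finally show "real (card Y) * (unit_ball_vol (real ?n) * \<epsilon> ^ ?n) \<le>
      unit_ball_vol (real DIM('a)) * (4 * c * real DIM('a)) ^ DIM('a) * (\<Prod>i\<in>I. w i)" .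
  qed
  finally show ?thesis .
qed

section \<open>Coverings from potentials\<close>

text \<open>Points carry finitely many labels \<open>q\<close>, whose weights \<open>z u q\<close>
  dominate the kernel on the pairs they link. By pigeonhole a point of large potential has a label
  with \<open>z u q * P q \<ge> l / M u\<close>, where \<open>P q\<close> is the mass of
  \<open>A u q\<close>. Covering the block of such a label takes
  \<open>M u / z u q \<le> M u ^ 2 * P q / l\<close> balls, and the masses \<open>P q\<close> sum to
  at most \<open>M u\<close>, because each \<open>y\<close> lies in at most \<open>M u\<close> of
  the sets \<open>A u q\<close>.\<close>

lemma cover_hyp_labels:
  fixes f :: "'p \<Rightarrow> 'e::metric_space" and S :: "real \<Rightarrow> 'p \<Rightarrow> 'q set" and z :: "real \<Rightarrow> 'q \<Rightarrow> real"
    and A :: "real \<Rightarrow> 'q \<Rightarrow> 'p set"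
  assumes u0: "u0 > 0" and C: "C > 0"
    and M: "\<And>u. 0 < u \<Longrightarrow> u < u0 \<Longrightarrow> 0 < M u \<and> M u \<le> C * ln (1 / u) ^ \<kappa>"
    and fin: "\<And>u x. 0 < u \<Longrightarrow> u < u0 \<Longrightarrow> x \<in> E \<Longrightarrow> finite (S u x) \<and> real (card (S u x)) \<le> M u"
    and Zle: "\<And>u x y. 0 < u \<Longrightarrow> u < u0 \<Longrightarrow> x \<in> E \<Longrightarrow> y \<in> E \<Longrightarrow>
      Z u x y \<le> (\<Sum>q\<in>S u x. z u q * (if y \<in> A u q then 1 else 0))"
    and z: "\<And>u x q. 0 < u \<Longrightarrow> u < u0 \<Longrightarrow> x \<in> E \<Longrightarrow> q \<in> S u x \<Longrightarrow> 0 < z u q"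
    and cov: "\<And>u x q. 0 < u \<Longrightarrow> u < u0 \<Longrightarrow> x \<in> E \<Longrightarrow> q \<in> S u x \<Longrightarrow>
       covered (f ` {x\<in>E. q \<in> S u x}) (M u / z u q) (u / 4)"
    and mult: "\<And>u y F. 0 < u \<Longrightarrow> u < u0 \<Longrightarrow> y \<in> E \<Longrightarrow> finite F \<Longrightarrow> F \<subseteq> (\<Union>x\<in>E. S u x) \<Longrightarrow>
       real (card {q\<in>F. y \<in> A u q}) \<le> M u"
  shows "cover_hyp Z E f"
  unfolding cover_hyp_def
\<comment> \<open>Cubes because three factors \<open>M u\<close> occur: the number of labels of a
  point, the cost of a block and the multiplicity.\<close>
proof (rule exI[of _ "C^3"], rule exI[of _ "\<kappa> * 3"], rule exI[of _ u0], intro conjI allI impI)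
  show "C^3 > 0" "u0 > 0" using C u0 by auto
  fix u n x p X l
  assume u: "0 < u" "u < u0" and w: "weights E n x p" and l: "(0::real) < l"
    and X: "\<forall>i\<in>X. i < n \<and> l \<le> (\<Sum>j<n. p j * Z u (x i) (x j))"
  note M = M[OF u]
  have xE: "x i \<in> E" "0 \<le> p i" if "i < n" for i using w that by (auto simp: weights_def)
  define P where "P q = (\<Sum>j<n. p j * (if x j \<in> A u q then 1 else 0))" for q
  have "\<exists>q\<in>S u (x i). l / M u \<le> z u q * P q" if i: "i \<in> X" for i
  proof (rule ccontr)
    assume "\<not> ?thesis"
    then have lt: "z u q * P q < l / M u" if "q \<in> S u (x i)" for q using that by force
    have iE: "i < n" "x i \<in> E" using X i xE by auto
    note fin' = fin[OF u iE(2)]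
    have "l \<le> (\<Sum>j<n. p j * Z u (x i) (x j))" using X i by auto
    also have "\<dots> \<le> (\<Sum>j<n. p j * (\<Sum>q\<in>S u (x i). z u q * (if x j \<in> A u q then 1 else 0)))"
      using xE iE u by (intro sum_mono mult_left_mono Zle) auto
    also have "\<dots> = (\<Sum>q\<in>S u (x i). z u q * P q)"
      unfolding P_def sum_distrib_left by (subst sum.swap) (simp add: mult_ac)
    finally have 1: "l \<le> (\<Sum>q\<in>S u (x i). z u q * P q)" .
    have ne: "S u (x i) \<noteq> {}" using 1 l by auto
    have "(\<Sum>q\<in>S u (x i). z u q * P q) < (\<Sum>q\<in>S u (x i). l / M u)"
      using lt fin' ne by (intro sum_strict_mono) auto
    also have "\<dots> = real (card (S u (x i))) * (l / M u)" by simp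
    also have "\<dots> \<le> M u * (l / M u)" using fin' l M by (intro mult_right_mono) auto
    also have "\<dots> = l" using M by simp
    finally show False using 1 by simp
  qed
  then obtain q where q: "\<And>i. i \<in> X \<Longrightarrow> q i \<in> S u (x i) \<and> l / M u \<le> z u (q i) * P (q i)" by metis
  define F where "F = q ` X"
  have finX: "finite X" by (rule finite_subset[of _ "{..<n}"]) (use X in auto)
  then have finF: "finite F" by (simp add: F_def)
  have XE: "x i \<in> E" if "i \<in> X" for i using that X xE by auto
  have FS: "F \<subseteq> (\<Union>x\<in>E. S u x)" unfolding F_def using q XE by blast
  have P0: "0 \<le> P r" for r unfolding P_def using xE by (intro sum_nonneg) auto
  have zF: "0 < z u r" "l / M u \<le> z u r * P r" "covered (f ` {x\<in>E. r \<in> S u x}) (M u / z u r) (u / 4)" if "r \<in> F" for r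
  proof -
    obtain i where i: "i \<in> X" "r = q i" using \<open>r \<in> F\<close> by (auto simp: F_def)
    then show "0 < z u r" "l / M u \<le> z u r * P r" "covered (f ` {x\<in>E. r \<in> S u x}) (M u / z u r) (u / 4)"
      using q[OF i(1)] z[OF u XE[OF i(1)]] cov[OF u XE[OF i(1)]] by auto
  qed
  have "covered (\<Union>r\<in>F. f ` {x\<in>E. r \<in> S u x}) (\<Sum>r\<in>F. M u / z u r) (u / 4)"
    using finF zF by (intro covered_UN) auto
  moreover have "f ` x ` X \<subseteq> (\<Union>r\<in>F. f ` {x\<in>E. r \<in> S u x})"
    using q XE by (fastforce simp: F_def)
  moreover have "(\<Sum>r\<in>F. M u / z u r) \<le> C^3 * ln (1 / u) ^ (\<kappa> * 3) / l"
  proof -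
    have "(\<Sum>r\<in>F. M u / z u r) \<le> (\<Sum>r\<in>F. M u * (M u * P r / l))"
    proof (rule sum_mono)
      fix r assume r: "r \<in> F"
      have "l \<le> M u * (z u r * P r)" using zF(2)[OF r] M by (simp add: divide_simps mult.commute)
      then have "1 / z u r \<le> M u * P r / l"
        using zF(1)[OF r] l by (simp add: divide_simps mult_ac)
      then have "M u * (1 / z u r) \<le> M u * (M u * P r / l)" using M by (intro mult_left_mono) auto
      then show "M u / z u r \<le> M u * (M u * P r / l)" by simp
    qed
    also have "\<dots> = M u * M u / l * (\<Sum>r\<in>F. P r)"
      by (simp add: sum_distrib_left mult.assoc)
    also have "(\<Sum>r\<in>F. P r) = (\<Sum>j<n. p j * real (card {r\<in>F. x j \<in> A u r}))"
    proof -
      have "(\<Sum>r\<in>F. P r) = (\<Sum>j<n. p j * (\<Sum>r\<in>F. if x j \<in> A u r then 1 else 0))"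
        unfolding P_def sum_distrib_left by (subst sum.swap) simp
      also have "\<dots> = (\<Sum>j<n. p j * real (card {r\<in>F. x j \<in> A u r}))"
        using finF by (simp add: sum.If_cases Int_def)
      finally show ?thesis .
    qed
    also have "M u * M u / l * \<dots> \<le> M u * M u / l * (\<Sum>j<n. p j * M u)"
      using xE l M mult[OF u _ finF FS] by (intro mult_left_mono sum_mono) auto
    also have "(\<Sum>j<n. p j * M u) = M u" using w by (simp add: weights_def flip: sum_distrib_right)
    also have "M u * M u / l * M u = M u ^ 3 / l" by (simp add: power3_eq_cube)
    also have "\<dots> \<le> (C * ln (1 / u) ^ \<kappa>) ^ 3 / l" using M l by (intro divide_right_mono power_mono) auto
    also have "\<dots> = C^3 * ln (1 / u) ^ (\<kappa> * 3) / l" by (simp add: power_mult_distrib power_mult)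
    finally show ?thesis .
  qed
  ultimately show "covered (f ` x ` X) (C^3 * ln (1 / u) ^ (\<kappa> * 3) / l) (u / 4)"
    by (rule covered_mono)
qed

text \<open>The labels are cells of grids of mesh
  \<open>h u j = 2 ^ j * u powr (1 / \<alpha>)\<close>. The image of a cell has diameter of order
  \<open>L u * 2 powr (j * \<alpha>) * u\<close>, so in \<open>m\<close> coordinates it takes of
  order \<open>L u ^ m * 2 powr (j * \<tau>)\<close> balls of radius \<open>u / 4\<close>. Up to the
  logarithm this is the reciprocal of the kernel at distance \<open>h u j\<close>.\<close>

lemma cover_hyp_profile:
  fixes E :: "'a::euclidean_space set" and f :: "'a \<Rightarrow> 'e::euclidean_space" and g :: "'i \<Rightarrow> 'e \<Rightarrow> real"
  assumes E: "bounded E" and \<alpha>: "0 < \<alpha>" "\<alpha> \<le> 1" and I: "finite I" "I \<noteq> {}" and u1: "u1 > 0" and Cm: "Cm > 0" and cg: "cg > 0"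
    and modulus: "\<And>u h x y. 0 < u \<Longrightarrow> u < u1 \<Longrightarrow> u powr (1 / \<alpha>) \<le> h \<Longrightarrow> x \<in> E \<Longrightarrow> y \<in> E \<Longrightarrow> dist x y \<le> h \<Longrightarrow>
      dist (f x) (f y) \<le> Cm * ln (1 / u) * h powr \<alpha>"
    and g1: "\<And>a b. a \<in> f ` E \<Longrightarrow> b \<in> f ` E \<Longrightarrow> dist a b \<le> cg * (\<Sum>i\<in>I. \<bar>g i a - g i b\<bar>)"
    and g2: "\<And>a b i. a \<in> f ` E \<Longrightarrow> b \<in> f ` E \<Longrightarrow> i \<in> I \<Longrightarrow> \<bar>g i a - g i b\<bar> \<le> dist a b"
  shows "cover_hyp (\<lambda>u x y. profile_phi (\<alpha> * real (card I)) (u powr (1 / \<alpha>)) (dist x y)) E f"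
proof -
  define m where "m = card I"
  have m: "m \<ge> 1" using I by (simp add: m_def Suc_le_eq card_gt_0_iff)
  define \<tau> where "\<tau> = \<alpha> * real m"
  have \<tau>: "\<tau> > 0" using \<alpha> m by (simp add: \<tau>_def)
  obtain R0 where R0: "\<And>x y. x \<in> E \<Longrightarrow> y \<in> E \<Longrightarrow> dist x y \<le> R0"
    using E by (meson bounded_two_points)
  define R where "R = max 1 R0"
  have R: "R \<ge> 1" "\<And>x y. x \<in> E \<Longrightarrow> y \<in> E \<Longrightarrow> dist x y \<le> R"
    using R0 by (auto simp: R_def le_max_iff_disj)
  define u0 where "u0 = min u1 (exp (-1))"
  define L where "L u = ln (1 / u)" for u :: real
  have L: "1 \<le> L u" if "0 < u" "u < u0" for u
  proof -
    have "ln u < ln (exp (-1))" using that by (subst ln_less_cancel_iff) (auto simp: u0_def)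
    then show ?thesis using that by (simp add: L_def ln_div)
  qed
  \<comment> \<open>Enough levels for the mesh to reach the diameter bound: at level
    \<open>J u - 1\<close> it is at least \<open>R\<close>.\<close>
  define J where "J u = nat \<lceil>(ln R + L u / \<alpha>) / ln 2\<rceil> + 1" for u
  define CJ where "CJ = 2 * ln R + 2 / \<alpha> + 2"
  have CJ: "CJ > 0" using R \<alpha> by (simp add: CJ_def add_nonneg_pos)
  have JC: "real (J u) \<le> CJ * L u" if "0 < u" "u < u0" for u
  proof -
    have l: "1 \<le> L u" using L that by simp
    have pos: "0 \<le> (ln R + L u / \<alpha>) / ln 2" using R l \<alpha> by simp
    define X where "X = (ln R + L u / \<alpha>) / ln 2"
    have "X \<le> (ln R + L u / \<alpha>) / (1/2)"
      unfolding X_def using ln2_ge_two_thirds R l \<alpha> by (intro divide_left_mono) auto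
    then have "X \<le> 2 * ln R + 2 * L u / \<alpha>" by (simp add: mult.commute)
    moreover have "real (J u) \<le> X + 2" unfolding J_def X_def[symmetric] using pos[folded X_def] by simp linarith
    ultimately have "real (J u) \<le> 2 * ln R + 2 * L u / \<alpha> + 2" by linarith
    also have "\<dots> \<le> (2 * ln R) * L u + (2 / \<alpha>) * L u + 2 * L u"
      using l R by (intro add_mono) (auto simp: mult_le_cancel_left1)
    also have "\<dots> = CJ * L u" by (simp add: CJ_def algebra_simps)
    finally show ?thesis .
  qed
  define h where "h u j = 2 ^ j * u powr (1 / \<alpha>)" for u :: real and j :: nat
  have h0: "0 < h u j" if "0 < u" for u j using that by (simp add: h_def)
  have hv: "u powr (1 / \<alpha>) \<le> h u j" for u j
    by (simp add: h_def mult_le_cancel_right1)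
  have h\<alpha>: "h u j powr \<alpha> = 2 powr (real j * \<alpha>) * u" if "0 < u" for u j
    using that \<alpha> by (simp add: h_def powr_mult powr_powr powr_realpow[symmetric])
  have RJ: "R \<le> h u (J u - 1)" if "0 < u" "u < u0" for u
  proof -
    have "(ln R + L u / \<alpha>) / ln 2 \<le> real (J u - 1)" unfolding J_def by simp linarith
    then have "ln R + L u / \<alpha> \<le> real (J u - 1) * ln 2" by (simp add: divide_simps)
    then have "exp (ln R) \<le> exp (real (J u - 1) * ln 2 + (1 / \<alpha>) * ln u)"
      using that by (simp add: L_def ln_div)
    also have "\<dots> = h u (J u - 1)"
      using that by (simp add: h_def powr_def exp_add exp_of_nat_mult)
    finally show ?thesis using R by simp
  qed
  let ?d = "real DIM('a)"
  \<comment> \<open>The asymmetry between \<open>S\<close> and \<open>A\<close> is deliberate: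
    \<open>x\<close> also receives the neighbouring cells, so that every \<open>y\<close> within the
    mesh is linked to it, while \<open>y\<close> belongs to one cell per level, which bounds the
    multiplicity by \<open>J u\<close>.\<close>
  define S where "S u x = Sigma {..<J u} (\<lambda>j. PiE Basis (\<lambda>b. {\<lfloor>(x \<bullet> b) / h u j\<rfloor> - 1..\<lfloor>(x \<bullet> b) / h u j\<rfloor> + 1}))" for u and x :: 'a
  define A where "A u q = {y::'a. \<forall>b\<in>Basis. \<lfloor>(y \<bullet> b) / h u (fst q)\<rfloor> = snd q b}" for u and q :: "nat \<times> ('a \<Rightarrow> int)"
  \<comment> \<open>The extra \<open>2 powr \<tau>\<close> is there because the least level
    \<open>j\<close> with distance at most \<open>h u j\<close> only says that the distance exceeds
    the mesh one level below.\<close>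
  define z where "z u q = 2 powr (\<tau> - real (fst q) * \<tau>)" for u :: real and q :: "nat \<times> ('a \<Rightarrow> int)"
  define Cp where "Cp = 8 * cg * real m * Cm * (3 * ?d) powr \<alpha> + 2"
  have Cp: "Cp > 0" using cg Cm by (simp add: Cp_def add_nonneg_pos)
  define K where "K = CJ * 3 ^ DIM('a) + 2 powr \<tau> * Cp ^ m"
  have K: "K > 0" using CJ Cp by (simp add: K_def add_pos_pos)
  \<comment> \<open>The exponent dominates both requirements: \<open>L u\<close> from the number of
    levels and \<open>L u ^ m\<close> from the modulus in \<open>m\<close> coordinates.\<close>
  define M where "M u = K * L u ^ (m + 1)" for u
  have LL: "L u \<le> L u ^ (m + 1)" "L u ^ m \<le> L u ^ (m + 1)" if "0 < u" "u < u0" for u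
    using L[OF that] power_increasing[of 1 "m+1" "L u"] power_increasing[of m "m+1" "L u"] by auto
  have M1: "CJ * 3 ^ DIM('a) * L u \<le> M u" and M2: "2 powr \<tau> * Cp ^ m * L u ^ m \<le> M u" if u: "0 < u" "u < u0" for u
  proof -
    have "CJ * 3 ^ DIM('a) * L u \<le> K * L u ^ (m + 1)"
      using LL[OF u] L[OF u] CJ Cp by (intro mult_mono) (auto simp: K_def)
    then show "CJ * 3 ^ DIM('a) * L u \<le> M u" by (simp add: M_def)
    have "2 powr \<tau> * Cp ^ m * L u ^ m \<le> K * L u ^ (m + 1)"
      using LL[OF u] L[OF u] CJ Cp by (intro mult_mono) (auto simp: K_def)
    then show "2 powr \<tau> * Cp ^ m * L u ^ m \<le> M u" by (simp add: M_def)
  qed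
  have JM: "real (J u) * 3 ^ DIM('a) \<le> M u" if u: "0 < u" "u < u0" for u
  proof -
    have "real (J u) * 3 ^ DIM('a) \<le> CJ * L u * 3 ^ DIM('a)" using JC[OF u] by (intro mult_right_mono) auto
    also have "\<dots> \<le> M u" using M1[OF u] by (simp add: mult_ac)
    finally show ?thesis .
  qed
  have "cover_hyp (\<lambda>u x y. profile_phi \<tau> (u powr (1 / \<alpha>)) (dist x y)) E f"
  proof (rule cover_hyp_labels[where ?u0.0 = u0 and C = K and \<kappa> = "m+1" and M = M and S = S and z = z and A = A])
    show "u0 > 0" "K > 0" using u1 K by (auto simp: u0_def)
    fix u :: real assume u: "0 < u" "u < u0"
    have u1': "u < u1" using u by (simp add: u0_def)
    show "0 < M u \<and> M u \<le> K * ln (1 / u) ^ (m + 1)"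
      using L[OF u] K by (simp add: M_def L_def)
    fix x assume x: "x \<in> E"
    have finS: "finite (S u y)" for y unfolding S_def by (intro finite_SigmaI finite_PiE) auto
    have "card (S u x) = J u * 3 ^ DIM('a)"
      unfolding S_def by (subst card_SigmaI) (auto simp: card_PiE intro: finite_PiE)
    then show "finite (S u x) \<and> real (card (S u x)) \<le> M u" using JM[OF u] finS by simp
    {
      fix y assume y: "y \<in> E"
      let ?v = "u powr (1 / \<alpha>)"
      have v: "?v > 0" using u by simp
      have "dist x y \<le> h u (J u - 1)" using R(2)[OF x y] RJ[OF u] by simp
      define j where "j = (LEAST j. dist x y \<le> h u j)"
      have j: "dist x y \<le> h u j" "j \<le> J u - 1" unfolding j_def
        by (rule LeastI, fact) (rule Least_le, fact)
      then have jJ: "j < J u" by (simp add: J_def)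
      define k where "k = restrict (\<lambda>b. \<lfloor>(y \<bullet> b) / h u j\<rfloor>) (Basis::'a set)"
      have yA: "y \<in> A u (j, k)" by (simp add: A_def k_def)
      have "(j, k) \<in> S u x"
        unfolding S_def
      proof (intro SigmaI PiE_I)
        show "j \<in> {..<J u}" using jJ by simp
        fix b :: 'a assume b: "b \<in> Basis"
        have "\<bar>(x - y) \<bullet> b\<bar> \<le> norm (x - y)" using b by (rule Basis_le_norm)
        then have "\<bar>x \<bullet> b - y \<bullet> b\<bar> \<le> h u j" using j by (simp add: inner_diff_left dist_norm)
        then have "\<bar>x \<bullet> b - y \<bullet> b\<bar> / h u j \<le> 1" using h0[OF u(1)] by simp
        then have "\<bar>(x \<bullet> b) / h u j - (y \<bullet> b) / h u j\<bar> \<le> 1"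
          using h0[OF u(1), of j] by (simp add: abs_divide flip: diff_divide_distrib)
        then have "\<bar>\<lfloor>(x \<bullet> b) / h u j\<rfloor> - \<lfloor>(y \<bullet> b) / h u j\<rfloor>\<bar> \<le> 1" by linarith
        then show "k b \<in> {\<lfloor>(x \<bullet> b) / h u j\<rfloor> - 1..\<lfloor>(x \<bullet> b) / h u j\<rfloor> + 1}" using b by (auto simp: k_def)
      qed (simp add: k_def)
      then have "z u (j, k) * (if y \<in> A u (j, k) then 1 else 0) \<le> (\<Sum>q\<in>S u x. z u q * (if y \<in> A u q then 1 else 0))"
        using finS by (intro member_le_sum[where f = "\<lambda>q. z u q * (if y \<in> A u q then 1 else 0)"]) (auto simp: z_def)
      then have "z u (j, k) \<le> (\<Sum>q\<in>S u x. z u q * (if y \<in> A u q then 1 else 0))" using yA by simp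
      moreover have "profile_phi \<tau> ?v (dist x y) \<le> z u (j, k)"
      proof (cases j)
        case 0
        have "1 \<le> 2 powr \<tau>" using \<tau> by (simp add: ge_one_powr_ge_zero)
        then show ?thesis using 0 by (auto simp: profile_phi_def z_def)
      next
        case (Suc i)
        have "\<not> dist x y \<le> h u i" using not_less_Least[of i "\<lambda>j. dist x y \<le> h u j"] Suc unfolding j_def by simp
        then have D: "h u i < dist x y" by simp
        then have D0: "0 < dist x y" using h0[OF u(1), of i] by linarith
        have "?v / dist x y \<le> ?v / h u i" using D D0 h0[OF u(1), of i] v by (intro divide_left_mono mult_pos_pos) auto
        also have "\<dots> = 2 powr (- real i)" using v by (simp add: h_def powr_minus powr_realpow divide_simps)
        finally have "(?v / dist x y) powr \<tau> \<le> (2 powr (- real i)) powr \<tau>"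
          using \<tau> v D0 by (intro powr_mono2) auto
        also have "\<dots> = z u (j, k)" using Suc by (simp add: z_def powr_powr algebra_simps)
        finally show ?thesis using D0 by (simp add: profile_phi_def min.coboundedI2)
      qed
      ultimately show "profile_phi \<tau> ?v (dist x y) \<le> (\<Sum>q\<in>S u x. z u q * (if y \<in> A u q then 1 else 0))" by linarith
    }
    {
      fix q assume q: "q \<in> S u x"
      show "0 < z u q" by (simp add: z_def)
      obtain j k where jk: "q = (j, k)" by (cases q)
      define G where "G = {x'\<in>E. q \<in> S u x'}"
      have Gdist: "dist a b \<le> 3 * ?d * h u j" if ab: "a \<in> G" "b \<in> G" for a b
      proof -
        have "\<bar>(a - b) \<bullet> e\<bar> \<le> 3 * h u j" if e: "e \<in> Basis" for e
        proof -
          have "k e \<in> {\<lfloor>(a \<bullet> e) / h u j\<rfloor> - 1..\<lfloor>(a \<bullet> e) / h u j\<rfloor> + 1}" "k e \<in> {\<lfloor>(b \<bullet> e) / h u j\<rfloor> - 1..\<lfloor>(b \<bullet> e) / h u j\<rfloor> + 1}"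
            using ab e unfolding G_def S_def jk by (auto simp: PiE_iff)
          \<comment> \<open>Both floors lie within 1 of \<open>k e\<close>, and the fractional parts
            add less than 1 more.\<close>
          then have "\<bar>(a \<bullet> e) / h u j - (b \<bullet> e) / h u j\<bar> \<le> 3" by simp linarith
          then have "\<bar>a \<bullet> e - b \<bullet> e\<bar> / h u j \<le> 3"
            using h0[OF u(1), of j] by (simp add: abs_divide flip: diff_divide_distrib)
          then show ?thesis using h0[OF u(1), of j] by (simp add: divide_simps inner_diff_left)
        qed
        then have "(\<Sum>e\<in>Basis. \<bar>(a - b) \<bullet> e\<bar>) \<le> (\<Sum>e\<in>(Basis::'a set). 3 * h u j)" by (intro sum_mono) auto
        then show ?thesis using norm_le_l1[of "a - b"] by (simp add: dist_norm mult_ac)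
      qed
      define \<rho> where "\<rho> = Cm * L u * (3 * ?d * h u j) powr \<alpha>"
      have \<rho>0: "\<rho> \<ge> 0" using Cm L[OF u] by (simp add: \<rho>_def)
      have "1 \<le> ?d" using DIM_positive[where 'a='a] by linarith
      then have "1 \<le> 3 * ?d" by linarith
      from mult_right_mono[OF this less_imp_le[OF h0[OF u(1), of j]]] have "1 * h u j \<le> (3 * ?d) * h u j" .
      then have hd: "u powr (1 / \<alpha>) \<le> 3 * ?d * h u j" using hv[of u j] by linarith
      have fG: "dist (f a) (f b) \<le> \<rho>" if "a \<in> G" "b \<in> G" for a b
        unfolding \<rho>_def L_def using that hd by (intro modulus[OF u(1) u1']) (auto simp: G_def intro!: Gdist[unfolded G_def])
      define \<delta> where "\<delta> = u / (4 * cg * real m)"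
      have \<delta>: "\<delta> > 0" using u cg m by (simp add: \<delta>_def)
      have xG: "x \<in> G" using x q by (simp add: G_def)
      have GE: "G \<subseteq> E" by (auto simp: G_def)
      have "covered (f ` G) (\<Prod>i\<in>I. 2 * \<rho> / \<delta> + 2) (u / 4)"
      proof (rule grid_covered[where g = "\<lambda>i a. g i a - g i (f x)", OF I(1) \<delta> \<rho>0])
        fix a i assume "a \<in> f ` G" "i \<in> I"
        then show "\<bar>g i a - g i (f x)\<bar> \<le> \<rho>"
          using g2[of a "f x" i] fG xG GE by fastforce
      next
        fix a b assume ab: "a \<in> f ` G" "b \<in> f ` G"
          and d: "\<And>i. i \<in> I \<Longrightarrow> \<bar>g i a - g i (f x) - (g i b - g i (f x))\<bar> \<le> \<delta>"
        have "dist a b \<le> cg * (\<Sum>i\<in>I. \<bar>g i a - g i b\<bar>)" using ab GE by (intro g1) auto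
        also have "\<dots> \<le> cg * (\<Sum>i\<in>I. \<delta>)" using cg d by (intro mult_left_mono sum_mono) auto
        also have "\<dots> = u / 4" using cg m by (simp add: \<delta>_def m_def[symmetric])
        finally show "dist a b \<le> u / 4" .
      qed
      moreover have "(\<Prod>i\<in>I. 2 * \<rho> / \<delta> + 2) \<le> M u / z u q"
      proof -
        let ?e = "2 powr (real j * \<alpha>)"
        have e1: "1 \<le> ?e" using \<alpha> by (simp add: ge_one_powr_ge_zero)
        have "2 * \<rho> / \<delta> = 8 * cg * real m * Cm * (3 * ?d) powr \<alpha> * (L u * ?e)"
          using u h0[OF u(1), of j] cg m by (simp add: \<rho>_def \<delta>_def powr_mult h\<alpha>)
        moreover have "1 * 1 \<le> L u * ?e" using e1 L[OF u] by (intro mult_mono) auto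
        ultimately have "2 * \<rho> / \<delta> + 2 \<le> Cp * (L u * ?e)" by (simp add: Cp_def distrib_right)
        then have "(2 * \<rho> / \<delta> + 2) ^ m \<le> (Cp * (L u * ?e)) ^ m" using \<rho>0 \<delta> by (intro power_mono) auto
        also have "\<dots> = Cp ^ m * L u ^ m * ?e ^ m" by (simp add: power_mult_distrib)
        also have "?e ^ m = 2 powr (real j * \<tau>)" by (simp add: powr_power \<tau>_def mult_ac)
        also have "Cp ^ m * L u ^ m * 2 powr (real j * \<tau>) = 2 powr \<tau> * Cp ^ m * L u ^ m / z u q"
          by (simp add: z_def jk powr_diff)
        also have "\<dots> \<le> M u / z u q" using M2[OF u] by (intro divide_right_mono) (auto simp: z_def)
        finally show ?thesis by (simp add: m_def)
      qed
      ultimately show "covered (f ` {x'\<in>E. q \<in> S u x'}) (M u / z u q) (u / 4)"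
        unfolding G_def by (rule covered_mono[OF _ subset_refl])
    }
  next
    fix u y F assume u: "0 < u" "u < u0" and F: "finite F" "F \<subseteq> (\<Union>x\<in>E. S u x)"
    let ?Q = "{q\<in>F. y \<in> A u q}"
    have "inj_on fst ?Q"
    proof (rule inj_onI)
      fix q q' assume q: "q \<in> ?Q" "q' \<in> ?Q" "fst q = fst q'"
      have ext: "snd q \<in> extensional Basis" "snd q' \<in> extensional Basis"
        using q F(2) by (auto simp: S_def PiE_iff)
      have "snd q = snd q'"
        by (rule extensionalityI[OF ext]) (use q in \<open>auto simp: A_def\<close>)
      then show "q = q'" using q(3) by (simp add: prod_eq_iff)
    qed
    then have "card ?Q = card (fst ` ?Q)" by (simp add: card_image)
    also have "\<dots> \<le> card {..<J u}"
      using F(2) by (intro card_mono) (auto simp: S_def)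
    finally have "real (card ?Q) \<le> real (J u) * 1" by simp
    also have "\<dots> \<le> real (J u) * 3 ^ DIM('a)" by (intro mult_left_mono) auto
    also note JM[OF u]
    finally show "real (card ?Q) \<le> M u" .
  qed
  then show ?thesis by (simp add: \<tau>_def m_def)
qed

section \<open>Profile kernels\<close>

lemma profile_phi_bounds: "0 \<le> profile_phi \<tau> v \<Delta>" "profile_phi \<tau> v \<Delta> \<le> 1"
  by (auto simp: profile_phi_def)

lemma sets_borel_of_euclidean: "sets (borel_of euclidean) = sets borel"
  by (simp add: sets_borel_of borel_def)

text \<open>\<open>u\<close> is a scale in the image and \<open>u powr (1 / \<alpha>)\<close> the
  domain scale that an \<alpha>-Hoelder map carries to it. Projections use
  \<open>\<alpha> = 1\<close>.\<close>

definition profile_Z :: "real \<Rightarrow> nat \<Rightarrow> real \<Rightarrow> 'a::metric_space \<Rightarrow> 'a \<Rightarrow> real" where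
  "profile_Z \<alpha> m u x y = profile_phi (\<alpha> * real m) (u powr (1 / \<alpha>)) (dist x y)"

lemma profile_Z_eq:
  assumes "0 < \<alpha>" "0 < u" "x \<noteq> y"
  shows "profile_Z \<alpha> m u x y = min 1 (u ^ m / dist x y powr (\<alpha> * real m))"
  using assms by (simp add: profile_Z_def profile_phi_def powr_divide powr_powr powr_realpow)

text \<open>For distinct points the kernel is a multiple of \<open>u ^ m\<close> truncated at 1,
  whatever \<alpha> is; hence the doubling constant \<open>2 ^ m\<close>.\<close>

lemma profile_kernel_family:
  assumes adm: "admissible \<Phi>" and log_cond: "\<And>\<epsilon>. \<epsilon> > 0 \<Longrightarrow> ((\<lambda>r. r powr \<epsilon> * ln (\<Phi> r)) \<longlongrightarrow> 0) (at_right 0)"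
    and \<alpha>: "0 < \<alpha>"
  shows "kernel_family \<Phi> (profile_Z \<alpha> m :: real \<Rightarrow> 'a::metric_space \<Rightarrow> 'a \<Rightarrow> real) (2 ^ m)"
proof
  show "admissible \<Phi>" by fact
  show "((\<lambda>r. r powr \<epsilon> * ln (\<Phi> r)) \<longlongrightarrow> 0) (at_right 0)" if "\<epsilon> > 0" for \<epsilon> by (rule log_cond) fact
  fix u v :: real and x y :: 'a
  assume u: "0 < u"
  show "0 \<le> profile_Z \<alpha> m u x y" "profile_Z \<alpha> m u x y \<le> 1"
    by (simp_all add: profile_Z_def profile_phi_bounds)
  show "profile_Z \<alpha> m u x y \<le> profile_Z \<alpha> m v x y" if "u \<le> v"
  proof (cases "x = y")
    case False
    have "u ^ m / dist x y powr (\<alpha> * real m) \<le> v ^ m / dist x y powr (\<alpha> * real m)"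
      using that u by (intro divide_right_mono power_mono) auto
    then show ?thesis
      using False that u \<alpha> min.mono[OF order_refl[of "1::real"]] by (simp add: profile_Z_eq)
  qed (simp add: profile_Z_def profile_phi_def)
  show "profile_Z \<alpha> m (2 * u) x y \<le> 2 ^ m * profile_Z \<alpha> m u x y"
  proof (cases "x = y")
    case False
    define q where "q = u ^ m / dist x y powr (\<alpha> * real m)"
    have "min 1 (2 ^ m * q) \<le> 2 ^ m * min 1 q"
    proof (cases "1 \<le> q")
      case True
      then show ?thesis using one_le_power[of "2::real" m] by (simp add: min.coboundedI1)
    qed simp
    then show ?thesis
      using False u \<alpha> by (simp add: profile_Z_eq q_def power_mult_distrib)
  qed (simp add: profile_Z_def profile_phi_def)
qed (auto simp: profile_Z_def dist_commute)

text \<open>If \<open>a\<close> and \<open>b\<close> are within the domain scale, then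
  \<open>x\<close> and \<open>y\<close> are within twice that scale and their kernel value is
  bounded below; otherwise the distance of \<open>x\<close> and \<open>y\<close> is at most twice
  that of \<open>a\<close> and \<open>b\<close>. So the kernel is nearly constant on cells no larger
  than the scale.\<close>

lemma profile_Z_comparable:
  assumes \<alpha>: "0 < \<alpha>" and u: "0 < u" and d: "dist x y \<le> dist a b + u powr (1 / \<alpha>)"
  shows "profile_Z \<alpha> m u a b \<le> 2 powr (\<alpha> * real m) * profile_Z \<alpha> m u x y"
proof -
  let ?v = "u powr (1 / \<alpha>)" and ?\<tau> = "\<alpha> * real m"
  have v: "?v > 0" using u by simp
  have \<tau>: "?\<tau> \<ge> 0" using \<alpha> by simp
  have two: "1 \<le> 2 powr ?\<tau>" using \<tau> by (simp add: ge_one_powr_ge_zero)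
  show ?thesis
  proof (cases "x = y")
    case True
    then show ?thesis using two profile_phi_bounds(2)[of ?\<tau> ?v "dist a b"]
      by (simp add: profile_Z_def profile_phi_def[of _ _ 0])
  next
    case False
    then have D: "dist x y > 0" by simp
    have eq: "profile_Z \<alpha> m u x y = min 1 ((?v / dist x y) powr ?\<tau>)"
      using False by (simp add: profile_Z_def profile_phi_def)
    show ?thesis
    proof (cases "dist a b \<le> ?v")
      case True
      then have "dist x y \<le> 2 * ?v" using d by simp
      then have "1 \<le> 2 * (?v / dist x y)" using D by (simp add: divide_simps)
      then have "1 \<le> (2 * (?v / dist x y)) powr ?\<tau>" using \<tau> by (simp add: ge_one_powr_ge_zero)
      also have "\<dots> = 2 powr ?\<tau> * (?v / dist x y) powr ?\<tau>" using v D by (intro powr_mult) 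
      finally have "1 \<le> 2 powr ?\<tau> * profile_Z \<alpha> m u x y" using two by (auto simp: eq min_def)
      then show ?thesis using profile_phi_bounds(2)[of ?\<tau> ?v "dist a b"] by (simp add: profile_Z_def)
    next
      case False
      then have "dist x y \<le> 2 * dist a b" using d by simp
      then have "?v * dist x y \<le> ?v * (2 * dist a b)" using v by (intro mult_left_mono) auto
      moreover have "dist a b > 0" using False v by linarith
      ultimately have "?v / dist a b \<le> 2 * (?v / dist x y)" using D by (simp add: divide_simps mult_ac)
      then have "(?v / dist a b) powr ?\<tau> \<le> (2 * (?v / dist x y)) powr ?\<tau>" using v False \<tau> by (intro powr_mono2) auto
      also have "\<dots> = 2 powr ?\<tau> * (?v / dist x y) powr ?\<tau>" using v D by (intro powr_mult)
      finally have 1: "(?v / dist a b) powr ?\<tau> \<le> 2 powr ?\<tau> * (?v / dist x y) powr ?\<tau>" .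
      have "dist a b \<noteq> 0" using False v by linarith
      then have "profile_Z \<alpha> m u a b = min 1 ((?v / dist a b) powr ?\<tau>)" by (simp add: profile_Z_def profile_phi_def)
      also have "\<dots> \<le> 2 powr ?\<tau> * min 1 ((?v / dist x y) powr ?\<tau>)" using 1 two by (auto simp: min_def)
      finally show ?thesis by (simp add: eq)
    qed
  qed
qed

text \<open>The cells are disjointed balls of radius \<open>v / 2\<close>, with \<open>v\<close> the
  smallest domain scale of the kernel, so \<open>profile_Z_comparable\<close> applies at all its
  scales. At the top exponent, \<open>u = r\<close> alone bounds the kernel below by a power of the
  diameter bound of \<open>E\<close>.\<close>

lemma profile_dim_kernel:
  fixes E :: "'a::euclidean_space set"
  assumes adm: "admissible \<Phi>" and log_cond: "\<And>\<epsilon>. \<epsilon> > 0 \<Longrightarrow> ((\<lambda>r. r powr \<epsilon> * ln (\<Phi> r)) \<longlongrightarrow> 0) (at_right 0)"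
    and \<alpha>: "0 < \<alpha>" and E: "E \<noteq> {}" "bounded E"
  shows "dim_kernel \<Phi> (profile_Z \<alpha> m) (2 ^ m) E (\<lambda>s r. capacity euclidean (ker_max \<Phi> (profile_Z \<alpha> m) s r) E)
    (real m) (2 powr (\<alpha> * real m))"
proof -
  interpret kernel_family \<Phi> "profile_Z \<alpha> m :: real \<Rightarrow> 'a \<Rightarrow> 'a \<Rightarrow> real" "2 ^ m"
    by (rule profile_kernel_family[OF adm log_cond \<alpha>])
  let ?K = "\<lambda>s r. ker_max \<Phi> (profile_Z \<alpha> m :: real \<Rightarrow> 'a \<Rightarrow> 'a \<Rightarrow> real) s r"
  let ?\<tau> = "\<alpha> * real m"
  note small = Phi_small[of 1, OF zero_less_one]
  have clo: "(euclidean :: 'a topology) closure_of E = closure E" by simp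
  show ?thesis
  proof
    show "E \<noteq> {}" "0 \<le> real m" using E by auto
    fix s :: real assume s: "0 \<le> s" "s \<le> real m"
    show "\<forall>\<^sub>F r in at_right 0. \<forall>n x p. weights E n x p \<longrightarrow>
        inverse (capacity euclidean (?K s r) E) \<le> ennreal (energy (?K s r) n x p)"
      using small
    proof eventually_elim
      case (elim r)
      show ?case
        by (intro allI impI inverse_capacity_le_energy) (use elim s in \<open>auto intro: ker_max_nonneg\<close>)
    qed
    show "\<forall>\<^sub>F r in at_right 0. 1 < capacity euclidean (?K s r) E \<longrightarrow>
        (\<exists>n x p. weights E n x p \<and> energy (?K s r) n x p \<le> 2 powr ?\<tau>)"
      using small
    proof eventually_elim
      case (elim r)
      then have r: "0 < \<Phi> r" "\<Phi> r \<le> r" by auto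
      show ?case
      proof
        assume cap: "1 < capacity euclidean (?K s r) E"
        define v where "v = \<Phi> r powr (1 / \<alpha>)"
        have v: "v > 0" using r by (simp add: v_def)
        obtain n x where nx: "n > 0" "\<forall>i<n. x i \<in> E" "\<And>e. e \<in> E \<Longrightarrow> \<exists>i<n::nat. dist e (x i) \<le> v / 2"
          using finite_image_net[of "\<lambda>x. x" E "v / 2"] E v by auto
        define A where "A = disjointed (\<lambda>i. cball (x i) (v / 2))"
        have A: "A i \<subseteq> cball (x i) (v / 2)" for i unfolding A_def by (rule disjointed_subset)
        have "\<exists>p. weights E n x p \<and> energy (?K s r) n x p \<le> 2 powr ?\<tau>"
        proof (rule energy_le_of_capacity[OF cap])
          show "A i \<in> sets (borel_of euclidean)" for i
            unfolding sets_borel_of_euclidean A_def disjointed_def by (intro sets.Diff sets.finite_UN) auto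
          show "disjoint_family_on A {..<n}"
            unfolding A_def using disjoint_family_disjointed by (rule disjoint_family_on_mono[OF subset_UNIV])
          \<comment> \<open>Finitely many closed balls covering \<open>E\<close> also cover its
            closure, on which the competing measures live.\<close>
          have "E \<subseteq> (\<Union>i<n. cball (x i) (v / 2))" using nx(3) by (fastforce simp: dist_commute)
          then have "closure E \<subseteq> (\<Union>i<n. cball (x i) (v / 2))" by (intro closure_minimal) (auto intro!: closed_UN)
          also have "\<dots> = (\<Union>i<n. A i)"
            using finite_UN_disjointed_eq[of "\<lambda>i. cball (x i) (v / 2)" n] by (simp add: A_def atLeast0LessThan)
          finally show "euclidean closure_of E \<subseteq> (\<Union>i<n. A i)" by (simp add: clo)
          show "0 \<le> ?K s r a b" for a b by (rule ker_max_nonneg[OF r s(1)])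
          show "0 < 2 powr ?\<tau>" by simp
          fix i j a b assume ij: "i < n" "j < n" and a: "a \<in> A i \<inter> euclidean closure_of E" and b: "b \<in> A j \<inter> euclidean closure_of E"
          show "?K s r (x i) (x j) \<le> 2 powr ?\<tau> * ?K s r a b"
          proof (rule ker_max_le[OF r(2)])
            fix u assume u: "\<Phi> r \<le> u" "u \<le> r"
            have "v \<le> u powr (1 / \<alpha>)" unfolding v_def using r u \<alpha> by (intro powr_mono2) auto
            moreover have "dist a b \<le> dist (x i) a + dist (x i) (x j) + dist (x j) b" using dist_triangle[of a b "x i"] dist_triangle[of "x i" b "x j"] by (simp add: dist_commute)
            moreover have "dist (x i) a \<le> v / 2" "dist (x j) b \<le> v / 2" using a b subsetD[OF A[of i]] subsetD[OF A[of j]] by auto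
            ultimately have "dist a b \<le> dist (x i) (x j) + u powr (1 / \<alpha>)" by linarith
            then have "u powr - s * profile_Z \<alpha> m u (x i) (x j) \<le> u powr - s * (2 powr ?\<tau> * profile_Z \<alpha> m u a b)"
              using u r \<alpha> by (intro mult_left_mono profile_Z_comparable) auto
            also have "\<dots> = 2 powr ?\<tau> * (u powr - s * profile_Z \<alpha> m u a b)" by simp
            also have "\<dots> \<le> 2 powr ?\<tau> * ?K s r a b"
              using u r s by (intro mult_left_mono ker_max_ge) auto
            finally show "u powr - s * profile_Z \<alpha> m u (x i) (x j) \<le> 2 powr ?\<tau> * ?K s r a b" .
          qed
        qed (use nx in auto)
        then show "\<exists>n x p. weights E n x p \<and> energy (?K s r) n x p \<le> 2 powr ?\<tau>" by blast
      qed
    qed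
  next
    obtain R0 where R0: "\<And>x y. x \<in> closure E \<Longrightarrow> y \<in> closure E \<Longrightarrow> dist x y \<le> R0"
      using E by (metis bounded_closure bounded_two_points)
    define R where "R = max 1 R0"
    have R: "R \<ge> 1" "\<And>x y. x \<in> closure E \<Longrightarrow> y \<in> closure E \<Longrightarrow> dist x y \<le> R"
      using R0 by (auto simp: R_def le_max_iff_disj)
    let ?b = "R powr - ?\<tau>"
    have R1: "?b \<le> 1" using R \<alpha> powr_mono2'[of "- ?\<tau>" 1 R] by simp
    have "\<forall>\<^sub>F r in at_right 0. capacity euclidean (?K (real m) r) E \<le> ennreal (1 / ?b)"
      using small
    proof eventually_elim
      case (elim r)
      then have r: "0 < r" "r < 1" "0 < \<Phi> r" "\<Phi> r \<le> r" by auto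
      show ?case
      proof (rule capacity_le)
        show "?b > 0" using R by simp
        fix x y assume xy: "x \<in> euclidean closure_of E" "y \<in> euclidean closure_of E"
        have "?b \<le> r powr - real m * profile_Z \<alpha> m r x y"
        proof -
          have rm: "1 \<le> r powr - real m" using r by (simp add: powr_minus powr_realpow one_le_inverse power_le_one)
          show ?thesis
          proof (cases "x = y")
            case True
            then show ?thesis using R1 rm by (simp add: profile_Z_def profile_phi_def)
          next
            case False
            have "?b \<le> dist x y powr - ?\<tau>"
              using xy False \<alpha> by (intro powr_mono2' R(2)) (auto simp: clo)
            also have "\<dots> = r powr - real m * (r ^ m / dist x y powr ?\<tau>)"
              using r by (simp add: powr_minus powr_realpow divide_simps)
            finally have "?b \<le> r powr - real m * min 1 (r ^ m / dist x y powr ?\<tau>)"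
              using R1 rm by (auto simp: min_def)
            then show ?thesis using profile_Z_eq[OF \<alpha> r(1) False, of m] by simp
          qed
        qed
        also have "\<dots> \<le> ?K (real m) r x y" using r by (intro ker_max_ge) auto
        finally show "?b \<le> ?K (real m) r x y" .
      qed
    qed
    then have "Limsup (at_right 0) (\<lambda>r. capacity euclidean (?K (real m) r) E) \<le> ennreal (1 / ?b)"
      by (rule Limsup_bounded)
    then show "Limsup (at_right 0) (\<lambda>r. capacity euclidean (?K (real m) r) E) < \<infinity>"
      by (rule le_less_trans) simp
  qed
qed

section \<open>Change of scale by powers of \<open>r\<close>\<close>

lemma Inf_image_mult:
  fixes S :: "real set"
  assumes "0 < c" "S \<noteq> {}" "bdd_below S"
  shows "Inf ((*) c ` S) = c * Inf S"
  using assms by (intro continuous_at_Inf_mono[symmetric] continuous_intros) (auto simp: mono_def)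

lemma powr_filterlim_at_right_0:
  assumes "0 < a" shows "filterlim (\<lambda>r::real. r powr a) (at_right 0) (at_right 0)"
proof (rule tendsto_imp_filterlim_at_right)
  have "((\<lambda>r::real. r powr a) \<longlongrightarrow> 0 powr a) (at_right 0)"
    by (intro tendsto_powr' tendsto_intros) (use assms in \<open>auto intro: eventually_mono[OF eventually_at_right_less]\<close>)
  then show "((\<lambda>r::real. r powr a) \<longlongrightarrow> 0) (at_right 0)" by simp
  show "\<forall>\<^sub>F r::real in at_right 0. 0 < r powr a"
    using eventually_at_right_less[of 0] by eventually_elim simp
qed

lemma filtermap_powr_at_right_0:
  assumes "0 < a" shows "filtermap (\<lambda>r::real. r powr a) (at_right 0) = at_right 0"
proof (rule filtermap_fun_inverse[where g = "\<lambda>r. r powr (1 / a)"])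
  show "\<forall>\<^sub>F r::real in at_right 0. (r powr (1 / a)) powr a = r"
    using eventually_at_right_less[of 0] by eventually_elim (use assms in \<open>simp add: powr_powr\<close>)
qed (use assms in \<open>auto intro!: powr_filterlim_at_right_0\<close>)

text \<open>\<open>r powr a\<close> preserves the filter at 0 from the right. One inequality comes
  from this map, the other from its inverse \<open>r powr (1 / a)\<close>.\<close>

lemma Limsup_powr_at_right_0:
  fixes h :: "real \<Rightarrow> ennreal"
  assumes a: "0 < a"
  shows "Limsup (at_right 0) (\<lambda>r. h (r powr a)) = Limsup (at_right 0) h"
    "Liminf (at_right 0) (\<lambda>r. h (r powr a)) = Liminf (at_right 0) h"
proof -
  have inv: "\<forall>\<^sub>F r::real in at_right 0. h ((r powr (1 / a)) powr a) = h r"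
    using eventually_at_right_less[of 0] by eventually_elim (use assms in \<open>simp add: powr_powr\<close>)
  show "Limsup (at_right 0) (\<lambda>r. h (r powr a)) = Limsup (at_right 0) h"
  proof (rule antisym)
    show "Limsup (at_right 0) (\<lambda>r. h (r powr a)) \<le> Limsup (at_right 0) h"
      using Limsup_filtermap_ge[of "at_right 0" h "\<lambda>r. r powr a"] filtermap_powr_at_right_0[OF a] by simp
    have "Limsup (at_right 0) h = Limsup (at_right 0) (\<lambda>r. h ((r powr (1 / a)) powr a))"
      using Limsup_eq[OF inv] by simp
    also have "\<dots> \<le> Limsup (at_right 0) (\<lambda>r. h (r powr a))"
      using Limsup_filtermap_ge[of "at_right 0" "\<lambda>r. h (r powr a)" "\<lambda>r. r powr (1 / a)"] filtermap_powr_at_right_0[of "1 / a"] a by simp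
    finally show "Limsup (at_right 0) h \<le> Limsup (at_right 0) (\<lambda>r. h (r powr a))" .
  qed
  show "Liminf (at_right 0) (\<lambda>r. h (r powr a)) = Liminf (at_right 0) h"
  proof (rule antisym)
    show "Liminf (at_right 0) h \<le> Liminf (at_right 0) (\<lambda>r. h (r powr a))"
      using Liminf_filtermap_le[of "\<lambda>r. r powr a" "at_right 0" h] filtermap_powr_at_right_0[OF a] by simp
    have "Liminf (at_right 0) (\<lambda>r. h (r powr a)) \<le> Liminf (at_right 0) (\<lambda>r. h ((r powr (1 / a)) powr a))"
      using Liminf_filtermap_le[of "\<lambda>r. r powr (1 / a)" "at_right 0" "\<lambda>r. h (r powr a)"] filtermap_powr_at_right_0[of "1 / a"] a by simp
    also have "\<dots> = Liminf (at_right 0) h"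
      by (rule Liminf_eq[OF inv])
    finally show "Liminf (at_right 0) (\<lambda>r. h (r powr a)) \<le> Liminf (at_right 0) h" .
  qed
qed

text \<open>The substitution \<open>v = u powr (1 / \<alpha>)\<close> carries the window of \<Phi>
  at \<open>r\<close> to that of \<open>Phi_pow \<Phi> \<alpha>\<close> at
  \<open>r powr (1 / \<alpha>)\<close> and turns the exponent \<open>s\<close> into
  \<open>\<alpha> * s\<close>. This is the source of the factor in the dimension formula for
  Brownian images.\<close>

lemma profile_kernel_Phi_pow:
  assumes \<alpha>: "0 < \<alpha>" and r: "0 < r" "0 < \<Phi> r"
  shows "profile_kernel (Phi_pow \<Phi> \<alpha>) (\<alpha> * real m) (\<alpha> * s) (r powr (1 / \<alpha>)) = ker_max \<Phi> (profile_Z \<alpha> m) s r"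
proof (intro ext)
  fix x y :: 'a
  have "Phi_pow \<Phi> \<alpha> (r powr (1 / \<alpha>)) = \<Phi> r powr (1 / \<alpha>)"
    using \<alpha> r by (simp add: Phi_pow_def powr_powr)
  moreover have "{\<Phi> r powr (1 / \<alpha>)..r powr (1 / \<alpha>)} = (\<lambda>u. u powr (1 / \<alpha>)) ` {\<Phi> r..r}"
  proof (intro equalityI subsetI)
    fix v assume v: "v \<in> {\<Phi> r powr (1 / \<alpha>)..r powr (1 / \<alpha>)}"
    have "0 < \<Phi> r powr (1 / \<alpha>)" using r by simp
    then have v0: "0 < v" using v by (simp only: atLeastAtMost_iff) linarith
    have "(\<Phi> r powr (1 / \<alpha>)) powr \<alpha> \<le> v powr \<alpha>" "v powr \<alpha> \<le> (r powr (1 / \<alpha>)) powr \<alpha>"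
      using v v0 \<alpha> by (auto intro!: powr_mono2)
    then have "v powr \<alpha> \<in> {\<Phi> r..r}" using r \<alpha> by (simp add: powr_powr)
    moreover have "v = (v powr \<alpha>) powr (1 / \<alpha>)" using v0 \<alpha> by (simp add: powr_powr)
    ultimately show "v \<in> (\<lambda>u. u powr (1 / \<alpha>)) ` {\<Phi> r..r}" by blast
  next
    fix v assume "v \<in> (\<lambda>u. u powr (1 / \<alpha>)) ` {\<Phi> r..r}"
    then show "v \<in> {\<Phi> r powr (1 / \<alpha>)..r powr (1 / \<alpha>)}" using r \<alpha> by (auto intro!: powr_mono2)
  qed
  ultimately have "profile_kernel (Phi_pow \<Phi> \<alpha>) (\<alpha> * real m) (\<alpha> * s) (r powr (1 / \<alpha>)) x y =
      (SUP u\<in>{\<Phi> r..r}. (u powr (1 / \<alpha>)) powr (- (\<alpha> * s)) * profile_phi (\<alpha> * real m) (u powr (1 / \<alpha>)) (dist x y))"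
    unfolding profile_kernel_def by (simp add: image_image)
  also have "\<dots> = ker_max \<Phi> (profile_Z \<alpha> m) s r x y"
    unfolding ker_max_def profile_Z_def using \<alpha> by (simp add: powr_powr)
  finally show "profile_kernel (Phi_pow \<Phi> \<alpha>) (\<alpha> * real m) (\<alpha> * s) (r powr (1 / \<alpha>)) x y = ker_max \<Phi> (profile_Z \<alpha> m) s r x y" .
qed

lemma profile_Phi_pow:
  fixes E :: "'a::euclidean_space set"
  assumes dk: "dim_kernel \<Phi> (profile_Z \<alpha> m) C0 E (\<lambda>s r. capacity euclidean (ker_max \<Phi> (profile_Z \<alpha> m) s r) E) (real m) c0"
    and \<alpha>: "0 < \<alpha>"
  shows "upper_profile (Phi_pow \<Phi> \<alpha>) (\<alpha> * real m) E =
      \<alpha> * dim_kernel.upper_cap (\<lambda>s r. capacity euclidean (ker_max \<Phi> (profile_Z \<alpha> m) s r) E) (real m)"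
    "lower_profile (Phi_pow \<Phi> \<alpha>) (\<alpha> * real m) E =
      \<alpha> * dim_kernel.lower_cap (\<lambda>s r. capacity euclidean (ker_max \<Phi> (profile_Z \<alpha> m) s r) E) (real m)"
proof -
  interpret dim_kernel \<Phi> "profile_Z \<alpha> m" C0 E "\<lambda>s r. capacity euclidean (ker_max \<Phi> (profile_Z \<alpha> m) s r) E" "real m" c0
    by (rule dk)
  let ?h = "\<lambda>s r. capacity euclidean (profile_kernel (Phi_pow \<Phi> \<alpha>) (\<alpha> * real m) s r) E"
  let ?c = "\<lambda>s r. capacity euclidean (ker_max \<Phi> (profile_Z \<alpha> m) s r) E"
  have ev: "\<forall>\<^sub>F r in at_right 0. ?h (\<alpha> * s) (r powr (1 / \<alpha>)) = ?c s r" for s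
    using Phi_small[of 1, OF zero_less_one] by eventually_elim (use \<alpha> in \<open>simp add: profile_kernel_Phi_pow\<close>)
  have LS: "Limsup (at_right 0) (?h (\<alpha> * s)) = Limsup (at_right 0) (?c s)" for s
    using Limsup_eq[OF ev[of s]] Limsup_powr_at_right_0(1)[of "1 / \<alpha>" "?h (\<alpha> * s)"] \<alpha> by simp
  have LI: "Liminf (at_right 0) (?h (\<alpha> * s)) = Liminf (at_right 0) (?c s)" for s
    using Liminf_eq[OF ev[of s]] Limsup_powr_at_right_0(2)[of "1 / \<alpha>" "?h (\<alpha> * s)"] \<alpha> by simp
  have img: "{s\<in>{0..\<alpha> * real m}. P s} = (*) \<alpha> ` {s\<in>{0..real m}. P (\<alpha> * s)}" for P :: "real \<Rightarrow> bool"
  proof (intro equalityI subsetI)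
    fix s assume s: "s \<in> {s\<in>{0..\<alpha> * real m}. P s}"
    then have "s / \<alpha> \<in> {s\<in>{0..real m}. P (\<alpha> * s)}" using \<alpha> by (auto simp: divide_simps mult_ac)
    moreover have "s = \<alpha> * (s / \<alpha>)" using \<alpha> by simp
    ultimately show "s \<in> (*) \<alpha> ` {s\<in>{0..real m}. P (\<alpha> * s)}" by blast
  qed (use \<alpha> in auto)
  have bdd: "bdd_below {s\<in>{0..real m}. P s}" for P by (auto intro!: bdd_belowI[of _ 0])
  have "real m \<in> {s\<in>{0..real m}. Limsup (at_right 0) (?c s) < \<infinity>}" using cap_D by simp
  then show "upper_profile (Phi_pow \<Phi> \<alpha>) (\<alpha> * real m) E = \<alpha> * upper_cap"
    unfolding upper_profile_def upper_cap_def img LS using bdd \<alpha> by (intro Inf_image_mult) auto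
  have "Liminf (at_right 0) (?c (real m)) \<le> Limsup (at_right 0) (?c (real m))"
    by (rule Liminf_le_Limsup) simp
  then have "real m \<in> {s\<in>{0..real m}. Liminf (at_right 0) (?c s) < \<infinity>}" using cap_D by (auto intro: le_less_trans)
  then show "lower_profile (Phi_pow \<Phi> \<alpha>) (\<alpha> * real m) E = \<alpha> * lower_cap"
    unfolding lower_profile_def lower_cap_def img LI using bdd \<alpha> by (intro Inf_image_mult) auto
qed

section \<open>Singular values\<close>

text \<open>Induction on the dimension: a maximiser \<open>b\<close> of the quadratic form on the
  unit sphere of \<open>W\<close> is an eigenvector, and the orthogonal complement of
  \<open>b\<close> in \<open>W\<close> is again invariant. The statement concerns invariant
  subspaces so that the induction hypothesis applies to this complement.\<close>

lemma symmetric_eigenbasis_subspace: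
  fixes S :: "real^'d^'d"
  assumes sym: "\<And>x y. (S *v x) \<bullet> y = x \<bullet> (S *v y)"
    and W: "subspace W" "\<And>w. w \<in> W \<Longrightarrow> S *v w \<in> W"
  shows "\<exists>B l. finite B \<and> B \<subseteq> W \<and> W \<subseteq> span B \<and> pairwise orthogonal B \<and> (\<forall>b\<in>B. norm b = 1 \<and> S *v b = l b *\<^sub>R b)"
  using W
proof (induction "dim W" arbitrary: W rule: less_induct)
  case less
  show ?case
  proof (cases "W \<subseteq> {0}")
    case True
    then show ?thesis by (intro exI[of _ "{}"]) auto
  next
    case False
    then obtain w where w: "w \<in> W" "w \<noteq> 0" by auto
    let ?K = "W \<inter> sphere 0 1"
    have "compact ?K"
      using closed_subspace[OF less.prems(1)] by (intro closed_Int_compact) auto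
    moreover have "(1 / norm w) *\<^sub>R w \<in> ?K"
      using w less.prems(1) by (simp add: subspace_scale)
    then have "?K \<noteq> {}" by blast
    moreover have "continuous_on ?K (\<lambda>x. x \<bullet> (S *v x))"
      by (intro continuous_intros linear_continuous_on) (simp add: linear_linear)
    ultimately have "\<exists>b\<in>?K. \<forall>x\<in>?K. x \<bullet> (S *v x) \<le> b \<bullet> (S *v b)"
      by (rule continuous_attains_sup)
    then obtain b where b: "b \<in> ?K" and max: "\<And>x. x \<in> ?K \<Longrightarrow> x \<bullet> (S *v x) \<le> b \<bullet> (S *v b)"
      by auto
    define l where "l = b \<bullet> (S *v b)"
    have bW: "b \<in> W" and nb: "norm b = 1" using b by auto
    then have bb: "b \<bullet> b = 1" by (simp add: norm_eq_1)
    have quad: "x \<bullet> (S *v x) \<le> l * (x \<bullet> x)" if x: "x \<in> W" for x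
    proof (cases "x = 0")
      case False
      then have "(1 / norm x) *\<^sub>R x \<in> ?K" using x less.prems(1) by (simp add: subspace_scale)
      from max[OF this] have "(x \<bullet> (S *v x)) / (norm x)^2 \<le> l"
        by (simp add: l_def matrix_vector_mult_scaleR power2_eq_square)
      then show ?thesis using False by (simp add: divide_simps power2_norm_eq_inner)
    qed simp
    define c where "c = S *v b - l *\<^sub>R b"
    have cW: "c \<in> W" unfolding c_def using less.prems bW by (intro subspace_diff subspace_scale) auto
    have cb: "c \<bullet> b = 0" using inner_commute[of b "S *v b"] by (simp add: c_def l_def inner_diff_left bb)
    have cSb: "c \<bullet> (S *v b) = c \<bullet> c"
    proof -
      have "S *v b = c + l *\<^sub>R b" by (simp add: c_def)
      then show ?thesis using cb by (simp add: inner_add_right)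
    qed
    \<comment> \<open>Bounds the second-order term in the direction \<open>c\<close>, with 1 added
      for positivity. Inserting the step \<open>(c \<bullet> c) / k\<close> into the maximum
      property leaves
      \<open>2 * (c \<bullet> c)\<^sup>2 \<le> (c \<bullet> c)\<^sup>2\<close>.\<close>
    define k where "k = \<bar>l * (c \<bullet> c) - c \<bullet> (S *v c)\<bar> + 1"
    have k: "k > 0" by (simp add: k_def)
    have "c \<bullet> c = 0"
    proof -
      let ?t = "(c \<bullet> c) / k"
      have "b + ?t *\<^sub>R c \<in> W" using less.prems(1) bW cW by (intro subspace_add subspace_scale)
      moreover have "S *v (b + ?t *\<^sub>R c) = S *v b + ?t *\<^sub>R (S *v c)"
        by (simp only: matrix_vector_right_distrib matrix_vector_mult_scaleR)
      ultimately have "(b + ?t *\<^sub>R c) \<bullet> (S *v b + ?t *\<^sub>R (S *v c)) \<le> l * ((b + ?t *\<^sub>R c) \<bullet> (b + ?t *\<^sub>R c))"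
        using quad by metis
      moreover have "b \<bullet> (S *v c) = c \<bullet> c"
        using cSb sym[of b c] by (simp add: inner_commute)
      moreover have "b \<bullet> c = 0" using cb by (simp add: inner_commute)
      ultimately have "l + 2 * ?t * (c \<bullet> c) + ?t^2 * (c \<bullet> (S *v c)) \<le> l * (1 + ?t^2 * (c \<bullet> c))"
        using cb cSb bb by (simp add: l_def[symmetric] inner_add_left inner_add_right power2_eq_square algebra_simps)
      then have "2 * ?t * (c \<bullet> c) \<le> ?t^2 * (l * (c \<bullet> c) - c \<bullet> (S *v c))" by (simp add: algebra_simps)
      also have "\<dots> \<le> ?t^2 * k" by (intro mult_left_mono) (auto simp: k_def)
      finally have "2 * (c \<bullet> c)\<^sup>2 \<le> (c \<bullet> c)\<^sup>2"
        using k by (simp add: power2_eq_square divide_simps)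
      then show ?thesis by simp
    qed
    then have eig: "S *v b = l *\<^sub>R b" by (simp add: c_def)
    define W' where "W' = {w\<in>W. w \<bullet> b = 0}"
    have W': "subspace W'"
      unfolding W'_def subspace_def using less.prems(1)
      by (auto simp: subspace_0 subspace_add subspace_scale inner_add_left)
    have inv: "S *v w \<in> W'" if "w \<in> W'" for w
      using that less.prems(2) by (auto simp: W'_def sym eig)
    have "b \<notin> W'" by (simp add: W'_def bb)
    moreover have "W' \<subseteq> W" by (auto simp: W'_def)
    ultimately have "W' \<subset> W" using bW by blast
    then have "dim W' < dim W"
      using W' less.prems(1) by (intro dim_psubset) (simp add: span_eq_iff[THEN iffD2])
    from less.hyps[OF this W' inv] obtain B l' where B: "finite B" "B \<subseteq> W'" "W' \<subseteq> span B" "pairwise orthogonal B"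
      "\<forall>b\<in>B. norm b = 1 \<and> S *v b = l' b *\<^sub>R b" by auto
    have "b \<notin> B" using B \<open>b \<notin> W'\<close> by auto
    show ?thesis
    proof (intro exI[of _ "insert b B"] exI[of _ "l'(b := l)"] conjI)
      show "finite (insert b B)" "insert b B \<subseteq> W" using B bW by (auto simp: W'_def)
      show "W \<subseteq> span (insert b B)"
      proof
        fix w assume w: "w \<in> W"
        have "w - (w \<bullet> b) *\<^sub>R b \<in> W'"
          using w bW less.prems(1) by (auto simp: W'_def inner_diff_left bb subspace_diff subspace_scale)
        then have "w - (w \<bullet> b) *\<^sub>R b \<in> span B" using B by auto
        then show "w \<in> span (insert b B)" by (auto simp: span_insert)
      qed
      show "pairwise orthogonal (insert b B)"
        using B by (auto simp: pairwise_insert orthogonal_def W'_def inner_commute)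
      show "\<forall>ba\<in>insert b B. norm ba = 1 \<and> S *v ba = (l'(b := l)) ba *\<^sub>R ba"
        using B(5) nb eig \<open>b \<notin> B\<close> by auto
    qed
  qed
qed

lemma sum_const_mset: "finite S \<Longrightarrow> (\<Sum>b\<in>S. {#x#}) = replicate_mset (card S) x"
  by (induction S rule: finite_induct) auto

locale onb =
  fixes B :: "'a::euclidean_space set"
  assumes finB: "finite B" and cardB: "card B = DIM('a)" and norm1: "\<And>b. b \<in> B \<Longrightarrow> norm b = 1"
    and orth: "\<And>b c. b \<in> B \<Longrightarrow> c \<in> B \<Longrightarrow> b \<noteq> c \<Longrightarrow> b \<bullet> c = 0"
    and expand: "\<And>v. v = (\<Sum>b\<in>B. (v \<bullet> b) *\<^sub>R b)"
begin

lemma norm_le: "norm v \<le> (\<Sum>b\<in>B. \<bar>v \<bullet> b\<bar>)"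
proof -
  have "norm v = norm (\<Sum>b\<in>B. (v \<bullet> b) *\<^sub>R b)" using expand[of v] by simp
  also have "\<dots> \<le> (\<Sum>b\<in>B. norm ((v \<bullet> b) *\<^sub>R b))" by (rule norm_sum)
  also have "\<dots> = (\<Sum>b\<in>B. \<bar>v \<bullet> b\<bar>)" using norm1 by simp
  finally show ?thesis .
qed

lemma inner_le: "b \<in> B \<Longrightarrow> \<bar>v \<bullet> b\<bar> \<le> norm v"
  using Cauchy_Schwarz_ineq2[of v b] norm1[of b] by simp

end

lemma orthonormal_expand:
  fixes B :: "'a::euclidean_space set"
  assumes "finite B" "pairwise orthogonal B" "\<And>b. b \<in> B \<Longrightarrow> norm b = 1" "v \<in> span B"
  shows "v = (\<Sum>b\<in>B. (v \<bullet> b) *\<^sub>R b)"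
proof -
  let ?w = "(\<Sum>b\<in>B. (v \<bullet> b) *\<^sub>R b)"
  have "orthogonal (v - ?w) x" if "x \<in> span B" for x
  proof (rule orthogonal_to_span[OF that])
    fix c assume c: "c \<in> B"
    have "?w \<bullet> c = (\<Sum>b\<in>B. (v \<bullet> b) * (b \<bullet> c))" by (simp add: inner_sum_left)
    also have "\<dots> = (\<Sum>b\<in>B. if b = c then v \<bullet> c else 0)"
    proof (intro sum.cong refl)
      fix b assume b: "b \<in> B"
      show "v \<bullet> b * (b \<bullet> c) = (if b = c then v \<bullet> c else 0)"
      proof (cases "b = c")
        case True
        then show ?thesis using assms(3)[OF c] by (simp add: norm_eq_1)
      next
        case False
        then have "b \<bullet> c = 0" using assms(2) b c by (auto simp: pairwise_def orthogonal_def)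
        then show ?thesis using False by simp
      qed
    qed
    also have "\<dots> = v \<bullet> c" using assms(1) c by simp
    finally show "orthogonal (v - ?w) c" by (simp add: orthogonal_def inner_diff_left)
  qed
  moreover have "v - ?w \<in> span B"
    using assms(4) by (intro span_diff span_sum span_scale) (auto intro: span_base)
  ultimately have "orthogonal (v - ?w) (v - ?w)" by blast
  then show ?thesis by (simp add: orthogonal_def)
qed

lemma onbI:
  fixes B :: "'a::euclidean_space set"
  assumes "finite B" "pairwise orthogonal B" "\<And>b. b \<in> B \<Longrightarrow> norm b = 1" "span B = UNIV"
  shows "onb B"
proof
  show "finite B" by fact
  have "0 \<notin> B" using assms(3) by force
  then have "independent B" using assms(2) by (intro pairwise_orthogonal_independent)
  then show "card B = DIM('a)" using dim_eq_card[of B UNIV] assms(4) by simp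
  show "norm b = 1" if "b \<in> B" for b by (rule assms(3)[OF that])
  show "b \<bullet> c = 0" if "b \<in> B" "c \<in> B" "b \<noteq> c" for b c
    using that assms(2)[unfolded pairwise_def orthogonal_def] by blast
  show "v = (\<Sum>b\<in>B. (v \<bullet> b) *\<^sub>R b)" for v
    by (rule orthonormal_expand[OF assms(1-3)]) (simp_all add: assms(4))
qed

text \<open>A product over all singular values is symmetric in them, so it can be computed from the
  lengths \<open>norm (A *v b)\<close> over an orthonormal eigenbasis of
  \<open>transpose A ** A\<close>. The images \<open>A *v b\<close> are mutually orthogonal: they
  are the axes of the image ellipsoid of the unit ball.\<close>

lemma prod_singular_value:
  fixes A :: "real^'d^'d"
  obtains B where "onb B" "\<And>b c. b \<in> B \<Longrightarrow> c \<in> B \<Longrightarrow> b \<noteq> c \<Longrightarrow> (A *v b) \<bullet> (A *v c) = 0"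
    "\<And>g. (\<Prod>k=1..CARD('d). g (singular_value A k)) = (\<Prod>b\<in>B. g (norm (A *v b)) :: real)"
proof -
  define S where "S = transpose A ** A"
  have SA: "x \<bullet> (S *v y) = (A *v x) \<bullet> (A *v y)" for x y
  proof -
    have "S *v y = (A *v y) v* A"
      by (simp only: S_def matrix_vector_mul_assoc[symmetric] transpose_matrix_vector)
    then have "x \<bullet> (S *v y) = ((A *v y) v* A) \<bullet> x" by (simp only: inner_commute)
    also have "\<dots> = (A *v y) \<bullet> (A *v x)" by (rule dot_lmul_matrix)
    finally show ?thesis by (simp only: inner_commute)
  qed
  have sym: "(S *v x) \<bullet> y = x \<bullet> (S *v y)" for x y
    using SA[of y x] SA[of x y] inner_commute[of "S *v x" y] inner_commute[of "A *v x" "A *v y"] by simp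
  from symmetric_eigenbasis_subspace[of S UNIV, OF sym subspace_UNIV UNIV_I]
  obtain B l where B0: "finite B" "UNIV \<subseteq> span B" "pairwise orthogonal B"
    "\<forall>b\<in>B. norm b = 1 \<and> S *v b = l b *\<^sub>R b"
    by (elim exE conjE)
  then have B: "finite B" "span B = UNIV" "pairwise orthogonal B" and
    eig: "\<And>b. b \<in> B \<Longrightarrow> norm b = 1" "\<And>b. b \<in> B \<Longrightarrow> S *v b = l b *\<^sub>R b"
    by auto
  interpret onb B using B eig by (intro onbI) auto
  have l: "l b = (norm (A *v b))^2" if "b \<in> B" for b
    using SA[of b b] eig(2)[OF that] norm1[OF that] by (simp add: power2_norm_eq_inner norm_eq_1)
  have orthA: "(A *v b) \<bullet> (A *v c) = 0" if "b \<in> B" "c \<in> B" "b \<noteq> c" for b c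
    using SA[of b c] eig(2)[OF that(2)] orth[OF that] by simp
  have Sv: "(S *v v) \<bullet> b = l b * (v \<bullet> b)" if "b \<in> B" for v b
    using eig(2)[OF that] by (simp add: sym)
  \<comment> \<open>An eigenvector for \<open>c\<close> has zero coefficients at all basis vectors
    with another eigenvalue. So the multiplicities in \<open>singular_values\<close> count basis
    vectors.\<close>
  have eigsp: "eigenspace S c = span {b\<in>B. l b = c}" for c
  proof (intro equalityI subsetI)
    fix v assume "v \<in> eigenspace S c"
    then have v: "S *v v = c *\<^sub>R v" by (simp add: eigenspace_def)
    have "v = (\<Sum>b\<in>B. (v \<bullet> b) *\<^sub>R b)" by (rule expand)
    also have "\<dots> \<in> span {b\<in>B. l b = c}"
    proof (rule span_sum)
      fix b assume b: "b \<in> B"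
      show "(v \<bullet> b) *\<^sub>R b \<in> span {b\<in>B. l b = c}"
      proof (cases "l b = c")
        case True
        then show ?thesis using b by (intro span_scale span_base) auto
      next
        case False
        then have "v \<bullet> b = 0" using Sv[OF b, of v] by (simp add: v)
        then show ?thesis by (simp add: span_zero)
      qed
    qed
    finally show "v \<in> span {b\<in>B. l b = c}" .
  next
    fix v assume "v \<in> span {b\<in>B. l b = c}"
    moreover have "subspace (eigenspace S c)"
      by (auto simp: subspace_def eigenspace_def matrix_vector_right_distrib matrix_vector_mult_scaleR scaleR_add_right)
    moreover have "{b\<in>B. l b = c} \<subseteq> eigenspace S c" using eig by (auto simp: eigenspace_def)
    ultimately show "v \<in> eigenspace S c" using span_minimal by blast
  qed
  have "0 \<notin> B" using eig(1) by force
  then have ind: "independent B" using B by (intro pairwise_orthogonal_independent)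
  have dimeig: "dim (eigenspace S c) = card {b\<in>B. l b = c}" for c
    unfolding eigsp dim_span using independent_mono[OF ind] by (intro dim_eq_card_independent) auto
  have eigne: "{c. eigenspace S c \<noteq> {0}} = l ` B"
  proof (intro equalityI subsetI)
    fix c assume "c \<in> {c. eigenspace S c \<noteq> {0}}"
    then have ne: "span {b\<in>B. l b = c} \<noteq> {0}" unfolding eigsp by simp
    have "{b\<in>B. l b = c} \<noteq> {}"
    proof
      assume "{b\<in>B. l b = c} = {}"
      with ne show False by (simp only: span_empty)
    qed
    then show "c \<in> l ` B" by auto
  next
    fix c assume "c \<in> l ` B"
    then obtain b where b: "b \<in> B" "c = l b" by auto
    then have "b \<in> eigenspace S c" using eig by (simp add: eigenspace_def)
    moreover have "b \<noteq> 0" using b \<open>0 \<notin> B\<close> by auto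
    ultimately show "c \<in> {c. eigenspace S c \<noteq> {0}}" by auto
  qed
  have "singular_values A = (\<Sum>c\<in>l ` B. replicate_mset (card {b\<in>B. l b = c}) (sqrt c))"
    by (simp add: singular_values_def S_def[symmetric] eigne dimeig)
  also have "\<dots> = (\<Sum>c\<in>l ` B. \<Sum>b\<in>{b\<in>B. l b = c}. {#norm (A *v b)#})"
  proof (intro sum.cong refl)
    fix c assume "c \<in> l ` B"
    have "replicate_mset (card {b\<in>B. l b = c}) (sqrt c) = (\<Sum>b\<in>{b\<in>B. l b = c}. {#sqrt c#})"
      using B by (simp add: sum_const_mset)
    also have "\<dots> = (\<Sum>b\<in>{b\<in>B. l b = c}. {#norm (A *v b)#})"
      using l by (intro sum.cong) auto
    finally show "replicate_mset (card {b\<in>B. l b = c}) (sqrt c) = (\<Sum>b\<in>{b\<in>B. l b = c}. {#norm (A *v b)#})" .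
  qed
  also have "\<dots> = (\<Sum>b\<in>B. {#norm (A *v b)#})"
    using sum.image_gen[OF B(1), of "\<lambda>b. {#norm (A *v b)#}" l] by simp
  also have "\<dots> = image_mset (\<lambda>b. norm (A *v b)) (mset_set B)"
    using B(1) by (induction B rule: finite_induct) auto
  finally have sv: "singular_values A = image_mset (\<lambda>b. norm (A *v b)) (mset_set B)" .
  define L where "L = rev (sorted_list_of_multiset (singular_values A))"
  have mL: "mset L = singular_values A" by (simp add: L_def)
  have lenL: "length L = CARD('d)"
  proof -
    have "length L = size (singular_values A)" using mL by (metis size_mset)
    then show ?thesis using B cardB by (simp add: sv)
  qed
  have "(\<Prod>k=1..CARD('d). g (singular_value A k)) = (\<Prod>b\<in>B. g (norm (A *v b)))" for g :: "real \<Rightarrow> real"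
  proof -
    have "(\<Prod>k=1..CARD('d). g (singular_value A k)) = (\<Prod>k=0..<CARD('d). g (L ! k))"
      by (rule prod.reindex_bij_witness[of _ Suc "\<lambda>k. k - 1"]) (auto simp: singular_value_def L_def)
    also have "\<dots> = prod_list (map g L)" by (simp add: prod.list_conv_set_nth lenL)
    also have "\<dots> = prod_mset (image_mset g (mset L))" by (simp flip: prod_mset_prod_list)
    also have "\<dots> = prod_mset (image_mset (\<lambda>b. g (norm (A *v b))) (mset_set B))"
      by (simp add: mL sv multiset.map_comp o_def)
    also have "\<dots> = (\<Prod>b\<in>B. g (norm (A *v b)))" by (simp add: prod_unfold_prod_mset)
    finally show ?thesis .
  qed
  with that[OF onb_axioms orthA] show thesis by blast
qed

section \<open>Self-affine sets\<close>

definition prefix_matrix :: "('k \<Rightarrow> real^'d^'d) \<Rightarrow> (nat \<Rightarrow> 'k) \<Rightarrow> nat \<Rightarrow> real^'d^'d" where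
  "prefix_matrix T x n = word_matrix T (map x [0..<n])"

lemma word_matrix_simps: "word_matrix T [] = mat 1" "word_matrix T (j # w) = T j ** word_matrix T w"
  by (simp_all add: word_matrix_def)

lemma word_matrix_append: "word_matrix T (v @ w) = word_matrix T v ** word_matrix T w"
  by (induction v) (simp_all add: word_matrix_simps matrix_mul_assoc)

lemma prefix_matrix_0: "prefix_matrix T x 0 = mat 1"
  by (simp add: prefix_matrix_def word_matrix_simps)

lemma prefix_matrix_add: "prefix_matrix T x (n + k) = prefix_matrix T x n ** prefix_matrix T (\<lambda>i. x (n + i)) k"
proof -
  have "map x [0..<n + k] = map x [0..<n] @ map (\<lambda>i. x (n + i)) [0..<k]"
    by (intro nth_equalityI) (auto simp: nth_append)
  then show ?thesis by (simp add: prefix_matrix_def word_matrix_append)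
qed

lemma foldr_affine_eq:
  "foldr (\<lambda>j x. T j *v x + a $ j) w v = word_matrix T w *v v + foldr (\<lambda>j x. T j *v x + a $ j) w 0"
proof (induction w)
  case (Cons j w)
  show ?case
    unfolding foldr.simps comp_apply word_matrix_simps
    by (subst Cons.IH) (simp only: matrix_vector_right_distrib matrix_vector_mul_assoc add.assoc)
qed (simp add: word_matrix_simps)

text \<open>The limit defining the coding map becomes a series that is linear in the translations
  \<open>a\<close>; the transversality argument rests on this linearity.\<close>

lemma foldr_affine_sum:
  "foldr (\<lambda>j x. T j *v x + a $ j) (map x [0..<n]) 0 = (\<Sum>k<n. prefix_matrix T x k *v a $ x k)"
proof (induction n)
  case (Suc n)
  have "foldr (\<lambda>j x. T j *v x + a $ j) (map x [0..<Suc n]) 0 = foldr (\<lambda>j x. T j *v x + a $ j) (map x [0..<n]) (a $ x n)"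
    by simp
  also have "\<dots> = prefix_matrix T x n *v a $ x n + foldr (\<lambda>j x. T j *v x + a $ j) (map x [0..<n]) 0"
    unfolding prefix_matrix_def by (rule foldr_affine_eq)
  finally show ?case unfolding Suc sum.lessThan_Suc by (simp only: add.commute)
qed simp

locale ifs =
  fixes T :: "'k::finite \<Rightarrow> real^'d^'d" and \<rho> :: real
  assumes inv: "\<And>j. invertible (T j)" and \<rho>: "0 < \<rho>" "\<rho> < 1"
    and T_le: "\<And>j v. norm (T j *v v) \<le> \<rho> * norm v"
begin

lemma word_le: "norm (word_matrix T w *v v) \<le> \<rho> ^ length w * norm v"
proof (induction w arbitrary: v)
  case (Cons j w)
  have "norm (word_matrix T (j # w) *v v) = norm (T j *v (word_matrix T w *v v))"
    by (simp add: word_matrix_simps matrix_vector_mul_assoc)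
  also have "\<dots> \<le> \<rho> * norm (word_matrix T w *v v)" by (rule T_le)
  also have "\<dots> \<le> \<rho> * (\<rho> ^ length w * norm v)" using Cons \<rho> by (intro mult_left_mono) auto
  finally show ?case by simp
qed (simp add: word_matrix_simps)

lemma prefix_le: "norm (prefix_matrix T x n *v v) \<le> \<rho> ^ n * norm v"
  using word_le[of "map x [0..<n]"] by (simp add: prefix_matrix_def)

lemma word_inv: "invertible (word_matrix T w)"
  by (induction w) (auto simp: word_matrix_simps inv invertible_mult invertible_def[of "mat 1"] intro!: exI[of _ "mat 1"])

lemma word_pos: "v \<noteq> 0 \<Longrightarrow> 0 < norm (word_matrix T w *v v)"
  using word_inv[of w] by (metis invertible_def matrix_vector_mul_assoc matrix_vector_mul_lid matrix_vector_mult_0_right zero_less_norm_iff)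

lemma coding_summable: "summable (\<lambda>k. prefix_matrix T x k *v a $ x k)"
proof (rule summable_comparison_test')
  show "summable (\<lambda>k. norm a * \<rho> ^ k)" using \<rho> by (intro summable_mult summable_geometric) auto
  fix k :: nat
  have "norm (prefix_matrix T x k *v a $ x k) \<le> \<rho> ^ k * norm (a $ x k)" by (rule prefix_le)
  also have "\<dots> \<le> \<rho> ^ k * norm a" using \<rho> by (intro mult_left_mono Finite_Cartesian_Product.norm_nth_le) auto
  finally show "norm (prefix_matrix T x k *v a $ x k) \<le> norm a * \<rho> ^ k" by (simp add: mult.commute)
qed

lemma coding_eq: "coding_map T a x = (\<Sum>k. prefix_matrix T x k *v a $ x k)"
proof -
  have "(\<lambda>n. foldr (\<lambda>j x. T j *v x + a $ j) (map x [0..<n]) 0) \<longlonglongrightarrow> (\<Sum>k. prefix_matrix T x k *v a $ x k)"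
    unfolding foldr_affine_sum using coding_summable summable_LIMSEQ by blast
  then show ?thesis unfolding coding_map_def by (rule limI)
qed

lemma coding_le:
  assumes "\<And>j. norm (a $ j) \<le> M"
  shows "norm (coding_map T a x) \<le> M / (1 - \<rho>)"
proof -
  have s: "summable (\<lambda>k. M * \<rho> ^ k)" using \<rho> by (intro summable_mult summable_geometric) auto
  have le: "norm (prefix_matrix T x k *v a $ x k) \<le> M * \<rho> ^ k" for k
  proof -
    have "norm (prefix_matrix T x k *v a $ x k) \<le> \<rho> ^ k * norm (a $ x k)" by (rule prefix_le)
    also have "\<dots> \<le> \<rho> ^ k * M" using \<rho> assms by (intro mult_left_mono) auto
    finally show ?thesis by (simp add: mult.commute)
  qed
  have sn: "summable (\<lambda>k. norm (prefix_matrix T x k *v a $ x k))"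
    by (rule summable_comparison_test'[OF s]) (use le in auto)
  have "norm (coding_map T a x) \<le> (\<Sum>k. norm (prefix_matrix T x k *v a $ x k))"
    unfolding coding_eq by (rule summable_norm[OF sn])
  also have "\<dots> \<le> (\<Sum>k. M * \<rho> ^ k)" using le by (intro suminf_le sn s) auto
  also have "\<dots> = M / (1 - \<rho>)" using \<rho> by (simp add: suminf_mult suminf_geometric summable_geometric)
  finally show ?thesis .
qed

lemma coding_shift:
  "coding_map T a x = (\<Sum>k<n. prefix_matrix T x k *v a $ x k) + prefix_matrix T x n *v coding_map T a (\<lambda>i. x (n + i))"
proof -
  have "coding_map T a x = (\<Sum>k. prefix_matrix T x (k + n) *v a $ x (k + n)) + (\<Sum>k<n. prefix_matrix T x k *v a $ x k)"
    unfolding coding_eq by (rule suminf_split_initial_segment[OF coding_summable])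
  also have "(\<Sum>k. prefix_matrix T x (k + n) *v a $ x (k + n)) =
      (\<Sum>k. prefix_matrix T x n *v (prefix_matrix T (\<lambda>i. x (n + i)) k *v a $ x (n + k)))"
    by (simp add: add.commute[of _ n] prefix_matrix_add matrix_vector_mul_assoc)
  also have "\<dots> = prefix_matrix T x n *v coding_map T a (\<lambda>i. x (n + i))"
    unfolding coding_eq
    by (rule bounded_linear.suminf[OF matrix_vector_mul_bounded_linear coding_summable, symmetric])
  finally show ?thesis by simp
qed

lemma coding_linear: "linear (\<lambda>a. coding_map T a x)"
proof (rule linearI)
  fix a b :: "real^'d^'k" and c :: real
  show "coding_map T (a + b) x = coding_map T a x + coding_map T b x"
    unfolding coding_eq suminf_add[OF coding_summable coding_summable]
    by (simp add: matrix_vector_right_distrib)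
  show "coding_map T (c *\<^sub>R a) x = c *\<^sub>R coding_map T a x"
    unfolding coding_eq suminf_scaleR_right[OF coding_summable]
    by (simp add: matrix_vector_mult_scaleR)
qed

section \<open>The singular value kernel\<close>

definition zw :: "real \<Rightarrow> 'k list \<Rightarrow> real" where
  "zw u w = (\<Prod>k=1..CARD('d). min 1 (u / singular_value (word_matrix T w) k))"

lemma zw_basis:
  obtains B where "onb (B :: (real^'d) set)" "\<And>b c. b \<in> B \<Longrightarrow> c \<in> B \<Longrightarrow> b \<noteq> c \<Longrightarrow> (word_matrix T w *v b) \<bullet> (word_matrix T w *v c) = 0"
    "\<And>b. b \<in> B \<Longrightarrow> 0 < norm (word_matrix T w *v b)" "\<And>b. b \<in> B \<Longrightarrow> norm (word_matrix T w *v b) \<le> \<rho> ^ length w"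
    "\<And>u. zw u w = (\<Prod>b\<in>B. min 1 (u / norm (word_matrix T w *v b)))"
proof -
  obtain B where B: "onb B" "\<And>b c. b \<in> B \<Longrightarrow> c \<in> B \<Longrightarrow> b \<noteq> c \<Longrightarrow> (word_matrix T w *v b) \<bullet> (word_matrix T w *v c) = 0"
    "\<And>g. (\<Prod>k=1..CARD('d). g (singular_value (word_matrix T w) k)) = (\<Prod>b\<in>B. g (norm (word_matrix T w *v b)) :: real)"
    using prod_singular_value[of "word_matrix T w"] by metis
  interpret onb B by (rule B)
  show thesis
  proof (rule that[OF B(1,2)])
    fix b assume b: "b \<in> B"
    show "0 < norm (word_matrix T w *v b)" using norm1[OF b] by (intro word_pos) auto
    show "norm (word_matrix T w *v b) \<le> \<rho> ^ length w" using word_le[of w b] norm1[OF b] by simp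
  next
    fix u show "zw u w = (\<Prod>b\<in>B. min 1 (u / norm (word_matrix T w *v b)))"
      unfolding zw_def using B(3)[of "\<lambda>x. min 1 (u / x)"] by simp
  qed
qed

text \<open>Read off factor by factor from the product in \<open>zw_basis\<close>. The last two use
  that words contract: all factors of a long word equal 1, and every factor is at least
  \<open>u\<close> when \<open>u \<le> 1\<close>.\<close>

lemma zw_pos: "0 < u \<Longrightarrow> 0 < zw u w" and zw_le1: "0 < u \<Longrightarrow> zw u w \<le> 1"
  and zw_mono: "0 < u \<Longrightarrow> u \<le> v \<Longrightarrow> zw u w \<le> zw v w"
  and zw_double: "0 < u \<Longrightarrow> zw (2 * u) w \<le> 2 ^ CARD('d) * zw u w"
  and zw_eq1: "\<rho> ^ length w \<le> u \<Longrightarrow> zw u w = 1"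
  and zw_ge: "0 < u \<Longrightarrow> u \<le> 1 \<Longrightarrow> u ^ CARD('d) \<le> zw u w"
proof -
  obtain B where B: "onb (B :: (real^'d) set)"
    "\<And>b. b \<in> B \<Longrightarrow> 0 < norm (word_matrix T w *v b)" "\<And>b. b \<in> B \<Longrightarrow> norm (word_matrix T w *v b) \<le> \<rho> ^ length w"
    "\<And>u. zw u w = (\<Prod>b\<in>B. min 1 (u / norm (word_matrix T w *v b)))"
    using zw_basis[of w] by metis
  interpret onb B by (rule B)
  note z = B(4)
  show "0 < u \<Longrightarrow> 0 < zw u w" unfolding z using B(2) by (intro prod_pos) auto
  show "0 < u \<Longrightarrow> zw u w \<le> 1" unfolding z by (rule prod_le_1) simp
  show "0 < u \<Longrightarrow> u \<le> v \<Longrightarrow> zw u w \<le> zw v w"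
    unfolding z
  proof (rule prod_mono, intro conjI)
    fix b assume b: "b \<in> B" and u: "0 < u" "u \<le> v"
    show "0 \<le> min 1 (u / norm (word_matrix T w *v b))" using u by simp
    show "min 1 (u / norm (word_matrix T w *v b)) \<le> min 1 (v / norm (word_matrix T w *v b))"
      by (rule min.mono[OF order_refl divide_right_mono[OF u(2)]]) simp
  qed
  show "zw (2 * u) w \<le> 2 ^ CARD('d) * zw u w" if u: "0 < u"
  proof -
    have "zw (2 * u) w \<le> (\<Prod>b\<in>B. 2 * min 1 (u / norm (word_matrix T w *v b)))"
      unfolding z
    proof (rule prod_mono, intro conjI)
      fix b assume b: "b \<in> B"
      show "0 \<le> min 1 (2 * u / norm (word_matrix T w *v b))" using u B(2)[OF b] by auto
      define t where "t = u / norm (word_matrix T w *v b)"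
      have "min 1 (2 * t) \<le> 2 * min 1 t" by (auto simp: min_def)
      then show "min 1 (2 * u / norm (word_matrix T w *v b)) \<le> 2 * min 1 (u / norm (word_matrix T w *v b))"
        by (simp add: t_def)
    qed
    also have "\<dots> = 2 ^ CARD('d) * zw u w" unfolding z by (simp add: prod.distrib cardB)
    finally show ?thesis .
  qed
  show "zw u w = 1" if u: "\<rho> ^ length w \<le> u"
  proof -
    have "min 1 (u / norm (word_matrix T w *v b)) = 1" if "b \<in> B" for b
      using u B(2,3)[OF that] by simp
    then show ?thesis unfolding z by (simp cong: prod.cong)
  qed
  show "u ^ CARD('d) \<le> zw u w" if u: "0 < u" "u \<le> 1"
  proof -
    have "u ^ CARD('d) = (\<Prod>b\<in>B. u)" by (simp add: cardB)
    also have "\<dots> \<le> zw u w"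
      unfolding z
    proof (rule prod_mono, intro conjI)
      fix b assume b: "b \<in> B"
      have "norm (word_matrix T w *v b) \<le> 1" using B(3)[OF b] \<rho> power_le_one[of \<rho> "length w"] by auto
      then have "u * norm (word_matrix T w *v b) \<le> u" using u by (simp add: mult_left_le)
      then show "u \<le> min 1 (u / norm (word_matrix T w *v b))" using u B(2)[OF b] by (simp add: divide_simps)
    qed (use u in auto)
    finally show ?thesis .
  qed
qed

definition sep :: "(nat \<Rightarrow> 'k) \<Rightarrow> (nat \<Rightarrow> 'k) \<Rightarrow> nat" where
  "sep x y = (LEAST n. x n \<noteq> y n)"

lemma sep_neq: "x (sep x y) \<noteq> y (sep x y)" if "x \<noteq> y"
proof -
  obtain n where "x n \<noteq> y n" using \<open>x \<noteq> y\<close> by (auto simp: fun_eq_iff)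
  then show ?thesis unfolding sep_def by (rule LeastI)
qed

lemma sep_eq: "n < sep x y \<Longrightarrow> x n = y n"
  unfolding sep_def using not_less_Least by blast

lemmas sep = sep_neq sep_eq

lemma sep_sym: "sep x y = sep y x"
  unfolding sep_def by (intro arg_cong[where f = Least]) auto

lemma prefix_sep: "n \<le> sep x y \<Longrightarrow> map x [0..<n] = map y [0..<n]"
  using sep(2)[of _ x y] by auto

lemma sep_le: "x n \<noteq> y n \<Longrightarrow> sep x y \<le> n"
  unfolding sep_def by (rule Least_le)

lemma Z_kernel_eq: "Z_kernel T u x y = (if x = y then 1 else zw u (map x [0..<sep x y]))"
  by (simp add: Z_kernel_def zw_def common_prefix_def sep_def)

lemma Z_kernel_eq1:
  assumes "map x [0..<n] = map y [0..<n]" "\<rho> ^ n \<le> u"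
  shows "Z_kernel T u x y = 1"
proof (cases "x = y")
  case False
  have "\<not> sep x y < n"
  proof
    assume "sep x y < n"
    then have "x (sep x y) = y (sep x y)" using assms(1) by simp
    then show False using sep(1)[OF False] by simp
  qed
  then have "\<rho> ^ sep x y \<le> \<rho> ^ n" using \<rho> by (intro power_decreasing) auto
  then show ?thesis using False assms(2) by (simp add: Z_kernel_eq zw_eq1)
qed (simp add: Z_kernel_eq)

text \<open>Once two prefixes of length \<open>n\<close> differ, the kernel sees only these
  prefixes, so it is constant on pairs of distinct cylinders.\<close>

lemma Z_kernel_cong:
  assumes "map x [0..<n] = map x' [0..<n]" "map y [0..<n] = map y' [0..<n]" "map x [0..<n] \<noteq> map y [0..<n]"
  shows "Z_kernel T u x y = Z_kernel T u x' y'"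
proof -
  have eq: "x i = x' i" "y i = y' i" if "i < n" for i
    using assms(1,2) that by auto
  obtain i where i: "i < n" "x i \<noteq> y i" using assms(3) by auto
  have ne: "x \<noteq> y" "x' \<noteq> y'" using i eq by auto
  have lt: "sep x y < n" "sep x' y' < n" using sep_le[of x i y] sep_le[of x' i y'] i eq by auto
  have "sep x y = sep x' y'"
  proof (rule antisym)
    show "sep x y \<le> sep x' y'" using sep(1)[OF ne(2)] eq lt by (intro sep_le) auto
    show "sep x' y' \<le> sep x y" using sep(1)[OF ne(1)] eq lt by (intro sep_le) auto
  qed
  moreover have "map x [0..<sep x' y'] = map x' [0..<sep x' y']" using eq lt by auto
  ultimately show ?thesis by (simp only: Z_kernel_eq ne if_False)
qed

lemma code_kernel_eq: "code_kernel \<Phi> T s r = ker_max \<Phi> (Z_kernel T) s r"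
  by (intro ext) (simp add: code_kernel_def ker_max_def)

lemma code_kernel_family:
  assumes "admissible \<Phi>" "\<And>\<epsilon>. \<epsilon> > 0 \<Longrightarrow> ((\<lambda>r. r powr \<epsilon> * ln (\<Phi> r)) \<longlongrightarrow> 0) (at_right 0)"
  shows "kernel_family \<Phi> (Z_kernel T) (2 ^ CARD('d))"
proof
  show "Z_kernel T u x y = Z_kernel T u y x" for u x y
    using prefix_sep[of "sep x y" x y, OF order_refl]
    by (cases "x = y") (simp_all only: Z_kernel_eq sep_sym[of y x] if_True if_False eq_commute[of y x])
  show "Z_kernel T (2 * u) x y \<le> 2 ^ CARD('d) * Z_kernel T u x y" if "0 < u" for u x y
    using zw_double[OF that] by (auto simp: Z_kernel_eq)
qed (use assms in \<open>auto simp: Z_kernel_eq zw_le1 zw_mono less_imp_le zw_pos\<close>)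

section \<open>Cylinders as cells of the code space\<close>

lemma cylinder_open:
  "openin code_topology {x :: nat \<Rightarrow> 'k. map x [0..<n] = w}"
proof -
  interpret Metric_space UNIV code_dist by (rule Metric_space_code)
  show ?thesis
    unfolding code_topology_def openin_mtopology
  proof (intro conjI allI impI)
    fix x :: "nat \<Rightarrow> 'k" assume x: "x \<in> {x. map x [0..<n] = w}"
    have "mball x (exp (- real n)) \<subseteq> {x. map x [0..<n] = w}"
    proof
      fix y assume "y \<in> mball x (exp (- real n))"
      then have y: "code_dist x y < exp (- real n)" by auto
      have "map x [0..<n] = map y [0..<n]"
      proof (cases "x = y")
        case False
        then have "n \<le> sep x y" using y by (simp add: code_dist_def common_prefix_def sep_def)
        then show ?thesis by (rule prefix_sep)
      qed simp
      with x show "y \<in> {x. map x [0..<n] = w}" by (simp only: mem_Collect_eq)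
    qed
    then show "\<exists>r>0. mball x r \<subseteq> {x. map x [0..<n] = w}" by (intro exI[of _ "exp (- real n)"]) auto
  qed auto
qed

text \<open>The cells are the cylinders of a length \<open>n\<close> with
  \<open>\<rho> ^ n \<le> \<Phi> r\<close>. On two distinct cylinders \<open>Z_kernel\<close> is
  constant, and on a single one it equals 1 at all scales considered, so the comparison constant is
  1. At the top exponent \<open>zw_ge\<close> makes the kernel at least 1.\<close>

lemma code_dim_kernel:
  assumes adm: "admissible \<Phi>" and log_cond: "\<And>\<epsilon>. \<epsilon> > 0 \<Longrightarrow> ((\<lambda>r. r powr \<epsilon> * ln (\<Phi> r)) \<longlongrightarrow> 0) (at_right 0)"
    and E: "E \<noteq> {}"
  shows "dim_kernel \<Phi> (Z_kernel T) (2 ^ CARD('d)) E (\<lambda>s r. capacity code_topology (code_kernel \<Phi> T s r) E) (real CARD('d)) 1"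
proof -
  interpret kernel_family \<Phi> "Z_kernel T" "2 ^ CARD('d)" by (rule code_kernel_family[OF adm log_cond])
  interpret M: Metric_space UNIV code_dist by (rule Metric_space_code)
  let ?K = "\<lambda>s r. ker_max \<Phi> (Z_kernel T) s r"
  note small = Phi_small[of 1, OF zero_less_one]
  have top: "topspace (code_topology :: (nat \<Rightarrow> 'k) topology) = UNIV" by (simp add: code_topology_def)
  show ?thesis
    unfolding code_kernel_eq
  proof
    show "E \<noteq> {}" "0 \<le> real CARD('d)" using E by auto
    fix s :: real assume s: "0 \<le> s" "s \<le> real CARD('d)"
    show "\<forall>\<^sub>F r in at_right 0. \<forall>n x p. weights E n x p \<longrightarrow>
        inverse (capacity code_topology (?K s r) E) \<le> ennreal (energy (?K s r) n x p)"
      using small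
    proof eventually_elim
      case (elim r)
      show ?case
        by (intro allI impI inverse_capacity_le_energy) (use elim s in \<open>auto intro: ker_max_nonneg simp: top\<close>)
    qed
    show "\<forall>\<^sub>F r in at_right 0. 1 < capacity code_topology (?K s r) E \<longrightarrow>
        (\<exists>n x p. weights E n x p \<and> energy (?K s r) n x p \<le> 1)"
      using small
    proof eventually_elim
      case (elim r)
      then have r: "0 < \<Phi> r" "\<Phi> r \<le> r" by auto
      show ?case
      proof
        assume cap: "1 < capacity code_topology (?K s r) E"
        obtain n where "\<rho> ^ n < \<Phi> r" using real_arch_pow_inv[OF r(1) \<rho>(2)] by auto
        then have n: "\<rho> ^ n \<le> \<Phi> r" by simp
        define W where "W = (\<lambda>e. map e [0..<n]) ` E"
        have "W \<subseteq> {w. set w \<subseteq> UNIV \<and> length w = n}" by (auto simp: W_def)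
        then have "finite W" by (rule finite_subset) (rule finite_lists_length_eq, simp)
        then obtain w where w: "bij_betw w {0..<card W} W" using ex_bij_betw_nat_finite by blast
        have "\<forall>i<card W. \<exists>e. e \<in> E \<and> map e [0..<n] = w i"
          using w by (auto simp: bij_betw_def W_def set_eq_iff image_iff)  (metis atLeastLessThan_iff le0)
        then obtain e where e: "\<And>i. i < card W \<Longrightarrow> e i \<in> E \<and> map (e i) [0..<n] = w i" by metis
        define A where "A i = {x. map x [0..<n] = w i}" for i
        have winj: "w i \<noteq> w j" if "i < card W" "j < card W" "i \<noteq> j" for i j
          using w that by (auto simp: bij_betw_def inj_on_def)
        have "\<exists>p. weights E (card W) e p \<and> energy (?K s r) (card W) e p \<le> 1"
        proof (rule energy_le_of_capacity[OF cap])
          show "A i \<in> sets (borel_of code_topology)" for i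
            unfolding A_def by (intro openin_borel_of cylinder_open)
          show "disjoint_family_on A {..<card W}"
            unfolding disjoint_family_on_def A_def using winj by auto
          show "code_topology closure_of E \<subseteq> (\<Union>i<card W. A i)"
          proof
            fix x assume x: "x \<in> code_topology closure_of E"
            then have "\<And>U. x \<in> U \<Longrightarrow> openin code_topology U \<Longrightarrow> \<exists>y. y \<in> E \<and> y \<in> U"
              by (auto simp: in_closure_of)
            from this[OF _ cylinder_open[of n "map x [0..<n]"]]
            obtain y where y: "y \<in> E" "map y [0..<n] = map x [0..<n]" by auto
            then have "map x [0..<n] \<in> W" unfolding W_def by (intro image_eqI[of _ _ y]) simp_all
            then obtain i where "i < card W" "w i = map x [0..<n]"
              using w by (metis atLeastLessThan_iff bij_betw_imp_surj_on imageE)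
            then show "x \<in> (\<Union>i<card W. A i)" unfolding A_def by (intro UN_I[of i]) simp_all
          qed
          show "e i \<in> E" if "i < card W" for i using e[OF that] by simp
          show "0 \<le> ?K s r a b" for a b by (rule ker_max_nonneg[OF r s(1)])
          fix i j x y assume ij: "i < card W" "j < card W" and x: "x \<in> A i \<inter> code_topology closure_of E"
            and y: "y \<in> A j \<inter> code_topology closure_of E"
          have xy: "map x [0..<n] = map (e i) [0..<n]" "map y [0..<n] = map (e j) [0..<n]"
            using x y e ij by (auto simp: A_def)
          have "Z_kernel T u (e i) (e j) \<le> Z_kernel T u x y" if u: "\<Phi> r \<le> u" for u
          proof (cases "i = j")
            case True
            then have "Z_kernel T u x y = 1" using xy u n by (intro Z_kernel_eq1[of x n y]) auto
            then show ?thesis using Z_le1[of u] u r by simp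
          next
            case False
            then have "Z_kernel T u (e i) (e j) = Z_kernel T u x y"
              using xy winj[OF ij False] e ij by (intro Z_kernel_cong[of _ n]) auto
            then show ?thesis by simp
          qed
          then have "?K s r (e i) (e j) \<le> ?K s r x y"
          proof (intro ker_max_le[OF r(2)])
            fix u assume Z: "\<And>u. \<Phi> r \<le> u \<Longrightarrow> Z_kernel T u (e i) (e j) \<le> Z_kernel T u x y" and u: "\<Phi> r \<le> u" "u \<le> r"
            have "u powr - s * Z_kernel T u (e i) (e j) \<le> u powr - s * Z_kernel T u x y"
              using Z[OF u(1)] by (intro mult_left_mono) auto
            also have "\<dots> \<le> ?K s r x y" using u r s by (intro ker_max_ge) auto
            finally show "u powr - s * Z_kernel T u (e i) (e j) \<le> ?K s r x y" .
          qed
          then show "?K s r (e i) (e j) \<le> 1 * ?K s r x y" by simp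
        qed auto
        then show "\<exists>n x p. weights E n x p \<and> energy (?K s r) n x p \<le> 1" by blast
      qed
    qed
  next
    have "\<forall>\<^sub>F r in at_right 0. capacity code_topology (?K (real CARD('d)) r) E \<le> ennreal (1 / 1)"
      using small
    proof eventually_elim
      case (elim r)
      then have r: "0 < r" "r < 1" "0 < \<Phi> r" "\<Phi> r \<le> r" by auto
      show ?case
      proof (rule capacity_le)
        fix x y :: "nat \<Rightarrow> 'k"
        have "r ^ CARD('d) \<le> Z_kernel T r x y"
          using r zw_ge[of r] by (simp add: Z_kernel_eq power_le_one)
        then have "r powr - real CARD('d) * r ^ CARD('d) \<le> r powr - real CARD('d) * Z_kernel T r x y"
          by (intro mult_left_mono) auto
        also have "\<dots> \<le> ?K (real CARD('d)) r x y" using r by (intro ker_max_ge) auto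
        finally show "1 \<le> ?K (real CARD('d)) r x y" using r by (simp add: powr_minus powr_realpow)
      qed simp
    qed
    then have "Limsup (at_right 0) (\<lambda>r. capacity code_topology (?K (real CARD('d)) r) E) \<le> ennreal (1 / 1)"
      by (rule Limsup_bounded)
    then show "Limsup (at_right 0) (\<lambda>r. capacity code_topology (?K (real CARD('d)) r) E) < \<infinity>"
      by (rule le_less_trans) simp
  qed
qed

section \<open>Covering images of cylinders\<close>

lemma coding_word:
  "coding_map T a x = foldr (\<lambda>j x. T j *v x + a $ j) (map x [0..<n]) 0
     + word_matrix T (map x [0..<n]) *v coding_map T a (\<lambda>i. x (n + i))"
  unfolding foldr_affine_sum using coding_shift[of a x n] by (simp add: prefix_matrix_def)

text \<open>The labels of \<open>x\<close> are its prefixes up to the length \<open>n0 u\<close>, at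
  which \<open>\<rho> ^ n0 u \<le> u\<close>. The image of the cylinder of \<open>w\<close> lies in
  a translate of an ellipsoid whose semi-axes are proportional to the singular values of the word
  matrix. Covering it at scale \<open>u\<close> takes, up to a constant, the product of the ratios
  of the axes to \<open>u\<close> truncated below at 1, which is \<open>1 / zw u w\<close>.\<close>

lemma cover_hyp_code: "cover_hyp (Z_kernel T) E (coding_map T a)"
proof -
  define R where "R = norm a / (1 - \<rho>)"
  have R: "norm (coding_map T a x) \<le> R" for x unfolding R_def by (intro coding_le Finite_Cartesian_Product.norm_nth_le)
  have R0: "R \<ge> 0" using \<rho> by (simp add: R_def)
  let ?d = "real CARD('d)"
  define u0 :: real where "u0 = exp (-1)"
  define L where "L u = ln (1 / u)" for u :: real
  have L: "1 \<le> L u" if "0 < u" "u < u0" for u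
  proof -
    have "ln u < ln (exp (-1))" using that by (subst ln_less_cancel_iff) (auto simp: u0_def)
    then show ?thesis using that by (simp add: L_def ln_div)
  qed
  define l\<rho> where "l\<rho> = ln (1 / \<rho>)"
  have l\<rho>: "l\<rho> > 0" using \<rho> by (simp add: l\<rho>_def)
  define n0 where "n0 u = nat \<lceil>L u / l\<rho>\<rceil>" for u
  define CJ where "CJ = 1 / l\<rho> + 2"
  have JC: "real (n0 u + 1) \<le> CJ * L u" if "0 < u" "u < u0" for u
  proof -
    define X where "X = L u / l\<rho>"
    have X: "0 \<le> X" using L[OF that] l\<rho> by (simp add: X_def)
    have "real (n0 u + 1) \<le> X + 2" unfolding n0_def X_def[symmetric] using X by simp linarith
    also have "\<dots> \<le> X + 2 * L u" using L[OF that] by simp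
    also have "\<dots> = CJ * L u" by (simp add: CJ_def X_def algebra_simps)
    finally show ?thesis .
  qed
  have n0: "\<rho> ^ n0 u \<le> u" if "0 < u" for u
  proof -
    have "L u / l\<rho> \<le> real (n0 u)" unfolding n0_def by linarith
    then have "L u \<le> real (n0 u) * l\<rho>" using l\<rho> by (simp add: divide_simps)
    then have "real (n0 u) * ln \<rho> \<le> ln u" using that \<rho> by (simp add: L_def l\<rho>_def ln_div)
    then have "ln (\<rho> ^ n0 u) \<le> ln u" using \<rho> by (simp add: ln_realpow)
    then show ?thesis using that \<rho> by (subst (asm) ln_le_cancel_iff) auto
  qed
  define S where "S u x = (\<lambda>n. map x [0..<n]) ` {..n0 u}" for u and x :: "nat \<Rightarrow> 'k"
  define A where "A u w = {y::nat \<Rightarrow> 'k. map y [0..<length w] = w}" for u :: real and w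
  define Cp where "Cp = 8 * ?d * R + 2"
  have Cp: "Cp \<ge> 2" using R0 by (simp add: Cp_def)
  define K where "K = CJ + Cp ^ CARD('d)"
  have CJ: "CJ > 0" using l\<rho> by (simp add: CJ_def add_pos_pos)
  have K: "K > 0" using CJ Cp by (simp add: K_def add_pos_pos)
  have M1: "CJ * L u \<le> K * L u" and M2: "Cp ^ CARD('d) \<le> K * L u" if "0 < u" "u < u0" for u
  proof -
    show "CJ * L u \<le> K * L u" using L[OF that] Cp by (intro mult_right_mono) (auto simp: K_def)
    have "Cp ^ CARD('d) * 1 \<le> K * L u" using L[OF that] Cp CJ by (intro mult_mono) (auto simp: K_def)
    then show "Cp ^ CARD('d) \<le> K * L u" by simp
  qed
  show ?thesis
  proof (rule cover_hyp_labels[where ?u0.0 = u0 and C = K and \<kappa> = 1 and M = "\<lambda>u. K * L u" and S = S and z = zw and A = A])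
    show "u0 > 0" "K > 0" using K by (auto simp: u0_def)
    fix u :: real assume u: "0 < u" "u < u0"
    show "0 < K * L u \<and> K * L u \<le> K * ln (1 / u) ^ 1" using L[OF u] K by (simp add: L_def)
    fix x assume x: "x \<in> E"
    have "card (S u x) \<le> card {..n0 u}" unfolding S_def by (rule card_image_le) simp
    then have "real (card (S u x)) \<le> real (n0 u + 1)" by simp
    then show "finite (S u x) \<and> real (card (S u x)) \<le> K * L u" using JC[OF u] M1[OF u] by (auto simp: S_def)
    {
      fix y assume y: "y \<in> E"
      \<comment> \<open>Either the sequences agree to length \<open>n0 u\<close>, where kernel and
        label weight both equal 1, or they separate earlier, and then the common prefix is a label
        whose weight is the kernel itself.\<close>
      have "\<exists>n\<le>n0 u. y \<in> A u (map x [0..<n]) \<and> Z_kernel T u x y \<le> zw u (map x [0..<n])"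
      proof (cases "map x [0..<n0 u] = map y [0..<n0 u]")
        case True
        then have "Z_kernel T u x y = 1" using n0[OF u(1)] by (rule Z_kernel_eq1)
        moreover have "zw u (map x [0..<n0 u]) = 1" using n0[OF u(1)] by (intro zw_eq1) simp
        ultimately have le: "Z_kernel T u x y \<le> zw u (map x [0..<n0 u])" by simp
        have "y \<in> A u (map x [0..<n0 u])"
          using True by (simp only: A_def mem_Collect_eq length_map length_upt diff_zero)
        with le show ?thesis by blast
      next
        case False
        then obtain i where "i < n0 u" "x i \<noteq> y i" by auto
        then have "sep x y < n0 u" "x \<noteq> y" using sep_le[of x i y] by auto
        moreover have "y \<in> A u (map x [0..<sep x y])"
          using prefix_sep[of "sep x y" x y, OF order_refl]
          by (simp only: A_def mem_Collect_eq length_map length_upt diff_zero)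
        ultimately show ?thesis
          by (intro exI[of _ "sep x y"] conjI) (simp_all only: Z_kernel_eq if_False less_imp_le order_refl)
      qed
      then obtain n where n: "n \<le> n0 u" "y \<in> A u (map x [0..<n])" "Z_kernel T u x y \<le> zw u (map x [0..<n])" by auto
      have "zw u (map x [0..<n]) * (if y \<in> A u (map x [0..<n]) then 1 else 0) \<le> (\<Sum>q\<in>S u x. zw u q * (if y \<in> A u q then 1 else 0))"
        using n(1) zw_pos[OF u(1)]
        by (intro member_le_sum[where f = "\<lambda>q. zw u q * (if y \<in> A u q then 1 else 0)"]) (auto simp: S_def less_imp_le)
      then show "Z_kernel T u x y \<le> (\<Sum>q\<in>S u x. zw u q * (if y \<in> A u q then 1 else 0))" using n by simp
    }
    {
      fix w assume w: "w \<in> S u x"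
      show "0 < zw u w" by (rule zw_pos[OF u(1)])
      let ?W = "word_matrix T w"
      obtain B where B: "onb (B :: (real^'d) set)" "\<And>b c. b \<in> B \<Longrightarrow> c \<in> B \<Longrightarrow> b \<noteq> c \<Longrightarrow> (?W *v b) \<bullet> (?W *v c) = 0"
        "\<And>b. b \<in> B \<Longrightarrow> 0 < norm (?W *v b)" "\<And>b. b \<in> B \<Longrightarrow> norm (?W *v b) \<le> \<rho> ^ length w"
        "\<And>u. zw u w = (\<Prod>b\<in>B. min 1 (u / norm (?W *v b)))"
        using zw_basis[of w] by metis
      interpret onb B by (rule B(1))
      define cw where "cw = foldr (\<lambda>j x. T j *v x + a $ j) w 0"
      define G where "G = {x'\<in>E. w \<in> S u x'}"
      have rep: "\<exists>z. norm z \<le> R \<and> y = cw + ?W *v z" if y: "y \<in> coding_map T a ` G" for y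
      proof -
        obtain x' n where "y = coding_map T a x'" "w = map x' [0..<n]" using y by (auto simp: G_def S_def)
        then show ?thesis using coding_word[of a x' n] R by (intro exI[of _ "coding_map T a (\<lambda>i. x' (n + i))"]) (auto simp: cw_def)
      qed
      have Wexp: "?W *v z = (\<Sum>b\<in>B. (z \<bullet> b) *\<^sub>R (?W *v b))" for z
      proof -
        have "?W *v z = ?W *v (\<Sum>b\<in>B. (z \<bullet> b) *\<^sub>R b)" by (rule arg_cong[OF expand])
        also have "\<dots> = (\<Sum>b\<in>B. ?W *v ((z \<bullet> b) *\<^sub>R b))"
          by (rule linear_sum[OF matrix_vector_mul_linear])
        finally show ?thesis by (simp add: matrix_vector_mult_scaleR)
      qed
      have Wb: "(?W *v z) \<bullet> (?W *v b) = (z \<bullet> b) * (norm (?W *v b))^2" if b: "b \<in> B" for z b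
      proof -
        have "(?W *v z) \<bullet> (?W *v b) = (\<Sum>c\<in>B. (z \<bullet> c) * ((?W *v c) \<bullet> (?W *v b)))"
          by (subst Wexp) (simp add: inner_sum_left)
        also have "\<dots> = (\<Sum>c\<in>B. if c = b then (z \<bullet> b) * (norm (?W *v b))^2 else 0)"
          using B(2) b by (intro sum.cong) (auto simp: power2_norm_eq_inner)
        finally show ?thesis using b finB by simp
      qed
      \<comment> \<open>Coordinate along the normalised axis \<open>?W *v b\<close>; by
        orthogonality of the axes its value at \<open>cw + ?W *v z\<close> is
        \<open>(z \<bullet> b) * norm (?W *v b)\<close>.\<close>
      define g where "g b y = ((y - cw) \<bullet> (?W *v b)) / norm (?W *v b)" for b y
      have gz: "g b (cw + ?W *v z) = (z \<bullet> b) * norm (?W *v b)" if b: "b \<in> B" for b z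
        using B(3)[OF b] by (simp add: g_def Wb[OF b] power2_eq_square)
      define \<delta> where "\<delta> = u / (4 * ?d)"
      have \<delta>: "\<delta> > 0" using u by (simp add: \<delta>_def)
      have "covered (coding_map T a ` G) (\<Prod>b\<in>B. 2 * (R * norm (?W *v b)) / \<delta> + 2) (u / 4)"
      proof (rule grid_covered[where g = g, OF finB \<delta>])
        show "0 \<le> R * norm (?W *v b)" for b using R0 by simp
        fix y b assume y: "y \<in> coding_map T a ` G" and b: "b \<in> B"
        from rep[OF y] obtain z where z: "norm z \<le> R" "y = cw + ?W *v z" by auto
        have "\<bar>z \<bullet> b\<bar> \<le> R" using inner_le[OF b, of z] z by simp
        then show "\<bar>g b y\<bar> \<le> R * norm (?W *v b)" using z gz[OF b] by (simp add: abs_mult mult_right_mono)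
      next
        fix y y' assume y: "y \<in> coding_map T a ` G" "y' \<in> coding_map T a ` G"
          and le: "\<And>b. b \<in> B \<Longrightarrow> \<bar>g b y - g b y'\<bar> \<le> \<delta>"
        from rep[OF y(1)] obtain z where z: "y = cw + ?W *v z" by auto
        from rep[OF y(2)] obtain z' where z': "y' = cw + ?W *v z'" by auto
        have "dist y y' = norm (?W *v (z - z'))" by (simp add: z z' dist_norm matrix_vector_mult_diff_distrib)
        also have "\<dots> = norm (\<Sum>b\<in>B. ((z - z') \<bullet> b) *\<^sub>R (?W *v b))" by (subst Wexp) simp
        also have "\<dots> \<le> (\<Sum>b\<in>B. norm (((z - z') \<bullet> b) *\<^sub>R (?W *v b)))" by (rule norm_sum)
        also have "\<dots> = (\<Sum>b\<in>B. \<bar>g b y - g b y'\<bar>)"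
        proof (intro sum.cong refl)
          fix b assume b: "b \<in> B"
          have "g b y - g b y' = ((z - z') \<bullet> b) * norm (?W *v b)"
            unfolding z z' gz[OF b] by (simp add: inner_diff_left left_diff_distrib)
          then show "norm (((z - z') \<bullet> b) *\<^sub>R (?W *v b)) = \<bar>g b y - g b y'\<bar>" by (simp add: abs_mult)
        qed
        also have "\<dots> \<le> (\<Sum>b\<in>B. \<delta>)" by (intro sum_mono le)
        also have "\<dots> = u / 4" by (simp add: cardB \<delta>_def)
        finally show "dist y y' \<le> u / 4" .
      qed
      moreover have "(\<Prod>b\<in>B. 2 * (R * norm (?W *v b)) / \<delta> + 2) \<le> K * L u / zw u w"
      proof -
        have "(\<Prod>b\<in>B. 2 * (R * norm (?W *v b)) / \<delta> + 2) \<le> (\<Prod>b\<in>B. Cp / min 1 (u / norm (?W *v b)))"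
        proof (rule prod_mono, intro conjI)
          fix b assume b: "b \<in> B"
          define s where "s = norm (?W *v b)"
          have s: "s > 0" using B(3)[OF b] by (simp add: s_def)
          have e: "2 * (R * s) / \<delta> + 2 = 8 * ?d * R * (s / u) + 2" using u by (simp add: \<delta>_def)
          show "0 \<le> 2 * (R * norm (?W *v b)) / \<delta> + 2" using R0 \<delta> by simp
          have "8 * ?d * R * (s / u) + 2 \<le> Cp / min 1 (u / s)"
          proof (cases "u \<le> s")
            case True
            then have "min 1 (u / s) = u / s" "1 \<le> s / u" using s u by auto
            then show ?thesis using s u by (simp add: Cp_def divide_simps algebra_simps)
          next
            case False
            then have "min 1 (u / s) = 1" "s / u \<le> 1" using s u by (auto simp: min_def)
            moreover have "8 * ?d * R * (s / u) \<le> 8 * ?d * R * 1" using \<open>s / u \<le> 1\<close> R0 by (intro mult_left_mono) auto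
            ultimately show ?thesis by (simp add: Cp_def)
          qed
          then show "2 * (R * norm (?W *v b)) / \<delta> + 2 \<le> Cp / min 1 (u / norm (?W *v b))"
            using e by (simp add: s_def)
        qed
        also have "\<dots> = Cp ^ CARD('d) / zw u w" by (simp add: B(5) prod_dividef cardB)
        also have "\<dots> \<le> K * L u / zw u w"
          using M2[OF u] zw_pos[OF u(1), of w] by (intro divide_right_mono) auto
        finally show ?thesis .
      qed
      ultimately show "covered (coding_map T a ` {x'\<in>E. w \<in> S u x'}) (K * L u / zw u w) (u / 4)"
        unfolding G_def by (rule covered_mono[OF _ subset_refl])
    }
  next
    fix u y F assume u: "0 < u" "u < u0" and F: "finite F" "F \<subseteq> (\<Union>x\<in>E. S u x)"
    let ?Q = "{w\<in>F. y \<in> A u w}"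
    \<comment> \<open>Labels whose cylinder contains \<open>y\<close> are prefixes of
      \<open>y\<close>, hence determined by their lengths.\<close>
    have "inj_on length ?Q" by (rule inj_onI) (auto simp: A_def)
    then have "card ?Q = card (length ` ?Q)" by (simp add: card_image)
    also have "\<dots> \<le> card {..n0 u}" using F(2) by (intro card_mono) (auto simp: S_def)
    finally have "real (card ?Q) \<le> real (n0 u + 1)" by simp
    then show "real (card ?Q) \<le> K * L u" using JC[OF u] M1[OF u] by linarith
  qed
qed

section \<open>Transversality\<close>

text \<open>\<open>axis l v\<close> changes only the translation of the letter \<open>l\<close>. A
  leading \<open>l\<close> contributes \<open>v\<close> itself, and each later occurrence
  contributes at most \<open>norm v\<close> times \<rho> to the power of its position. The tail is
  kept as a sum over occurrences of \<open>l\<close> so that different letters can be weighed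
  against each other.\<close>

lemma axis_coding_bound:
  fixes v :: "real^'d"
  shows "norm (coding_map T (axis l v) x - (if x 0 = l then v else 0)) \<le>
    (\<Sum>k. if x (Suc k) = l then \<rho> ^ Suc k else 0) * norm v"
    and "summable (\<lambda>k. if x (Suc k) = l then \<rho> ^ Suc k else 0)"
proof -
  have sg: "summable (\<lambda>k. \<rho> ^ Suc k)" using \<rho> summable_geometric[of \<rho>] by (subst summable_Suc_iff) auto
  show s: "summable (\<lambda>k. if x (Suc k) = l then \<rho> ^ Suc k else 0)"
    by (rule summable_comparison_test'[OF sg]) (use \<rho> in auto)
  let ?a = "axis l v :: real^'d^'k"
  have "coding_map T ?a x = (\<Sum>k. prefix_matrix T x (Suc k) *v ?a $ x (Suc k)) + prefix_matrix T x 0 *v ?a $ x 0"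
    unfolding coding_eq using suminf_split_head[OF coding_summable[of x ?a]] by simp
  also have "prefix_matrix T x 0 *v ?a $ x 0 = (if x 0 = l then v else 0)"
    by (simp add: prefix_matrix_0 axis_def)
  finally have e: "coding_map T ?a x - (if x 0 = l then v else 0) = (\<Sum>k. prefix_matrix T x (Suc k) *v ?a $ x (Suc k))" by simp
  have le: "norm (prefix_matrix T x (Suc k) *v ?a $ x (Suc k)) \<le> (if x (Suc k) = l then \<rho> ^ Suc k else 0) * norm v" for k
    using prefix_le[of x "Suc k" v] by (simp add: axis_def)
  have sm: "summable (\<lambda>k. (if x (Suc k) = l then \<rho> ^ Suc k else 0) * norm v)" by (rule summable_mult2[OF s])
  have sn: "summable (\<lambda>k. norm (prefix_matrix T x (Suc k) *v ?a $ x (Suc k)))"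
    by (rule summable_comparison_test'[OF sm]) (use le in auto)
  have "norm (coding_map T ?a x - (if x 0 = l then v else 0)) \<le> (\<Sum>k. norm (prefix_matrix T x (Suc k) *v ?a $ x (Suc k)))"
    unfolding e by (rule summable_norm[OF sn])
  also have "\<dots> \<le> (\<Sum>k. (if x (Suc k) = l then \<rho> ^ Suc k else 0) * norm v)"
    by (intro suminf_le le sn sm)
  also have "\<dots> = (\<Sum>k. if x (Suc k) = l then \<rho> ^ Suc k else 0) * norm v"
    by (rule suminf_mult2[OF s, symmetric])
  finally show "norm (coding_map T (axis l v) x - (if x 0 = l then v else 0)) \<le>
    (\<Sum>k. if x (Suc k) = l then \<rho> ^ Suc k else 0) * norm v" .
qed

text \<open>
  The total weight of the letters \<open>x 0\<close> and \<open>y 0\<close> in the tails of both series is at most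
  \<open>2 \<rho> / (1 - \<rho>)\<close>, so one of the two letters carries at most half of it.  This is where
  the hypothesis \<open>\<rho> < 1/2\<close> enters.
\<close>

lemma transversal_letter:
  assumes half: "\<rho> < 1/2" and ne: "x 0 \<noteq> y 0"
  obtains l where "\<And>v. (1 - 2 * \<rho>) / (1 - \<rho>) * norm v \<le> norm (coding_map T (axis l v) x - coding_map T (axis l v) y)"
proof -
  define s where "s x l = (\<Sum>k. if x (Suc k) = l then \<rho> ^ Suc k else 0)" for x :: "nat \<Rightarrow> 'k" and l
  have pair: "s x i + s x j \<le> \<rho> / (1 - \<rho>)" if "i \<noteq> j" for x i j
  proof -
    have sg: "summable (\<lambda>k. \<rho> ^ Suc k)" using \<rho> summable_geometric[of \<rho>] by (subst summable_Suc_iff) auto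
    note ss = axis_coding_bound(2)[of x i] axis_coding_bound(2)[of x j]
    have "s x i + s x j = (\<Sum>k. (if x (Suc k) = i then \<rho> ^ Suc k else 0) + (if x (Suc k) = j then \<rho> ^ Suc k else 0))"
      unfolding s_def by (rule suminf_add[OF ss])
    also have "\<dots> \<le> (\<Sum>k. \<rho> ^ Suc k)"
      using that \<rho> by (intro suminf_le sg summable_add ss) auto
    also have "\<dots> = \<rho> / (1 - \<rho>)"
      using \<rho> by (simp add: suminf_mult suminf_geometric summable_geometric)
    finally show ?thesis .
  qed
  have "s x (x 0) + s y (x 0) \<le> \<rho> / (1 - \<rho>) \<or> s x (y 0) + s y (y 0) \<le> \<rho> / (1 - \<rho>)"
    using pair[of "x 0" "y 0" x] pair[of "x 0" "y 0" y] ne by linarith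
  then obtain l where l: "l = x 0 \<or> l = y 0" "s x l + s y l \<le> \<rho> / (1 - \<rho>)" by blast
  show thesis
  proof (rule that[of l])
    fix v :: "real^'d"
    define p q where "p = coding_map T (axis l v) x" and "q = coding_map T (axis l v) y"
    define v1 v2 where "v1 = (if x 0 = l then v else 0)" and "v2 = (if y 0 = l then v else 0)"
    have "norm (v1 - v2) = norm v" using l(1) ne by (auto simp: v1_def v2_def)
    moreover have "norm (v1 - v2) \<le> norm (p - q) + norm (p - v1) + norm (q - v2)"
    proof -
      have "norm (v1 - v2) = norm ((p - q) - (p - v1) + (q - v2))" by simp
      also have "\<dots> \<le> norm ((p - q) - (p - v1)) + norm (q - v2)" by (rule norm_triangle_ineq)
      also have "\<dots> \<le> norm (p - q) + norm (p - v1) + norm (q - v2)"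
        by (intro add_right_mono norm_triangle_ineq4)
      finally show ?thesis .
    qed
    moreover have "norm (p - v1) \<le> s x l * norm v" "norm (q - v2) \<le> s y l * norm v"
      unfolding p_def q_def v1_def v2_def s_def by (rule axis_coding_bound(1))+
    moreover have "(s x l + s y l) * norm v \<le> \<rho> / (1 - \<rho>) * norm v" using l(2) by (intro mult_right_mono) auto
    ultimately have "norm v - \<rho> / (1 - \<rho>) * norm v \<le> norm (p - q)" by (simp add: distrib_right)
    moreover have "norm v - \<rho> / (1 - \<rho>) * norm v = (1 - 2 * \<rho>) / (1 - \<rho>) * norm v"
      using \<rho> by (simp add: divide_simps) (simp add: algebra_simps)
    ultimately show "(1 - 2 * \<rho>) / (1 - \<rho>) * norm v \<le> norm (coding_map T (axis l v) x - coding_map T (axis l v) y)"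
      by (simp add: p_def q_def)
  qed
qed

text \<open>With the common prefix split off, the difference of the images is its word matrix
  applied to a linear function \<open>Lm\<close> of \<open>a\<close>. By
  \<open>transversal_letter\<close> one component \<open>a $ l\<close> can be traded for
  \<open>Lm a\<close> as a coordinate, with control of the inverse. In these coordinates the event
  confines \<open>Lm a\<close> to a box of widths \<open>u / norm (?W *v b)\<close>, truncated at a
  constant, and the volume of this box is a multiple of the kernel.\<close>

lemma coding_transversality:
  assumes half: "\<rho> < 1/2" and R: "R \<ge> 1"
  obtains c where "c \<ge> 0" "\<And>x y u. 0 < u \<Longrightarrow>
    emeasure lborel {a \<in> cball 0 R. dist (coding_map T a x) (coding_map T a y) \<le> u} \<le> ennreal (c * Z_kernel T u x y)"
proof -
  define \<kappa> where "\<kappa> = (1 - 2 * \<rho>) / (1 - \<rho>)"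
  have \<kappa>: "\<kappa> > 0" using half \<rho> by (simp add: \<kappa>_def)
  \<comment> \<open>Lipschitz constant of the inverse coordinate change: \<open>1 / \<kappa>\<close>
    for the coordinates of \<open>Lm\<close>, and \<open>1 + 2 / ((1 - \<rho>) * \<kappa>)\<close>
    for the other components, which enter directly and through their effect on
    \<open>Lm\<close>.\<close>
  define c1 where "c1 = 1 / \<kappa> + 1 + 2 / ((1 - \<rho>) * \<kappa>)"
  have c1: "c1 > 0" using \<kappa> \<rho> by (simp add: c1_def add_pos_pos)
  \<comment> \<open>Bounds \<open>Lm a\<close> on the ball of radius \<open>R\<close>, and being at
    least \<open>R\<close> it also serves as the width of the remaining coordinates.\<close>
  define R' where "R' = 2 * R / (1 - \<rho>)"
  have R': "R' \<ge> 1" "R' \<ge> R" using R \<rho> by (auto simp: R'_def divide_simps)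
  let ?n = "DIM(real^'d^'k)"
  define V where "V = unit_ball_vol (real ?n) * (4 * c1 * real ?n) ^ ?n * R' ^ ?n"
  have V: "V \<ge> 0" using c1 R' by (simp add: V_def)
  define V1 where "V1 = unit_ball_vol (real ?n) * R ^ ?n"
  have V1: "V1 \<ge> 0" using R by (simp add: V1_def)
  show thesis
  proof (rule that[of "V + V1"])
    show "V + V1 \<ge> 0" using V V1 by simp
    fix x y :: "nat \<Rightarrow> 'k" and u :: real assume u: "0 < u"
    let ?S = "{a \<in> cball 0 R. dist (coding_map T a x) (coding_map T a y) \<le> u}"
    show "emeasure lborel ?S \<le> ennreal ((V + V1) * Z_kernel T u x y)"
    proof (cases "x = y")
      case True
      have "emeasure lborel ?S \<le> emeasure lborel (cball (0::real^'d^'k) R)"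
        by (intro emeasure_mono) auto
      also have "\<dots> = ennreal V1" using R by (simp add: emeasure_cball V1_def)
      also have "\<dots> \<le> ennreal ((V + V1) * Z_kernel T u x y)"
        using True V by (intro ennreal_leI) (simp add: Z_kernel_eq)
      finally show ?thesis .
    next
      case False
      define n where "n = sep x y"
      define w where "w = map x [0..<n]"
      have wy: "map y [0..<n] = w" using prefix_sep[of n x y] by (simp add: n_def w_def)
      define x' y' where "x' = (\<lambda>i. x (n + i))" and "y' = (\<lambda>i. y (n + i))"
      have ne: "x' 0 \<noteq> y' 0" using sep(1)[OF False] by (simp add: x'_def y'_def n_def)
      obtain l where l: "\<And>v. \<kappa> * norm v \<le> norm (coding_map T (axis l v) x' - coding_map T (axis l v) y')"
        using transversal_letter[of x' y', OF half ne] unfolding \<kappa>_def by metis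
      define Lm where "Lm a = coding_map T a x' - coding_map T a y'" for a
      have linL: "linear Lm" unfolding Lm_def by (intro linear_compose_sub coding_linear)
      let ?W = "word_matrix T w"
      have diff: "coding_map T a x - coding_map T a y = ?W *v Lm a" for a
        using coding_word[of a x n] coding_word[of a y n]
        by (simp add: wy w_def[symmetric] x'_def[symmetric] y'_def[symmetric] Lm_def matrix_vector_mult_diff_distrib)
      have Lle: "norm (Lm a) \<le> 2 * M / (1 - \<rho>)" if "\<And>j. norm (a $ j) \<le> M" for a M
        using coding_le[of a M x'] coding_le[of a M y'] norm_triangle_ineq4[of "coding_map T a x'" "coding_map T a y'"] that
        by (simp add: Lm_def)
      obtain B where B: "onb (B :: (real^'d) set)" "\<And>b c. b \<in> B \<Longrightarrow> c \<in> B \<Longrightarrow> b \<noteq> c \<Longrightarrow> (?W *v b) \<bullet> (?W *v c) = 0"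
        "\<And>b. b \<in> B \<Longrightarrow> 0 < norm (?W *v b)" "\<And>b. b \<in> B \<Longrightarrow> norm (?W *v b) \<le> \<rho> ^ length w"
        "\<And>u. zw u w = (\<Prod>b\<in>B. min 1 (u / norm (?W *v b)))"
        using zw_basis[of w] by metis
      interpret onb B by (rule B(1))
      have Wb: "\<bar>z \<bullet> b\<bar> * norm (?W *v b) \<le> norm (?W *v z)" if b: "b \<in> B" for z b
      proof -
        have "?W *v z = ?W *v (\<Sum>b\<in>B. (z \<bullet> b) *\<^sub>R b)" by (rule arg_cong[OF expand])
        also have "\<dots> = (\<Sum>b\<in>B. (z \<bullet> b) *\<^sub>R (?W *v b))"
          by (simp add: linear_sum[OF matrix_vector_mul_linear] matrix_vector_mult_scaleR)
        finally have "(?W *v z) \<bullet> (?W *v b) = (\<Sum>c\<in>B. (z \<bullet> c) * ((?W *v c) \<bullet> (?W *v b)))"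
          by (simp add: inner_sum_left)
        also have "\<dots> = (\<Sum>c\<in>B. if c = b then (z \<bullet> b) * (norm (?W *v b))^2 else 0)"
          using B(2) b by (intro sum.cong) (auto simp: power2_norm_eq_inner)
        also have "\<dots> = (z \<bullet> b) * (norm (?W *v b))^2" using b finB by simp
        finally have "\<bar>z \<bullet> b\<bar> * (norm (?W *v b))^2 \<le> norm (?W *v z) * norm (?W *v b)"
          using Cauchy_Schwarz_ineq2[of "?W *v z" "?W *v b"] by (simp add: abs_mult)
        then show ?thesis using B(3)[OF b] by (simp add: power2_eq_square mult_le_cancel_right flip: mult.assoc)
      qed
      define I where "I = (UNIV :: 'k set) \<times> B"
      define g where "g kb a = (if fst kb = l then Lm a \<bullet> snd kb else a $ fst kb \<bullet> snd kb)" for kb and a :: "real^'d^'k"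
      define wd where "wd kb = (if fst kb = l then min R' (u / norm (?W *v snd kb)) else R')" for kb :: "'k \<times> (real^'d)"
      have finI: "finite I" "card I = ?n" using finB cardB by (auto simp: I_def card_cartesian_product)
      have "emeasure lborel ?S \<le> ennreal (unit_ball_vol (real ?n) * (4 * c1 * real ?n) ^ ?n * (\<Prod>kb\<in>I. wd kb))"
      proof (rule emeasure_slab_le[where g = g, OF finI c1])
        show "0 < wd kb" if "kb \<in> I" for kb using that R' u B(3) by (auto simp: wd_def I_def)
        fix a kb assume a: "a \<in> ?S" and kb: "kb \<in> I"
        then have an: "norm (a $ j) \<le> R" for j using Finite_Cartesian_Product.norm_nth_le[of a j] by auto
        obtain k b where kb': "kb = (k, b)" "b \<in> B" using kb by (auto simp: I_def)
        show "\<bar>g kb a\<bar> \<le> wd kb"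
        proof (cases "k = l")
          case True
          have "\<bar>Lm a \<bullet> b\<bar> \<le> R'" using inner_le[OF kb'(2), of "Lm a"] Lle[OF an] by (simp add: R'_def)
          moreover have "\<bar>Lm a \<bullet> b\<bar> * norm (?W *v b) \<le> u"
            using Wb[OF kb'(2), of "Lm a"] a diff[of a] by (simp add: dist_norm)
          ultimately show ?thesis using True kb' B(3)[OF kb'(2)] by (simp add: g_def wd_def divide_simps)
        next
          case False
          then show ?thesis using kb' inner_le[OF kb'(2), of "a $ k"] an[of k] R' by (simp add: g_def wd_def)
        qed
      next
        fix a a' assume "a \<in> ?S" "a' \<in> ?S"
        define e where "e = a - a'"
        have ge: "g kb a - g kb a' = g kb e" for kb
          using linear_diff[OF linL, of a a'] by (simp add: g_def e_def inner_diff_left)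
        have sumI: "(\<Sum>kb\<in>I. \<bar>g kb e\<bar>) = (\<Sum>k\<in>UNIV. \<Sum>b\<in>B. \<bar>g (k, b) e\<bar>)"
          unfolding I_def by (simp add: sum.cartesian_product case_prod_beta)
        define N where "N k = (\<Sum>b\<in>B. \<bar>g (k, b) e\<bar>)" for k
        have N0: "0 \<le> N k" for k by (simp add: N_def sum_nonneg)
        have Nk: "norm (e $ k) \<le> N k" if "k \<noteq> l" for k
          using norm_le[of "e $ k"] that by (simp add: N_def g_def)
        have Nl: "norm (Lm e) \<le> N l" using norm_le[of "Lm e"] by (simp add: N_def g_def)
        define s where "s = (\<Sum>k\<in>UNIV - {l}. N k)"
        have s0: "0 \<le> s" using N0 by (simp add: s_def sum_nonneg)
        \<comment> \<open>Removing the component \<open>l\<close> isolates its contribution to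
          \<open>Lm\<close>, to which transversality applies; the rest is controlled by the other
          components.\<close>
        define e' where "e' = e - axis l (e $ l)"
        have "norm (e' $ k) \<le> s" for k
        proof (cases "k = l")
          case False
          then have "norm (e' $ k) \<le> N k" using Nk by (simp add: e'_def axis_def)
          also have "\<dots> \<le> s" unfolding s_def using False N0 by (intro member_le_sum) auto
          finally show ?thesis .
        qed (simp add: e'_def axis_def s0)
        then have Le': "norm (Lm e') \<le> 2 * s / (1 - \<rho>)" by (rule Lle)
        have "Lm (axis l (e $ l)) = Lm e - Lm e'"
          using linear_diff[OF linL, of e e'] by (simp add: e'_def)
        then have "\<kappa> * norm (e $ l) \<le> norm (Lm e - Lm e')" using l[of "e $ l"] by (simp add: Lm_def)
        also have "\<dots> \<le> N l + 2 * s / (1 - \<rho>)" using norm_triangle_ineq4[of "Lm e" "Lm e'"] Nl Le' by linarith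
        finally have el: "norm (e $ l) \<le> 1 / \<kappa> * N l + 2 / ((1 - \<rho>) * \<kappa>) * s"
          using \<kappa> \<rho> by (simp add: divide_simps) (simp add: algebra_simps)
        have "norm e \<le> (\<Sum>k\<in>UNIV. norm (e $ k))"
          unfolding norm_vec_def by (rule L2_set_le_sum) simp
        also have "\<dots> = norm (e $ l) + (\<Sum>k\<in>UNIV - {l}. norm (e $ k))" by (simp add: sum.remove)
        also have "(\<Sum>k\<in>UNIV - {l}. norm (e $ k)) \<le> s" unfolding s_def using Nk by (intro sum_mono) auto
        finally have "norm e \<le> 1 / \<kappa> * N l + (2 / ((1 - \<rho>) * \<kappa>) + 1) * s" using el by (simp add: distrib_right)
        also have "\<dots> \<le> c1 * N l + c1 * s"
          using \<kappa> \<rho> N0 s0 by (intro add_mono mult_right_mono) (auto simp: c1_def)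
        also have "\<dots> = c1 * (\<Sum>kb\<in>I. \<bar>g kb e\<bar>)"
          unfolding sumI N_def[symmetric] s_def by (simp add: sum.remove[of UNIV l] distrib_left)
        finally show "norm (a - a') \<le> c1 * (\<Sum>kb\<in>I. \<bar>g kb a - g kb a'\<bar>)" by (simp add: ge e_def)
      qed
      also have "\<dots> \<le> ennreal ((V + V1) * Z_kernel T u x y)"
      proof (rule ennreal_leI)
        have "(\<Prod>kb\<in>I. wd kb) \<le> (\<Prod>kb\<in>I. R' * (if fst kb = l then min 1 (u / norm (?W *v snd kb)) else 1))"
        proof (rule prod_mono, intro conjI)
          fix kb assume kb: "kb \<in> I"
          have t: "0 < u / norm (?W *v snd kb)" using kb u B(3) by (auto simp: I_def)
          then show "0 \<le> wd kb" using R' by (auto simp: wd_def)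
          have "min R' t \<le> R' * min 1 t" if "0 < t" for t
            using R' that by (auto simp: min_def mult_le_cancel_right1)
          then show "wd kb \<le> R' * (if fst kb = l then min 1 (u / norm (?W *v snd kb)) else 1)"
            using t by (auto simp: wd_def)
        qed
        also have "\<dots> = R' ^ ?n * (\<Prod>k\<in>UNIV. \<Prod>b\<in>B. if k = l then min 1 (u / norm (?W *v b)) else 1)"
          unfolding prod.distrib prod_constant finI(2) by (simp add: I_def prod.cartesian_product case_prod_beta)
        also have "(\<Prod>k\<in>UNIV. \<Prod>b\<in>B. if k = l then min 1 (u / norm (?W *v b)) else 1) =
            (\<Prod>k\<in>(UNIV :: 'k set). if k = l then zw u w else 1)"
          by (intro prod.cong) (auto simp: B(5))
        also have "\<dots> = zw u w" by simp
        also have "zw u w = Z_kernel T u x y" using False by (simp add: Z_kernel_eq w_def n_def)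
        finally have "unit_ball_vol (real ?n) * (4 * c1 * real ?n) ^ ?n * (\<Prod>kb\<in>I. wd kb) \<le>
            unit_ball_vol (real ?n) * (4 * c1 * real ?n) ^ ?n * (R' ^ ?n * Z_kernel T u x y)"
          using c1 by (intro mult_left_mono) auto
        also have "\<dots> = V * Z_kernel T u x y" by (simp add: V_def)
        also have "\<dots> \<le> (V + V1) * Z_kernel T u x y"
          using V1 zw_pos[OF u] by (intro mult_right_mono) (auto simp: Z_kernel_eq less_imp_le)
        finally show "unit_ball_vol (real ?n) * (4 * c1 * real ?n) ^ ?n * (\<Prod>kb\<in>I. wd kb) \<le> (V + V1) * Z_kernel T u x y" .
      qed
      finally show ?thesis .
    qed
  qed
qed

lemma capacity_dims_le:
  assumes "admissible \<Phi>" "\<And>\<epsilon>. \<epsilon> > 0 \<Longrightarrow> ((\<lambda>r. r powr \<epsilon> * ln (\<Phi> r)) \<longlongrightarrow> 0) (at_right 0)" and E: "E \<noteq> {}"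
  shows "lower_Phi_dim \<Phi> (coding_map T a ` E) \<le> lower_capacity_dim \<Phi> T E"
    "upper_Phi_dim \<Phi> (coding_map T a ` E) \<le> upper_capacity_dim \<Phi> T E"
proof -
  interpret dim_kernel \<Phi> "Z_kernel T" "2 ^ CARD('d)" E "\<lambda>s r. capacity code_topology (code_kernel \<Phi> T s r) E" "real CARD('d)" 1
    by (rule code_dim_kernel[OF assms])
  have bd: "bounded (coding_map T a ` E)"
    by (rule boundedI[of _ "norm a / (1 - \<rho>)"]) (auto intro!: coding_le Finite_Cartesian_Product.norm_nth_le)
  show "lower_Phi_dim \<Phi> (coding_map T a ` E) \<le> lower_capacity_dim \<Phi> T E"
    "upper_Phi_dim \<Phi> (coding_map T a ` E) \<le> upper_capacity_dim \<Phi> T E"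
    using Phi_dims_le[OF cover_hyp_code bd]
    by (simp_all add: lower_capacity_dim_def upper_capacity_dim_def lower_cap_def upper_cap_def)
qed

text \<open>Lebesgue measure is infinite and transversality is an estimate on balls, so the almost
  sure result is applied to the restriction to each ball of a countable exhaustion.\<close>

lemma capacity_dims_AE_eq:
  assumes "admissible \<Phi>" "\<And>\<epsilon>. \<epsilon> > 0 \<Longrightarrow> ((\<lambda>r. r powr \<epsilon> * ln (\<Phi> r)) \<longlongrightarrow> 0) (at_right 0)" and E: "E \<noteq> {}"
    and half: "\<rho> < 1/2"
  shows "AE a in lborel. lower_Phi_dim \<Phi> (coding_map T a ` E) = lower_capacity_dim \<Phi> T E \<and>
    upper_Phi_dim \<Phi> (coding_map T a ` E) = upper_capacity_dim \<Phi> T E"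
proof -
  interpret dim_kernel \<Phi> "Z_kernel T" "2 ^ CARD('d)" E "\<lambda>s r. capacity code_topology (code_kernel \<Phi> T s r) E" "real CARD('d)" 1
    by (rule code_dim_kernel[OF assms(1-3)])
  let ?Q = "\<lambda>a. lower_Phi_dim \<Phi> (coding_map T a ` E) = lower_capacity_dim \<Phi> T E \<and>
    upper_Phi_dim \<Phi> (coding_map T a ` E) = upper_capacity_dim \<Phi> T E"
  have meas: "(\<lambda>a. coding_map T a x) \<in> borel_measurable borel" for x
    using coding_linear by (intro borel_measurable_continuous_onI linear_continuous_on) (simp add: linear_linear)
  have "AE a in lborel. a \<in> cball 0 (real (Suc N)) \<longrightarrow> ?Q a" for N :: nat
  proof -
    define R where "R = real (Suc N)"
    define P where "P = restrict_space (lborel :: (real^'d^'k) measure) (cball 0 R)"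
    obtain c where c: "c \<ge> 0" "\<And>x y u. 0 < u \<Longrightarrow>
      emeasure lborel {a \<in> cball 0 R. dist (coding_map T a x) (coding_map T a y) \<le> u} \<le> ennreal (c * Z_kernel T u x y)"
      using coding_transversality[OF half, of R] by (auto simp: R_def)
    have sp: "space P = cball 0 R" by (simp add: P_def space_restrict_space)
    have "AE a in P. lower_Phi_dim \<Phi> (coding_map T a ` E) = lower_cap \<and> upper_Phi_dim \<Phi> (coding_map T a ` E) = upper_cap"
    proof (rule AE_Phi_dims_eq[where ?u1.0 = 1 and c = c])
      show "finite_measure P"
        unfolding P_def by (rule finite_measureI) (simp add: space_restrict_space emeasure_restrict_space emeasure_cball R_def)
      show "(\<lambda>a. coding_map T a x) \<in> borel_measurable P" for x
        unfolding P_def using meas[of x] by (intro measurable_restrict_space1) simp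
      show "emeasure P {a \<in> space P. dist (coding_map T a x) (coding_map T a y) \<le> u} \<le> ennreal (c * Z_kernel T u x y)"
        if "0 < u" for x y u
      proof -
        have "emeasure P {a \<in> space P. dist (coding_map T a x) (coding_map T a y) \<le> u} =
            emeasure lborel {a \<in> cball 0 R. dist (coding_map T a x) (coding_map T a y) \<le> u}"
          unfolding sp unfolding P_def by (rule emeasure_restrict_space) auto
        then show ?thesis using c(2)[OF that, of x y] by simp
      qed
      show "AE a in P. cover_hyp (Z_kernel T) E (coding_map T a) \<and> bounded (coding_map T a ` E)"
      proof (intro always_eventually allI conjI)
        fix a show "cover_hyp (Z_kernel T) E (coding_map T a)" by (rule cover_hyp_code)
        show "bounded (coding_map T a ` E)"
          by (rule boundedI[of _ "norm a / (1 - \<rho>)"]) (auto intro!: coding_le Finite_Cartesian_Product.norm_nth_le)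
      qed
    qed (use c in auto)
    then show ?thesis
      unfolding P_def by (subst (asm) AE_restrict_space_iff)
        (auto simp: R_def lower_capacity_dim_def upper_capacity_dim_def lower_cap_def upper_cap_def)
  qed
  then have "AE a in lborel. \<forall>N. a \<in> cball 0 (real (Suc N)) \<longrightarrow> ?Q a" by (subst AE_all_countable) blast
  then show ?thesis
  proof eventually_elim
    case (elim a)
    obtain N where "norm a \<le> real N" using real_arch_simple by blast
    then have "a \<in> cball 0 (real (Suc N))" by simp
    then show ?case using elim by blast
  qed
qed

end

section \<open>Orthogonal projections\<close>

lemma profile_kernel_1:
  assumes "0 < \<Phi> r"
  shows "profile_kernel \<Phi> (real m) s r = ker_max \<Phi> (profile_Z 1 m) s r"
  unfolding profile_kernel_def ker_max_def profile_Z_def using assms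
  by (intro ext SUP_cong) auto

lemma profile_eq_cap:
  fixes E :: "'a::euclidean_space set"
  assumes dk: "dim_kernel \<Phi> (profile_Z 1 m) C0 E (\<lambda>s r. capacity euclidean (ker_max \<Phi> (profile_Z 1 m) s r) E) (real m) c0"
  shows "upper_profile \<Phi> (real m) E = dim_kernel.upper_cap (\<lambda>s r. capacity euclidean (ker_max \<Phi> (profile_Z 1 m) s r) E) (real m)"
    "lower_profile \<Phi> (real m) E = dim_kernel.lower_cap (\<lambda>s r. capacity euclidean (ker_max \<Phi> (profile_Z 1 m) s r) E) (real m)"
proof -
  interpret dim_kernel \<Phi> "profile_Z 1 m" C0 E "\<lambda>s r. capacity euclidean (ker_max \<Phi> (profile_Z 1 m) s r) E" "real m" c0
    by (rule dk)
  have ev: "\<forall>\<^sub>F r in at_right 0. capacity euclidean (profile_kernel \<Phi> (real m) s r) E =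
      capacity euclidean (ker_max \<Phi> (profile_Z 1 m) s r) E" for s
    using Phi_small[of 1, OF zero_less_one] by eventually_elim (simp add: profile_kernel_1)
  show "upper_profile \<Phi> (real m) E = upper_cap" "lower_profile \<Phi> (real m) E = lower_cap"
    unfolding upper_profile_def upper_cap_def lower_profile_def lower_cap_def
    using Limsup_eq[OF ev] Liminf_eq[OF ev] by simp_all
qed

section \<open>Orthogonal projections and adapted bases\<close>

lemma orth_proj_norm_le:
  assumes "subspace V" shows "norm (orth_proj V x) \<le> norm x"
proof -
  have "orthogonal (x - orth_proj V x) (orth_proj V x)" using orth_proj[OF assms] by blast
  then have "(norm (x - orth_proj V x + orth_proj V x))\<^sup>2 = (norm (x - orth_proj V x))\<^sup>2 + (norm (orth_proj V x))\<^sup>2"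
    by (rule norm_add_Pythagorean)
  then have "(norm (orth_proj V x))\<^sup>2 \<le> (norm x)\<^sup>2" by simp
  then show ?thesis by (rule power2_le_imp_le) simp
qed

lemma orth_proj_image:
  assumes V: "subspace V" and g: "orthogonal_transformation g"
  shows "orth_proj (g ` V) (g x) = g (orth_proj V x)"
proof (rule orth_proj_unique)
  have lin: "linear g" using g by (rule orthogonal_transformation_linear)
  show "subspace (g ` V)" using lin V by (rule linear_subspace_image)
  show "g (orth_proj V x) \<in> g ` V" using orth_proj(1)[OF V] by blast
  fix w assume "w \<in> g ` V"
  then obtain v where v: "v \<in> V" "w = g v" by auto
  have "(g x - g (orth_proj V x)) \<bullet> g v = g (x - orth_proj V x) \<bullet> g v" using linear_diff[OF lin] by simp
  also have "\<dots> = (x - orth_proj V x) \<bullet> v" using g by (simp add: orthogonal_transformation_def)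
  also have "\<dots> = 0" using orth_proj(2)[OF V v(1)] by (simp add: orthogonal_def)
  finally show "orthogonal (g x - g (orth_proj V x)) w" using v by (simp add: orthogonal_def)
qed

lemma orth_proj_diff_le:
  assumes V: "subspace V" and W: "subspace W"
  shows "norm (orth_proj V x - orth_proj W x) \<le> grass_dist V W * norm x"
proof -
  have "bounded_linear (\<lambda>x. orth_proj V x - orth_proj W x)"
    using V W by (intro bounded_linear_sub linear_conv_bounded_linear[THEN iffD1] linear_orth_proj)
  from onorm[OF this, of x] show ?thesis using V W by (simp add: grass_dist_def)
qed

text \<open>Rotating both subspaces conjugates the difference of their projections. The resulting
  continuity of the rotation action yields its measurability.\<close>

lemma grass_dist_image_le:
  assumes V: "subspace V" and W: "subspace W" and g: "orthogonal_transformation (g :: 'a::euclidean_space \<Rightarrow> 'a)"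
  shows "grass_dist (g ` V) (g ` W) \<le> grass_dist V W"
proof -
  have lin: "linear g" using g by (rule orthogonal_transformation_linear)
  have sub: "subspace (g ` V)" "subspace (g ` W)" using lin V W by (auto intro: linear_subspace_image)
  have "onorm (\<lambda>x. orth_proj (g ` V) x - orth_proj (g ` W) x) \<le> grass_dist V W"
  proof (rule onorm_le)
    fix x
    obtain y where y: "x = g y" using orthogonal_transformation_surj[OF g] by (metis surjD)
    have "norm (orth_proj (g ` V) x - orth_proj (g ` W) x) = norm (g (orth_proj V y - orth_proj W y))"
      unfolding y orth_proj_image[OF V g] orth_proj_image[OF W g] using linear_diff[OF lin] by simp
    also have "\<dots> = norm (orth_proj V y - orth_proj W y)" using g by (rule orthogonal_transformation_norm)
    also have "\<dots> \<le> grass_dist V W * norm y" by (rule orth_proj_diff_le[OF V W])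
    also have "norm y = norm x" unfolding y using g by (simp add: orthogonal_transformation_norm)
    finally show "norm (orth_proj (g ` V) x - orth_proj (g ` W) x) \<le> grass_dist V W * norm x" .
  qed
  then show ?thesis using sub by (simp add: grass_dist_def)
qed

lemma subspace_onb:
  fixes V :: "'a::euclidean_space set"
  assumes V: "subspace V"
  obtains B C where "onb (B \<union> C)" "B \<inter> C = {}" "finite B" "card B = dim V" "B \<subseteq> V" "V \<subseteq> span B"
    "pairwise orthogonal B" "\<And>b. b \<in> B \<Longrightarrow> norm b = 1"
proof -
  obtain B where B: "B \<subseteq> V" "pairwise orthogonal B" "\<And>x. x \<in> B \<Longrightarrow> norm x = 1" "independent B" "card B = dim V" "span B = V"
    by (rule orthonormal_basis_subspace[OF V]) auto
  define W where "W = {x. \<forall>v\<in>V. x \<bullet> v = 0}"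
  have W: "subspace W" by (auto simp: W_def subspace_def inner_add_left)
  obtain C where C: "C \<subseteq> W" "pairwise orthogonal C" "\<And>x. x \<in> C \<Longrightarrow> norm x = 1" "independent C" "card C = dim W" "span C = W"
    by (rule orthonormal_basis_subspace[OF W]) auto
  have CB: "c \<bullet> b = 0" if "b \<in> B" "c \<in> C" for b c
    using that B(1) C(1) unfolding W_def by blast
  have BC: "b \<bullet> c = 0" if "b \<in> B" "c \<in> C" for b c
    using CB[OF that] by (simp only: inner_commute)
  have disj: "B \<inter> C = {}"
  proof -
    have False if "b \<in> B" "b \<in> C" for b using BC[OF that] B(3)[OF that(1)] by simp
    then show ?thesis by auto
  qed
  have fin: "finite B" "finite C" using B(4) C(4) independent_imp_finite by auto
  have "onb (B \<union> C)"
  proof (rule onbI)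
    show "finite (B \<union> C)" using fin by simp
    show "pairwise orthogonal (B \<union> C)"
      using B(2) C(2) BC CB unfolding pairwise_def orthogonal_def by blast
    show "norm b = 1" if "b \<in> B \<union> C" for b using that B(3) C(3) by auto
    have "x \<in> span (B \<union> C)" for x
    proof -
      have "orth_proj V x \<in> span B" using orth_proj(1)[OF V] B(6) by simp
      moreover have "x - orth_proj V x \<in> span C"
        unfolding C(6) W_def using orth_proj(2)[OF V] by (auto simp: orthogonal_def)
      ultimately have "orth_proj V x + (x - orth_proj V x) \<in> span (B \<union> C)"
        by (intro span_add) (auto intro: span_mono[THEN subsetD])
      then show ?thesis by simp
    qed
    then show "span (B \<union> C) = UNIV" by auto
  qed
  then show thesis using that[OF _ disj fin(1) B(5,1) _ B(2,3)] B(6) by simp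
qed

text \<open>In an orthonormal basis adapted to \<open>V\<close> the set lies in a box with
  \<open>dim V\<close> half-widths equal to \<open>t\<close> and the others equal to 1.\<close>

lemma emeasure_proj_slab_le:
  fixes V :: "'a::euclidean_space set"
  assumes V: "subspace V" and t: "t > 0"
  shows "emeasure lborel {x \<in> cball 0 1. norm (orth_proj V x) \<le> t} \<le>
    ennreal (unit_ball_vol (real DIM('a)) * (4 * real DIM('a)) ^ DIM('a) * t ^ dim V)"
proof -
  obtain B C where BC: "onb (B \<union> C)" "B \<inter> C = {}" "finite B" "card B = dim V" "B \<subseteq> V"
    using subspace_onb[OF V] by metis
  interpret onb "B \<union> C" by (rule BC)
  define w where "w b = (if b \<in> B then t else 1)" for b
  have "emeasure lborel {x \<in> cball 0 1. norm (orth_proj V x) \<le> t} \<le>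
    ennreal (unit_ball_vol (real DIM('a)) * (4 * 1 * real DIM('a)) ^ DIM('a) * (\<Prod>b\<in>B \<union> C. w b))"
  proof (rule emeasure_slab_le[where g = "\<lambda>b x. x \<bullet> b", OF finB cardB])
    show "0 < w b" for b using t by (simp add: w_def)
    fix x b assume x: "x \<in> {x \<in> cball 0 1. norm (orth_proj V x) \<le> t}" and b: "b \<in> B \<union> C"
    show "\<bar>x \<bullet> b\<bar> \<le> w b"
    proof (cases "b \<in> B")
      case True
      then have "(x - orth_proj V x) \<bullet> b = 0" using orth_proj(2)[OF V, of b x] BC(5) by (auto simp: orthogonal_def)
      then have "x \<bullet> b = orth_proj V x \<bullet> b" by (simp add: inner_diff_left)
      then show ?thesis using inner_le[OF b, of "orth_proj V x"] x True by (simp add: w_def)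
    next
      case False
      then show ?thesis using inner_le[OF b, of x] x by (simp add: w_def)
    qed
  next
    show "norm (a - b) \<le> 1 * (\<Sum>i\<in>B \<union> C. \<bar>a \<bullet> i - b \<bullet> i\<bar>)" for a b
      using norm_le[of "a - b"] by (simp add: inner_diff_left)
  qed simp
  also have "(\<Prod>b\<in>B \<union> C. w b) = t ^ dim V"
  proof -
    have "finite C" using finB by simp
    then have "(\<Prod>b\<in>B \<union> C. w b) = (\<Prod>b\<in>B. w b) * (\<Prod>b\<in>C. w b)" using BC by (intro prod.union_disjoint) auto
    also have "(\<Prod>b\<in>B. w b) = t ^ dim V" using BC(4) by (simp add: w_def)
    also have "(\<Prod>b\<in>C. w b) = 1" using BC(2) by (intro prod.neutral) (auto simp: w_def)
    finally show ?thesis by simp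
  qed
  finally show ?thesis by simp
qed

text \<open>Coordinates are taken along an orthonormal basis of \<open>V\<close>, so that their
  number, which becomes the exponent of the kernel, is \<open>m\<close>. Projections are
  1-Lipschitz, and the logarithm in \<open>cover_hyp_profile\<close> is at least 1 for
  \<open>u < exp (-1)\<close>.\<close>

lemma cover_hyp_orth_proj:
  fixes E :: "'a::euclidean_space set"
  assumes V: "subspace V" "dim V = m" "m \<ge> 1" and E: "bounded E"
  shows "cover_hyp (profile_Z 1 m) E (orth_proj V)"
proof -
  obtain B where B: "finite B" "card B = dim V" "B \<subseteq> V" "V \<subseteq> span B" "pairwise orthogonal B" "\<And>b. b \<in> B \<Longrightarrow> norm b = 1"
    using subspace_onb[OF V(1)] by metis
  note lin = linear_orth_proj[OF V(1)]
  have "cover_hyp (\<lambda>u x y. profile_phi (1 * real (card B)) (u powr (1 / 1)) (dist x y)) E (orth_proj V)"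
  proof (rule cover_hyp_profile[where I = B and g = "\<lambda>b y. y \<bullet> b" and ?u1.0 = "exp (-1)" and Cm = 1 and cg = 1])
    show "B \<noteq> {}" using B V by auto
    fix u h :: real and x y :: 'a assume u: "0 < u" "u < exp (-1)" and h: "u powr (1 / 1) \<le> h" and d: "dist x y \<le> h"
    have "ln u < ln (exp (-1))" using u by (subst ln_less_cancel_iff) auto
    then have L: "1 \<le> ln (1 / u)" using u by (simp add: ln_div)
    have "dist (orth_proj V x) (orth_proj V y) = norm (orth_proj V (x - y))"
      by (simp add: dist_norm linear_diff[OF lin])
    also have "\<dots> \<le> norm (x - y)" by (rule orth_proj_norm_le[OF V(1)])
    also have "\<dots> \<le> 1 * h" using d by (simp add: dist_norm)
    also have "\<dots> \<le> ln (1 / u) * h" using L u h by (intro mult_right_mono) auto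
    finally show "dist (orth_proj V x) (orth_proj V y) \<le> 1 * ln (1 / u) * h powr 1" using u h by simp
  next
    fix a b assume ab: "a \<in> orth_proj V ` E" "b \<in> orth_proj V ` E"
    then have "a - b \<in> span B" using orth_proj(1)[OF V(1)] B(4) V(1) by (auto intro!: subsetD[OF B(4)] subspace_diff)
    from orthonormal_expand[OF B(1,5,6) this]
    have "norm (a - b) = norm (\<Sum>c\<in>B. ((a - b) \<bullet> c) *\<^sub>R c)" by (rule arg_cong)
    also have "\<dots> \<le> (\<Sum>c\<in>B. norm (((a - b) \<bullet> c) *\<^sub>R c))" by (rule norm_sum)
    also have "\<dots> = (\<Sum>c\<in>B. \<bar>a \<bullet> c - b \<bullet> c\<bar>)" using B(6) by (simp add: inner_diff_left)
    finally show "dist a b \<le> 1 * (\<Sum>c\<in>B. \<bar>a \<bullet> c - b \<bullet> c\<bar>)" by (simp add: dist_norm)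
  next
    fix a b c assume "c \<in> B"
    then show "\<bar>a \<bullet> c - b \<bullet> c\<bar> \<le> dist a b"
      using Cauchy_Schwarz_ineq2[of "a - b" c] B(6) by (simp add: dist_norm inner_diff_left)
  qed (use B E in auto)
  moreover have "(\<lambda>u x y. profile_phi (1 * real (card B)) (u powr (1 / 1)) (dist x y)) = (profile_Z 1 m :: real \<Rightarrow> 'a \<Rightarrow> 'a \<Rightarrow> real)"
    using B V by (simp add: profile_Z_def[abs_def])
  ultimately show ?thesis by (simp only:)
qed

section \<open>The invariant measure on the Grassmannian\<close>

context
  fixes m :: nat and \<gamma> :: "(real^'d) set measure"
  assumes inv: "grass_invariant_measure m \<gamma>"
begin

lemma grass_prob: "prob_space \<gamma>" and grass_sets: "sets \<gamma> = sets (borel_of (grass_topology m))"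
  using inv by (auto simp: grass_invariant_measure_def)

lemma grass_topspace: "topspace (grass_topology m) = (grassmannian m :: (real^'d) set set)"
proof -
  interpret M: Metric_space "grassmannian m :: (real^'d) set set" grass_dist by (rule Metric_space_grassmannian)
  show ?thesis by (simp add: grass_topology_def)
qed

lemma grass_space: "space \<gamma> = grassmannian m"
  using sets_eq_imp_space_eq[OF grass_sets] by (simp add: space_borel_of grass_topspace)

lemma grass_subspace: "V \<in> space \<gamma> \<Longrightarrow> subspace V" "V \<in> space \<gamma> \<Longrightarrow> dim V = m"
  by (auto simp: grass_space grassmannian_def)

lemma grass_openI:
  assumes "U \<subseteq> (grassmannian m :: (real^'d) set set)" "\<And>V. V \<in> U \<Longrightarrow> \<exists>r>0. \<forall>W\<in>grassmannian m. grass_dist V W < r \<longrightarrow> W \<in> U"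
  shows "openin (grass_topology m) U"
proof -
  interpret M: Metric_space "grassmannian m :: (real^'d) set set" grass_dist by (rule Metric_space_grassmannian)
  show ?thesis
    unfolding grass_topology_def M.openin_mtopology using assms by (fastforce simp: M.mball_def)
qed

lemma grass_openD:
  assumes "openin (grass_topology m) U" "V \<in> (U :: (real^'d) set set)"
  shows "\<exists>r>0. \<forall>W\<in>grassmannian m. grass_dist V W < r \<longrightarrow> W \<in> U"
proof -
  interpret M: Metric_space "grassmannian m :: (real^'d) set set" grass_dist by (rule Metric_space_grassmannian)
  have U: "U \<subseteq> grassmannian m" using openin_subset[OF assms(1)] by (simp add: grass_topspace)
  obtain r where "r > 0" "M.mball V r \<subseteq> U"
    using assms unfolding grass_topology_def M.openin_mtopology by blast
  moreover have "W \<in> M.mball V r" if "W \<in> grassmannian m" "grass_dist V W < r" for W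
    using that U assms(2) by (simp add: M.in_mball subset_iff)
  ultimately show ?thesis by blast
qed

text \<open>For fixed \<open>x\<close> the projection depends continuously on \<open>V\<close> in
  the operator norm metric, so preimages of open sets are open.\<close>

lemma orth_proj_measurable: "(\<lambda>V. orth_proj V x) \<in> borel_measurable \<gamma>"
proof (rule borel_measurableI)
  fix S :: "(real^'d) set" assume S: "open S"
  have "openin (grass_topology m) ((\<lambda>V. orth_proj V x) -` S \<inter> grassmannian m)"
  proof (rule grass_openI)
    fix V assume V: "V \<in> (\<lambda>V. orth_proj V x) -` S \<inter> grassmannian m"
    then have "orth_proj V x \<in> S" by simp
    then obtain e where e: "e > 0" "ball (orth_proj V x) e \<subseteq> S" by (rule openE[OF S])
    show "\<exists>r>0. \<forall>W\<in>grassmannian m. grass_dist V W < r \<longrightarrow> W \<in> (\<lambda>V. orth_proj V x) -` S \<inter> grassmannian m"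
    proof (intro exI[of _ "e / (norm x + 1)"] conjI ballI impI)
      have p: "norm x + 1 > 0" by (simp add: add_nonneg_pos)
      then show "e / (norm x + 1) > 0" using e by simp
      fix W assume W: "W \<in> grassmannian m" "grass_dist V W < e / (norm x + 1)"
      have "norm (orth_proj V x - orth_proj W x) \<le> grass_dist V W * norm x"
        using V W by (intro orth_proj_diff_le) (auto simp: grassmannian_def)
      also have "\<dots> \<le> e / (norm x + 1) * norm x" using W by (intro mult_right_mono) auto
      also have "\<dots> < e" using e p by (simp add: divide_simps)
      finally have "orth_proj W x \<in> ball (orth_proj V x) e" by (simp add: dist_norm)
      then show "W \<in> (\<lambda>V. orth_proj V x) -` S \<inter> grassmannian m" using e W by auto
    qed
  qed auto
  then show "(\<lambda>V. orth_proj V x) -` S \<inter> space \<gamma> \<in> sets \<gamma>"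
    unfolding grass_space grass_sets by (rule openin_borel_of)
qed

lemma grass_image_measurable:
  assumes g: "orthogonal_transformation (g :: real^'d \<Rightarrow> real^'d)"
  shows "(\<lambda>V. g ` V) \<in> measurable \<gamma> \<gamma>"
proof (rule measurable_sigma_sets)
  have lin: "linear g" "inj g" using g orthogonal_transformation_linear orthogonal_transformation_inj by auto
  have img: "g ` V \<in> grassmannian m" if "V \<in> grassmannian m" for V
    using that lin by (auto simp: grassmannian_def linear_subspace_image dim_image_eq inj_on_subset)
  show "sets \<gamma> = sigma_sets (grassmannian m) {U. openin (grass_topology m) U}"
    unfolding grass_sets sets_borel_of grass_topspace ..
  show "{U. openin (grass_topology m) U} \<subseteq> Pow (grassmannian m :: (real^'d) set set)"
    using openin_subset grass_topspace by blast
  show "(\<lambda>V. g ` V) \<in> space \<gamma> \<rightarrow> grassmannian m" using img by (auto simp: grass_space)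
  fix U :: "(real^'d) set set" assume U: "U \<in> {U. openin (grass_topology m) U}"
  have "openin (grass_topology m) ((\<lambda>V. g ` V) -` U \<inter> grassmannian m)"
  proof (rule grass_openI)
    fix V assume V: "V \<in> (\<lambda>V. g ` V) -` U \<inter> grassmannian m"
    then obtain r where r: "r > 0" "\<And>W. W \<in> grassmannian m \<Longrightarrow> grass_dist (g ` V) W < r \<Longrightarrow> W \<in> U"
      using grass_openD[of U "g ` V"] U by auto
    show "\<exists>r>0. \<forall>W\<in>grassmannian m. grass_dist V W < r \<longrightarrow> W \<in> (\<lambda>V. g ` V) -` U \<inter> grassmannian m"
    proof (intro exI[of _ r] conjI ballI impI r(1))
      fix W assume W: "W \<in> grassmannian m" "grass_dist V W < r"
      have "grass_dist (g ` V) (g ` W) \<le> grass_dist V W"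
        using V W g by (intro grass_dist_image_le) (auto simp: grassmannian_def)
      then have "g ` W \<in> U" using W img by (intro r(2)) auto
      then show "W \<in> (\<lambda>V. g ` V) -` U \<inter> grassmannian m" using W by simp
    qed
  qed auto
  then show "(\<lambda>V. g ` V) -` U \<inter> space \<gamma> \<in> sets \<gamma>"
    unfolding grass_space grass_sets by (rule openin_borel_of)
qed

text \<open>The threshold is relative to \<open>norm x\<close>, which makes the function invariant
  under positive scalings as well as under rotations.\<close>

definition hit :: "real \<Rightarrow> real^'d \<Rightarrow> ennreal" where
  "hit t x = emeasure \<gamma> {V \<in> space \<gamma>. norm (orth_proj V x) \<le> t * norm x}"

lemma hit_sets: "{V \<in> space \<gamma>. norm (orth_proj V x) \<le> s} \<in> sets \<gamma>"
  using orth_proj_measurable[of x] by measurable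

lemma hit_orthogonal:
  assumes g: "orthogonal_transformation g"
  shows "hit t (g x) = hit t x"
proof -
  let ?A = "{V \<in> space \<gamma>. norm (orth_proj V (g x)) \<le> t * norm (g x)}"
  note gm = grass_image_measurable[OF g]
  have "distr \<gamma> \<gamma> (\<lambda>V. g ` V) = \<gamma>"
    using inv g unfolding grass_invariant_measure_def by blast
  then have "hit t (g x) = emeasure (distr \<gamma> \<gamma> (\<lambda>V. g ` V)) ?A" by (simp only: hit_def)
  also have "\<dots> = emeasure \<gamma> ((\<lambda>V. g ` V) -` ?A \<inter> space \<gamma>)"
    by (rule emeasure_distr[OF gm hit_sets])
  also have "(\<lambda>V. g ` V) -` ?A \<inter> space \<gamma> = {V \<in> space \<gamma>. norm (orth_proj V x) \<le> t * norm x}"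
    using measurable_space[OF gm] grass_subspace(1) g
    by (auto simp: orth_proj_image orthogonal_transformation_norm)
  finally show ?thesis by (simp add: hit_def)
qed

lemma hit_scale:
  assumes "c > 0" shows "hit t (c *\<^sub>R x) = hit t x"
proof -
  have "norm (orth_proj V (c *\<^sub>R x)) \<le> t * norm (c *\<^sub>R x) \<longleftrightarrow> norm (orth_proj V x) \<le> t * norm x" if "V \<in> space \<gamma>" for V
  proof -
    have "orth_proj V (c *\<^sub>R x) = c *\<^sub>R orth_proj V x"
      by (rule linear_scale[OF linear_orth_proj[OF grass_subspace(1)[OF that]]])
    then show ?thesis using assms by (simp add: mult.left_commute)
  qed
  then show ?thesis unfolding hit_def by (metis (no_types, lifting) Collect_cong)
qed

text \<open>Rotations and positive scalings together act transitively on the nonzero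
  vectors.\<close>

lemma hit_const:
  assumes "x \<noteq> 0" "y \<noteq> 0" shows "hit t x = hit t y"
proof -
  have "norm ((norm y / norm x) *\<^sub>R x) = norm y" using assms by simp
  then obtain g where g: "orthogonal_transformation g" "g ((norm y / norm x) *\<^sub>R x) = y"
    by (rule orthogonal_transformation_exists)
  have "hit t y = hit t ((norm y / norm x) *\<^sub>R x)" using hit_orthogonal[OF g(1)] g(2) by metis
  also have "\<dots> = hit t x" using assms by (intro hit_scale) simp
  finally show ?thesis by simp
qed

text \<open>
  By invariance \<open>hit t\<close> is constant off the origin; its value is found by integrating it over
  the unit ball and exchanging the order of integration, which avoids the Haar measure of the
  orthogonal group.
\<close>

lemma hit_le:
  assumes x: "x \<noteq> 0" and t: "t > 0"
  shows "hit t x \<le> ennreal ((4 * real CARD('d)) ^ CARD('d) * t ^ m)"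
proof -
  interpret G: prob_space \<gamma> by (rule grass_prob)
  let ?L = "lborel :: (real^'d) measure"
  interpret pair_sigma_finite \<gamma> ?L by unfold_locales
  let ?d = "DIM(real^'d)"
  define S where "S = {p \<in> space (\<gamma> \<Otimes>\<^sub>M ?L). norm (orth_proj (fst p) (snd p)) \<le> t * norm (snd p) \<and> norm (snd p) \<le> 1}"
  \<comment> \<open>Expressing the projection through its values on the standard basis gives joint
    measurability in \<open>(V, y)\<close> from measurability in \<open>V\<close> for fixed
    vectors.\<close>
  have expand: "orth_proj V y = (\<Sum>b\<in>Basis. (y \<bullet> b) *\<^sub>R orth_proj V b)" if "V \<in> space \<gamma>" for V y
  proof -
    note lin = linear_orth_proj[OF grass_subspace(1)[OF that]]
    have "orth_proj V y = orth_proj V (\<Sum>b\<in>Basis. (y \<bullet> b) *\<^sub>R b)" by (simp add: euclidean_representation)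
    also have "\<dots> = (\<Sum>b\<in>Basis. (y \<bullet> b) *\<^sub>R orth_proj V b)"
      by (simp add: linear_sum[OF lin] linear_scale[OF lin])
    finally show ?thesis .
  qed
  have meas: "(\<lambda>p. \<Sum>b\<in>Basis. (snd p \<bullet> b) *\<^sub>R orth_proj (fst p) b) \<in> borel_measurable (\<gamma> \<Otimes>\<^sub>M ?L)"
  proof (intro borel_measurable_sum borel_measurable_scaleR borel_measurable_inner)
    fix b :: "real^'d"
    show "(\<lambda>p. orth_proj (fst p) b) \<in> borel_measurable (\<gamma> \<Otimes>\<^sub>M ?L)"
      by (rule measurable_compose[OF measurable_fst orth_proj_measurable])
    show "snd \<in> borel_measurable (\<gamma> \<Otimes>\<^sub>M ?L)"
      using measurable_snd[of \<gamma> ?L] by (simp add: measurable_lborel1 cong: measurable_cong_sets)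
  qed simp
  have snd: "snd \<in> borel_measurable (\<gamma> \<Otimes>\<^sub>M ?L)"
    using measurable_snd[of \<gamma> ?L] by (simp cong: measurable_cong_sets)
  have "{p \<in> space (\<gamma> \<Otimes>\<^sub>M ?L). norm (\<Sum>b\<in>Basis. (snd p \<bullet> b) *\<^sub>R orth_proj (fst p) b) \<le> t * norm (snd p) \<and> norm (snd p) \<le> 1} \<in> sets (\<gamma> \<Otimes>\<^sub>M ?L)"
    using meas snd by measurable
  also have "{p \<in> space (\<gamma> \<Otimes>\<^sub>M ?L). norm (\<Sum>b\<in>Basis. (snd p \<bullet> b) *\<^sub>R orth_proj (fst p) b) \<le> t * norm (snd p) \<and> norm (snd p) \<le> 1} = S"
    unfolding S_def using expand by (intro Collect_cong) (auto simp: space_pair_measure)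
  finally have S: "S \<in> sets (\<gamma> \<Otimes>\<^sub>M ?L)" .
  let ?B = "cball (0::real^'d) 1"
  have vol: "emeasure ?L ?B = ennreal (unit_ball_vol (real ?d))" by (simp add: emeasure_cball)
  have "hit t x * emeasure ?L ?B = (\<integral>\<^sup>+y. hit t x * indicator ?B y \<partial>?L)"
    by (simp add: nn_integral_cmult_indicator)
  also have "\<dots> = (\<integral>\<^sup>+y. (\<integral>\<^sup>+V. indicator S (V, y) \<partial>\<gamma>) \<partial>?L)"
  proof (rule nn_integral_cong_AE)
    \<comment> \<open>The common value of \<open>hit\<close> is taken off the origin, which is a
      null set.\<close>
    have "AE y in ?L. y \<noteq> 0" by (rule AE_lborel_singleton)
    then show "AE y in ?L. hit t x * indicator ?B y = (\<integral>\<^sup>+V. indicator S (V, y) \<partial>\<gamma>)"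
    proof eventually_elim
      case (elim y)
      have "(\<integral>\<^sup>+V. indicator S (V, y) \<partial>\<gamma>) = (\<integral>\<^sup>+V. indicator {V \<in> space \<gamma>. norm (orth_proj V y) \<le> t * norm y} V * indicator ?B y \<partial>\<gamma>)"
        by (intro nn_integral_cong) (auto simp: S_def space_pair_measure indicator_def)
      also have "\<dots> = hit t y * indicator ?B y"
        unfolding hit_def
        by (subst nn_integral_multc[OF borel_measurable_indicator[OF hit_sets]]) (simp only: nn_integral_indicator[OF hit_sets])
      also have "hit t y = hit t x" using elim x by (rule hit_const)
      finally show ?case by simp
    qed
  qed
  also have "\<dots> = (\<integral>\<^sup>+V. (\<integral>\<^sup>+y. indicator S (V, y) \<partial>?L) \<partial>\<gamma>)"
    using S by (intro Fubini'[of "\<lambda>V y. indicator S (V, y)"]) simp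
  also have "\<dots> \<le> (\<integral>\<^sup>+V. ennreal (unit_ball_vol (real ?d) * (4 * real ?d) ^ ?d * t ^ m) \<partial>\<gamma>)"
  proof (rule nn_integral_mono)
    fix V assume V: "V \<in> space \<gamma>"
    have "(\<integral>\<^sup>+y. indicator S (V, y) \<partial>?L) = (\<integral>\<^sup>+y. indicator (Pair V -` S) y \<partial>?L)"
      by (simp add: indicator_def)
    also have "\<dots> = emeasure ?L (Pair V -` S)" using sets_Pair1[OF S] by simp
    also have "\<dots> \<le> emeasure ?L {y \<in> ?B. norm (orth_proj V y) \<le> t}"
    proof (rule emeasure_mono)
      show "Pair V -` S \<subseteq> {y \<in> ?B. norm (orth_proj V y) \<le> t}"
        using t by (auto simp: S_def intro: order.trans mult_left_le)
      have "continuous_on UNIV (orth_proj V)"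
        using linear_orth_proj[OF grass_subspace(1)[OF V]] by (intro linear_continuous_on) (simp add: linear_linear)
      then have "closed {y. norm (orth_proj V y) \<le> t}"
        by (intro closed_Collect_le continuous_intros)
      then have "closed (?B \<inter> {y. norm (orth_proj V y) \<le> t})" by (intro closed_Int closed_cball)
      then have "closed {y \<in> ?B. norm (orth_proj V y) \<le> t}" by (simp only: Collect_conj_eq Collect_mem_eq)
      then show "{y \<in> ?B. norm (orth_proj V y) \<le> t} \<in> sets ?L" by (simp add: borel_closed)
    qed
    also have "\<dots> \<le> ennreal (unit_ball_vol (real ?d) * (4 * real ?d) ^ ?d * t ^ m)"
      using emeasure_proj_slab_le[OF grass_subspace(1)[OF V] t] grass_subspace(2)[OF V] by simp
    finally show "(\<integral>\<^sup>+y. indicator S (V, y) \<partial>?L) \<le> ennreal (unit_ball_vol (real ?d) * (4 * real ?d) ^ ?d * t ^ m)" .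
  qed
  also have "\<dots> = ennreal (unit_ball_vol (real ?d)) * ennreal ((4 * real ?d) ^ ?d * t ^ m)"
    using t by (simp add: G.emeasure_space_1 mult.assoc flip: ennreal_mult)
  finally have "ennreal (unit_ball_vol (real ?d)) * hit t x \<le> ennreal (unit_ball_vol (real ?d)) * ennreal ((4 * real ?d) ^ ?d * t ^ m)"
    by (simp add: vol mult.commute)
  then have "hit t x \<le> ennreal ((4 * real ?d) ^ ?d * t ^ m)"
  proof (subst (asm) ennreal_mult_le_mult_iff)
    have "0 < unit_ball_vol (real ?d)" by (rule unit_ball_vol_pos) simp
    then show "ennreal (unit_ball_vol (real ?d)) \<noteq> 0" by (simp only: ennreal_eq_0_iff not_le)
  qed auto
  then show ?thesis by simp
qed

text \<open>When \<open>(u / dist x y) ^ m \<le> 1\<close> this follows from \<open>hit_le\<close>.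
  For larger ratios, and for equal points, the kernel is 1 and the trivial bound for a probability
  applies; hence the added 1 in the constant.\<close>

lemma grass_small_ball:
  fixes x y :: "real^'d"
  assumes u: "u > 0"
  shows "emeasure \<gamma> {V \<in> space \<gamma>. dist (orth_proj V x) (orth_proj V y) \<le> u}
    \<le> ennreal (((4 * real CARD('d)) ^ CARD('d) + 1) * profile_Z 1 m u x y)"
proof -
  interpret G: prob_space \<gamma> by (rule grass_prob)
  let ?c = "(4 * real CARD('d)) ^ CARD('d)"
  let ?S = "{V \<in> space \<gamma>. dist (orth_proj V x) (orth_proj V y) \<le> u}"
  have le1: "emeasure \<gamma> ?S \<le> ennreal 1" by (simp add: G.emeasure_le_1)
  show ?thesis
  proof (cases "x = y")
    case True
    then have "profile_Z 1 m u x y = 1" by (simp add: profile_Z_def profile_phi_def)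
    then have "ennreal 1 \<le> ennreal ((?c + 1) * profile_Z 1 m u x y)" by (intro ennreal_leI) simp
    with le1 show ?thesis by (rule order_trans)
  next
    case False
    define t where "t = u / dist x y"
    have t: "t > 0" using u False by (simp add: t_def)
    have Z: "profile_Z 1 m u x y = min 1 (t ^ m)"
      using profile_Z_eq[of 1 u x y m] u False by (simp add: t_def power_divide powr_realpow)
    have "?S = {V \<in> space \<gamma>. norm (orth_proj V (x - y)) \<le> t * norm (x - y)}"
      using False by (auto simp: t_def dist_norm linear_diff[OF linear_orth_proj[OF grass_subspace(1)]])
    then have "emeasure \<gamma> ?S = hit t (x - y)" by (simp add: hit_def)
    also have "\<dots> \<le> ennreal (?c * t ^ m)" using False t by (intro hit_le) auto
    finally have le2: "emeasure \<gamma> ?S \<le> ennreal (?c * t ^ m)" .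
    show ?thesis
    proof (cases "t ^ m \<le> 1")
      case True
      have "ennreal (?c * t ^ m) \<le> ennreal ((?c + 1) * profile_Z 1 m u x y)"
        unfolding Z using True t by (intro ennreal_leI mult_mono) auto
      with le2 show ?thesis by (rule order_trans)
    next
      case False
      have "ennreal 1 \<le> ennreal ((?c + 1) * profile_Z 1 m u x y)"
        unfolding Z using False by (intro ennreal_leI) simp
      with le1 show ?thesis by (rule order_trans)
    qed
  qed
qed

end

lemma projection_dims_le:
  fixes E :: "'a::euclidean_space set"
  assumes adm: "admissible \<Phi>" "\<And>\<epsilon>. \<epsilon> > 0 \<Longrightarrow> ((\<lambda>r. r powr \<epsilon> * ln (\<Phi> r)) \<longlongrightarrow> 0) (at_right 0)"
    and m: "m \<ge> 1" and E: "E \<noteq> {}" "bounded E" and V: "V \<in> grassmannian m"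
  shows "lower_Phi_dim \<Phi> (orth_proj V ` E) \<le> lower_profile \<Phi> (real m) E"
    "upper_Phi_dim \<Phi> (orth_proj V ` E) \<le> upper_profile \<Phi> (real m) E"
proof -
  let ?cap = "\<lambda>s r. capacity euclidean (ker_max \<Phi> (profile_Z 1 m) s r) E"
  have dk: "dim_kernel \<Phi> (profile_Z 1 m) (2 ^ m) E ?cap (real m) (2 powr (1 * real m))"
    by (rule profile_dim_kernel[OF adm(1) _ zero_less_one E]) (rule adm(2))
  have eq: "upper_profile \<Phi> (real m) E = dim_kernel.upper_cap ?cap (real m)"
    "lower_profile \<Phi> (real m) E = dim_kernel.lower_cap ?cap (real m)"
    by (rule profile_eq_cap(1)[OF dk]) (rule profile_eq_cap(2)[OF dk])
  have V': "subspace V" "dim V = m" using V by (auto simp: grassmannian_def)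
  have "bounded (orth_proj V ` E)"
    using E(2) linear_orth_proj[OF V'(1)] by (simp add: bounded_linear_image linear_conv_bounded_linear)
  then show "lower_Phi_dim \<Phi> (orth_proj V ` E) \<le> lower_profile \<Phi> (real m) E"
    "upper_Phi_dim \<Phi> (orth_proj V ` E) \<le> upper_profile \<Phi> (real m) E"
    unfolding eq
    using dim_kernel.Phi_dims_le[OF dk cover_hyp_orth_proj[OF V' m E(2)]] by auto
qed

lemma projection_dims_AE_eq:
  fixes E :: "(real^'d) set"
  assumes adm: "admissible \<Phi>" "\<And>\<epsilon>. \<epsilon> > 0 \<Longrightarrow> ((\<lambda>r. r powr \<epsilon> * ln (\<Phi> r)) \<longlongrightarrow> 0) (at_right 0)"
    and m: "m \<ge> 1" and E: "E \<noteq> {}" "bounded E" and inv: "grass_invariant_measure m \<gamma>"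
  shows "AE V in \<gamma>. lower_Phi_dim \<Phi> (orth_proj V ` E) = lower_profile \<Phi> (real m) E \<and>
    upper_Phi_dim \<Phi> (orth_proj V ` E) = upper_profile \<Phi> (real m) E"
proof -
  let ?cap = "\<lambda>s r. capacity euclidean (ker_max \<Phi> (profile_Z 1 m) s r) E"
  have dk: "dim_kernel \<Phi> (profile_Z 1 m) (2 ^ m) E ?cap (real m) (2 powr (1 * real m))"
    by (rule profile_dim_kernel[OF adm(1) _ zero_less_one E]) (rule adm(2))
  have eq: "upper_profile \<Phi> (real m) E = dim_kernel.upper_cap ?cap (real m)"
    "lower_profile \<Phi> (real m) E = dim_kernel.lower_cap ?cap (real m)"
    by (rule profile_eq_cap(1)[OF dk]) (rule profile_eq_cap(2)[OF dk])
  interpret G: prob_space \<gamma> by (rule grass_prob[OF inv])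
  show ?thesis
    unfolding eq
  proof (rule dim_kernel.AE_Phi_dims_eq[OF dk, where ?u1.0 = 1 and c = "(4 * real CARD('d)) ^ CARD('d) + 1"])
    show "finite_measure \<gamma>" by unfold_locales
    show "(\<lambda>V. orth_proj V x) \<in> borel_measurable \<gamma>" for x by (rule orth_proj_measurable[OF inv])
    show "emeasure \<gamma> {V \<in> space \<gamma>. dist (orth_proj V x) (orth_proj V y) \<le> u}
        \<le> ennreal (((4 * real CARD('d)) ^ CARD('d) + 1) * profile_Z 1 m u x y)" if "0 < u" for x y u
      by (rule grass_small_ball[OF inv that])
    show "AE V in \<gamma>. cover_hyp (profile_Z 1 m) E (orth_proj V) \<and> bounded (orth_proj V ` E)"
    proof (rule AE_I2)
      fix V assume V: "V \<in> space \<gamma>"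
      show "cover_hyp (profile_Z 1 m) E (orth_proj V) \<and> bounded (orth_proj V ` E)"
        using E(2) linear_orth_proj[OF grass_subspace(1)[OF inv V]]
          cover_hyp_orth_proj[OF grass_subspace[OF inv V] m E(2)]
        by (simp add: bounded_linear_image linear_conv_bounded_linear)
    qed
  qed auto
qed

section \<open>Fractional Brownian motion\<close>

lemma mat_vector_mult: "(mat s :: real^'n^'n) *v c = s *\<^sub>R c"
proof -
  have "mat s = s *\<^sub>R (mat 1 :: real^'n^'n)" by (simp add: mat_def vec_eq_iff)
  then show ?thesis by (simp add: scaleR_matrix_vector_assoc[symmetric])
qed

section \<open>Gaussian estimates for increments\<close>

locale fbm =
  fixes M :: "'w measure" and \<alpha> :: real and B :: "real^'d \<Rightarrow> 'w \<Rightarrow> real^'n"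
  assumes fbm: "fractional_brownian_motion M \<alpha> B" and \<alpha>: "0 < \<alpha>" "\<alpha> \<le> 1"
begin

sublocale prob_space M
  using fbm by (simp add: fractional_brownian_motion_def)

lemma B_meas: "B x \<in> borel_measurable M"
  using fbm by (simp add: fractional_brownian_motion_def gaussian_process_def)

lemma component_meas: "(\<lambda>\<omega>. (B x \<omega> - B y \<omega>) $ i) \<in> borel_measurable M"
  using borel_measurable_diff[OF B_meas[of x] B_meas[of y]] by (rule measurable_compose) simp

lemma increment_distributed:
  assumes "x \<noteq> y"
  shows "distributed M lborel (\<lambda>\<omega>. (B x \<omega> - B y \<omega>) $ i) (normal_density 0 (norm (x - y) powr \<alpha>))"
proof -
  let ?s = "norm (x - y) powr (2 * \<alpha>)"
  have "normal_rv M (\<lambda>\<omega>. axis i 1 \<bullet> (B x \<omega> - B y \<omega>)) (axis i 1 \<bullet> (0 :: real^'n)) (axis i 1 \<bullet> (mat ?s *v (axis i 1 :: real^'n)))"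
    using fbm unfolding fractional_brownian_motion_def multivariate_normal_def by blast
  moreover have "axis i 1 \<bullet> (mat ?s *v (axis i 1 :: real^'n)) = ?s"
    by (simp add: mat_vector_mult inner_axis)
  moreover have "axis i 1 \<bullet> v = v $ i" for v :: "real^'n" by (simp add: inner_axis')
  ultimately have "normal_rv M (\<lambda>\<omega>. (B x \<omega> - B y \<omega>) $ i) 0 ?s" by simp
  moreover have "?s \<noteq> 0" using assms by simp
  moreover have "sqrt ?s = norm (x - y) powr \<alpha>" by (simp add: powr_half_sqrt[symmetric] powr_powr)
  ultimately show ?thesis by (simp add: normal_rv_def)
qed

text \<open>The density is at most the reciprocal of twice the standard deviation
  \<open>norm (x - y) powr \<alpha>\<close>, because \<open>sqrt (2 * pi) \<ge> 2\<close>, and the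
  interval has length \<open>2 * u\<close>.\<close>

lemma component_small_ball:
  assumes xy: "x \<noteq> y" and u: "0 < u"
  shows "prob ((\<lambda>\<omega>. (B x \<omega> - B y \<omega>) $ i) -` {- u..u} \<inter> space M) \<le> u / norm (x - y) powr \<alpha>"
proof -
  let ?s = "norm (x - y) powr \<alpha>"
  have s: "?s > 0" using xy by simp
  have dens: "normal_density 0 ?s z \<le> 1 / (2 * ?s)" for z
  proof -
    have "2 \<le> sqrt (2 * pi)" using pi_gt3 by (intro real_le_rsqrt) simp
    then have "2 * ?s \<le> sqrt (2 * pi) * ?s" using s by (intro mult_right_mono) auto
    also have "\<dots> = sqrt (2 * pi * ?s\<^sup>2)" using s by (simp add: real_sqrt_mult)
    finally have "1 / sqrt (2 * pi * ?s\<^sup>2) \<le> 1 / (2 * ?s)" using s by (intro divide_left_mono mult_pos_pos) auto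
    moreover have "1 / sqrt (2 * pi * ?s\<^sup>2) * exp (- (z - 0)\<^sup>2 / (2 * ?s\<^sup>2)) \<le> 1 / sqrt (2 * pi * ?s\<^sup>2) * 1"
      using s by (intro mult_left_mono) auto
    ultimately show ?thesis unfolding normal_density_def by linarith
  qed
  have "emeasure M ((\<lambda>\<omega>. (B x \<omega> - B y \<omega>) $ i) -` {- u..u} \<inter> space M) =
      (\<integral>\<^sup>+z. ennreal (normal_density 0 ?s z) * indicator {- u..u} z \<partial>lborel)"
    by (rule distributed_emeasure[OF increment_distributed[OF xy]]) simp
  also have "\<dots> \<le> (\<integral>\<^sup>+z. ennreal (1 / (2 * ?s)) * indicator {- u..u} z \<partial>lborel)"
    by (intro nn_integral_mono mult_right_mono ennreal_leI dens) auto
  also have "\<dots> = ennreal (1 / (2 * ?s)) * ennreal (2 * u)"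
    using u by (simp add: nn_integral_cmult_indicator)
  also have "\<dots> = ennreal (u / ?s)" using s u by (simp flip: ennreal_mult)
  finally show ?thesis using u s by (simp add: emeasure_eq_measure)
qed

text \<open>A ball of radius \<open>u\<close> lies in a cube, and independence of the components
  turns the probability of the cube into a product. Its \<open>CARD('n)\<close> factors are bounded
  by the ratio whose power is the untruncated kernel.\<close>

lemma increment_small_ball:
  assumes u: "0 < u"
  shows "emeasure M {\<omega> \<in> space M. dist (B x \<omega>) (B y \<omega>) \<le> u} \<le> ennreal (1 * profile_Z \<alpha> CARD('n) u x y)"
proof -
  let ?S = "{\<omega> \<in> space M. dist (B x \<omega>) (B y \<omega>) \<le> u}"
  show ?thesis
  proof (cases "x = y")
    case True
    then show ?thesis by (simp add: profile_Z_def profile_phi_def emeasure_eq_measure)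
  next
    case False
    let ?s = "norm (x - y) powr \<alpha>"
    define X where "X i \<omega> = (B x \<omega> - B y \<omega>) $ i" for i \<omega>
    have "indep_vars (\<lambda>_. PiM UNIV (\<lambda>_. borel)) (\<lambda>i \<omega> x. B x \<omega> $ i) UNIV"
      using fbm by (simp add: fractional_brownian_motion_def)
    \<comment> \<open>Independence is given for the components as random functions; composing with
      evaluation at two points passes it to the increments.\<close>
    then have "indep_vars (\<lambda>_. borel) (\<lambda>i \<omega>. (\<lambda>f. f x - f y) (\<lambda>x. B x \<omega> $ i)) UNIV"
      by (rule indep_vars_compose2) measurable
    then have ind: "indep_vars (\<lambda>_. borel) X UNIV" by (simp add: X_def[abs_def])
    have "prob ?S \<le> prob (\<Inter>i\<in>UNIV. X i -` {- u..u} \<inter> space M)"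
    proof (rule finite_measure_mono)
      show "?S \<subseteq> (\<Inter>i\<in>UNIV. X i -` {- u..u} \<inter> space M)"
      proof (intro subsetI INT_I IntI)
        fix \<omega> i assume w: "\<omega> \<in> ?S"
        have "\<bar>X i \<omega>\<bar> \<le> norm (B x \<omega> - B y \<omega>)" unfolding X_def by (rule component_le_norm_cart)
        then show "\<omega> \<in> X i -` {- u..u}" using w by (simp add: dist_norm abs_le_iff)
      qed auto
      show "(\<Inter>i\<in>UNIV. X i -` {- u..u} \<inter> space M) \<in> events"
        using component_meas[of x y] unfolding X_def by (intro sets.finite_INT measurable_sets[of _ M borel]) auto
    qed
    also have "\<dots> = (\<Prod>i\<in>UNIV. prob (X i -` {- u..u} \<inter> space M))"
      by (rule indep_varsD_finite[OF ind]) auto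
    also have "\<dots> \<le> (\<Prod>i\<in>(UNIV :: 'n set). u / ?s)"
      unfolding X_def by (intro prod_mono conjI component_small_ball[OF False u]) auto
    also have "\<dots> = u ^ CARD('n) / dist x y powr (\<alpha> * real CARD('n))"
      using False by (simp add: power_divide powr_powr dist_norm flip: powr_realpow)
    finally have "prob ?S \<le> min 1 (u ^ CARD('n) / dist x y powr (\<alpha> * real CARD('n)))" by simp
    then show ?thesis
      unfolding emeasure_eq_measure by (intro ennreal_leI) (simp add: profile_Z_eq[OF \<alpha>(1) u False])
  qed
qed

text \<open>Completing the square gives \<open>- w\<^sup>2 / 2 \<le> 1 / 2 - w\<close>, so the
  Gaussian density is dominated by an exponential one up to \<open>exp (1 / 2) \<le> 2\<close>, and
  \<open>sqrt (2 * pi) \<ge> 2\<close> cancels this 2. The dominating function integrates to exactly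
  \<open>exp (- t)\<close>.\<close>

lemma component_upper_tail:
  assumes xy: "x \<noteq> y"
  shows "prob ((\<lambda>\<omega>. (B x \<omega> - B y \<omega>) $ i) -` {t * norm (x - y) powr \<alpha>..} \<inter> space M) \<le> exp (- t)"
proof -
  let ?s = "norm (x - y) powr \<alpha>"
  have s: "?s > 0" using xy by simp
  have dens: "normal_density 0 ?s z \<le> (1 / ?s) * exp (- z / ?s)" for z
  proof -
    have h: "exp (1 / 2 :: real) \<le> 2"
    proof -
      have "(exp (1 / 2 :: real))\<^sup>2 = exp 1" by (simp add: power2_eq_square flip: exp_add)
      also have "\<dots> \<le> 2\<^sup>2" using exp_le by simp
      finally show ?thesis by (rule power2_le_imp_le) simp
    qed
    have "2 \<le> sqrt (2 * pi)" using pi_gt3 by (intro real_le_rsqrt) simp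
    then have "2 * ?s \<le> sqrt (2 * pi) * ?s" using s by (intro mult_right_mono) auto
    also have "\<dots> = sqrt (2 * pi * ?s\<^sup>2)" using s by (simp add: real_sqrt_mult)
    finally have d: "1 / sqrt (2 * pi * ?s\<^sup>2) \<le> 1 / (2 * ?s)" using s by (intro divide_left_mono mult_pos_pos) auto
    define w where "w = z / ?s"
    have "- (z - 0)\<^sup>2 / (2 * ?s\<^sup>2) = - w\<^sup>2 / 2" using s by (simp add: w_def power_divide)
    also have "\<dots> \<le> 1 / 2 - w" using sum_power2_ge_zero[of "w - 1" 0] by (simp add: power2_eq_square algebra_simps)
    finally have "exp (- (z - 0)\<^sup>2 / (2 * ?s\<^sup>2)) \<le> exp (1 / 2 - w)" by simp
    also have "\<dots> = exp (1 / 2) * exp (- w)" by (simp flip: exp_add)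
    also have "\<dots> \<le> 2 * exp (- w)" using h by (intro mult_right_mono) auto
    finally have e: "exp (- (z - 0)\<^sup>2 / (2 * ?s\<^sup>2)) \<le> 2 * exp (- w)" .
    have "normal_density 0 ?s z \<le> (1 / (2 * ?s)) * (2 * exp (- w))"
      unfolding normal_density_def using d e s by (intro mult_mono) auto
    then show ?thesis by (simp add: w_def)
  qed
  have "emeasure M ((\<lambda>\<omega>. (B x \<omega> - B y \<omega>) $ i) -` {t * ?s..} \<inter> space M) =
      (\<integral>\<^sup>+z. ennreal (normal_density 0 ?s z) * indicator {t * ?s..} z \<partial>lborel)"
    by (rule distributed_emeasure[OF increment_distributed[OF xy]]) simp
  also have "\<dots> \<le> (\<integral>\<^sup>+z. ennreal ((1 / ?s) * exp (- z / ?s)) * indicator {t * ?s..} z \<partial>lborel)"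
    by (intro nn_integral_mono mult_right_mono ennreal_leI dens) auto
  also have "\<dots> = ennreal (0 - (- exp (- (t * ?s) / ?s)))"
  proof (rule nn_integral_FTC_atLeast)
    show "((\<lambda>z. - exp (- z / ?s)) has_real_derivative (1 / ?s) * exp (- z / ?s)) (at z)" for z
      using s by (auto intro!: derivative_eq_intros)
    show "((\<lambda>z. - exp (- z / ?s)) \<longlongrightarrow> 0) at_top"
    proof -
      have "((\<lambda>z. exp (- (z * (1 / ?s)))) \<longlongrightarrow> 0) at_top"
        by (intro filterlim_compose[OF exp_at_bot] filterlim_compose[OF filterlim_uminus_at_bot_at_top]
            filterlim_at_top_mult_tendsto_pos[OF tendsto_const] filterlim_ident) (use s in auto)
      then have "((\<lambda>z. - exp (- (z * (1 / ?s)))) \<longlongrightarrow> - 0) at_top" by (rule tendsto_minus)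
      then show ?thesis by simp
    qed
  qed (use s in auto)
  also have "\<dots> = ennreal (exp (- t))" using s by simp
  finally show ?thesis by (simp add: emeasure_eq_measure)
qed

lemma component_tail:
  assumes xy: "x \<noteq> y"
  shows "prob {\<omega> \<in> space M. t * norm (x - y) powr \<alpha> \<le> \<bar>(B x \<omega> - B y \<omega>) $ i\<bar>} \<le> 2 * exp (- t)"
proof -
  let ?s = "norm (x - y) powr \<alpha>"
  let ?A = "\<lambda>x y. (\<lambda>\<omega>. (B x \<omega> - B y \<omega>) $ i) -` {t * ?s..} \<inter> space M"
  have m: "?A x y \<in> events" "?A y x \<in> events"
    using component_meas by (auto intro!: measurable_sets[of _ M borel])
  have "{\<omega> \<in> space M. t * ?s \<le> \<bar>(B x \<omega> - B y \<omega>) $ i\<bar>} \<subseteq> ?A x y \<union> ?A y x"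
    by (auto simp: abs_if split: if_splits)
  then have "prob {\<omega> \<in> space M. t * ?s \<le> \<bar>(B x \<omega> - B y \<omega>) $ i\<bar>} \<le> prob (?A x y \<union> ?A y x)"
    using m by (intro finite_measure_mono) auto
  also have "\<dots> \<le> prob (?A x y) + prob (?A y x)" using m by (rule measure_Un_le)
  also have "prob (?A x y) \<le> exp (- t)" by (rule component_upper_tail[OF xy])
  also have "prob (?A y x) \<le> exp (- t)"
    using component_upper_tail[of y x i t] xy by (simp add: norm_minus_commute)
  finally show ?thesis by simp
qed

section \<open>Dyadic grids and chaining\<close>

text \<open>The margin 1 beyond \<open>R\<close> leaves room for rounding down points of the cube of
  half-width \<open>R\<close>.\<close>

definition grid :: "real \<Rightarrow> nat \<Rightarrow> (real^'d) set" where
  "grid R n = {p. \<forall>i. \<exists>k::int. p $ i = of_int k / 2 ^ n \<and> \<bar>of_int k\<bar> \<le> 2 ^ n * (R + 1)}"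

lemma card_grid:
  assumes R: "R \<ge> 0"
  shows "finite (grid R n)" "real (card (grid R n)) \<le> (2 * (2 ^ n * (R + 1)) + 1) ^ CARD('d)"
proof -
  let ?N = "2 ^ n * (R + 1)"
  let ?I = "{- \<lfloor>?N\<rfloor>..\<lfloor>?N\<rfloor>}"
  define F where "F = PiE (UNIV :: 'd set) (\<lambda>_. ?I)"
  define g where "g k = ((\<chi> i. real_of_int (k i) / 2 ^ n) :: real^'d)" for k :: "'d \<Rightarrow> int"
  have sub: "grid R n \<subseteq> g ` F"
  proof
    fix p assume "p \<in> grid R n"
    then obtain k where k: "\<And>i. p $ i = of_int (k i :: int) / 2 ^ n \<and> \<bar>of_int (k i)\<bar> \<le> ?N"
      unfolding grid_def by (auto simp: choice_iff)
    have "k i \<in> ?I" for i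
    proof -
      have "real_of_int (k i) \<le> ?N" "real_of_int (- k i) \<le> ?N" using k[of i] by auto
      then have "k i \<le> \<lfloor>?N\<rfloor>" "- k i \<le> \<lfloor>?N\<rfloor>" by (simp_all only: le_floor_iff)
      then show ?thesis by auto
    qed
    then have "k \<in> F" by (auto simp: F_def)
    moreover have "p = g k" using k by (simp add: g_def vec_eq_iff)
    ultimately show "p \<in> g ` F" by blast
  qed
  have finF: "finite F" unfolding F_def by (intro finite_PiE) auto
  then show "finite (grid R n)" using sub finite_surj by blast
  have "real (card (grid R n)) \<le> real (card (g ` F))"
    using sub finF by (intro of_nat_mono card_mono) auto
  also have "\<dots> \<le> real (card F)" using card_image_le[OF finF] by simp
  also have "\<dots> = real (card ?I) ^ CARD('d)" by (simp add: F_def card_PiE)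
  also have "\<dots> \<le> (2 * ?N + 1) ^ CARD('d)"
  proof (rule power_mono)
    have "0 \<le> ?N" using R by simp
    then show "real (card ?I) \<le> 2 * ?N + 1" by simp
  qed simp
  finally show "real (card (grid R n)) \<le> (2 * ?N + 1) ^ CARD('d)" .
qed

definition nbrs :: "real \<Rightarrow> nat \<Rightarrow> ((real^'d) \<times> (real^'d)) set" where
  "nbrs R n = {(p, q). p \<in> grid R n \<and> q \<in> grid R n \<and> (\<forall>i. \<bar>p $ i - q $ i\<bar> \<le> 1 / 2 ^ n)}"

text \<open>The tail parameter \<open>(2 * real CARD('d) + 1) * real n\<close> times a bound, by
  \<open>nbrs_norm\<close>, for the standard deviation of an increment between neighbours at level
  \<open>n\<close>.\<close>

definition thr :: "nat \<Rightarrow> real" where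
  "thr n = (2 * real CARD('d) + 1) * real n * (real CARD('d) / 2 ^ n) powr \<alpha>"

lemma nbrs_norm: "(p, q) \<in> nbrs R n \<Longrightarrow> norm (p - q) powr \<alpha> \<le> (real CARD('d) / 2 ^ n) powr \<alpha>"
proof (rule powr_mono2)
  assume pq: "(p, q) \<in> nbrs R n"
  have "norm (p - q) \<le> (\<Sum>i\<in>UNIV. \<bar>(p - q) $ i\<bar>)" by (rule norm_le_l1_cart)
  also have "\<dots> \<le> (\<Sum>i\<in>(UNIV :: 'd set). 1 / 2 ^ n)" using pq by (intro sum_mono) (simp add: nbrs_def)
  finally show "norm (p - q) \<le> real CARD('d) / 2 ^ n" by simp
qed (use \<alpha> in auto)

text \<open>
  Exponential tails suffice for a modulus of continuity with a logarithmic loss: the number of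
  neighbouring pairs at level \<open>n\<close> is \<open>O(4\<^bsup>dn\<^esup>)\<close>, and each exceeds the threshold with
  probability at most \<open>2 exp (-(2 d + 1) n)\<close>.
\<close>

lemma AE_grid_increments:
  assumes R: "R \<ge> 0"
  shows "AE \<omega> in M. \<forall>\<^sub>F n in sequentially. \<forall>(p, q)\<in>nbrs R n. norm (B p \<omega> - B q \<omega>) \<le> real CARD('n) * thr n"
proof -
  let ?d = "real CARD('d)"
  define bad where "bad n = (\<lambda>(pq, i). {\<omega> \<in> space M. thr n < \<bar>(B (fst pq) \<omega> - B (snd pq) \<omega>) $ i\<bar>})" for n
  define A where "A n = (\<Union>pqi\<in>nbrs R n \<times> (UNIV :: 'n set). bad n pqi)" for n
  have sub: "nbrs R n \<subseteq> grid R n \<times> grid R n" for n by (auto simp: nbrs_def)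
  have fin: "finite (nbrs R n)" for n
    by (rule finite_subset[OF sub]) (simp add: card_grid(1)[OF R])
  have badm: "bad n pqi \<in> events" for n pqi
  proof -
    obtain p q i where pqi: "pqi = ((p, q), i)" by (metis surj_pair)
    show ?thesis unfolding bad_def pqi using component_meas[of p q i] by simp
  qed
  have Am: "A n \<in> events" for n unfolding A_def using fin badm by (intro sets.finite_UN) auto
  have thr0: "thr n \<ge> 0" for n by (simp add: thr_def)
  have pbad: "prob (bad n pqi) \<le> 2 * exp (- ((2 * ?d + 1) * real n))" if "pqi \<in> nbrs R n \<times> UNIV" for n pqi
  proof -
    obtain p q i where pqi: "pqi = ((p, q), i)" by (metis surj_pair)
    show ?thesis
    proof (cases "p = q")
      case True
      \<comment> \<open>Equal points count as neighbours; their increment vanishes and cannot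
        strictly exceed a nonnegative threshold.\<close>
      then have "bad n pqi = {}" using thr0[of n] by (auto simp: bad_def pqi)
      then show ?thesis by simp
    next
      case False
      have "(2 * ?d + 1) * real n * norm (p - q) powr \<alpha> \<le> thr n"
        unfolding thr_def using that pqi by (intro mult_left_mono nbrs_norm[of p q R]) auto
      then have "bad n pqi \<subseteq> {\<omega> \<in> space M. ((2 * ?d + 1) * real n) * norm (p - q) powr \<alpha> \<le> \<bar>(B p \<omega> - B q \<omega>) $ i\<bar>}"
        by (auto simp: bad_def pqi)
      then have "prob (bad n pqi) \<le> prob {\<omega> \<in> space M. ((2 * ?d + 1) * real n) * norm (p - q) powr \<alpha> \<le> \<bar>(B p \<omega> - B q \<omega>) $ i\<bar>}"
        using component_meas[of p q i] by (intro finite_measure_mono) auto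
      also have "\<dots> \<le> 2 * exp (- ((2 * ?d + 1) * real n))" by (rule component_tail[OF False])
      finally show ?thesis .
    qed
  qed
  define C where "C = 2 * real CARD('n) * ((2 * (R + 1) + 1) ^ CARD('d))\<^sup>2"
  have pA: "prob (A n) \<le> C * exp (- 1) ^ n" for n
  proof -
    have "prob (A n) \<le> (\<Sum>pqi\<in>nbrs R n \<times> (UNIV :: 'n set). prob (bad n pqi))"
      unfolding A_def using fin badm by (intro measure_UNION_le) auto
    also have "\<dots> \<le> (\<Sum>pqi\<in>nbrs R n \<times> (UNIV :: 'n set). 2 * exp (- ((2 * ?d + 1) * real n)))"
      by (intro sum_mono pbad)
    also have "\<dots> = real (card (nbrs R n)) * (2 * real CARD('n) * exp (- ((2 * ?d + 1) * real n)))"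
      by (simp add: card_cartesian_product)
    also have "\<dots> \<le> (((2 * (R + 1) + 1) ^ CARD('d))\<^sup>2 * exp (2 * ?d * real n)) * (2 * real CARD('n) * exp (- ((2 * ?d + 1) * real n)))"
    proof (rule mult_right_mono)
      have "card (nbrs R n) \<le> card (grid R n \<times> grid R n)" using sub card_grid(1)[OF R] by (intro card_mono) auto
      then have "real (card (nbrs R n)) \<le> real (card (grid R n)) * real (card (grid R n))"
        by (simp add: card_cartesian_product flip: of_nat_mult)
      also have "\<dots> \<le> (2 * (2 ^ n * (R + 1)) + 1) ^ CARD('d) * (2 * (2 ^ n * (R + 1)) + 1) ^ CARD('d)"
        using R by (intro mult_mono card_grid) auto
      also have "\<dots> = ((2 * (2 ^ n * (R + 1)) + 1) ^ CARD('d))\<^sup>2" by (simp add: power2_eq_square)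
      \<comment> \<open>By \<open>2 ^ n \<le> exp n\<close> the number of pairs is at most a
        constant times \<open>exp (2 * ?d * real n)\<close>. The tail bound decays faster by one
        factor \<open>exp n\<close>, which gives summability.\<close>
      also have "\<dots> \<le> (((2 * (R + 1) + 1) * exp (real n)) ^ CARD('d))\<^sup>2"
      proof (intro power_mono)
        have "(2::real) ^ n \<le> exp 1 ^ n" using exp_ge_add_one_self[of 1] by (intro power_mono) auto
        also have "\<dots> = exp (real n)" by (simp flip: exp_of_nat_mult)
        finally have e: "(2::real) ^ n \<le> exp (real n)" .
        have "2 * (2 ^ n * (R + 1)) \<le> 2 * (exp (real n) * (R + 1))" using e R by (intro mult_left_mono mult_right_mono) auto
        then have "2 * (2 ^ n * (R + 1)) + 1 \<le> 2 * (exp (real n) * (R + 1)) + exp (real n)"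
          by (intro add_mono) auto
        also have "\<dots> = (2 * (R + 1) + 1) * exp (real n)" by (simp add: algebra_simps)
        finally show "2 * (2 ^ n * (R + 1)) + 1 \<le> (2 * (R + 1) + 1) * exp (real n)" .
      qed (use R in auto)
      also have "\<dots> = ((2 * (R + 1) + 1) ^ CARD('d))\<^sup>2 * exp (2 * ?d * real n)"
      proof -
        have "(exp (real n) ^ CARD('d))\<^sup>2 = exp (2 * ?d * real n)"
          by (simp add: power_mult[symmetric] exp_of_nat_mult[symmetric] mult_ac)
        then show ?thesis by (simp add: power_mult_distrib)
      qed
      finally show "real (card (nbrs R n)) \<le> ((2 * (R + 1) + 1) ^ CARD('d))\<^sup>2 * exp (2 * ?d * real n)" .
    qed simp
    also have "\<dots> = C * (exp (2 * ?d * real n) * exp (- ((2 * ?d + 1) * real n)))" by (simp add: C_def)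
    also have "exp (2 * ?d * real n) * exp (- ((2 * ?d + 1) * real n)) = exp (- real n)"
      by (simp add: algebra_simps flip: exp_add)
    also have "\<dots> = exp (- 1) ^ n" by (simp flip: exp_of_nat_mult)
    finally show ?thesis .
  qed
  have "summable (\<lambda>n. C * exp (- 1) ^ n)" by (intro summable_mult summable_geometric) auto
  then have "summable (\<lambda>n. prob (A n))" by (rule summable_comparison_test') (use pA in auto)
  then have "AE \<omega> in M. \<forall>\<^sub>F n in sequentially. \<omega> \<in> space M - A n"
    using Am by (intro borel_cantelli_AE1) (auto simp: emeasure_eq_measure)
  then show ?thesis
  proof eventually_elim
    case (elim \<omega>)
    then show ?case
    proof eventually_elim
      case (elim n)
      show ?case
      proof clarify
        fix p q assume pq: "(p, q) \<in> nbrs R n"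
        have "\<bar>(B p \<omega> - B q \<omega>) $ i\<bar> \<le> thr n" for i
        proof (rule ccontr)
          assume "\<not> ?thesis"
          then have "\<omega> \<in> bad n ((p, q), i)" using elim by (simp add: bad_def)
          then have "\<omega> \<in> A n" using pq unfolding A_def by blast
          then show False using elim by simp
        qed
        then have "(\<Sum>i\<in>UNIV. \<bar>(B p \<omega> - B q \<omega>) $ i\<bar>) \<le> (\<Sum>i\<in>(UNIV :: 'n set). thr n)" by (intro sum_mono)
        then show "norm (B p \<omega> - B q \<omega>) \<le> real CARD('n) * thr n"
          using norm_le_l1_cart[of "B p \<omega> - B q \<omega>"] by simp
      qed
    qed
  qed
qed

definition fl :: "nat \<Rightarrow> real^'d \<Rightarrow> real^'d" where
  "fl n x = (\<chi> i. of_int \<lfloor>2 ^ n * x $ i\<rfloor> / 2 ^ n)"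

lemma fl_close: "\<bar>fl n x $ i - x $ i\<bar> \<le> 1 / 2 ^ n"
proof -
  define a where "a = 2 ^ n * x $ i"
  have "\<bar>of_int \<lfloor>a\<rfloor> - a\<bar> \<le> 1" by linarith
  then have "\<bar>(of_int \<lfloor>a\<rfloor> - a) / 2 ^ n\<bar> \<le> 1 / 2 ^ n" by (simp add: divide_right_mono)
  moreover have "(of_int \<lfloor>a\<rfloor> - a) / 2 ^ n = fl n x $ i - x $ i" by (simp add: fl_def a_def diff_divide_distrib)
  ultimately show ?thesis by simp
qed

lemma fl_tendsto: "(\<lambda>n. fl n x) \<longlonglongrightarrow> x"
proof (rule vec_tendstoI)
  fix i
  have "(\<lambda>n. 1 / 2 ^ n :: real) \<longlonglongrightarrow> 0" using LIMSEQ_realpow_zero[of "1/2"] by (simp add: power_one_over)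
  then have "(\<lambda>n. fl n x $ i - x $ i) \<longlonglongrightarrow> 0"
    by (rule Lim_null_comparison[rotated]) (use fl_close in auto)
  then show "(\<lambda>n. fl n x $ i) \<longlonglongrightarrow> x $ i" by (simp add: LIM_zero_iff)
qed

text \<open>Doubling the numerator rewrites a point of level \<open>m\<close> at level
  \<open>Suc m\<close>, so that consecutive approximations of a point can be compared inside one
  grid.\<close>

lemma fl_grid:
  assumes R: "\<And>i. \<bar>x $ i\<bar> \<le> R" and n: "n = m \<or> n = Suc m"
  shows "fl m x \<in> grid R n"
  unfolding grid_def
proof (intro CollectI allI)
  fix i
  define a where "a = 2 ^ m * x $ i"
  have "\<bar>a\<bar> \<le> 2 ^ m * R" unfolding a_def abs_mult using R[of i] by simp
  then have "\<bar>of_int \<lfloor>a\<rfloor>\<bar> \<le> 2 ^ m * R + 1" by linarith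
  also have "\<dots> \<le> 2 ^ m * R + 2 ^ m" by simp
  finally have f: "\<bar>of_int \<lfloor>a\<rfloor>\<bar> \<le> 2 ^ m * (R + 1)" by (simp add: algebra_simps)
  have e: "fl m x $ i = of_int \<lfloor>a\<rfloor> / 2 ^ m" by (simp add: fl_def a_def)
  show "\<exists>k::int. fl m x $ i = of_int k / 2 ^ n \<and> \<bar>of_int k\<bar> \<le> 2 ^ n * (R + 1)"
  proof (cases "n = m")
    case True
    then show ?thesis using e f by blast
  next
    case False
    then have "n = Suc m" using n by simp
    then show ?thesis using e f by (intro exI[of _ "2 * \<lfloor>a\<rfloor>"]) (simp add: abs_mult)
  qed
qed

lemma fl_nbrs_Suc:
  assumes R: "\<And>i. \<bar>x $ i\<bar> \<le> R"
  shows "(fl (Suc n) x, fl n x) \<in> nbrs R (Suc n)"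
proof -
  have "\<bar>fl (Suc n) x $ i - fl n x $ i\<bar> \<le> 1 / 2 ^ Suc n" for i
  proof -
    define a where "a = 2 ^ n * x $ i"
    have "\<bar>\<lfloor>2 * a\<rfloor> - 2 * \<lfloor>a\<rfloor>\<bar> \<le> 1" by linarith
    then have "real_of_int \<bar>\<lfloor>2 * a\<rfloor> - 2 * \<lfloor>a\<rfloor>\<bar> \<le> real_of_int 1" by (simp only: of_int_le_iff)
    then have "\<bar>of_int \<lfloor>2 * a\<rfloor> - 2 * of_int \<lfloor>a\<rfloor>\<bar> \<le> (1::real)" by simp
    then have "\<bar>(of_int \<lfloor>2 * a\<rfloor> - 2 * of_int \<lfloor>a\<rfloor>) / 2 ^ Suc n\<bar> \<le> (1::real) / 2 ^ Suc n"
      by (simp add: divide_right_mono)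
    moreover have "(of_int \<lfloor>2 * a\<rfloor> - 2 * of_int \<lfloor>a\<rfloor>) / 2 ^ Suc n = fl (Suc n) x $ i - fl n x $ i"
      by (simp add: fl_def a_def diff_divide_distrib mult.assoc)
    ultimately show ?thesis by metis
  qed
  then show ?thesis using R by (auto simp: nbrs_def intro!: fl_grid)
qed

lemma fl_nbrs:
  assumes R: "\<And>i. \<bar>x $ i\<bar> \<le> R" "\<And>i. \<bar>y $ i\<bar> \<le> R" and d: "dist x y \<le> 1 / 2 ^ n"
  shows "(fl n x, fl n y) \<in> nbrs R n"
proof -
  have "\<bar>fl n x $ i - fl n y $ i\<bar> \<le> 1 / 2 ^ n" for i
  proof -
    define a b where "a = 2 ^ n * x $ i" and "b = 2 ^ n * y $ i"
    have "\<bar>x $ i - y $ i\<bar> \<le> 1 / 2 ^ n"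
      using component_le_norm_cart[of "x - y" i] d by (simp add: dist_norm)
    then have "2 ^ n * \<bar>x $ i - y $ i\<bar> \<le> 1" by (simp add: field_simps)
    moreover have "\<bar>a - b\<bar> = 2 ^ n * \<bar>x $ i - y $ i\<bar>"
      by (simp add: a_def b_def abs_mult flip: right_diff_distrib)
    ultimately have "\<bar>a - b\<bar> \<le> 1" by simp
    then have "\<bar>\<lfloor>a\<rfloor> - \<lfloor>b\<rfloor>\<bar> \<le> 1" by linarith
    then have "real_of_int \<bar>\<lfloor>a\<rfloor> - \<lfloor>b\<rfloor>\<bar> \<le> real_of_int 1" by (simp only: of_int_le_iff)
    then have "\<bar>of_int \<lfloor>a\<rfloor> - of_int \<lfloor>b\<rfloor>\<bar> \<le> (1::real)" by simp
    then have "\<bar>(of_int \<lfloor>a\<rfloor> - of_int \<lfloor>b\<rfloor>) / 2 ^ n\<bar> \<le> (1::real) / 2 ^ n" by (simp add: divide_right_mono)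
    then show ?thesis by (simp add: fl_def a_def b_def diff_divide_distrib)
  qed
  then show ?thesis using R by (auto simp: nbrs_def intro!: fl_grid)
qed

lemma summable_linear_geometric:
  fixes q :: real
  assumes "0 < q" "q < 1" shows "summable (\<lambda>j. (real j + 2) * q ^ j)"
proof -
  have "summable (\<lambda>j. of_nat (Suc j) * q ^ j)"
    using geometric_deriv_sums[of q] assms by (auto dest: sums_summable)
  from summable_add[OF this summable_geometric[of q]] show ?thesis
    using assms by (simp add: algebra_simps)
qed

text \<open>Telescoping along the dyadic approximations, which converge to \<open>x\<close>;
  continuity of the path passes the bound to the limit. The factor \<open>real k\<close> in the
  increments only replaces a geometric series by that of
  \<open>(real j + 2) * q ^ j\<close>.\<close>

lemma chaining:
  assumes R: "\<And>i. \<bar>x $ i\<bar> \<le> R" and n: "n \<ge> 1" and q: "0 < q" "q < 1" and c: "c \<ge> 0"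
    and cont: "continuous_on UNIV (\<lambda>x. B x \<omega>)"
    and inc: "\<And>k p p'. k \<ge> n \<Longrightarrow> (p, p') \<in> nbrs R k \<Longrightarrow> norm (B p \<omega> - B p' \<omega>) \<le> c * real k * q ^ k"
  shows "norm (B x \<omega> - B (fl n x) \<omega>) \<le> c * (\<Sum>j. (real j + 2) * q ^ j) * real n * q ^ n"
proof -
  note s = summable_linear_geometric[OF q]
  define S where "S = (\<Sum>j. (real j + 2) * q ^ j)"
  have part: "norm (B (fl (n + m) x) \<omega> - B (fl n x) \<omega>) \<le> (\<Sum>j<m. c * real n * q ^ n * ((real j + 2) * q ^ j))" for m
  proof (induction m)
    case (Suc m)
    let ?k = "n + m"
    have "norm (B (fl (Suc ?k) x) \<omega> - B (fl ?k x) \<omega>) \<le> c * real (Suc ?k) * q ^ Suc ?k"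
      by (rule inc) (use fl_nbrs_Suc[OF R] in auto)
    \<comment> \<open>For \<open>n \<ge> 1\<close> one has
      \<open>n + m + 1 \<le> n * (m + 2)\<close>, which takes \<open>real n\<close> out of every
      term.\<close>
    also have "\<dots> \<le> c * (real n * (real m + 2)) * (q ^ n * q ^ m)"
    proof (intro mult_mono mult_left_mono)
      have "real m * 1 \<le> real m * real n" using n by (intro mult_left_mono) auto
      then show "real (Suc ?k) \<le> real n * (real m + 2)" using n by (simp add: algebra_simps)
      show "q ^ Suc ?k \<le> q ^ n * q ^ m" using q by (simp add: power_add mult_left_le_one_le)
    qed (use c q in auto)
    finally have "norm (B (fl (Suc ?k) x) \<omega> - B (fl ?k x) \<omega>) \<le> c * real n * q ^ n * ((real m + 2) * q ^ m)"
      by (simp add: mult_ac)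
    then show ?case
      using Suc norm_triangle_ineq[of "B (fl (Suc ?k) x) \<omega> - B (fl ?k x) \<omega>" "B (fl ?k x) \<omega> - B (fl n x) \<omega>"] by simp
  qed simp
  have bound: "norm (B (fl (n + m) x) \<omega> - B (fl n x) \<omega>) \<le> c * S * real n * q ^ n" for m
  proof -
    have "(\<Sum>j<m. (real j + 2) * q ^ j) \<le> S" unfolding S_def using q by (intro sum_le_suminf s) auto
    then have "c * real n * q ^ n * (\<Sum>j<m. (real j + 2) * q ^ j) \<le> c * real n * q ^ n * S"
      using c q by (intro mult_left_mono) auto
    moreover have "norm (B (fl (n + m) x) \<omega> - B (fl n x) \<omega>) \<le> c * real n * q ^ n * (\<Sum>j<m. (real j + 2) * q ^ j)"
      using part[of m] by (simp only: sum_distrib_left)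
    ultimately have "norm (B (fl (n + m) x) \<omega> - B (fl n x) \<omega>) \<le> c * real n * q ^ n * S" by linarith
    then show ?thesis by (simp only: mult_ac)
  qed
  have "(\<lambda>m. fl (n + m) x) \<longlonglongrightarrow> x" using LIMSEQ_ignore_initial_segment[OF fl_tendsto[of x], of n] by (simp add: add.commute)
  then have "(\<lambda>m. B (fl (n + m) x) \<omega>) \<longlonglongrightarrow> B x \<omega>"
    by (rule continuous_on_tendsto_compose[OF cont]) auto
  then have "(\<lambda>m. norm (B (fl (n + m) x) \<omega> - B (fl n x) \<omega>)) \<longlonglongrightarrow> norm (B x \<omega> - B (fl n x) \<omega>)"
    by (intro tendsto_intros)
  then show ?thesis unfolding S_def[symmetric] by (rule LIMSEQ_le_const2) (use bound in auto)
qed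

text \<open>For small \<open>h\<close>, chaining from the level \<open>n\<close> with
  \<open>(1/2)^n\<close> comparable to \<open>h\<close> gives a modulus of order
  \<open>n * h powr \<alpha>\<close>; for \<open>h\<close> bounded below, boundedness of the image
  suffices. As only \<open>h \<ge> u powr (1 / \<alpha>)\<close> is considered, \<open>n\<close> is
  at most a multiple of \<open>ln (1 / u)\<close>.\<close>

lemma AE_cover_hyp:
  assumes E: "bounded E"
  shows "AE \<omega> in M. cover_hyp (profile_Z \<alpha> CARD('n)) E (\<lambda>x. B x \<omega>) \<and> bounded ((\<lambda>x. B x \<omega>) ` E)"
proof -
  obtain R where R: "R > 0" "\<And>x. x \<in> E \<Longrightarrow> norm x \<le> R" using E bounded_pos by blast
  have Ri: "\<bar>x $ i\<bar> \<le> R" if "x \<in> E" for x i using R(2)[OF that] component_le_norm_cart[of x i] by simp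
  have "AE \<omega> in M. continuous_on UNIV (\<lambda>x. B x \<omega>) \<and> B 0 \<omega> = 0"
    using fbm by (simp add: fractional_brownian_motion_def)
  with AE_grid_increments[OF less_imp_le[OF R(1)]] show ?thesis
  proof eventually_elim
    case (elim \<omega>)
    have cont: "continuous_on UNIV (\<lambda>x. B x \<omega>)" using elim by simp
    have "compact ((\<lambda>x. B x \<omega>) ` closure E)"
      using E cont by (intro compact_continuous_image continuous_on_subset[OF cont]) (auto simp: compact_closure)
    then have bd: "bounded ((\<lambda>x. B x \<omega>) ` E)"
      using closure_subset by (intro bounded_subset[OF compact_imp_bounded]) auto
    then obtain Dm where Dm: "\<And>x y. x \<in> E \<Longrightarrow> y \<in> E \<Longrightarrow> dist (B x \<omega>) (B y \<omega>) \<le> Dm"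
      by (meson bounded_two_points imageI)
    obtain N0 where N0: "\<And>n p q. n \<ge> N0 \<Longrightarrow> (p, q) \<in> nbrs R n \<Longrightarrow> norm (B p \<omega> - B q \<omega>) \<le> real CARD('n) * thr n"
      using elim(1) unfolding eventually_sequentially by fast
    define N where "N = max N0 1"
    \<comment> \<open>\<open>q ^ n\<close> is then the mesh \<open>1 / 2 ^ n\<close> to the power
      \<alpha>.\<close>
    define q where "q = 2 powr (- \<alpha>)"
    have q: "0 < q" "q < 1" using \<alpha> powr_less_mono[of "- \<alpha>" 0 2] by (auto simp: q_def)
    have qn: "(1 / 2 ^ n) powr \<alpha> = q ^ n" for n
      by (simp add: q_def powr_power powr_divide powr_minus powr_powr divide_simps mult.commute flip: powr_realpow)
    define c where "c = real CARD('n) * (2 * real CARD('d) + 1) * real CARD('d) powr \<alpha>"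
    have c: "c \<ge> 0" by (simp add: c_def)
    have cthr: "real CARD('n) * thr n = c * real n * q ^ n" for n
      unfolding thr_def c_def qn[symmetric] by (simp add: powr_divide)
    have inc: "norm (B p \<omega> - B p' \<omega>) \<le> c * real n * q ^ n" if "n \<ge> N" "(p, p') \<in> nbrs R n" for n p p'
      using N0[of n p p'] that cthr by (simp add: N_def)
    define S where "S = (\<Sum>j. (real j + 2) * q ^ j)"
    have S: "S \<ge> 0"
    proof -
      show ?thesis unfolding S_def using q by (intro suminf_nonneg summable_linear_geometric[OF q]) auto
    qed
    define c2 where "c2 = c * (2 * S + 1)"
    have c2: "c2 \<ge> 0" using c S by (simp add: c2_def)
    have modn: "dist (B x \<omega>) (B y \<omega>) \<le> c2 * real n * q ^ n"
      if xy: "x \<in> E" "y \<in> E" and n: "n \<ge> N" and d: "dist x y \<le> 1 / 2 ^ n" for x y n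
    proof -
      have n1: "n \<ge> 1" using n by (simp add: N_def)
      have ch: "norm (B x \<omega> - B (fl n x) \<omega>) \<le> c * S * real n * q ^ n" if "x \<in> E" for x
        unfolding S_def using n by (intro chaining[OF Ri[OF that] n1 q c cont] inc) auto
      have "norm (B (fl n x) \<omega> - B (fl n y) \<omega>) \<le> c * real n * q ^ n"
        by (intro inc n fl_nbrs Ri xy d)
      moreover have "dist (B x \<omega>) (B y \<omega>) \<le> norm (B x \<omega> - B (fl n x) \<omega>) + norm (B (fl n x) \<omega> - B (fl n y) \<omega>) + norm (B y \<omega> - B (fl n y) \<omega>)"
        using dist_triangle[of "B x \<omega>" "B y \<omega>" "B (fl n x) \<omega>"] dist_triangle[of "B (fl n x) \<omega>" "B y \<omega>" "B (fl n y) \<omega>"]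
        by (simp add: dist_norm norm_minus_commute)
      ultimately show ?thesis using ch[OF xy(1)] ch[OF xy(2)] by (simp add: c2_def algebra_simps)
    qed
    \<comment> \<open>Sum of the constants for the two ranges of \<open>h\<close>, with 1 added for
      positivity.\<close>
    define Cm where "Cm = c2 * (2 / \<alpha>) * 2 powr \<alpha> + \<bar>Dm\<bar> * (2 ^ N) powr \<alpha> + 1"
    have Cm: "Cm > 0" using c2 \<alpha> by (simp add: Cm_def add_nonneg_pos)
    have "cover_hyp (\<lambda>u x y. profile_phi (\<alpha> * real (card (UNIV :: 'n set))) (u powr (1 / \<alpha>)) (dist x y)) E (\<lambda>x. B x \<omega>)"
    proof (rule cover_hyp_profile[OF E \<alpha>, where g = "\<lambda>i y. y $ i" and ?u1.0 = "exp (-1)" and Cm = Cm and cg = 1])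
      fix u h :: real and x y assume u: "0 < u" "u < exp (-1)" and h: "u powr (1 / \<alpha>) \<le> h" and xy: "x \<in> E" "y \<in> E" and d: "dist x y \<le> h"
      have "ln u < ln (exp (-1))" using u by (subst ln_less_cancel_iff) auto
      then have L: "1 \<le> ln (1 / u)" using u by (simp add: ln_div)
      have h0: "h > 0" using h u by (smt (verit) powr_gt_zero)
      have le: "dist (B x \<omega>) (B y \<omega>) \<le> (c2 * (2 / \<alpha>) * 2 powr \<alpha>) * (ln (1 / u) * h powr \<alpha>) \<or>
          dist (B x \<omega>) (B y \<omega>) \<le> (\<bar>Dm\<bar> * (2 ^ N) powr \<alpha>) * (ln (1 / u) * h powr \<alpha>)"
      proof (cases "h \<le> 1 / 2 ^ N")
        case True
        have "(1::real) / 2 ^ N \<le> 1" by simp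
        then have "h \<le> 1" using True by linarith
        from dyadic_scale[OF h0 this] obtain n where n: "h \<le> (1/2)^n * 1" "(1/2)^n * 1 < 2 * h" by metis
        have nN: "n \<ge> N"
        proof (rule ccontr)
          assume "\<not> n \<ge> N"
          then have "(1/2::real) ^ (N - 1) \<le> (1/2) ^ n" by (intro power_decreasing) auto
          moreover have "(1/2::real) ^ (N - 1) = 2 * (1 / 2 ^ N)"
            by (cases N) (auto simp: N_def power_one_over)
          ultimately show False using n True by linarith
        qed
        have "dist (B x \<omega>) (B y \<omega>) \<le> c2 * real n * q ^ n"
          using d n by (intro modn xy nN) (simp add: power_one_over)
        also have "q ^ n = ((1/2)^n) powr \<alpha>" by (simp add: qn[symmetric] power_one_over)
        also have "c2 * real n * ((1/2)^n) powr \<alpha> \<le> c2 * ((2 / \<alpha>) * ln (1 / u)) * (2 * h) powr \<alpha>"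
        proof (intro mult_mono mult_left_mono powr_mono2)
          \<comment> \<open>Uses \<open>u powr (1 / \<alpha>) \<le> h \<le> (1/2)^n\<close>;
            together with \<open>ln 2 \<ge> 1/2\<close> this bounds the level by
            \<open>(2 / \<alpha>) * ln (1 / u)\<close>.\<close>
          have "ln (u powr (1 / \<alpha>)) \<le> ln ((1/2)^n)" using n h h0 u by (subst ln_le_cancel_iff) auto
          then have "real n * ln 2 \<le> ln (1 / u) / \<alpha>"
            using u by (simp add: ln_powr ln_realpow ln_div)
          moreover have "real n * (1/2) \<le> real n * ln 2"
            using ln2_ge_two_thirds by (intro mult_left_mono) auto
          ultimately have "real n \<le> 2 * (ln (1 / u) / \<alpha>)" by linarith
          then show "real n \<le> (2 / \<alpha>) * ln (1 / u)" by simp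
        qed (use c2 n L \<alpha> in auto)
        also have "\<dots> = (c2 * (2 / \<alpha>) * 2 powr \<alpha>) * (ln (1 / u) * h powr \<alpha>)"
          using h0 by (simp add: powr_mult)
        finally show ?thesis by simp
      next
        case False
        then have "1 < 2 ^ N * h" by (simp add: divide_simps mult.commute)
        then have "1 \<le> (2 ^ N * h) powr \<alpha>" using \<alpha> by (intro ge_one_powr_ge_zero) auto
        then have "1 * 1 \<le> ln (1 / u) * (2 ^ N * h) powr \<alpha>" using L by (intro mult_mono) auto
        then have "\<bar>Dm\<bar> * 1 \<le> \<bar>Dm\<bar> * (ln (1 / u) * (2 ^ N * h) powr \<alpha>)" by (intro mult_left_mono) auto
        also have "\<dots> = (\<bar>Dm\<bar> * (2 ^ N) powr \<alpha>) * (ln (1 / u) * h powr \<alpha>)"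
          using h0 by (simp add: powr_mult)
        finally show ?thesis using Dm[OF xy] by linarith
      qed
      have pos: "0 \<le> ln (1 / u) * h powr \<alpha>" using L by simp
      have "(c2 * (2 / \<alpha>) * 2 powr \<alpha>) * (ln (1 / u) * h powr \<alpha>) \<le> Cm * (ln (1 / u) * h powr \<alpha>)"
        "(\<bar>Dm\<bar> * (2 ^ N) powr \<alpha>) * (ln (1 / u) * h powr \<alpha>) \<le> Cm * (ln (1 / u) * h powr \<alpha>)"
        using c2 \<alpha> by (intro mult_right_mono pos; simp add: Cm_def)+
      then show "dist (B x \<omega>) (B y \<omega>) \<le> Cm * ln (1 / u) * h powr \<alpha>" using le by (auto simp: mult.assoc)
    next
      fix a b :: "real^'n" and i
      show "dist a b \<le> 1 * (\<Sum>i\<in>UNIV. \<bar>a $ i - b $ i\<bar>)"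
        using norm_le_l1_cart[of "a - b"] by (simp add: dist_norm)
      show "\<bar>a $ i - b $ i\<bar> \<le> dist a b"
        using component_le_norm_cart[of "a - b" i] by (simp add: dist_norm)
    qed (use Cm in auto)
    moreover have "(\<lambda>u x y. profile_phi (\<alpha> * real (card (UNIV :: 'n set))) (u powr (1 / \<alpha>)) (dist x y)) =
        (profile_Z \<alpha> CARD('n) :: real \<Rightarrow> real^'d \<Rightarrow> real^'d \<Rightarrow> real)"
      by (simp add: profile_Z_def[abs_def])
    ultimately show ?case using bd by (simp only: simp_thms)
  qed
qed

text \<open>The general equality is in terms of \<open>lower_cap\<close> and
  \<open>upper_cap\<close> at image scales; \<open>profile_Phi_pow\<close> identifies these with the
  profiles for \<open>Phi_pow \<Phi> \<alpha>\<close> divided by \<alpha>.\<close>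

lemma fbm_dims_AE_eq:
  assumes adm: "admissible \<Phi>" "\<And>\<epsilon>. \<epsilon> > 0 \<Longrightarrow> ((\<lambda>r. r powr \<epsilon> * ln (\<Phi> r)) \<longlongrightarrow> 0) (at_right 0)"
    and E: "E \<noteq> {}" "bounded E"
  shows "AE \<omega> in M. lower_Phi_dim \<Phi> ((\<lambda>x. B x \<omega>) ` E) = 1 / \<alpha> * lower_profile (Phi_pow \<Phi> \<alpha>) (\<alpha> * real CARD('n)) E \<and>
    upper_Phi_dim \<Phi> ((\<lambda>x. B x \<omega>) ` E) = 1 / \<alpha> * upper_profile (Phi_pow \<Phi> \<alpha>) (\<alpha> * real CARD('n)) E"
proof -
  let ?cap = "\<lambda>s r. capacity euclidean (ker_max \<Phi> (profile_Z \<alpha> CARD('n)) s r) E"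
  have dk: "dim_kernel \<Phi> (profile_Z \<alpha> CARD('n)) (2 ^ CARD('n)) E ?cap (real CARD('n)) (2 powr (\<alpha> * real CARD('n)))"
    by (rule profile_dim_kernel[OF adm(1) _ \<alpha>(1) E]) (rule adm(2))
  have "upper_profile (Phi_pow \<Phi> \<alpha>) (\<alpha> * real CARD('n)) E = \<alpha> * dim_kernel.upper_cap ?cap (real CARD('n))"
    "lower_profile (Phi_pow \<Phi> \<alpha>) (\<alpha> * real CARD('n)) E = \<alpha> * dim_kernel.lower_cap ?cap (real CARD('n))"
    by (rule profile_Phi_pow(1)[OF dk \<alpha>(1)]) (rule profile_Phi_pow(2)[OF dk \<alpha>(1)])
  then have eq: "1 / \<alpha> * upper_profile (Phi_pow \<Phi> \<alpha>) (\<alpha> * real CARD('n)) E = dim_kernel.upper_cap ?cap (real CARD('n))"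
    "1 / \<alpha> * lower_profile (Phi_pow \<Phi> \<alpha>) (\<alpha> * real CARD('n)) E = dim_kernel.lower_cap ?cap (real CARD('n))"
    using \<alpha> by auto
  show ?thesis
    unfolding eq
  proof (rule dim_kernel.AE_Phi_dims_eq[OF dk, where ?u1.0 = 1 and c = 1])
    show "finite_measure M" by unfold_locales
    show "AE \<omega> in M. cover_hyp (profile_Z \<alpha> CARD('n)) E (\<lambda>x. B x \<omega>) \<and> bounded ((\<lambda>x. B x \<omega>) ` E)"
      by (rule AE_cover_hyp[OF E(2)])
  qed (use B_meas increment_small_ball in auto)
qed

end

section \<open>The theorem\<close>

text \<open>A maximum over the finite alphabet turns the separate bounds into one ratio still
  strictly below \<open>c\<close>. The value 1/4 keeps it positive and lies below \<open>c\<close>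
  because \<open>c \<ge> 1/2\<close>.\<close>

lemma ifs_exists:
  fixes T :: "'k::finite \<Rightarrow> real^'d^'d"
  assumes inv: "\<And>j. invertible (T j)" and lt: "\<And>j. op_norm (T j) < c" and c: "1/2 \<le> c" "c \<le> 1"
  obtains \<rho> where "ifs T \<rho>" "\<rho> < c"
proof -
  define \<rho> where "\<rho> = max (1/4) (Max (range (\<lambda>j. op_norm (T j))))"
  have le: "op_norm (T j) \<le> \<rho>" for j
    unfolding \<rho>_def by (intro max.coboundedI2 Max_ge) auto
  have \<rho>: "0 < \<rho>" "\<rho> < c" using lt c by (auto simp: \<rho>_def)
  have "ifs T \<rho>"
  proof
    fix j v
    have "norm (T j *v v) \<le> op_norm (T j) * norm v"
      unfolding op_norm_def by (rule onorm[OF matrix_vector_mul_bounded_linear])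
    also have "\<dots> \<le> \<rho> * norm v" using le by (intro mult_right_mono) auto
    finally show "norm (T j *v v) \<le> \<rho> * norm v" .
  qed (use inv \<rho> c in auto)
  then show thesis using \<rho> that by blast
qed

theorem theorem1p6:
  fixes \<Phi> :: "real \<Rightarrow> real"
  assumes adm: "admissible \<Phi>"
    and log_cond: "\<And>\<epsilon>. \<epsilon> > 0 \<Longrightarrow> ((\<lambda>r. r powr \<epsilon> * ln (\<Phi> r)) \<longlongrightarrow> 0) (at_right 0)"
  shows
    "(\<forall>(T :: 'k::finite \<Rightarrow> real^'d^'d) (E :: (nat \<Rightarrow> 'k) set).
        (\<forall>j. invertible (T j) \<and> op_norm (T j) < 1) \<and> E \<noteq> {} \<longrightarrow>
        (\<forall>a. lower_Phi_dim \<Phi> (coding_map T a ` E) \<le> lower_capacity_dim \<Phi> T E \<and>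
             upper_Phi_dim \<Phi> (coding_map T a ` E) \<le> upper_capacity_dim \<Phi> T E) \<and>
        ((\<forall>j. op_norm (T j) < 1 / 2) \<longrightarrow>
           (AE a in lborel.
              lower_Phi_dim \<Phi> (coding_map T a ` E) = lower_capacity_dim \<Phi> T E \<and>
              upper_Phi_dim \<Phi> (coding_map T a ` E) = upper_capacity_dim \<Phi> T E)))
     \<and>
     (\<forall>(m :: nat) (\<gamma> :: (real^'d) set measure) (E :: (real^'d) set).
        1 \<le> m \<and> m \<le> CARD('d) \<and> grass_invariant_measure m \<gamma> \<and> E \<noteq> {} \<and> bounded E \<longrightarrow>
        (\<forall>V \<in> grassmannian m.
             lower_Phi_dim \<Phi> (orth_proj V ` E) \<le> lower_profile \<Phi> (real m) E \<and>
             upper_Phi_dim \<Phi> (orth_proj V ` E) \<le> upper_profile \<Phi> (real m) E) \<and>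
        (AE V in \<gamma>.
             lower_Phi_dim \<Phi> (orth_proj V ` E) = lower_profile \<Phi> (real m) E \<and>
             upper_Phi_dim \<Phi> (orth_proj V ` E) = upper_profile \<Phi> (real m) E))
     \<and>
     (\<forall>(\<alpha> :: real) (M :: 'w measure) (B :: real^'d \<Rightarrow> 'w \<Rightarrow> real^'n) (E :: (real^'d) set).
        0 < \<alpha> \<and> \<alpha> < 1 \<and> fractional_brownian_motion M \<alpha> B \<and> E \<noteq> {} \<and> bounded E \<longrightarrow>
        (AE \<omega> in M.
             lower_Phi_dim \<Phi> ((\<lambda>x. B x \<omega>) ` E) =
               1 / \<alpha> * lower_profile (Phi_pow \<Phi> \<alpha>) (\<alpha> * real CARD('n)) E \<and>
             upper_Phi_dim \<Phi> ((\<lambda>x. B x \<omega>) ` E) =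
               1 / \<alpha> * upper_profile (Phi_pow \<Phi> \<alpha>) (\<alpha> * real CARD('n)) E))"
proof (intro conjI)
  show "\<forall>(T :: 'k \<Rightarrow> real^'d^'d) (E :: (nat \<Rightarrow> 'k) set).
      (\<forall>j. invertible (T j) \<and> op_norm (T j) < 1) \<and> E \<noteq> {} \<longrightarrow>
      (\<forall>a. lower_Phi_dim \<Phi> (coding_map T a ` E) \<le> lower_capacity_dim \<Phi> T E \<and>
           upper_Phi_dim \<Phi> (coding_map T a ` E) \<le> upper_capacity_dim \<Phi> T E) \<and>
      ((\<forall>j. op_norm (T j) < 1 / 2) \<longrightarrow>
         (AE a in lborel.
            lower_Phi_dim \<Phi> (coding_map T a ` E) = lower_capacity_dim \<Phi> T E \<and>
            upper_Phi_dim \<Phi> (coding_map T a ` E) = upper_capacity_dim \<Phi> T E))"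
  proof (intro allI impI, elim conjE, intro conjI allI impI)
    fix T :: "'k \<Rightarrow> real^'d^'d" and E :: "(nat \<Rightarrow> 'k) set" and a
    assume T: "\<forall>j. invertible (T j) \<and> op_norm (T j) < 1" and E: "E \<noteq> {}"
    obtain \<rho> where "ifs T \<rho>" using ifs_exists[of T 1] T by auto
    then show "lower_Phi_dim \<Phi> (coding_map T a ` E) \<le> lower_capacity_dim \<Phi> T E"
      "upper_Phi_dim \<Phi> (coding_map T a ` E) \<le> upper_capacity_dim \<Phi> T E"
      using ifs.capacity_dims_le[OF _ adm log_cond E] by blast+
  next
    fix T :: "'k \<Rightarrow> real^'d^'d" and E :: "(nat \<Rightarrow> 'k) set"
    assume T: "\<forall>j. invertible (T j) \<and> op_norm (T j) < 1" "\<forall>j. op_norm (T j) < 1 / 2" and E: "E \<noteq> {}"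
    obtain \<rho> where "ifs T \<rho>" "\<rho> < 1/2" using ifs_exists[of T "1/2"] T by auto
    then show "AE a in lborel. lower_Phi_dim \<Phi> (coding_map T a ` E) = lower_capacity_dim \<Phi> T E \<and>
        upper_Phi_dim \<Phi> (coding_map T a ` E) = upper_capacity_dim \<Phi> T E"
      using ifs.capacity_dims_AE_eq[OF _ adm log_cond E] by blast
  qed
  show "\<forall>(m :: nat) (\<gamma> :: (real^'d) set measure) (E :: (real^'d) set).
      1 \<le> m \<and> m \<le> CARD('d) \<and> grass_invariant_measure m \<gamma> \<and> E \<noteq> {} \<and> bounded E \<longrightarrow>
      (\<forall>V \<in> grassmannian m.
           lower_Phi_dim \<Phi> (orth_proj V ` E) \<le> lower_profile \<Phi> (real m) E \<and>
           upper_Phi_dim \<Phi> (orth_proj V ` E) \<le> upper_profile \<Phi> (real m) E) \<and>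
      (AE V in \<gamma>.
           lower_Phi_dim \<Phi> (orth_proj V ` E) = lower_profile \<Phi> (real m) E \<and>
           upper_Phi_dim \<Phi> (orth_proj V ` E) = upper_profile \<Phi> (real m) E)"
  proof (intro allI impI, elim conjE, intro conjI ballI)
    fix m :: nat and \<gamma> :: "(real^'d) set measure" and E :: "(real^'d) set"
    assume m: "1 \<le> m" and inv: "grass_invariant_measure m \<gamma>" and E: "E \<noteq> {}" "bounded E"
    show "AE V in \<gamma>. lower_Phi_dim \<Phi> (orth_proj V ` E) = lower_profile \<Phi> (real m) E \<and>
        upper_Phi_dim \<Phi> (orth_proj V ` E) = upper_profile \<Phi> (real m) E"
      by (rule projection_dims_AE_eq[OF adm log_cond m E inv])
    fix V :: "(real^'d) set" assume V: "V \<in> grassmannian m"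
    show "lower_Phi_dim \<Phi> (orth_proj V ` E) \<le> lower_profile \<Phi> (real m) E"
      "upper_Phi_dim \<Phi> (orth_proj V ` E) \<le> upper_profile \<Phi> (real m) E"
      by (rule projection_dims_le[OF adm log_cond m E V]; assumption)+
  qed
  show "\<forall>(\<alpha> :: real) (M :: 'w measure) (B :: real^'d \<Rightarrow> 'w \<Rightarrow> real^'n) (E :: (real^'d) set).
      0 < \<alpha> \<and> \<alpha> < 1 \<and> fractional_brownian_motion M \<alpha> B \<and> E \<noteq> {} \<and> bounded E \<longrightarrow>
      (AE \<omega> in M.
           lower_Phi_dim \<Phi> ((\<lambda>x. B x \<omega>) ` E) =
             1 / \<alpha> * lower_profile (Phi_pow \<Phi> \<alpha>) (\<alpha> * real CARD('n)) E \<and>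
           upper_Phi_dim \<Phi> ((\<lambda>x. B x \<omega>) ` E) =
             1 / \<alpha> * upper_profile (Phi_pow \<Phi> \<alpha>) (\<alpha> * real CARD('n)) E)"
  proof (intro allI impI, elim conjE)
    fix \<alpha> :: real and M :: "'w measure" and B :: "real^'d \<Rightarrow> 'w \<Rightarrow> real^'n" and E :: "(real^'d) set"
    assume \<alpha>: "0 < \<alpha>" "\<alpha> < 1" and B: "fractional_brownian_motion M \<alpha> B" and E: "E \<noteq> {}" "bounded E"
    interpret fbm M \<alpha> B by unfold_locales (use \<alpha> B in auto)
    show "AE \<omega> in M. lower_Phi_dim \<Phi> ((\<lambda>x. B x \<omega>) ` E) =
          1 / \<alpha> * lower_profile (Phi_pow \<Phi> \<alpha>) (\<alpha> * real CARD('n)) E \<and>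
        upper_Phi_dim \<Phi> ((\<lambda>x. B x \<omega>) ` E) =
          1 / \<alpha> * upper_profile (Phi_pow \<Phi> \<alpha>) (\<alpha> * real CARD('n)) E"
      by (rule fbm_dims_AE_eq[OF adm log_cond E])
  qed
qed

end
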